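(* Let $H$ be a cobraided Hopf algebra over a non-zero commutative ring $k$, with universal $R$-form $r$, let $\sigma$ be a two-cocycle of $H$, and let $H'={}_\sigma H_{\sigma^{-1}}$, with the cobraided structure $r_\sigma=\sigma_{21}\,r\,\sigma^{-1}$. If $A$ is a Hopf algebra in the braided category ${}^H\mathcal{M}$, then ${}_\sigma A$ is a Hopf algebra in the braided category ${}^{H'}\mathcal{M}$. The equivalence ${}^H\mathcal{M}\cong{}^{H'}\mathcal{M}$, $M\mapsto{}_\sigma M$, induces an equivalence between the categories of Hopf algebras in these categories. For each Hopf algebra $A$ in ${}^H\mathcal{M}$, there is also a monoidal equivalence between the category of $A$-modules (in ${}^H\mathcal{M}$) and the category of ${}_\sigma A$-modules (in ${}^{H'}\mathcal{M}$).
   Context: ${}^H\mathcal{M}$ is the monoidal category of left $H$-comodules (coaction $m\mapsto\sum m_{-1}\otimes m_0$; tensor product over $k$ with coaction $m\otimes n\mapsto\sum m_{-1}n_{-1}\otimes m_0\otimes n_0$). A two-cocycle of $H$ is a convolution-invertible bilinear form $\sigma:H\times H\to k$ with $\sum\sigma(x_1,y_1)\sigma(x_2y_2,z)=\sum\sigma(y_1,z_1)\sigma(x,y_2z_2)$. The Hopf algebra $H'={}_\sigma H_{\sigma^{-1}}$ is $H$ as a coalgebra with product $x\star_\sigma y=\sum\sigma(x_1,y_1)x_2y_2\sigma^{-1}(x_3,y_3)$. The braiding on ${}^H\mathcal{M}$ is $\gamma_{M,N}(m\otimes n)=\sum r(n_{-1},m_{-1})\,n_0\otimes m_0$; on ${}^{H'}\mathcal{M}$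 it is defined in the same way with $r_\sigma=\sigma_{21}\,r\,\sigma^{-1}$ (convolution product), $\sigma_{21}(x,y)=\sigma(y,x)$. ${}_\sigma M$ is $M$ regarded as a left $H'$-comodule with the same coaction. The functor $M\mapsto{}_\sigma M$ is a braided monoidal equivalence ${}^H\mathcal{M}\to{}^{H'}\mathcal{M}$ with monoidal structure $\xi_{M,N}:{}_\sigma M\otimes{}_\sigma N\to{}_\sigma(M\otimes N)$, $\xi(m\otimes n)=\sum\sigma(m_{-1},n_{-1})m_0\otimes n_0$, and $\eta:k\to{}_\sigma k$, $\eta(1)=\sigma(1,1)^{-1}$. The structure maps of ${}_\sigma A$ are those transported from $A$ by this monoidal functor; in particular the product is $a*_\sigma b=\sum\sigma(a_{-1},b_{-1})a_0b_0$. Two algebras $A,B$ in a braided category have a braided tensor product $A\boldsymbol{\otimes}^bB$ with product $(\mu_A\otimes\mu_B)\circ(\mathrm{id}_A\otimes\gamma_{B,A}\otimes\mathrm{id}_B)$; a Hopf algebra $A$ in a braided category has a coproduct $A\to A\boldsymbol{\otimes}^bA$ that is a map of algebras. Modules over an algebra are modules inside the monoidal category. If $M$ is an $A$-module and $N$ a $B$-module with actions $\theta_A,\theta_B$, then $M\otimes N$ is an $A\boldsymbol{\otimes}^bB$-module via $(\theta_A\otimes\theta_B)\circ(\mathrm{id}_A\otimes\gamma_{B,M}\otimes\mathrm{id}_N)$; hence modules over a Hopf algebra $A$ form a monoidal category. *)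

theory Defs
  imports "HOL-Algebra.Module"
begin

section \<open>Categories, functors and equivalences\<close>

text \<open>Hom-sets are only meaningful between elements of \<open>Obj\<close>. They need not be disjoint, but
  composition does not depend on the objects.\<close>

record ('o, 'a) cat =
  Obj :: "'o set"
  Hom :: "'o \<Rightarrow> 'o \<Rightarrow> 'a set"
  Ident :: "'o \<Rightarrow> 'a"
  Comp :: "'a \<Rightarrow> 'a \<Rightarrow> 'a"  (infixr \<open>\<cdot>\<index>\<close> 55)

locale category =
  fixes C :: "('o, 'a, 'z) cat_scheme" (structure)
  assumes ident_hom: "X \<in> Obj C \<Longrightarrow> Ident C X \<in> Hom C X X"
    and comp_hom: "\<lbrakk>X \<in> Obj C; Y \<in> Obj C; Z \<in> Obj C; f \<in> Hom C X Y; g \<in> Hom C Y Z\<rbrakk>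
      \<Longrightarrow> g \<cdot> f \<in> Hom C X Z"
    and ident_left: "\<lbrakk>X \<in> Obj C; Y \<in> Obj C; f \<in> Hom C X Y\<rbrakk> \<Longrightarrow> Ident C Y \<cdot> f = f"
    and ident_right: "\<lbrakk>X \<in> Obj C; Y \<in> Obj C; f \<in> Hom C X Y\<rbrakk> \<Longrightarrow> f \<cdot> Ident C X = f"
    and comp_assoc: "\<lbrakk>W \<in> Obj C; X \<in> Obj C; Y \<in> Obj C; Z \<in> Obj C;
        f \<in> Hom C W X; g \<in> Hom C X Y; h \<in> Hom C Y Z\<rbrakk>
      \<Longrightarrow> (h \<cdot> g) \<cdot> f = h \<cdot> (g \<cdot> f)"

definition inverse_arrows :: "('o, 'a, 'z) cat_scheme \<Rightarrow> 'o \<Rightarrow> 'o \<Rightarrow> 'a \<Rightarrow> 'a \<Rightarrow> bool" where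
  "inverse_arrows C X Y f g \<longleftrightarrow> f \<in> Hom C X Y \<and> g \<in> Hom C Y X \<and>
     g \<cdot>\<^bsub>C\<^esub> f = Ident C X \<and> f \<cdot>\<^bsub>C\<^esub> g = Ident C Y"

definition iso_arrow :: "('o, 'a, 'z) cat_scheme \<Rightarrow> 'o \<Rightarrow> 'o \<Rightarrow> 'a \<Rightarrow> bool" where
  "iso_arrow C X Y f \<longleftrightarrow> (\<exists>g. inverse_arrows C X Y f g)"

definition inv_arrow :: "('o, 'a, 'z) cat_scheme \<Rightarrow> 'o \<Rightarrow> 'o \<Rightarrow> 'a \<Rightarrow> 'a" where
  "inv_arrow C X Y f = (THE g. inverse_arrows C X Y f g)"

record ('o1, 'a1, 'o2, 'a2) cat_fun =
  FO :: "'o1 \<Rightarrow> 'o2"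
  FA :: "'a1 \<Rightarrow> 'a2"

locale cat_functor = C: category C + D: category D
  for C :: "('o1, 'a1, 'y) cat_scheme" and D :: "('o2, 'a2, 'z) cat_scheme" +
  fixes F :: "('o1, 'a1, 'o2, 'a2, 'w) cat_fun_scheme"
  assumes FO_obj: "X \<in> Obj C \<Longrightarrow> FO F X \<in> Obj D"
    and FA_hom: "\<lbrakk>X \<in> Obj C; Y \<in> Obj C; f \<in> Hom C X Y\<rbrakk>
      \<Longrightarrow> FA F f \<in> Hom D (FO F X) (FO F Y)"
    and FA_ident: "X \<in> Obj C \<Longrightarrow> FA F (Ident C X) = Ident D (FO F X)"
    and FA_comp: "\<lbrakk>X \<in> Obj C; Y \<in> Obj C; Z \<in> Obj C; f \<in> Hom C X Y; g \<in> Hom C Y Z\<rbrakk>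
      \<Longrightarrow> FA F (g \<cdot>\<^bsub>C\<^esub> f) = FA F g \<cdot>\<^bsub>D\<^esub> FA F f"

definition id_functor :: "('o, 'a, 'o, 'a) cat_fun" where
  "id_functor = \<lparr>FO = (\<lambda>X. X), FA = (\<lambda>f. f)\<rparr>"

definition comp_functor ::
  "('o2, 'a2, 'o3, 'a3, 'w) cat_fun_scheme \<Rightarrow> ('o1, 'a1, 'o2, 'a2, 'v) cat_fun_scheme
    \<Rightarrow> ('o1, 'a1, 'o3, 'a3) cat_fun" where
  "comp_functor G F = \<lparr>FO = FO G \<circ> FO F, FA = FA G \<circ> FA F\<rparr>"

definition naturally_isomorphic ::
  "('o1, 'a1, 'y) cat_scheme \<Rightarrow> ('o2, 'a2, 'z) cat_scheme
    \<Rightarrow> ('o1, 'a1, 'o2, 'a2, 'v) cat_fun_scheme \<Rightarrow> ('o1, 'a1, 'o2, 'a2, 'w) cat_fun_scheme \<Rightarrow> bool"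
where
  "naturally_isomorphic C D F G \<longleftrightarrow>
     (\<exists>\<tau>. (\<forall>X\<in>Obj C. iso_arrow D (FO F X) (FO G X) (\<tau> X)) \<and>
          (\<forall>X\<in>Obj C. \<forall>Y\<in>Obj C. \<forall>f\<in>Hom C X Y.
             FA G f \<cdot>\<^bsub>D\<^esub> \<tau> X = \<tau> Y \<cdot>\<^bsub>D\<^esub> FA F f))"

definition equivalence_functor ::
  "('o1, 'a1, 'y) cat_scheme \<Rightarrow> ('o2, 'a2, 'z) cat_scheme
    \<Rightarrow> ('o1, 'a1, 'o2, 'a2, 'w) cat_fun_scheme \<Rightarrow> bool" where
  "equivalence_functor C D F \<longleftrightarrow> cat_functor C D F \<and>
     (\<exists>G :: ('o2, 'a2, 'o1, 'a1) cat_fun. cat_functor D C G \<and>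
        naturally_isomorphic C C (comp_functor G F) id_functor \<and>
        naturally_isomorphic D D (comp_functor F G) id_functor)"


section \<open>Monoidal and braided monoidal categories\<close>

record ('o, 'a) moncat = "('o, 'a) cat" +
  TenO :: "'o \<Rightarrow> 'o \<Rightarrow> 'o"  (infixr \<open>\<boxtimes>\<index>\<close> 70)
  TenA :: "'a \<Rightarrow> 'a \<Rightarrow> 'a"  (infixr \<open>\<boxtimes>\<^sub>m\<index>\<close> 70)
  Unit :: "'o"
  Assoc :: "'o \<Rightarrow> 'o \<Rightarrow> 'o \<Rightarrow> 'a"
  LUnit :: "'o \<Rightarrow> 'a"
  RUnit :: "'o \<Rightarrow> 'a"

locale monoidal_category = category C
  for C :: "('o, 'a, 'z) moncat_scheme" (structure) +
  assumes tenO_obj: "\<lbrakk>X \<in> Obj C; Y \<in> Obj C\<rbrakk> \<Longrightarrow> X \<boxtimes> Y \<in> Obj C"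
    and unit_obj: "Unit C \<in> Obj C"
    and tenA_hom: "\<lbrakk>X \<in> Obj C; X' \<in> Obj C; Y \<in> Obj C; Y' \<in> Obj C;
        f \<in> Hom C X X'; g \<in> Hom C Y Y'\<rbrakk> \<Longrightarrow> f \<boxtimes>\<^sub>m g \<in> Hom C (X \<boxtimes> Y) (X' \<boxtimes> Y')"
    and tenA_ident: "\<lbrakk>X \<in> Obj C; Y \<in> Obj C\<rbrakk>
      \<Longrightarrow> Ident C X \<boxtimes>\<^sub>m Ident C Y = Ident C (X \<boxtimes> Y)"
    and tenA_comp: "\<lbrakk>X \<in> Obj C; X' \<in> Obj C; X'' \<in> Obj C; Y \<in> Obj C; Y' \<in> Obj C; Y'' \<in> Obj C;
        f \<in> Hom C X X'; f' \<in> Hom C X' X''; g \<in> Hom C Y Y'; g' \<in> Hom C Y' Y''\<rbrakk>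
      \<Longrightarrow> (f' \<cdot> f) \<boxtimes>\<^sub>m (g' \<cdot> g) = (f' \<boxtimes>\<^sub>m g') \<cdot> (f \<boxtimes>\<^sub>m g)"
    and assoc_iso: "\<lbrakk>X \<in> Obj C; Y \<in> Obj C; Z \<in> Obj C\<rbrakk>
      \<Longrightarrow> iso_arrow C ((X \<boxtimes> Y) \<boxtimes> Z) (X \<boxtimes> (Y \<boxtimes> Z)) (Assoc C X Y Z)"
    and assoc_natural: "\<lbrakk>X \<in> Obj C; X' \<in> Obj C; Y \<in> Obj C; Y' \<in> Obj C; Z \<in> Obj C; Z' \<in> Obj C;
        f \<in> Hom C X X'; g \<in> Hom C Y Y'; h \<in> Hom C Z Z'\<rbrakk>
      \<Longrightarrow> Assoc C X' Y' Z' \<cdot> ((f \<boxtimes>\<^sub>m g) \<boxtimes>\<^sub>m h) = (f \<boxtimes>\<^sub>m (g \<boxtimes>\<^sub>m h)) \<cdot> Assoc C X Y Z"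
    and lunit_iso: "X \<in> Obj C \<Longrightarrow> iso_arrow C (Unit C \<boxtimes> X) X (LUnit C X)"
    and lunit_natural: "\<lbrakk>X \<in> Obj C; Y \<in> Obj C; f \<in> Hom C X Y\<rbrakk>
      \<Longrightarrow> LUnit C Y \<cdot> (Ident C (Unit C) \<boxtimes>\<^sub>m f) = f \<cdot> LUnit C X"
    and runit_iso: "X \<in> Obj C \<Longrightarrow> iso_arrow C (X \<boxtimes> Unit C) X (RUnit C X)"
    and runit_natural: "\<lbrakk>X \<in> Obj C; Y \<in> Obj C; f \<in> Hom C X Y\<rbrakk>
      \<Longrightarrow> RUnit C Y \<cdot> (f \<boxtimes>\<^sub>m Ident C (Unit C)) = f \<cdot> RUnit C X"
    and pentagon: "\<lbrakk>W \<in> Obj C; X \<in> Obj C; Y \<in> Obj C; Z \<in> Obj C\<rbrakk>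
      \<Longrightarrow> (Ident C W \<boxtimes>\<^sub>m Assoc C X Y Z) \<cdot> Assoc C W (X \<boxtimes> Y) Z \<cdot> (Assoc C W X Y \<boxtimes>\<^sub>m Ident C Z)
          = Assoc C W X (Y \<boxtimes> Z) \<cdot> Assoc C (W \<boxtimes> X) Y Z"
    and triangle: "\<lbrakk>X \<in> Obj C; Y \<in> Obj C\<rbrakk>
      \<Longrightarrow> (Ident C X \<boxtimes>\<^sub>m LUnit C Y) \<cdot> Assoc C X (Unit C) Y = RUnit C X \<boxtimes>\<^sub>m Ident C Y"

record ('o, 'a) brcat = "('o, 'a) moncat" +
  Braid :: "'o \<Rightarrow> 'o \<Rightarrow> 'a"

locale braided_monoidal_category = monoidal_category C
  for C :: "('o, 'a, 'z) brcat_scheme" (structure) +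
  assumes braid_iso: "\<lbrakk>X \<in> Obj C; Y \<in> Obj C\<rbrakk> \<Longrightarrow> iso_arrow C (X \<boxtimes> Y) (Y \<boxtimes> X) (Braid C X Y)"
    and braid_natural: "\<lbrakk>X \<in> Obj C; X' \<in> Obj C; Y \<in> Obj C; Y' \<in> Obj C;
        f \<in> Hom C X X'; g \<in> Hom C Y Y'\<rbrakk>
      \<Longrightarrow> Braid C X' Y' \<cdot> (f \<boxtimes>\<^sub>m g) = (g \<boxtimes>\<^sub>m f) \<cdot> Braid C X Y"
    and hexagon1: "\<lbrakk>X \<in> Obj C; Y \<in> Obj C; Z \<in> Obj C\<rbrakk>
      \<Longrightarrow> Assoc C Y Z X \<cdot> Braid C X (Y \<boxtimes> Z) \<cdot> Assoc C X Y Z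
          = (Ident C Y \<boxtimes>\<^sub>m Braid C X Z) \<cdot> Assoc C Y X Z \<cdot> (Braid C X Y \<boxtimes>\<^sub>m Ident C Z)"
    and hexagon2: "\<lbrakk>X \<in> Obj C; Y \<in> Obj C; Z \<in> Obj C\<rbrakk>
      \<Longrightarrow> Braid C (X \<boxtimes> Y) Z
          = Assoc C Z X Y \<cdot> (Braid C X Z \<boxtimes>\<^sub>m Ident C Y)
            \<cdot> inv_arrow C ((X \<boxtimes> Z) \<boxtimes> Y) (X \<boxtimes> (Z \<boxtimes> Y)) (Assoc C X Z Y)
            \<cdot> (Ident C X \<boxtimes>\<^sub>m Braid C Y Z) \<cdot> Assoc C X Y Z"

text \<open>Monoidal functors are strong: \<open>\<xi> X Y : F X \<otimes> F Y \<rightarrow> F (X \<otimes> Y)\<close> and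
  \<open>\<eta> : 1 \<rightarrow> F 1\<close> are isomorphisms.\<close>

record ('o1, 'a1, 'o2, 'a2) mon_fun = "('o1, 'a1, 'o2, 'a2) cat_fun" +
  FXi :: "'o1 \<Rightarrow> 'o1 \<Rightarrow> 'a2"
  FEta :: "'a2"

locale monoidal_functor = C: monoidal_category C + D: monoidal_category D + cat_functor C D F
  for C :: "('o1, 'a1, 'y) moncat_scheme" and D :: "('o2, 'a2, 'z) moncat_scheme"
    and F :: "('o1, 'a1, 'o2, 'a2, 'w) mon_fun_scheme" +
  assumes xi_iso: "\<lbrakk>X \<in> Obj C; Y \<in> Obj C\<rbrakk>
      \<Longrightarrow> iso_arrow D (FO F X \<boxtimes>\<^bsub>D\<^esub> FO F Y) (FO F (X \<boxtimes>\<^bsub>C\<^esub> Y)) (FXi F X Y)"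
    and xi_natural: "\<lbrakk>X \<in> Obj C; X' \<in> Obj C; Y \<in> Obj C; Y' \<in> Obj C;
        f \<in> Hom C X X'; g \<in> Hom C Y Y'\<rbrakk>
      \<Longrightarrow> FXi F X' Y' \<cdot>\<^bsub>D\<^esub> (FA F f \<boxtimes>\<^sub>m\<^bsub>D\<^esub> FA F g) = FA F (f \<boxtimes>\<^sub>m\<^bsub>C\<^esub> g) \<cdot>\<^bsub>D\<^esub> FXi F X Y"
    and eta_iso: "iso_arrow D (Unit D) (FO F (Unit C)) (FEta F)"
    and xi_assoc: "\<lbrakk>X \<in> Obj C; Y \<in> Obj C; Z \<in> Obj C\<rbrakk>
      \<Longrightarrow> FA F (Assoc C X Y Z) \<cdot>\<^bsub>D\<^esub> FXi F (X \<boxtimes>\<^bsub>C\<^esub> Y) Z \<cdot>\<^bsub>D\<^esub> (FXi F X Y \<boxtimes>\<^sub>m\<^bsub>D\<^esub> Ident D (FO F Z))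
          = FXi F X (Y \<boxtimes>\<^bsub>C\<^esub> Z) \<cdot>\<^bsub>D\<^esub> (Ident D (FO F X) \<boxtimes>\<^sub>m\<^bsub>D\<^esub> FXi F Y Z)
            \<cdot>\<^bsub>D\<^esub> Assoc D (FO F X) (FO F Y) (FO F Z)"
    and xi_lunit: "X \<in> Obj C
      \<Longrightarrow> FA F (LUnit C X) \<cdot>\<^bsub>D\<^esub> FXi F (Unit C) X \<cdot>\<^bsub>D\<^esub> (FEta F \<boxtimes>\<^sub>m\<^bsub>D\<^esub> Ident D (FO F X))
          = LUnit D (FO F X)"
    and xi_runit: "X \<in> Obj C
      \<Longrightarrow> FA F (RUnit C X) \<cdot>\<^bsub>D\<^esub> FXi F X (Unit C) \<cdot>\<^bsub>D\<^esub> (Ident D (FO F X) \<boxtimes>\<^sub>m\<^bsub>D\<^esub> FEta F)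
          = RUnit D (FO F X)"

definition monoidal_equivalence ::
  "('o1, 'a1, 'y) moncat_scheme \<Rightarrow> ('o2, 'a2, 'z) moncat_scheme
    \<Rightarrow> ('o1, 'a1, 'o2, 'a2, 'w) mon_fun_scheme \<Rightarrow> bool" where
  "monoidal_equivalence C D F \<longleftrightarrow> monoidal_functor C D F \<and> equivalence_functor C D F"

definition braided_monoidal_equivalence ::
  "('o1, 'a1, 'y) brcat_scheme \<Rightarrow> ('o2, 'a2, 'z) brcat_scheme
    \<Rightarrow> ('o1, 'a1, 'o2, 'a2, 'w) mon_fun_scheme \<Rightarrow> bool" where
  "braided_monoidal_equivalence C D F \<longleftrightarrow>
     braided_monoidal_category C \<and> braided_monoidal_category D \<and> monoidal_equivalence C D F \<and>
     (\<forall>X\<in>Obj C. \<forall>Y\<in>Obj C.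
        FA F (Braid C X Y) \<cdot>\<^bsub>D\<^esub> FXi F X Y = FXi F Y X \<cdot>\<^bsub>D\<^esub> Braid D (FO F X) (FO F Y))"


section \<open>Hopf algebras in a braided category and their modules\<close>

record ('o, 'a) alg_in =
  aobj :: "'o"
  amul :: "'a"
  aone :: "'a"

record ('o, 'a) hopf_in = "('o, 'a) alg_in" +
  acomul :: "'a"
  acounit :: "'a"
  aantip :: "'a"

context
  fixes C :: "('o, 'a, 'z) moncat_scheme" (structure)
begin

definition algebra_in :: "('o, 'a, 'y) alg_in_scheme \<Rightarrow> bool" where
  "algebra_in A \<longleftrightarrow> aobj A \<in> Obj C \<and>
     amul A \<in> Hom C (aobj A \<boxtimes> aobj A) (aobj A) \<and> aone A \<in> Hom C (Unit C) (aobj A) \<and>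
     amul A \<cdot> (amul A \<boxtimes>\<^sub>m Ident C (aobj A))
       = amul A \<cdot> (Ident C (aobj A) \<boxtimes>\<^sub>m amul A) \<cdot> Assoc C (aobj A) (aobj A) (aobj A) \<and>
     amul A \<cdot> (aone A \<boxtimes>\<^sub>m Ident C (aobj A)) = LUnit C (aobj A) \<and>
     amul A \<cdot> (Ident C (aobj A) \<boxtimes>\<^sub>m aone A) = RUnit C (aobj A)"

definition algebra_map ::
  "('o, 'a, 'y) alg_in_scheme \<Rightarrow> ('o, 'a, 'x) alg_in_scheme \<Rightarrow> 'a \<Rightarrow> bool" where
  "algebra_map A B f \<longleftrightarrow> f \<in> Hom C (aobj A) (aobj B) \<and>
     f \<cdot> amul A = amul B \<cdot> (f \<boxtimes>\<^sub>m f) \<and> f \<cdot> aone A = aone B"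

definition unit_algebra :: "('o, 'a) alg_in" where
  "unit_algebra = \<lparr>aobj = Unit C, amul = LUnit C (Unit C), aone = Ident C (Unit C)\<rparr>"

definition coalgebra_in :: "('o, 'a, 'y) hopf_in_scheme \<Rightarrow> bool" where
  "coalgebra_in A \<longleftrightarrow> aobj A \<in> Obj C \<and>
     acomul A \<in> Hom C (aobj A) (aobj A \<boxtimes> aobj A) \<and> acounit A \<in> Hom C (aobj A) (Unit C) \<and>
     Assoc C (aobj A) (aobj A) (aobj A) \<cdot> (acomul A \<boxtimes>\<^sub>m Ident C (aobj A)) \<cdot> acomul A
       = (Ident C (aobj A) \<boxtimes>\<^sub>m acomul A) \<cdot> acomul A \<and>
     LUnit C (aobj A) \<cdot> (acounit A \<boxtimes>\<^sub>m Ident C (aobj A)) \<cdot> acomul A = Ident C (aobj A) \<and>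
     RUnit C (aobj A) \<cdot> (Ident C (aobj A) \<boxtimes>\<^sub>m acounit A) \<cdot> acomul A = Ident C (aobj A)"

definition coalgebra_map ::
  "('o, 'a, 'y) hopf_in_scheme \<Rightarrow> ('o, 'a, 'x) hopf_in_scheme \<Rightarrow> 'a \<Rightarrow> bool" where
  "coalgebra_map A B f \<longleftrightarrow> f \<in> Hom C (aobj A) (aobj B) \<and>
     acomul B \<cdot> f = (f \<boxtimes>\<^sub>m f) \<cdot> acomul A \<and> acounit B \<cdot> f = acounit A"

definition module_in :: "('o, 'a, 'y) alg_in_scheme \<Rightarrow> 'o \<times> 'a \<Rightarrow> bool" where
  "module_in A P \<longleftrightarrow> (case P of (M, \<theta>) \<Rightarrow> M \<in> Obj C \<and> \<theta> \<in> Hom C (aobj A \<boxtimes> M) M \<and>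
     \<theta> \<cdot> (amul A \<boxtimes>\<^sub>m Ident C M)
       = \<theta> \<cdot> (Ident C (aobj A) \<boxtimes>\<^sub>m \<theta>) \<cdot> Assoc C (aobj A) (aobj A) M \<and>
     \<theta> \<cdot> (aone A \<boxtimes>\<^sub>m Ident C M) = LUnit C M)"

definition module_maps :: "('o, 'a, 'y) alg_in_scheme \<Rightarrow> 'o \<times> 'a \<Rightarrow> 'o \<times> 'a \<Rightarrow> 'a set" where
  "module_maps A P Q = {f \<in> Hom C (fst P) (fst Q).
     f \<cdot> snd P = snd Q \<cdot> (Ident C (aobj A) \<boxtimes>\<^sub>m f)}"

end

context
  fixes C :: "('o, 'a, 'z) brcat_scheme" (structure)
begin

text \<open>\<open>mid_swap X Y Z W\<close> is \<open>id \<otimes> \<gamma> \<otimes> id\<close>, with the associativity isomorphisms inserted, from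
  \<open>(X \<otimes> Y) \<otimes> (Z \<otimes> W)\<close> to \<open>(X \<otimes> Z) \<otimes> (Y \<otimes> W)\<close>.\<close>

definition mid_swap :: "'o \<Rightarrow> 'o \<Rightarrow> 'o \<Rightarrow> 'o \<Rightarrow> 'a" where
  "mid_swap X Y Z W =
     inv_arrow C ((X \<boxtimes> Z) \<boxtimes> (Y \<boxtimes> W)) (X \<boxtimes> (Z \<boxtimes> (Y \<boxtimes> W))) (Assoc C X Z (Y \<boxtimes> W))
     \<cdot> (Ident C X \<boxtimes>\<^sub>m
          (Assoc C Z Y W \<cdot> (Braid C Y Z \<boxtimes>\<^sub>m Ident C W)
           \<cdot> inv_arrow C ((Y \<boxtimes> Z) \<boxtimes> W) (Y \<boxtimes> (Z \<boxtimes> W)) (Assoc C Y Z W)))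
     \<cdot> Assoc C X Y (Z \<boxtimes> W)"

definition braided_tensor_algebra ::
  "('o, 'a, 'y) alg_in_scheme \<Rightarrow> ('o, 'a, 'x) alg_in_scheme \<Rightarrow> ('o, 'a) alg_in" where
  "braided_tensor_algebra A B = \<lparr>aobj = aobj A \<boxtimes> aobj B,
     amul = (amul A \<boxtimes>\<^sub>m amul B) \<cdot> mid_swap (aobj A) (aobj B) (aobj A) (aobj B),
     aone = (aone A \<boxtimes>\<^sub>m aone B) \<cdot> inv_arrow C (Unit C \<boxtimes> Unit C) (Unit C) (LUnit C (Unit C))\<rparr>"

text \<open>The action of \<open>A \<otimes>\<^sup>b B\<close> on \<open>M \<otimes> N\<close>.\<close>

definition braided_tensor_action ::
  "('o, 'a, 'y) alg_in_scheme \<Rightarrow> ('o, 'a, 'x) alg_in_scheme \<Rightarrow> 'o \<times> 'a \<Rightarrow> 'o \<times> 'a \<Rightarrow> 'a" where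
  "braided_tensor_action A B P Q =
     (snd P \<boxtimes>\<^sub>m snd Q) \<cdot> mid_swap (aobj A) (aobj B) (fst P) (fst Q)"

end

locale braided_hopf_algebra = braided_monoidal_category C
  for C :: "('o, 'a, 'z) brcat_scheme" (structure) +
  fixes A :: "('o, 'a) hopf_in"
  assumes algebra: "algebra_in C A"
    and coalgebra: "coalgebra_in C A"
    and comul_algebra_map: "algebra_map C A (braided_tensor_algebra C A A) (acomul A)"
    and counit_algebra_map: "algebra_map C A (unit_algebra C) (acounit A)"
    and antipode_hom: "aantip A \<in> Hom C (aobj A) (aobj A)"
    and antipode_left:
      "amul A \<cdot> (aantip A \<boxtimes>\<^sub>m Ident C (aobj A)) \<cdot> acomul A = aone A \<cdot> acounit A"
    and antipode_right:
      "amul A \<cdot> (Ident C (aobj A) \<boxtimes>\<^sub>m aantip A) \<cdot> acomul A = aone A \<cdot> acounit A"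

definition hopf_cat :: "('o, 'a, 'z) brcat_scheme \<Rightarrow> (('o, 'a) hopf_in, 'a) cat" where
  "hopf_cat C = \<lparr>Obj = {A. braided_hopf_algebra C A},
     Hom = (\<lambda>A B. {f. algebra_map C A B f \<and> coalgebra_map C A B f}),
     Ident = (\<lambda>A. Ident C (aobj A)),
     Comp = Comp C\<rparr>"

text \<open>Modules over a Hopf algebra \<open>A\<close>: tensor products and the unit object become \<open>A\<close>-modules by
  restriction along the coproduct and the counit.\<close>

definition module_cat ::
  "('o, 'a, 'z) brcat_scheme \<Rightarrow> ('o, 'a) hopf_in \<Rightarrow> ('o \<times> 'a, 'a) moncat" where
  "module_cat C A = \<lparr>Obj = {P. module_in C A P},
     Hom = module_maps C A,
     Ident = (\<lambda>P. Ident C (fst P)),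
     Comp = Comp C,
     TenO = (\<lambda>P Q. (fst P \<boxtimes>\<^bsub>C\<^esub> fst Q,
        braided_tensor_action C A A P Q \<cdot>\<^bsub>C\<^esub> (acomul A \<boxtimes>\<^sub>m\<^bsub>C\<^esub> Ident C (fst P \<boxtimes>\<^bsub>C\<^esub> fst Q)))),
     TenA = TenA C,
     Unit = (Unit C, LUnit C (Unit C) \<cdot>\<^bsub>C\<^esub> (acounit A \<boxtimes>\<^sub>m\<^bsub>C\<^esub> Ident C (Unit C))),
     Assoc = (\<lambda>P Q R. Assoc C (fst P) (fst Q) (fst R)),
     LUnit = (\<lambda>P. LUnit C (fst P)),
     RUnit = (\<lambda>P. RUnit C (fst P))\<rparr>"

definition transport_hopf ::
  "('o1, 'a1, 'y) brcat_scheme \<Rightarrow> ('o2, 'a2, 'z) brcat_scheme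
    \<Rightarrow> ('o1, 'a1, 'o2, 'a2, 'w) mon_fun_scheme \<Rightarrow> ('o1, 'a1) hopf_in \<Rightarrow> ('o2, 'a2) hopf_in" where
  "transport_hopf C D F A = \<lparr>aobj = FO F (aobj A),
     amul = FA F (amul A) \<cdot>\<^bsub>D\<^esub> FXi F (aobj A) (aobj A),
     aone = FA F (aone A) \<cdot>\<^bsub>D\<^esub> FEta F,
     acomul = inv_arrow D (FO F (aobj A) \<boxtimes>\<^bsub>D\<^esub> FO F (aobj A)) (FO F (aobj A \<boxtimes>\<^bsub>C\<^esub> aobj A))
                (FXi F (aobj A) (aobj A)) \<cdot>\<^bsub>D\<^esub> FA F (acomul A),
     acounit = inv_arrow D (Unit D) (FO F (Unit C)) (FEta F) \<cdot>\<^bsub>D\<^esub> FA F (acounit A),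
     aantip = FA F (aantip A)\<rparr>"

definition transport_hopf_functor ::
  "('o1, 'a1, 'y) brcat_scheme \<Rightarrow> ('o2, 'a2, 'z) brcat_scheme
    \<Rightarrow> ('o1, 'a1, 'o2, 'a2, 'w) mon_fun_scheme
    \<Rightarrow> (('o1, 'a1) hopf_in, 'a1, ('o2, 'a2) hopf_in, 'a2) cat_fun" where
  "transport_hopf_functor C D F = \<lparr>FO = transport_hopf C D F, FA = FA F\<rparr>"


section \<open>Tensor products of modules\<close>

text \<open>A list \<open>[(m1, n1), ..., (mr, nr)]\<close> stands for the sum of the pure tensors \<open>mi \<otimes> ni\<close>, and
  \<open>tens_eq\<close> is the congruence generated by the relations of \<open>M \<otimes> N\<close>. Additive inverses are
  available since \<open>-(m \<otimes> n) = (-m) \<otimes> n\<close>. An element of \<open>tensor k M N\<close> is a chosen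
  representative of its class, so that a map out of the tensor product can be applied by summing
  over the list (\<open>tsum\<close> below). The fields \<open>mult\<close> and \<open>one\<close> of a module record carry no
  information unless the module is an algebra.\<close>

inductive tens_eq ::
  "('k, 'y) ring_scheme \<Rightarrow> ('k, 'm, 'z) module_scheme \<Rightarrow> ('k, 'n, 'w) module_scheme
    \<Rightarrow> ('m \<times> 'n) list \<Rightarrow> ('m \<times> 'n) list \<Rightarrow> bool"
  for k and M and N where
  refl: "set s \<subseteq> carrier M \<times> carrier N \<Longrightarrow> tens_eq k M N s s"
| sym: "tens_eq k M N s t \<Longrightarrow> tens_eq k M N t s"
| trans: "tens_eq k M N s t \<Longrightarrow> tens_eq k M N t u \<Longrightarrow> tens_eq k M N s u"
| append: "tens_eq k M N s s' \<Longrightarrow> tens_eq k M N t t' \<Longrightarrow> tens_eq k M N (s @ t) (s' @ t')"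
| commute: "set s \<subseteq> carrier M \<times> carrier N \<Longrightarrow> set t \<subseteq> carrier M \<times> carrier N
    \<Longrightarrow> tens_eq k M N (s @ t) (t @ s)"
| add_left: "m \<in> carrier M \<Longrightarrow> m' \<in> carrier M \<Longrightarrow> n \<in> carrier N
    \<Longrightarrow> tens_eq k M N [(m \<oplus>\<^bsub>M\<^esub> m', n)] [(m, n), (m', n)]"
| add_right: "m \<in> carrier M \<Longrightarrow> n \<in> carrier N \<Longrightarrow> n' \<in> carrier N
    \<Longrightarrow> tens_eq k M N [(m, n \<oplus>\<^bsub>N\<^esub> n')] [(m, n), (m, n')]"
| balanced: "c \<in> carrier k \<Longrightarrow> m \<in> carrier M \<Longrightarrow> n \<in> carrier N
    \<Longrightarrow> tens_eq k M N [(c \<odot>\<^bsub>M\<^esub> m, n)] [(m, c \<odot>\<^bsub>N\<^esub> n)]"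
| zero: "n \<in> carrier N \<Longrightarrow> tens_eq k M N [(\<zero>\<^bsub>M\<^esub>, n)] []"

definition tens_rep ::
  "('k, 'y) ring_scheme \<Rightarrow> ('k, 'm, 'z) module_scheme \<Rightarrow> ('k, 'n, 'w) module_scheme
    \<Rightarrow> ('m \<times> 'n) list \<Rightarrow> ('m \<times> 'n) list" where
  "tens_rep k M N s = (SOME t. tens_eq k M N s t)"

definition tensor ::
  "('k, 'y) ring_scheme \<Rightarrow> ('k, 'm, 'z) module_scheme \<Rightarrow> ('k, 'n, 'w) module_scheme
    \<Rightarrow> ('k, ('m \<times> 'n) list) module" where
  "tensor k M N = \<lparr>carrier = tens_rep k M N ` {s. set s \<subseteq> carrier M \<times> carrier N},
     mult = undefined, one = undefined,
     zero = tens_rep k M N [],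
     add = (\<lambda>s t. tens_rep k M N (s @ t)),
     smult = (\<lambda>c s. tens_rep k M N (map (\<lambda>(m, n). (c \<odot>\<^bsub>M\<^esub> m, n)) s))\<rparr>"

definition tens ::
  "('k, 'y) ring_scheme \<Rightarrow> ('k, 'm, 'z) module_scheme \<Rightarrow> ('k, 'n, 'w) module_scheme
    \<Rightarrow> 'm \<Rightarrow> 'n \<Rightarrow> ('m \<times> 'n) list" where
  "tens k M N m n = tens_rep k M N [(m, n)]"

text \<open>For a bilinear map \<open>f\<close> with values in \<open>G\<close>, \<open>\<lambda>t. tsum G t f\<close> is the induced map on the
  tensor product. In particular \<open>tsum G (comult H x) (\<lambda>x1 x2. f x1 x2)\<close> is the Sweedler sum of
  the \<open>f(x1, x2)\<close>.\<close>

definition tsum :: "('g, 'z) ring_scheme \<Rightarrow> ('m \<times> 'n) list \<Rightarrow> ('m \<Rightarrow> 'n \<Rightarrow> 'g) \<Rightarrow> 'g" where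
  "tsum G t f = foldr (\<lambda>(a, b) s. f a b \<oplus>\<^bsub>G\<^esub> s) t \<zero>\<^bsub>G\<^esub>"

definition linear_map ::
  "('k, 'y) ring_scheme \<Rightarrow> ('k, 'm, 'z) module_scheme \<Rightarrow> ('k, 'n, 'w) module_scheme
    \<Rightarrow> ('m \<Rightarrow> 'n) \<Rightarrow> bool" where
  "linear_map k M N f \<longleftrightarrow> f \<in> carrier M \<rightarrow> carrier N \<and>
     (\<forall>x\<in>carrier M. \<forall>y\<in>carrier M. f (x \<oplus>\<^bsub>M\<^esub> y) = f x \<oplus>\<^bsub>N\<^esub> f y) \<and>
     (\<forall>c\<in>carrier k. \<forall>x\<in>carrier M. f (c \<odot>\<^bsub>M\<^esub> x) = c \<odot>\<^bsub>N\<^esub> f x)"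

definition self_module :: "('k, 'y) ring_scheme \<Rightarrow> ('k, 'k) module" where
  "self_module k = \<lparr>carrier = carrier k, mult = mult k, one = one k, zero = zero k, add = add k,
     smult = mult k\<rparr>"


section \<open>Cobraided Hopf algebras and two-cocycles\<close>

record ('k, 'h) hopf_data = "('k, 'h) module" +
  comult :: "'h \<Rightarrow> ('h \<times> 'h) list"
  counit :: "'h \<Rightarrow> 'k"

locale bialgebra = module k H + H: ring H
  for k :: "'k ring" and H :: "('k, 'h) hopf_data" +
  assumes smult_mult_left: "\<lbrakk>c \<in> carrier k; x \<in> carrier H; y \<in> carrier H\<rbrakk>
      \<Longrightarrow> (c \<odot>\<^bsub>H\<^esub> x) \<otimes>\<^bsub>H\<^esub> y = c \<odot>\<^bsub>H\<^esub> (x \<otimes>\<^bsub>H\<^esub> y)"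
    and smult_mult_right: "\<lbrakk>c \<in> carrier k; x \<in> carrier H; y \<in> carrier H\<rbrakk>
      \<Longrightarrow> x \<otimes>\<^bsub>H\<^esub> (c \<odot>\<^bsub>H\<^esub> y) = c \<odot>\<^bsub>H\<^esub> (x \<otimes>\<^bsub>H\<^esub> y)"
    and comult_linear: "linear_map k H (tensor k H H) (comult H)"
    and counit_linear: "linear_map k H (self_module k) (counit H)"
    and coassoc: "x \<in> carrier H \<Longrightarrow>
      (let HHH = tensor k H (tensor k H H) in
        tsum HHH (comult H x) (\<lambda>a x3. tsum HHH (comult H a) (\<lambda>x1 x2.
          tens k H (tensor k H H) x1 (tens k H H x2 x3)))
        = tsum HHH (comult H x) (\<lambda>x1 b. tsum HHH (comult H b) (\<lambda>x2 x3.
          tens k H (tensor k H H) x1 (tens k H H x2 x3))))"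
    and counit_left: "x \<in> carrier H \<Longrightarrow> tsum H (comult H x) (\<lambda>x1 x2. counit H x1 \<odot>\<^bsub>H\<^esub> x2) = x"
    and counit_right: "x \<in> carrier H \<Longrightarrow> tsum H (comult H x) (\<lambda>x1 x2. counit H x2 \<odot>\<^bsub>H\<^esub> x1) = x"
    and comult_mult: "\<lbrakk>x \<in> carrier H; y \<in> carrier H\<rbrakk> \<Longrightarrow>
      comult H (x \<otimes>\<^bsub>H\<^esub> y)
        = tsum (tensor k H H) (comult H x) (\<lambda>x1 x2. tsum (tensor k H H) (comult H y) (\<lambda>y1 y2.
            tens k H H (x1 \<otimes>\<^bsub>H\<^esub> y1) (x2 \<otimes>\<^bsub>H\<^esub> y2)))"
    and comult_one: "comult H \<one>\<^bsub>H\<^esub> = tens k H H \<one>\<^bsub>H\<^esub> \<one>\<^bsub>H\<^esub>"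
    and counit_mult: "\<lbrakk>x \<in> carrier H; y \<in> carrier H\<rbrakk>
      \<Longrightarrow> counit H (x \<otimes>\<^bsub>H\<^esub> y) = counit H x \<otimes>\<^bsub>k\<^esub> counit H y"
    and counit_one: "counit H \<one>\<^bsub>H\<^esub> = \<one>\<^bsub>k\<^esub>"

locale hopf_algebra = bialgebra +
  assumes antipode: "\<exists>S. linear_map k H H S \<and> (\<forall>x\<in>carrier H.
      tsum H (comult H x) (\<lambda>x1 x2. S x1 \<otimes>\<^bsub>H\<^esub> x2) = counit H x \<odot>\<^bsub>H\<^esub> \<one>\<^bsub>H\<^esub> \<and>
      tsum H (comult H x) (\<lambda>x1 x2. x1 \<otimes>\<^bsub>H\<^esub> S x2) = counit H x \<odot>\<^bsub>H\<^esub> \<one>\<^bsub>H\<^esub>)"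

definition bilinear_form :: "'k ring \<Rightarrow> ('k, 'h) hopf_data \<Rightarrow> ('h \<Rightarrow> 'h \<Rightarrow> 'k) \<Rightarrow> bool" where
  "bilinear_form k H \<sigma> \<longleftrightarrow>
     (\<forall>x\<in>carrier H. linear_map k H (self_module k) (\<lambda>y. \<sigma> x y)) \<and>
     (\<forall>y\<in>carrier H. linear_map k H (self_module k) (\<lambda>x. \<sigma> x y))"

definition conv ::
  "'k ring \<Rightarrow> ('k, 'h) hopf_data \<Rightarrow> ('h \<Rightarrow> 'h \<Rightarrow> 'k) \<Rightarrow> ('h \<Rightarrow> 'h \<Rightarrow> 'k) \<Rightarrow> 'h \<Rightarrow> 'h \<Rightarrow> 'k" where
  "conv k H \<sigma> \<tau> x y = tsum k (comult H x) (\<lambda>x1 x2. tsum k (comult H y) (\<lambda>y1 y2.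
     \<sigma> x1 y1 \<otimes>\<^bsub>k\<^esub> \<tau> x2 y2))"

definition conv_inverse ::
  "'k ring \<Rightarrow> ('k, 'h) hopf_data \<Rightarrow> ('h \<Rightarrow> 'h \<Rightarrow> 'k) \<Rightarrow> ('h \<Rightarrow> 'h \<Rightarrow> 'k) \<Rightarrow> bool" where
  "conv_inverse k H \<sigma> \<tau> \<longleftrightarrow> bilinear_form k H \<tau> \<and> (\<forall>x\<in>carrier H. \<forall>y\<in>carrier H.
     conv k H \<sigma> \<tau> x y = counit H x \<otimes>\<^bsub>k\<^esub> counit H y \<and>
     conv k H \<tau> \<sigma> x y = counit H x \<otimes>\<^bsub>k\<^esub> counit H y)"

text \<open>Well defined on the carrier, where convolution inverses are unique.\<close>

definition conv_inv ::
  "'k ring \<Rightarrow> ('k, 'h) hopf_data \<Rightarrow> ('h \<Rightarrow> 'h \<Rightarrow> 'k) \<Rightarrow> 'h \<Rightarrow> 'h \<Rightarrow> 'k" where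
  "conv_inv k H \<sigma> = (SOME \<tau>. conv_inverse k H \<sigma> \<tau>)"

text \<open>The conventions for a universal \<open>R\<close>-form are those of Kassel (Quantum Groups, VIII.5); they
  are the ones for which \<open>m \<otimes> n \<mapsto> r(n\<^sub>-\<^sub>1, m\<^sub>-\<^sub>1) n\<^sub>0 \<otimes> m\<^sub>0\<close> is a braiding on left comodules.\<close>

locale cobraided_hopf_algebra = hopf_algebra k H
  for k :: "'k ring" and H :: "('k, 'h) hopf_data" +
  fixes r :: "'h \<Rightarrow> 'h \<Rightarrow> 'k"
  assumes r_bilinear: "bilinear_form k H r"
    and r_invertible: "\<exists>\<tau>. conv_inverse k H r \<tau>"
    and r_commute: "\<lbrakk>x \<in> carrier H; y \<in> carrier H\<rbrakk> \<Longrightarrow>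
      tsum H (comult H x) (\<lambda>x1 x2. tsum H (comult H y) (\<lambda>y1 y2. r x2 y2 \<odot>\<^bsub>H\<^esub> (y1 \<otimes>\<^bsub>H\<^esub> x1)))
        = tsum H (comult H x) (\<lambda>x1 x2. tsum H (comult H y) (\<lambda>y1 y2. r x1 y1 \<odot>\<^bsub>H\<^esub> (x2 \<otimes>\<^bsub>H\<^esub> y2)))"
    and r_mult_left: "\<lbrakk>x \<in> carrier H; y \<in> carrier H; z \<in> carrier H\<rbrakk> \<Longrightarrow>
      r (x \<otimes>\<^bsub>H\<^esub> y) z = tsum k (comult H z) (\<lambda>z1 z2. r x z1 \<otimes>\<^bsub>k\<^esub> r y z2)"
    and r_mult_right: "\<lbrakk>x \<in> carrier H; y \<in> carrier H; z \<in> carrier H\<rbrakk> \<Longrightarrow>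
      r x (y \<otimes>\<^bsub>H\<^esub> z) = tsum k (comult H x) (\<lambda>x1 x2. r x1 z \<otimes>\<^bsub>k\<^esub> r x2 y)"

definition two_cocycle :: "'k ring \<Rightarrow> ('k, 'h) hopf_data \<Rightarrow> ('h \<Rightarrow> 'h \<Rightarrow> 'k) \<Rightarrow> bool" where
  "two_cocycle k H \<sigma> \<longleftrightarrow> bilinear_form k H \<sigma> \<and> (\<exists>\<tau>. conv_inverse k H \<sigma> \<tau>) \<and>
     (\<forall>x\<in>carrier H. \<forall>y\<in>carrier H. \<forall>z\<in>carrier H.
        tsum k (comult H x) (\<lambda>x1 x2. tsum k (comult H y) (\<lambda>y1 y2.
          \<sigma> x1 y1 \<otimes>\<^bsub>k\<^esub> \<sigma> (x2 \<otimes>\<^bsub>H\<^esub> y2) z))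
        = tsum k (comult H y) (\<lambda>y1 y2. tsum k (comult H z) (\<lambda>z1 z2.
          \<sigma> y1 z1 \<otimes>\<^bsub>k\<^esub> \<sigma> x (y2 \<otimes>\<^bsub>H\<^esub> z2))))"

text \<open>The Hopf algebra \<open>H' = \<^sub>\<sigma>H\<^bsub>\<sigma>\<^sup>-\<^sup>1\<^esub>\<close>. Its unit is that of \<open>H\<close>, also when \<open>\<sigma>\<close> is not
  normalized.\<close>

definition cocycle_deformation ::
  "'k ring \<Rightarrow> ('k, 'h) hopf_data \<Rightarrow> ('h \<Rightarrow> 'h \<Rightarrow> 'k) \<Rightarrow> ('k, 'h) hopf_data" where
  "cocycle_deformation k H \<sigma> = H\<lparr>mult := (\<lambda>x y.
     tsum H (comult H x) (\<lambda>x1 a. tsum H (comult H a) (\<lambda>x2 x3.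
     tsum H (comult H y) (\<lambda>y1 b. tsum H (comult H b) (\<lambda>y2 y3.
       (\<sigma> x1 y1 \<otimes>\<^bsub>k\<^esub> conv_inv k H \<sigma> x3 y3) \<odot>\<^bsub>H\<^esub> (x2 \<otimes>\<^bsub>H\<^esub> y2))))))\<rparr>"

definition deformed_r_form ::
  "'k ring \<Rightarrow> ('k, 'h) hopf_data \<Rightarrow> ('h \<Rightarrow> 'h \<Rightarrow> 'k) \<Rightarrow> ('h \<Rightarrow> 'h \<Rightarrow> 'k) \<Rightarrow> 'h \<Rightarrow> 'h \<Rightarrow> 'k" where
  "deformed_r_form k H \<sigma> r = conv k H (conv k H (\<lambda>x y. \<sigma> y x) r) (conv_inv k H \<sigma>)"


section \<open>The braided category of left comodules\<close>

text \<open>All objects of a category live in one type, which therefore has to contain the ground ring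
  and to be closed under tensor products. Every set of elements of the arbitrary type \<open>'x\<close> embeds
  via \<open>Atom\<close>, so every comodule on such a set is isomorphic to an object of the category.\<close>

datatype ('k, 'x) univ =
    Atom 'x
  | Scal (unscal: 'k)
  | Tens (untens: "(('k, 'x) univ \<times> ('k, 'x) univ) list")

record ('k, 'm, 'h) comodule = "('k, 'm) module" +
  coact :: "'m \<Rightarrow> ('h \<times> 'm) list"

type_synonym ('k, 'h, 'x) comod = "('k, ('k, 'x) univ, 'h) comodule"

type_synonym ('k, 'h, 'x) comod_arrow =
  "('k, 'h, 'x) comod \<times> (('k, 'x) univ \<Rightarrow> ('k, 'x) univ) \<times> ('k, 'h, 'x) comod"

locale left_comodule = module k M
  for k :: "'k ring" and H :: "('k, 'h) hopf_data" and M :: "('k, 'm, 'h) comodule" +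
  assumes coact_linear: "linear_map k M (tensor k H M) (coact M)"
    and coact_coassoc: "m \<in> carrier M \<Longrightarrow>
      (let HHM = tensor k H (tensor k H M) in
        tsum HHM (coact M m) (\<lambda>h n. tsum HHM (comult H h) (\<lambda>h1 h2.
          tens k H (tensor k H M) h1 (tens k H M h2 n)))
        = tsum HHM (coact M m) (\<lambda>h1 m'. tsum HHM (coact M m') (\<lambda>h2 n.
          tens k H (tensor k H M) h1 (tens k H M h2 n))))"
    and coact_counit: "m \<in> carrier M \<Longrightarrow> tsum M (coact M m) (\<lambda>h n. counit H h \<odot>\<^bsub>M\<^esub> n) = m"

definition utensor ::
  "'k ring \<Rightarrow> ('k, ('k, 'x) univ, 'y) module_scheme \<Rightarrow> ('k, ('k, 'x) univ, 'z) module_scheme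
    \<Rightarrow> ('k, ('k, 'x) univ) module" where
  "utensor k M N = (let T = tensor k M N in
     \<lparr>carrier = Tens ` carrier T, mult = undefined, one = undefined,
      zero = Tens \<zero>\<^bsub>T\<^esub>,
      add = (\<lambda>s t. Tens (untens s \<oplus>\<^bsub>T\<^esub> untens t)),
      smult = (\<lambda>c t. Tens (c \<odot>\<^bsub>T\<^esub> untens t))\<rparr>)"

definition utens ::
  "'k ring \<Rightarrow> ('k, ('k, 'x) univ, 'y) module_scheme \<Rightarrow> ('k, ('k, 'x) univ, 'z) module_scheme
    \<Rightarrow> ('k, 'x) univ \<Rightarrow> ('k, 'x) univ \<Rightarrow> ('k, 'x) univ" where
  "utens k M N m n = Tens (tens k M N m n)"

definition comod_tensor ::
  "'k ring \<Rightarrow> ('k, 'h) hopf_data \<Rightarrow> ('k, 'h, 'x) comod \<Rightarrow> ('k, 'h, 'x) comod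
    \<Rightarrow> ('k, 'h, 'x) comod" where
  "comod_tensor k H M N = (let T = utensor k M N; HT = tensor k H T in
     module.extend T (comodule.fields (\<lambda>t. tsum HT (untens t) (\<lambda>m n.
       tsum HT (coact M m) (\<lambda>g m0. tsum HT (coact N n) (\<lambda>h n0.
         tens k H T (g \<otimes>\<^bsub>H\<^esub> h) (utens k M N m0 n0)))))))"

definition comod_unit :: "'k ring \<Rightarrow> ('k, 'h) hopf_data \<Rightarrow> ('k, 'h, 'x) comod" where
  "comod_unit k H = (let K = \<lparr>carrier = Scal ` carrier k, mult = undefined, one = undefined,
       zero = Scal \<zero>\<^bsub>k\<^esub>,
       add = (\<lambda>a b. Scal (unscal a \<oplus>\<^bsub>k\<^esub> unscal b)),
       smult = (\<lambda>c a. Scal (c \<otimes>\<^bsub>k\<^esub> unscal a))\<rparr> in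
     module.extend K (comodule.fields (\<lambda>a. tens k H K \<one>\<^bsub>H\<^esub> a)))"

definition comod_hom ::
  "'k ring \<Rightarrow> ('k, 'h) hopf_data \<Rightarrow> ('k, 'h, 'x) comod \<Rightarrow> ('k, 'h, 'x) comod
    \<Rightarrow> ('k, 'h, 'x) comod_arrow set" where
  "comod_hom k H M N = {(M, f, N) | f. f \<in> extensional (carrier M) \<and> linear_map k M N f \<and>
     (\<forall>m\<in>carrier M. coact N (f m) = tsum (tensor k H N) (coact M m) (\<lambda>h m0. tens k H N h (f m0)))}"

definition comod_arrow ::
  "('k, 'h, 'x) comod \<Rightarrow> ('k, 'h, 'x) comod \<Rightarrow> (('k, 'x) univ \<Rightarrow> ('k, 'x) univ)
    \<Rightarrow> ('k, 'h, 'x) comod_arrow" where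
  "comod_arrow M N f = (M, restrict f (carrier M), N)"

definition comod_cat ::
  "'k ring \<Rightarrow> ('k, 'h) hopf_data \<Rightarrow> ('h \<Rightarrow> 'h \<Rightarrow> 'k)
    \<Rightarrow> (('k, 'h, 'x) comod, ('k, 'h, 'x) comod_arrow) brcat" where
  "comod_cat k H r = \<lparr>
     Obj = {M. left_comodule k H M},
     Hom = comod_hom k H,
     Ident = (\<lambda>M. comod_arrow M M (\<lambda>m. m)),
     Comp = (\<lambda>(_, g, P) (M, f, _). comod_arrow M P (\<lambda>m. g (f m))),
     TenO = comod_tensor k H,
     TenA = (\<lambda>(M, f, M') (N, g, N').
       comod_arrow (comod_tensor k H M N) (comod_tensor k H M' N') (\<lambda>t.
         tsum (comod_tensor k H M' N') (untens t) (\<lambda>m n. utens k M' N' (f m) (g n)))),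
     Unit = comod_unit k H,
     Assoc = (\<lambda>M N P. let NP = comod_tensor k H N P; Q = comod_tensor k H M NP in
       comod_arrow (comod_tensor k H (comod_tensor k H M N) P) Q (\<lambda>t.
         tsum Q (untens t) (\<lambda>s p. tsum Q (untens s) (\<lambda>m n.
           utens k M NP m (utens k N P n p))))),
     LUnit = (\<lambda>M. comod_arrow (comod_tensor k H (comod_unit k H) M) M (\<lambda>t.
       tsum M (untens t) (\<lambda>c m. unscal c \<odot>\<^bsub>M\<^esub> m))),
     RUnit = (\<lambda>M. comod_arrow (comod_tensor k H M (comod_unit k H)) M (\<lambda>t.
       tsum M (untens t) (\<lambda>m c. unscal c \<odot>\<^bsub>M\<^esub> m))),
     Braid = (\<lambda>M N. let NM = comod_tensor k H N M in
       comod_arrow (comod_tensor k H M N) NM (\<lambda>t. tsum NM (untens t) (\<lambda>m n.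
         tsum NM (coact M m) (\<lambda>g m0. tsum NM (coact N n) (\<lambda>h n0.
           r h g \<odot>\<^bsub>NM\<^esub> utens k N M n0 m0)))))\<rparr>"

text \<open>The monoidal functor \<open>M \<mapsto> \<^sub>\<sigma>M\<close>. As \<open>H'\<close> equals \<open>H\<close> as a coalgebra, it does not change
  the data of a comodule; only the monoidal structure differs.\<close>

definition twist_functor ::
  "'k ring \<Rightarrow> ('k, 'h) hopf_data \<Rightarrow> ('h \<Rightarrow> 'h \<Rightarrow> 'k)
    \<Rightarrow> (('k, 'h, 'x) comod, ('k, 'h, 'x) comod_arrow,
        ('k, 'h, 'x) comod, ('k, 'h, 'x) comod_arrow) mon_fun" where
  "twist_functor k H \<sigma> = (let H' = cocycle_deformation k H \<sigma> in \<lparr>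
     FO = (\<lambda>M. M),
     FA = (\<lambda>f. f),
     FXi = (\<lambda>M N. let MN = comod_tensor k H M N in
       comod_arrow (comod_tensor k H' M N) MN (\<lambda>t. tsum MN (untens t) (\<lambda>m n.
         tsum MN (coact M m) (\<lambda>g m0. tsum MN (coact N n) (\<lambda>h n0.
           \<sigma> g h \<odot>\<^bsub>MN\<^esub> utens k M N m0 n0))))),
     FEta = comod_arrow (comod_unit k H') (comod_unit k H) (\<lambda>c.
       inv\<^bsub>k\<^esub> (\<sigma> \<one>\<^bsub>H\<^esub> \<one>\<^bsub>H\<^esub>) \<odot>\<^bsub>comod_unit k H\<^esub> c)\<rparr>)"

end

theory Submission
  imports Defs
begin

text \<open>The comodules of \<open>H\<close> and of \<open>H' = \<^sub>\<sigma>H\<^bsub>\<sigma>\<^sup>-\<^sup>1\<^esub>\<close>, and the maps between them, are literally the same; only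
 tensor products and braidings differ. Let \<open>C\<close> and \<open>D\<close> be the two categories. The maps
 \<open>\<xi> (m \<otimes> n) = \<Sum> \<sigma>(m\<^sub>-\<^sub>1, n\<^sub>-\<^sub>1) m\<^sub>0 \<otimes> n\<^sub>0\<close> compare the two tensor products, and the proof consists in showing
 that they respect all structure and that such a comparison transports everything else.

 That \<open>\<xi>\<close> respects the structure comes down to identities between forms on \<open>H\<close>. Maps of the shape
 \<open>m \<otimes> n \<mapsto> \<Sum> \<phi>(m\<^sub>-\<^sub>1, n\<^sub>-\<^sub>1) u(m\<^sub>0, n\<^sub>0)\<close> compose by convolution of the forms (\<open>act_act\<close>). Hence \<open>\<xi>\<close> is
 invertible because \<open>\<sigma>\<close> is; it is colinear because \<open>\<Sum> \<sigma>(x\<^sub>1, y\<^sub>1) x\<^sub>2 y\<^sub>2 = \<Sum> (x\<^sub>1 \<star> y\<^sub>1) \<sigma>(x\<^sub>2, y\<^sub>2)\<close>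
 (\<open>star_\<sigma>\<close>); it is compatible with the associativity maps by the cocycle identity
 (\<open>cocycle_act_map\<close>), with the unit because \<open>\<sigma>(x, 1) = \<sigma>(1, x) = \<sigma>(1, 1) \<epsilon>(x)\<close> (\<open>\<sigma>_one_right\<close>), and with the
 braidings because \<open>r\<^sub>\<sigma> * \<sigma> = \<sigma>\<^sub>2\<^sub>1 * r\<close> (\<open>braid_act_map\<close>). The same calculus shows that \<open>C\<close> is braided:
 the hexagons are the multiplicativity of \<open>r\<close>. For \<open>D\<close> only compatibility of the product of \<open>H'\<close> with
 coproduct, counit and unit is computed; its associativity and its universal \<open>R\<close>-form enter through
 the comparison with \<open>C\<close> (\<open>colinear_assoc_D\<close>, \<open>colinear_braid_D\<close>).

 The second half is pure category theory, in the locale \<open>twist\<close>: two monoidal structures on one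
 category, the first of them braided, with comparison isomorphisms \<open>\<xi>\<close> and a second braiding carried
 over by \<open>\<xi>\<close>. Then the second structure is braided, Hopf algebras and their modules are transported
 (\<open>hopf_T\<close>, \<open>module_T\<close>), and since the situation is symmetric (\<open>twist_Finv\<close>) the transports are
 equivalences (\<open>hopf_equivalence\<close>, \<open>module_equivalence\<close>).

 The equivalence of module categories also needs that modules over a Hopf algebra \<open>A\<close> in \<open>C\<close> form a
 monoidal category (\<open>module_cat_monoidal\<close>). There the element formula
 \<open>a (m \<otimes> n) = \<Sum> r(m\<^sub>-\<^sub>1, a\<^sub>2\<^sub>,\<^sub>-\<^sub>1) a\<^sub>1 m\<^sub>0 \<otimes> a\<^sub>2\<^sub>,\<^sub>0 n\<close> for the action reduces each claim to the axioms of \<open>r\<close> and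
 of \<open>A\<close>.\<close>

text \<open>Composition and tensor products of arrows and objects are written \<open>oo\<close>, \<open>xx\<close>, \<open>ox\<close>, with an
 index for the category where it is not the ambient one; \<open>x el M\<close> stands for membership in the carrier,
 \<open>c *[M] x\<close> and \<open>x *<R> y\<close> for scalar multiplication and multiplication.\<close>

section \<open>Linear maps and tensor products of modules\<close>

abbreviation comp_in (infixr \<open>oo\<index>\<close> 55) where "comp_in \<equiv> Comp"
abbreviation tenA_in (infixr \<open>xx\<index>\<close> 70) where "tenA_in \<equiv> TenA"
abbreviation tenO_in (infixr \<open>ox\<index>\<close> 70) where "tenO_in \<equiv> TenO"
abbreviation el (infix \<open>el\<close> 50) where "x el M \<equiv> x \<in> carrier M"
abbreviation scale (\<open>(_ *[_]/ _)\<close> [70, 0, 71] 70) where "c *[M] x \<equiv> c \<odot>\<^bsub>M\<^esub> x"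
abbreviation times_in (\<open>(_ *<_>/ _)\<close> [70, 1000, 71] 70) where "x *<R> y \<equiv> x \<otimes>\<^bsub>R\<^esub> y"

definition bilinear_map ::
 "('k, 'y) ring_scheme \<Rightarrow> ('k, 'm, 'z) module_scheme \<Rightarrow> ('k, 'n, 'w) module_scheme
  \<Rightarrow> ('k, 'g, 'v) module_scheme \<Rightarrow> ('m \<Rightarrow> 'n \<Rightarrow> 'g) \<Rightarrow> bool" where
 "bilinear_map k M N G f \<longleftrightarrow> (\<forall>m\<in>carrier M. linear_map k N G (f m)) \<and>
   (\<forall>n\<in>carrier N. linear_map k M G (%m. f m n))"

definition pairs where
 "pairs M N t \<longleftrightarrow> set t \<subseteq> carrier M \<times> carrier N"

lemma linear_closed: "linear_map k M N f ==> x el M ==> f x el N"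
 by (auto simp: linear_map_def)

lemma linear_add: "linear_map k M N f ==> x el M ==> y el M ==>
  f (x \<oplus>\<^bsub>M\<^esub> y) = f x \<oplus>\<^bsub>N\<^esub> f y"
 by (auto simp: linear_map_def)

lemma linear_smult: "linear_map k M N f ==> c el k ==> x el M ==>
  f (c *[M] x) = c *[N] f x"
 by (auto simp: linear_map_def)

lemma linear_mapI:
 assumes "!!x. x el M ==> f x el N"
  and "!!x y. x el M ==> y el M ==> f (x \<oplus>\<^bsub>M\<^esub> y) = f x \<oplus>\<^bsub>N\<^esub> f y"
  and "!!c x. c el k ==> x el M ==> f (c *[M] x) = c *[N] f x"
 shows "linear_map k M N f"
 using assms by (auto simp: linear_map_def)

lemma linear_map_cong:
 assumes "!!x. x el M ==> f x = g x" "module k M"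
 shows "linear_map k M N f \<longleftrightarrow> linear_map k M N g"
proof -
 interpret M: module k M by fact
 show ?thesis unfolding linear_map_def using assms(1) by (auto simp: Pi_iff)
qed

lemma linear_comp: "linear_map k M N f ==> linear_map k N P g ==> linear_map k M P (%x. g (f x))"
 by (auto simp: linear_map_def Pi_iff)

lemma linear_id: "linear_map k M M (%x. x)"
 by (auto simp: linear_map_def)

lemma bilinear_mapI:
 assumes "!!m. m el M ==> linear_map k N G (%n. f m n)"
  and "!!n. n el N ==> linear_map k M G (%m. f m n)"
 shows "bilinear_map k M N G f"
 using assms by (auto simp: bilinear_map_def)

lemma bilinear_closed: "bilinear_map k M N G f ==> m el M ==> n el N ==> f m n el G"
 by (auto simp: bilinear_map_def intro: linear_closed)

lemma bilinear_right: "bilinear_map k A B G f ==> a el A ==> linear_map k P B g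
 ==> linear_map k P G (%x. f a (g x))"
 by (auto simp: bilinear_map_def intro: linear_comp)

lemma bilinear_left: "bilinear_map k A B G f ==> linear_map k P A g ==> b el B
 ==> linear_map k P G (%x. f (g x) b)"
 using linear_comp[of k P A g G "%a. f a b"] by (auto simp: bilinear_map_def)

lemma bilinear_form_iff: "bilinear_form k H \<sigma> \<longleftrightarrow> bilinear_map k H H (self_module k) \<sigma>"
 by (simp add: bilinear_form_def bilinear_map_def)

lemma tsum_Nil [simp]: "tsum G [] f = \<zero>\<^bsub>G\<^esub>"
 and tsum_Cons [simp]: "tsum G ((a, b) # t) f = f a b \<oplus>\<^bsub>G\<^esub> tsum G t f"
 by (simp_all add: tsum_def)

lemma tsum_change_group:
 assumes "add G = add G'" "\<zero>\<^bsub>G\<^esub> = \<zero>\<^bsub>G'\<^esub>"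
 shows "tsum G t f = tsum G' t f"
 by (simp add: tsum_def assms)

lemma tsum_cong:
 assumes "pairs A B t" "!!a b. a el A ==> b el B ==> f a b = g a b"
 shows "tsum G t f = tsum G t g"
 using assms by (induction t) (auto simp: pairs_def)

locale scalars = cring k for k :: "'k ring" (structure)
begin

abbreviation "K \<equiv> self_module k"

lemma K_simps [simp]: "carrier K = carrier k" "\<zero>\<^bsub>K\<^esub> = \<zero>\<^bsub>k\<^esub>" "\<one>\<^bsub>K\<^esub> = \<one>\<^bsub>k\<^esub>" "add K = add k"
 "mult K = mult k" "smult K = mult k"
 by (simp_all add: self_module_def)

lemma tsum_K: "tsum K = tsum k"
 by (intro ext) (simp add: tsum_def)

lemma module_K [simp]: "module k K"
proof (intro moduleI abelian_groupI)
 show "cring k" by (rule cring_axioms)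
 fix x assume "x el K"
 then show "\<exists>y\<in>carrier K. y \<oplus>\<^bsub>K\<^esub> x = \<zero>\<^bsub>K\<^esub>"
  by (intro bexI[of _ "\<ominus> x"]) (auto simp: l_neg)
qed (auto simp: l_distr r_distr m_assoc a_ac)

lemma linear_zero:
 assumes "module k M" "module k N" "linear_map k M N f"
 shows "f \<zero>\<^bsub>M\<^esub> = \<zero>\<^bsub>N\<^esub>"
proof -
 interpret M: module k M by fact
 interpret N: module k N by fact
 have "f (\<zero> *[M] \<zero>\<^bsub>M\<^esub>) = \<zero> *[N] f \<zero>\<^bsub>M\<^esub>"
  using assms by (intro linear_smult) auto
 then show ?thesis using linear_closed[OF assms(3)] by simp
qed

lemma tsum_closed:
 assumes "module k G" "pairs A B t" "!!a b. a el A ==> b el B ==> f a b el G"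
 shows "tsum G t f el G"
proof -
 interpret G: module k G by fact
 show ?thesis using assms(2,3) by (induction t) (auto simp: pairs_def)
qed

lemma tsum_append:
 assumes "module k G" "pairs A B s" "pairs A B t" "!!a b. a el A ==> b el B ==> f a b el G"
 shows "tsum G (s @ t) f = tsum G s f \<oplus>\<^bsub>G\<^esub> tsum G t f"
proof -
 interpret G: module k G by fact
 show ?thesis using assms(2-)
 proof (induction s)
  case Nil then show ?case using tsum_closed[OF assms(1) Nil(2,3)] by simp
 next
  case (Cons p s)
  obtain a b where "p = (a, b)" by (cases p)
  with Cons show ?case
   using tsum_closed[OF assms(1), of A B s f] tsum_closed[OF assms(1), of A B t f]
   by (auto simp: pairs_def G.a_assoc)
 qed
qed

lemma tsum_add:
 assumes "module k G" "pairs A B t" "!!a b. a el A ==> b el B ==> f a b el G"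
  "!!a b. a el A ==> b el B ==> g a b el G"
 shows "tsum G t (%a b. f a b \<oplus>\<^bsub>G\<^esub> g a b) = tsum G t f \<oplus>\<^bsub>G\<^esub> tsum G t g"
proof -
 interpret G: module k G by fact
 show ?thesis using assms(2-)
 proof (induction t)
  case Nil then show ?case by simp
 next
  case (Cons p s)
  obtain a b where "p = (a, b)" by (cases p)
  with Cons show ?case
   using tsum_closed[OF assms(1), of A B s f] tsum_closed[OF assms(1), of A B s g]
   by (auto simp: pairs_def G.a_ac)
 qed
qed

lemma tsum_zero: "module k G ==> tsum G t (%a b. \<zero>\<^bsub>G\<^esub>) = \<zero>\<^bsub>G\<^esub>"
proof -
 assume "module k G"
 then interpret G: module k G .
 show ?thesis by (induction t) auto
qed

lemma linear_tsum:
 assumes "module k G" "module k G'" "linear_map k G G' L" "pairs A B t" "!!a b. a el A ==> b el B ==> f a b el G"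
 shows "L (tsum G t f) = tsum G' t (%a b. L (f a b))"
proof -
 interpret G: module k G by fact
 interpret G': module k G' by fact
 show ?thesis using assms(4-)
 proof (induction t)
  case Nil then show ?case using linear_zero[OF assms(1-3)] by simp
 next
  case (Cons p s)
  obtain a b where "p = (a, b)" by (cases p)
  with Cons show ?case
   using tsum_closed[OF assms(1), of A B s f]
   by (auto simp: pairs_def linear_add[OF assms(3)])
 qed
qed

lemma tsum_swap:
 assumes "module k G" "pairs A B s" "pairs A' B' t"
  "!!a b c d. a el A ==> b el B ==> c el A' ==> d el B' ==> f a b c d el G"
 shows "tsum G s (%a b. tsum G t (%c d. f a b c d)) = tsum G t (%c d. tsum G s (%a b. f a b c d))"
proof -
 interpret G: module k G by fact
 show ?thesis using assms(2-)
 proof (induction s)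
  case Nil then show ?case by (simp add: tsum_zero[OF assms(1)])
 next
  case (Cons p s)
  obtain a b where p: "p = (a, b)" by (cases p)
  have ab: "a el A" "b el B" and s: "pairs A B s" using Cons p by (auto simp: pairs_def)
  have "tsum G t (%c d. f a b c d \<oplus>\<^bsub>G\<^esub> tsum G s (%a b. f a b c d)) =
   tsum G t (%c d. f a b c d) \<oplus>\<^bsub>G\<^esub> tsum G t (%c d. tsum G s (%a b. f a b c d))"
   by (rule tsum_add[OF assms(1) Cons.prems(2)]) (auto intro!: tsum_closed[OF assms(1) s] Cons.prems ab)
  with Cons s show ?case by (simp add: p)
 qed
qed

lemma linear_smult_const:
 assumes "module k G" "v el G" "linear_map k P K c"
 shows "linear_map k P G (%x. c x *[G] v)"
proof -
 interpret G: module k G by fact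
 show ?thesis
  using assms(2) linear_closed[OF assms(3)] linear_add[OF assms(3)] linear_smult[OF assms(3)]
  by (intro linear_mapI) (auto simp: G.smult_l_distr G.smult_assoc1)
qed

lemma linear_const_smult:
 assumes "module k G" "c el k" "linear_map k P G f"
 shows "linear_map k P G (%x. c *[G] f x)"
proof -
 interpret G: module k G by fact
 show ?thesis
  using assms(2) linear_closed[OF assms(3)] linear_add[OF assms(3)] linear_smult[OF assms(3)]
  by (intro linear_mapI) (auto simp: G.smult_r_distr G.smult_assoc1[symmetric] m_comm)
qed

lemma linear_tsum_inner:
 assumes "module k G" "pairs A B t" "!!a b. a el A ==> b el B ==> linear_map k P G (%x. F x a b)"
 shows "linear_map k P G (%x. tsum G t (F x))"
proof (rule linear_mapI)
 interpret G: module k G by fact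
 note F = assms(3)
 show "tsum G t (F x) el G" if "x el P" for x
  using that by (intro tsum_closed[OF assms(1,2)] linear_closed[OF F]) auto
 show "tsum G t (F (x \<oplus>\<^bsub>P\<^esub> y)) = tsum G t (F x) \<oplus>\<^bsub>G\<^esub> tsum G t (F y)" if "x el P" "y el P" for x y
 proof -
  have "tsum G t (F (x \<oplus>\<^bsub>P\<^esub> y)) = tsum G t (%a b. F x a b \<oplus>\<^bsub>G\<^esub> F y a b)"
   by (rule tsum_cong[OF assms(2)]) (simp add: linear_add[OF F] that)
  also have "... = tsum G t (F x) \<oplus>\<^bsub>G\<^esub> tsum G t (F y)"
   using that by (intro tsum_add[OF assms(1,2)] linear_closed[OF F]) auto
  finally show ?thesis .
 qed
 show "tsum G t (F (c *[P] x)) = c *[G] tsum G t (F x)" if "c el k" "x el P" for c x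
 proof -
  have "tsum G t (F (c *[P] x)) = tsum G t (%a b. c *[G] F x a b)"
   by (rule tsum_cong[OF assms(2)]) (simp add: linear_smult[OF F] that)
  also have "... = c *[G] tsum G t (F x)"
   using that by (intro linear_tsum[OF assms(1) assms(1) _ assms(2), symmetric] linear_closed[OF F]
    linear_const_smult assms linear_id) auto
  finally show ?thesis .
 qed
qed

lemma smult_tsum:
 assumes "module k G" "pairs A B t" "c el k" "!!a b. a el A ==> b el B ==> f a b el G"
 shows "c *[G] tsum G t f = tsum G t (%a b. c *[G] f a b)"
 by (rule linear_tsum[OF assms(1) assms(1) linear_const_smult[OF assms(1,3) linear_id] assms(2,4)])

lemma tsum_smult:
 assumes "module k G" "pairs A B t" "v el G" "!!a b. a el A ==> b el B ==> f a b el k"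
 shows "tsum k t f *[G] v = tsum G t (%a b. f a b *[G] v)"
 using linear_tsum[OF module_K assms(1) linear_smult_const[OF assms(1,3) linear_id] assms(2)] assms(4)
 by (simp add: tsum_K)

end

declare tens_eq.trans [trans]

lemma tens_eq_change:
 assumes "carrier M = carrier M'" "add M = add M'" "\<zero>\<^bsub>M\<^esub> = \<zero>\<^bsub>M'\<^esub>" "smult M = smult M'"
  and "carrier N = carrier N'" "add N = add N'" "\<zero>\<^bsub>N\<^esub> = \<zero>\<^bsub>N'\<^esub>" "smult N = smult N'"
 shows "tens_eq k M N = tens_eq k M' N'"
proof -
 have "tens_eq k M' N' s t" if "tens_eq k M N s t" for s t
  using that
 proof induction
  case (trans s t u) then show ?case by (blast intro: tens_eq.trans)
 qed (unfold assms, auto intro: tens_eq.intros)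
 moreover have "tens_eq k M N s t" if "tens_eq k M' N' s t" for s t
  using that
 proof induction
  case (trans s t u) then show ?case by (blast intro: tens_eq.trans)
 qed (unfold assms[symmetric], auto intro: tens_eq.intros)
 ultimately show ?thesis by blast
qed

lemma tens_rep_change:
 assumes "carrier M = carrier M'" "add M = add M'" "\<zero>\<^bsub>M\<^esub> = \<zero>\<^bsub>M'\<^esub>" "smult M = smult M'"
  and "carrier N = carrier N'" "add N = add N'" "\<zero>\<^bsub>N\<^esub> = \<zero>\<^bsub>N'\<^esub>" "smult N = smult N'"
 shows "tens_rep k M N = tens_rep k M' N'"
 unfolding tens_rep_def tens_eq_change[OF assms] ..

text \<open>Multiplication does not enter a tensor product. Hence the comodules \<open>M \<otimes> N\<close> formed with two
 different products on \<open>H\<close> have the same elements, and maps between them can be compared on the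
 same pure tensors.\<close>
lemma tensor_change:
 assumes "carrier M = carrier M'" "add M = add M'" "\<zero>\<^bsub>M\<^esub> = \<zero>\<^bsub>M'\<^esub>" "smult M = smult M'"
  and "carrier N = carrier N'" "add N = add N'" "\<zero>\<^bsub>N\<^esub> = \<zero>\<^bsub>N'\<^esub>" "smult N = smult N'"
 shows "tensor k M N = tensor k M' N'" "tens k M N = tens k M' N'"
 unfolding tensor_def tens_def [abs_def] tens_rep_change[OF assms] using assms by simp_all

context scalars
begin

context
 fixes M :: "('k, 'm, 'z) module_scheme" and N :: "('k, 'n, 'w) module_scheme"
 assumes M: "module k M" and N: "module k N"
begin

interpretation M: module k M by (rule M)
interpretation N: module k N by (rule N)

lemma tens_eq_pairs: "tens_eq k M N s t ==> pairs M N s \<and> pairs M N t"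
 by (induction rule: tens_eq.induct) (auto simp: pairs_def)

lemma tens_eq_tsum:
 assumes "tens_eq k M N s t" "module k G" "bilinear_map k M N G f"
 shows "tsum G s f = tsum G t f"
proof -
 interpret G: module k G by fact
 note cl = bilinear_closed[OF assms(3)]
 note l = assms(3)[unfolded bilinear_map_def]
 have l2: "linear_map k M G (%m. f m n)" if "n el N" for n using l that by blast
 from assms(1) show ?thesis
 proof induction
  case (append s s' t t')
  then show ?case using tens_eq_pairs[OF append.hyps(1)] tens_eq_pairs[OF append.hyps(2)]
   tsum_append[where A=M and B=N, OF assms(2) _ _ cl] by simp
 next
  case (commute s t)
  then show ?case using tsum_append[where A=M and B=N, OF assms(2) _ _ cl]
   tsum_closed[where A=M and B=N, OF assms(2) _ cl] G.a_comm by (simp add: pairs_def)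
 next
  case (zero n)
  then show ?case using linear_zero[OF M assms(2) l2] by simp
 next
  case (balanced c m n)
  then show ?case using l cl by (simp add: linear_smult[of k M G "%m. f m n"] linear_smult[of k N G "f m"])
 next
  case (add_left m m' n)
  then show ?case using cl linear_add[OF l2] by simp
 next
  case (add_right m n n')
  then show ?case using cl l by (simp add: linear_add[of k N G "f m"])
 qed auto
qed

lemma tens_rep_eq: "pairs M N s ==> tens_eq k M N s (tens_rep k M N s)"
 unfolding tens_rep_def by (rule someI[of _ s]) (simp add: pairs_def tens_eq.refl)

lemma tens_rep_cong: "tens_eq k M N s t ==> tens_rep k M N s = tens_rep k M N t"
proof -
 assume a: "tens_eq k M N s t"
 have "tens_eq k M N s = tens_eq k M N t"
  by (rule ext) (blast intro: a tens_eq.trans tens_eq.sym)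
 then show ?thesis unfolding tens_rep_def by simp
qed

lemma tens_rep_rep: "pairs M N s ==> tens_rep k M N (tens_rep k M N s) = tens_rep k M N s"
 by (rule tens_rep_cong[symmetric]) (rule tens_rep_eq)

lemma tensor_carrier: "t el (tensor k M N) \<longleftrightarrow> pairs M N t \<and> tens_rep k M N t = t"
proof
 assume "t el (tensor k M N)"
 then obtain s where "pairs M N s" "t = tens_rep k M N s" by (auto simp: tensor_def pairs_def)
 then show "pairs M N t \<and> tens_rep k M N t = t"
  using tens_eq_pairs[OF tens_rep_eq] tens_rep_rep by simp
next
 assume "pairs M N t \<and> tens_rep k M N t = t"
 then show "t el (tensor k M N)" by (force simp: tensor_def pairs_def)
qed

lemma tens_rep_closed: "pairs M N s ==> tens_rep k M N s el (tensor k M N)"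
 by (auto simp: tensor_def pairs_def)

lemma tensor_pairs: "t el (tensor k M N) ==> pairs M N t"
 by (simp add: tensor_carrier)

lemma tens_rep_append:
 assumes "pairs M N s" "pairs M N t"
 shows "tens_rep k M N (tens_rep k M N s @ t) = tens_rep k M N (s @ t)"
  "tens_rep k M N (s @ tens_rep k M N t) = tens_rep k M N (s @ t)"
 using assms by (auto intro!: tens_rep_cong[symmetric] tens_eq.append tens_rep_eq tens_eq.refl simp: pairs_def)

lemma pairs_smult: "c el k ==> pairs M N s ==> pairs M N (map (%(m, n). (c *[M] m, n)) s)"
 by (auto simp: pairs_def)

lemma tens_eq_smult:
 assumes "c el k" "tens_eq k M N s t"
 shows "tens_eq k M N (map (%(m, n). (c *[M] m, n)) s) (map (%(m, n). (c *[M] m, n)) t)"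
 using assms(2)
proof induction
 case (refl s) then show ?case using pairs_smult[OF assms(1), of s] by (simp add: pairs_def tens_eq.refl)
next
 case (sym s t) then show ?case by (blast intro: tens_eq.sym)
next
 case (trans s t u) then show ?case by (blast intro: tens_eq.trans)
next
 case (append s s' t t') then show ?case by (auto intro: tens_eq.append)
next
 case (commute s t) then show ?case
  using pairs_smult[OF assms(1), of s] pairs_smult[OF assms(1), of t] by (simp add: pairs_def tens_eq.commute)
next
 case (add_left m m' n) then show ?case using assms(1) by (auto simp: M.smult_r_distr intro!: tens_eq.add_left)
next
 case (add_right m n n') then show ?case using assms(1) by (auto intro!: tens_eq.add_right)
next
 case (balanced d m n)
 have e: "c *[M] (d *[M] m) = d *[M] (c *[M] m)" using balanced assms(1)
  by (simp add: M.smult_assoc1[symmetric] m_comm)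
 show ?case using balanced assms(1) by (simp add: e tens_eq.balanced)
next
 case (zero n) then show ?case using assms(1) by (auto intro: tens_eq.zero)
qed

lemma pairs_append: "pairs M N s ==> pairs M N t ==> pairs M N (s @ t)"
 by (auto simp: pairs_def)

lemma tens_eq_inverse: "pairs M N s ==> tens_eq k M N (map (%(m, n). (\<ominus>\<^bsub>M\<^esub> m, n)) s @ s) []"
proof (induction s)
 case Nil then show ?case by (auto intro: tens_eq.refl)
next
 case (Cons p s)
 obtain m n where p: "p = (m, n)" by (cases p)
 have mn: "m el M" "n el N" "pairs M N s" using Cons.prems p by (auto simp: pairs_def)
 let ?s = "map (%(m, n). (\<ominus>\<^bsub>M\<^esub> m, n)) s"
 have ps: "set ?s \<subseteq> carrier M \<times> carrier N" using mn by (auto simp: pairs_def)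
 have "tens_eq k M N (([(\<ominus>\<^bsub>M\<^esub> m, n)] @ ?s) @ [(m, n)] @ s) ((?s @ [(\<ominus>\<^bsub>M\<^esub> m, n)]) @ [(m, n)] @ s)"
  using mn ps by (intro tens_eq.append[OF tens_eq.commute tens_eq.refl]) (auto simp: pairs_def)
 also have "tens_eq k M N ... (?s @ [] @ s)"
 proof -
  have "tens_eq k M N [(\<ominus>\<^bsub>M\<^esub> m, n), (m, n)] [(\<ominus>\<^bsub>M\<^esub> m \<oplus>\<^bsub>M\<^esub> m, n)]"
   using mn by (intro tens_eq.sym[OF tens_eq.add_left]) auto
  also have "tens_eq k M N ... []" using mn by (simp add: M.l_neg tens_eq.zero)
  finally have "tens_eq k M N ([(\<ominus>\<^bsub>M\<^esub> m, n), (m, n)] @ s) ([] @ s)"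
   using mn by (intro tens_eq.append[OF _ tens_eq.refl]) (auto simp: pairs_def)
  then have "tens_eq k M N (?s @ ([(\<ominus>\<^bsub>M\<^esub> m, n), (m, n)] @ s)) (?s @ [] @ s)"
   using ps by (intro tens_eq.append[OF tens_eq.refl])
  then show ?thesis by simp
 qed
 also have "tens_eq k M N ... []" using Cons.IH mn by simp
 finally show ?case by (simp add: p)
qed

lemma tensor_simps:
 "\<zero>\<^bsub>tensor k M N\<^esub> = tens_rep k M N []"
 "s \<oplus>\<^bsub>tensor k M N\<^esub> t = tens_rep k M N (s @ t)"
 "c *[tensor k M N] s = tens_rep k M N (map (%(m, n). (c *[M] m, n)) s)"
 by (simp_all add: tensor_def)

lemma tens_rep_smult:
 assumes "pairs M N s" "c el k"
 shows "tens_rep k M N (map (%(m, n). (c *[M] m, n)) (tens_rep k M N s)) =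
  tens_rep k M N (map (%(m, n). (c *[M] m, n)) s)"
 by (rule tens_rep_cong[symmetric]) (intro tens_eq_smult assms tens_rep_eq)

lemma tens_eq_two_smults:
 assumes "pairs M N s" "c el k" "d el k"
 shows "tens_eq k M N (map (%(m, n). ((c \<oplus> d) *[M] m, n)) s)
  (map (%(m, n). (c *[M] m, n)) s @ map (%(m, n). (d *[M] m, n)) s)"
 using assms(1)
proof (induction s)
 case Nil then show ?case by (auto intro: tens_eq.refl)
next
 case (Cons p s)
 obtain m n where p: "p = (m, n)" by (cases p)
 have mn: "m el M" "n el N" "pairs M N s" using Cons.prems p by (auto simp: pairs_def)
 let ?c = "map (%(m, n). (c *[M] m, n)) s" and ?d = "map (%(m, n). (d *[M] m, n)) s"
 have ps: "set ?c \<subseteq> carrier M \<times> carrier N" "set ?d \<subseteq> carrier M \<times> carrier N"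
  using mn assms by (auto simp: pairs_def)
 have "tens_eq k M N ([((c \<oplus> d) *[M] m, n)] @ map (%(m, n). ((c \<oplus> d) *[M] m, n)) s)
  ([(c *[M] m, n), (d *[M] m, n)] @ (?c @ ?d))"
  using mn assms Cons.IH by (intro tens_eq.append) (auto simp: M.smult_l_distr intro!: tens_eq.add_left)
 also have "tens_eq k M N ([(c *[M] m, n)] @ ([(d *[M] m, n)] @ ?c) @ ?d)
   ([(c *[M] m, n)] @ (?c @ [(d *[M] m, n)]) @ ?d)"
  using mn assms ps by (intro tens_eq.append[OF tens_eq.refl tens_eq.append[OF tens_eq.commute tens_eq.refl]]) (auto simp: pairs_def)
 then have "tens_eq k M N ([(c *[M] m, n), (d *[M] m, n)] @ (?c @ ?d)) ([(c *[M] m, n)] @ (?c @ [(d *[M] m, n)]) @ ?d)"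
  by simp
 finally show ?case by (simp add: p)
qed

lemma module_tensor: "module k (tensor k M N)"
proof (intro moduleI abelian_groupI)
 show "cring k" by (rule cring_axioms)
 let ?T = "tensor k M N"
 fix x assume x: "x el ?T"
 note xp = tensor_pairs[OF x]
 show "\<zero>\<^bsub>?T\<^esub> \<oplus>\<^bsub>?T\<^esub> x = x" using x by (simp add: tensor_simps tens_rep_append tensor_carrier pairs_def)
 show "\<exists>y\<in>carrier ?T. y \<oplus>\<^bsub>?T\<^esub> x = \<zero>\<^bsub>?T\<^esub>"
 proof
  let ?y = "map (%(m, n). (\<ominus>\<^bsub>M\<^esub> m, n)) x"
  have y: "pairs M N ?y" using xp by (auto simp: pairs_def)
  show "tens_rep k M N ?y el ?T" using y by (rule tens_rep_closed)
  show "tens_rep k M N ?y \<oplus>\<^bsub>?T\<^esub> x = \<zero>\<^bsub>?T\<^esub>"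
   by (simp add: tensor_simps tens_rep_append xp y tens_rep_cong[OF tens_eq_inverse[OF xp]])
 qed
 show "\<one> *[?T] x = x"
 proof -
  have "map (%(m, n). (\<one> *[M] m, n)) x = x"
   using xp by (intro map_idI) (auto simp: pairs_def)
  then show ?thesis using x by (simp add: tensor_simps tensor_carrier)
 qed
 fix y assume y: "y el ?T"
 note yp = tensor_pairs[OF y]
 show "x \<oplus>\<^bsub>?T\<^esub> y el ?T" using xp yp by (simp add: tensor_simps tens_rep_closed pairs_append)
 show "x \<oplus>\<^bsub>?T\<^esub> y = y \<oplus>\<^bsub>?T\<^esub> x" using xp yp by (simp add: tensor_simps pairs_def tens_eq.commute tens_rep_cong)
 fix z assume z: "z el ?T"
 note zp = tensor_pairs[OF z]
 show "x \<oplus>\<^bsub>?T\<^esub> y \<oplus>\<^bsub>?T\<^esub> z = x \<oplus>\<^bsub>?T\<^esub> (y \<oplus>\<^bsub>?T\<^esub> z)"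
  using xp yp zp by (simp add: tensor_simps tens_rep_append pairs_append)
next
 let ?T = "tensor k M N"
 show "\<zero>\<^bsub>?T\<^esub> el ?T" by (simp add: tensor_simps tens_rep_closed pairs_def)
 fix c x assume c: "c el k" and x: "x el ?T"
 note xp = tensor_pairs[OF x]
 show "c *[?T] x el ?T" using c xp by (simp add: tensor_simps tens_rep_closed pairs_smult)
 show "c *[?T] (x \<oplus>\<^bsub>?T\<^esub> y) = c *[?T] x \<oplus>\<^bsub>?T\<^esub> c *[?T] y" if y: "y el ?T" for y
  using c xp tensor_pairs[OF y]
  by (simp add: tensor_simps tens_rep_append tens_rep_smult pairs_append pairs_smult tens_rep_closed tensor_pairs)
 fix d assume d: "d el k"
 show "(c \<oplus> d) *[?T] x = c *[?T] x \<oplus>\<^bsub>?T\<^esub> d *[?T] x"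
  using c d xp by (simp add: tensor_simps tens_rep_append tens_rep_smult pairs_append pairs_smult tens_rep_closed tensor_pairs
    tens_rep_cong[OF tens_eq_two_smults])
 show "(c \<otimes> d) *[?T] x = c *[?T] (d *[?T] x)"
 proof -
  have "map (%(m, n). ((c \<otimes> d) *[M] m, n)) x = map ((%(m, n). (c *[M] m, n)) \<circ> (%(m, n). (d *[M] m, n))) x"
   using xp c d by (auto simp: pairs_def M.smult_assoc1)
  then show ?thesis using c d xp by (simp only: tensor_simps tens_rep_smult pairs_smult map_map)
 qed
qed

lemma bilinear_tens: "bilinear_map k M N (tensor k M N) (tens k M N)"
proof (intro bilinear_mapI linear_mapI)
 fix m n assume mn: "m el M" "n el N"
 then show "tens k M N m n el (tensor k M N)"
  by (simp add: tens_def tens_rep_closed pairs_def)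
 show "tens k M N m n el (tensor k M N)" using mn
  by (simp add: tens_def tens_rep_closed pairs_def)
 show "tens k M N m (n \<oplus>\<^bsub>N\<^esub> n') = tens k M N m n \<oplus>\<^bsub>tensor k M N\<^esub> tens k M N m n'" if "n' el N" for n'
  using mn that tens_rep_append
  by (simp add: tens_def tensor_simps tens_rep_closed pairs_def tens_rep_append tensor_pairs[unfolded pairs_def] tens_rep_cong[OF tens_eq.add_right])
 show "tens k M N (m \<oplus>\<^bsub>M\<^esub> m') n = tens k M N m n \<oplus>\<^bsub>tensor k M N\<^esub> tens k M N m' n" if "m' el M" for m'
  using mn that
  by (simp add: tens_def tensor_simps tens_rep_closed pairs_def tens_rep_append tensor_pairs[unfolded pairs_def] tens_rep_cong[OF tens_eq.add_left])
 fix c assume c: "c el k"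
 show "tens k M N (c *[M] m) n = c *[tensor k M N] tens k M N m n" using mn c
  by (simp add: tens_def tensor_simps pairs_def tens_rep_smult)
 show "tens k M N m (c *[N] n) = c *[tensor k M N] tens k M N m n" using mn c
  by (simp add: tens_def tensor_simps pairs_def tens_rep_smult tens_rep_cong[OF tens_eq.balanced])
qed

lemma tsum_linear_on_tensor:
 assumes "module k G" "bilinear_map k M N G f"
 shows "linear_map k (tensor k M N) G (%t. tsum G t f)"
proof (rule linear_mapI)
 interpret G: module k G by fact
 note cl = bilinear_closed[OF assms(2)]
 have rep: "tsum G (tens_rep k M N s) f = tsum G s f" if "pairs M N s" for s
  by (rule tens_eq_tsum[symmetric]) (auto intro: tens_rep_eq that assms)
 fix s assume s: "s el (tensor k M N)"
 note sp = tensor_pairs[OF s]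
 show "tsum G s f el G" by (rule tsum_closed[OF assms(1) sp cl])
 show "tsum G (s \<oplus>\<^bsub>tensor k M N\<^esub> t) f = tsum G s f \<oplus>\<^bsub>G\<^esub> tsum G t f" if "t el (tensor k M N)" for t
  using tensor_pairs[OF that] sp
  by (simp add: tensor_simps rep pairs_append tsum_append[where A=M and B=N, OF assms(1) _ _ cl])
 show "tsum G (c *[tensor k M N] s) f = c *[G] tsum G s f" if c: "c el k" for c
 proof -
  have "tsum G (map (%(m, n). (c *[M] m, n)) s) f = tsum G s (%m n. c *[G] f m n)" using sp
  proof (induction s)
   case (Cons p s)
   obtain m n where p: "p = (m, n)" by (cases p)
   have mn: "m el M" "n el N" "pairs M N s" using Cons.prems p by (auto simp: pairs_def)
   have "linear_map k M G (%m. f m n)" using assms(2) mn by (auto simp: bilinear_map_def)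
   from linear_smult[OF this c mn(1)] show ?case using Cons.IH mn by (simp add: p)
  qed simp
  also have "... = c *[G] tsum G s f"
   by (rule smult_tsum[OF assms(1) sp c cl, symmetric])
  finally show ?thesis using sp c by (simp add: tensor_simps rep pairs_smult)
 qed
qed

lemma tsum_tens:
 assumes "module k G" "bilinear_map k M N G f" "m el M" "n el N"
 shows "tsum G (tens k M N m n) f = f m n"
proof -
 interpret G: module k G by fact
 have "tsum G (tens k M N m n) f = tsum G [(m, n)] f" unfolding tens_def
  by (rule tens_eq_tsum[symmetric]) (auto intro!: tens_rep_eq assms simp: pairs_def)
 then show ?thesis using bilinear_closed[OF assms(2-)] by simp
qed

lemma tsum_tens_self:
 assumes "t el (tensor k M N)"
 shows "tsum (tensor k M N) t (tens k M N) = t"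
proof -
 have *: "pairs M N s ==> tsum (tensor k M N) s (tens k M N) = tens_rep k M N s" for s
 proof (induction s)
  case (Cons p s)
  obtain m n where p: "p = (m, n)" by (cases p)
  have mn: "pairs M N [(m, n)]" "pairs M N s" using Cons.prems p by (auto simp: pairs_def)
  then show ?case using Cons.IH by (simp add: p tens_def tensor_simps tens_rep_append tens_rep_closed tensor_pairs)
 qed (simp add: tensor_simps)
 show ?thesis using assms * by (simp add: tensor_carrier)
qed

lemma tensor_ext:
 assumes "module k G" "linear_map k (tensor k M N) G f" "linear_map k (tensor k M N) G g"
  "!!m n. m el M ==> n el N ==> f (tens k M N m n) = g (tens k M N m n)"
  "t el (tensor k M N)"
 shows "f t = g t"
proof -
 have *: "h t = tsum G t (%m n. h (tens k M N m n))" if "linear_map k (tensor k M N) G h" for h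
  using linear_tsum[OF module_tensor assms(1) that tensor_pairs[OF assms(5)], of "tens k M N"] bilinear_closed[OF bilinear_tens]
  by (simp add: tsum_tens_self assms(5))
 have "tsum G t (%m n. f (tens k M N m n)) = tsum G t (%m n. g (tens k M N m n))"
  by (rule tsum_cong[OF tensor_pairs[OF assms(5)]]) (rule assms(4))
 then show ?thesis using *[OF assms(2)] *[OF assms(3)] by simp
qed

end

end

section \<open>Comodules and Sweedler sums\<close>

text \<open>Rules that decide by its shape whether an expression is linear in a variable; nearly all side conditions of the rules for Sweedler sums are of this kind.\<close>
named_theorems lin

context scalars
begin

abbreviation lmap where "lmap \<equiv> linear_map k"
abbreviation ct where "ct \<equiv> comod_tensor k"
abbreviation ut where "ut \<equiv> utens k"


lemmas [lin] = linear_id linear_smult_const linear_const_smult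

lemma smult_closed' [simp]: "module k G ==> c el k ==> v el G ==> c *[G] v el G"
 by (rule module.smult_closed)

lemma smult_commute: "module k G ==> c el k ==> d el k ==> v el G ==>
  c *[G] (d *[G] v) = d *[G] (c *[G] v)"
 by (simp add: module.smult_assoc1[symmetric] m_comm)

lemma mult_smult: "module k G ==> c el k ==> d el k ==> v el G ==>
  (c \<otimes> d) *[G] v = c *[G] (d *[G] v)"
 by (simp add: module.smult_assoc1)

lemma one_smult: "module k G ==> v el G ==> \<one> *[G] v = v"
 by (rule module.smult_one)

lemma linear_kmult [lin]:
 "c el k ==> lmap P K f ==> lmap P K (%x. c \<otimes> f x)"
 "c el k ==> lmap P K f ==> lmap P K (%x. f x \<otimes> c)"
 using linear_const_smult[OF module_K, of c P f] linear_smult_const[OF module_K, of c P f] by simp_all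

lemma tens_closed [simp]:
 "module k M ==> module k N ==> m el M ==> n el N ==> tens k M N m n el (tensor k M N)"
 by (rule bilinear_closed[OF bilinear_tens])

lemmas module_tensor [simp]

lemma linear_tens [lin]:
 "module k M ==> module k N ==> m el M ==> lmap P N f ==> lmap P (tensor k M N) (%x. tens k M N m (f x))"
 "module k M ==> module k N ==> n el N ==> lmap P M g ==> lmap P (tensor k M N) (%x. tens k M N (g x) n)"
 by (auto intro: bilinear_right[OF bilinear_tens] bilinear_left[OF bilinear_tens])

lemma linear_tsum_tensor:
 assumes "lmap P (tensor k A B) u" "module k A" "module k B" "module k G"
  "!!a. a el A ==> lmap B G (%b. F a b)"
  "!!b. b el B ==> lmap A G (%a. F a b)"
 shows "lmap P G (%x. tsum G (u x) F)"
 by (rule linear_comp[OF assms(1) tsum_linear_on_tensor[OF assms(2-4)]]) (intro bilinear_mapI assms)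

context
 fixes M N :: "('k, 'h, 'x) comod" and H :: "('k, 'h) hopf_data"
begin

abbreviation (input) "MN \<equiv> ct H M N"

lemma ct_simps:
 "carrier MN = Tens ` carrier (tensor k M N)" "\<zero>\<^bsub>MN\<^esub> = Tens \<zero>\<^bsub>tensor k M N\<^esub>"
 "s \<oplus>\<^bsub>MN\<^esub> t = Tens (untens s \<oplus>\<^bsub>tensor k M N\<^esub> untens t)" "c *[MN] t = Tens (c *[tensor k M N] untens t)"
 by (simp_all add: comod_tensor_def utensor_def Let_def module.defs comodule.defs)

lemma ct_fields: "add MN = add (utensor k M N)" "smult MN = smult (utensor k M N)"
 "carrier MN = carrier (utensor k M N)" "\<zero>\<^bsub>MN\<^esub> = \<zero>\<^bsub>utensor k M N\<^esub>"
 by (simp_all add: comod_tensor_def utensor_def Let_def module.defs comodule.defs)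

lemma ct_tensor_H: "tens k H (utensor k M N) = tens k H MN" "tensor k H (utensor k M N) = tensor k H MN"
 by (rule tensor_change, simp_all add: ct_fields)+

lemma coact_ct: "coact MN = (%t. tsum (tensor k H MN) (untens t) (%m n.
    tsum (tensor k H MN) (coact M m) (%g m0. tsum (tensor k H MN) (coact N n) (%h n0.
     tens k H MN (g *<H> h) (ut M N m0 n0)))))"
 unfolding ct_tensor_H[symmetric]
 by (simp add: comod_tensor_def Let_def module.defs comodule.defs)

end

lemma ct_change_H: "carrier (ct H M N) = carrier (ct H' M N)"
 "add (ct H M N) = add (ct H' M N)"
 "smult (ct H M N) = smult (ct H' M N)"
 "zero (ct H M N) = zero (ct H' M N)"
 by (simp_all add: ct_fields)

context
 fixes M N :: "('k, 'h, 'x) comod" and H :: "('k, 'h) hopf_data"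
 assumes M: "module k M" and N: "module k N"
begin

lemma module_ct: "module k (ct H M N)"
proof -
 interpret T: module k "tensor k M N" using M N by simp
 show ?thesis
 proof (intro moduleI abelian_groupI)
  show "cring k" by (rule cring_axioms)
  fix x assume "x el (ct H M N)"
  then obtain s where s: "x = Tens s" "s el (tensor k M N)" by (auto simp: ct_simps)
  then show "\<exists>y\<in>carrier (ct H M N). y \<oplus>\<^bsub>ct H M N\<^esub> x = \<zero>\<^bsub>ct H M N\<^esub>"
   by (intro bexI[of _ "Tens (\<ominus>\<^bsub>tensor k M N\<^esub> s)"]) (auto simp: ct_simps T.l_neg)
 qed (auto simp: ct_simps T.smult_l_distr T.smult_r_distr T.smult_assoc1 T.a_ac)
qed

lemma linear_untens0: "lmap (ct H M N) (tensor k M N) untens"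
 by (intro linear_mapI) (auto simp: ct_simps)

lemma linear_Tens: "lmap (tensor k M N) (ct H M N) Tens"
 by (intro linear_mapI) (auto simp: ct_simps)

lemma bilinear_utens: "bilinear_map k M N (ct H M N) (ut M N)"
 unfolding utens_def [abs_def]
 by (intro bilinear_mapI linear_comp[OF _ linear_Tens] linear_tens M N linear_id)

lemma utens_closed: "m el M ==> n el N ==> ut M N m n el (ct H M N)"
 by (rule bilinear_closed[OF bilinear_utens])

lemma untens_closed: "t el (ct H M N) ==> untens t el (tensor k M N)"
 by (auto simp: ct_simps)

lemma pairs_untens: "t el (ct H M N) ==> pairs M N (untens t)"
 using tensor_pairs[OF M N] untens_closed by blast

lemma tsum_untens_closed0:
 "t el (ct H M N) ==> module k G ==> (!!m n. m el M ==> n el N ==> F m n el G) ==>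
  tsum G (untens t) F el G"
 by (rule tsum_closed[OF _ pairs_untens])

lemma tsum_utens:
 assumes "module k G" "m el M" "n el N"
  "!!m. m el M ==> lmap N G (%n. f m n)" "!!n. n el N ==> lmap M G (%m. f m n)"
 shows "tsum G (untens (ut M N m n)) f = f m n"
 unfolding utens_def univ.sel by (rule tsum_tens[OF M N assms(1) _ assms(2,3)]) (intro bilinear_mapI assms)

lemma linear_untens:
 assumes "module k G" "lmap P (ct H M N) u"
  "!!m. m el M ==> lmap N G (%n. f m n)" "!!n. n el N ==> lmap M G (%m. f m n)"
 shows "lmap P G (%x. tsum G (untens (u x)) f)"
 by (rule linear_tsum_tensor[OF linear_comp[OF assms(2) linear_untens0] M N]) (intro assms; assumption)+

lemmas linear_untens_id = linear_untens[OF _ linear_id]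

lemma ct_ext:
 assumes "module k G" "lmap (ct H M N) G f" "lmap (ct H M N) G g"
  "!!m n. m el M ==> n el N ==> f (ut M N m n) = g (ut M N m n)"
  "t el (ct H M N)"
 shows "f t = g t"
proof -
 have "f (Tens (untens t)) = g (Tens (untens t))"
  by (rule tensor_ext[OF M N assms(1) linear_comp[OF linear_Tens assms(2)] linear_comp[OF linear_Tens assms(3)]
   _ untens_closed[OF assms(5)]]) (use assms(4) in \<open>simp add: utens_def\<close>)
 then show ?thesis using assms(5) by (auto simp: ct_simps)
qed

lemma tsum_utens_self:
 assumes "t el (ct H M N)"
 shows "tsum (ct H M N) (untens t) (ut M N) = t"
proof (rule ct_ext[OF module_ct _ linear_id _ assms])
 show "lmap (ct H M N) (ct H M N) (%x. tsum (ct H M N) (untens x) (ut M N))"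
  by (intro linear_untens module_ct linear_id bilinear_right[OF bilinear_utens] bilinear_left[OF bilinear_utens])
 show "tsum (ct H M N) (untens (ut M N m n)) (ut M N) = ut M N m n" if "m el M" "n el N" for m n
  by (intro tsum_utens module_ct linear_id bilinear_right[OF bilinear_utens] bilinear_left[OF bilinear_utens] that)
qed

end

lemma tsum_untens_closed:
 "t el (ct H M N) ==> module k M ==> module k N ==> module k G ==>
  (!!m n. m el M ==> n el N ==> F m n el G) ==> tsum G (untens t) F el G"
 by (rule tsum_untens_closed0)

lemma linear_untens_inner:
 assumes "t el (ct H M N)" "module k M" "module k N" "module k G"
  "!!a b. a el M ==> b el N ==> lmap P G (%x. F x a b)"
 shows "lmap P G (%x. tsum G (untens t) (F x))"
 by (rule linear_tsum_inner[OF assms(4) pairs_untens]) fact+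

lemma linear_utens:
 "module k M ==> module k N ==> m el M ==> lmap P N f ==> lmap P (ct H M N) (%x. ut M N m (f x))"
 "module k M ==> module k N ==> n el N ==> lmap P M g ==> lmap P (ct H M N) (%x. ut M N (g x) n)"
 by (auto intro: bilinear_right[OF bilinear_utens] bilinear_left[OF bilinear_utens])

lemmas [simp] = module_ct utens_closed tsum_untens_closed tsum_utens
lemmas [lin] = linear_untens_id linear_utens linear_untens_inner

end

locale coalgebra = scalars k for k :: "'k ring" (structure) +
 fixes H :: "('k, 'h) hopf_data"
 assumes module_H [simp]: "module k H"
  and comult_lin: "lmap H (tensor k H H) (comult H)"
  and counit_lin: "lmap H K (counit H)"
  and comult_coassoc: "x el H ==>
   (let HHH = tensor k H (tensor k H H) in
    tsum HHH (comult H x) (%a x3. tsum HHH (comult H a) (%x1 x2.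
     tens k H (tensor k H H) x1 (tens k H H x2 x3)))
    = tsum HHH (comult H x) (%x1 b. tsum HHH (comult H b) (%x2 x3.
     tens k H (tensor k H H) x1 (tens k H H x2 x3))))"
  and comult_counit_left: "x el H ==> tsum H (comult H x) (%x1 x2. counit H x1 *[H] x2) = x"
  and comult_counit_right: "x el H ==> tsum H (comult H x) (%x1 x2. counit H x2 *[H] x1) = x"

sublocale bialgebra \<subseteq> coalgebra k H
 by unfold_locales (fact module_axioms comult_linear counit_linear coassoc counit_left counit_right)+

context coalgebra
begin

abbreviation comod where "comod \<equiv> left_comodule k H"
abbreviation bform where "bform \<equiv> bilinear_form k H"


definition precomod where
 "precomod M \<longleftrightarrow> module k M \<and> lmap M (tensor k H M) (coact M)"

lemma precomod_module [simp]: "precomod M ==> module k M"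
 by (simp add: precomod_def)

lemma comodule_precomod [simp]: "comod M ==> precomod M"
 by (simp add: precomod_def left_comodule_def left_comodule_axioms_def)

lemma comodule_module [simp]: "comod M ==> module k M"
 by simp

lemma coact_pairs: "precomod M ==> m el M ==> pairs H M (coact M m)"
 using tensor_pairs[OF module_H, of M] linear_closed[of k M "tensor k H M" "coact M"] by (auto simp: precomod_def)

lemma comult_pairs: "x el H ==> pairs H H (comult H x)"
 using tensor_pairs[OF module_H module_H] linear_closed[OF comult_lin] by auto

lemma coact_closed [simp]: "precomod M ==> m el M ==> coact M m el (tensor k H M)"
 using linear_closed by (auto simp: precomod_def)

lemma comult_closed [simp]: "x el H ==> comult H x el (tensor k H H)"
 using linear_closed[OF comult_lin] by auto

lemma counit_closed [simp]: "x el H ==> counit H x el k"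
 using linear_closed[OF counit_lin] by auto

lemmas swap_cc = tsum_swap[OF _ coact_pairs coact_pairs]
 and swap_mc = tsum_swap[OF _ comult_pairs coact_pairs]
 and swap_mm = tsum_swap[OF _ comult_pairs comult_pairs]
 and smult_c = smult_tsum[OF _ coact_pairs]
 and smult_m = tsum_smult[OF _ comult_pairs]

lemma tsum_coact_closed [simp]:
 "precomod M ==> m el M ==> module k G ==> (!!h n. h el H ==> n el M ==> F h n el G)
 ==> tsum G (coact M m) F el G"
 by (rule tsum_closed[OF _ coact_pairs])

lemma tsum_comult_closed [simp]:
 "x el H ==> module k G ==> (!!h n. h el H ==> n el H ==> F h n el G)
 ==> tsum G (comult H x) F el G"
 by (rule tsum_closed[OF _ comult_pairs])

lemma tsum_comult_closed_k [simp]: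
 "x el H ==> (!!h n. h el H ==> n el H ==> F h n el k)
 ==> tsum k (comult H x) F el k"
 using tsum_comult_closed[OF _ module_K, of x F] by (simp add: tsum_K)

lemma lin_coact [lin]:
 assumes "precomod M" "lmap P M g"
 shows "lmap P (tensor k H M) (%x. coact M (g x))"
  "module k G ==> (!!h. h el H ==> lmap M G (%n. F h n)) ==>
   (!!n. n el M ==> lmap H G (%h. F h n)) ==> lmap P G (%x. tsum G (coact M (g x)) F)"
proof -
 show 1: "lmap P (tensor k H M) (%x. coact M (g x))" using assms by (auto simp: precomod_def intro: linear_comp)
 show "lmap P G (%x. tsum G (coact M (g x)) F)" if "module k G" "(!!h. h el H ==> lmap M G (%n. F h n))"
   "(!!n. n el M ==> lmap H G (%h. F h n))"
  by (rule linear_tsum_tensor[OF 1]) (use that assms in auto)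
qed

lemma lin_coact_inner [lin]:
 assumes "precomod M" "m el M" "module k G"
  "!!a b. a el H ==> b el M ==> lmap P G (%x. F x a b)"
 shows "lmap P G (%x. tsum G (coact M m) (F x))"
 by (rule linear_tsum_inner[OF assms(3) coact_pairs]) fact+

lemma lin_comult [lin]:
 assumes "lmap P H g"
 shows "lmap P (tensor k H H) (%x. comult H (g x))"
  "module k G ==> (!!h. h el H ==> lmap H G (%n. F h n)) ==>
   (!!n. n el H ==> lmap H G (%h. F h n)) ==> lmap P G (%x. tsum G (comult H (g x)) F)"
 using linear_tsum_tensor[OF linear_comp[OF assms comult_lin]] linear_comp[OF assms comult_lin] by auto

lemma lin_comult_k [lin]:
 assumes "lmap P H g" "(!!h. h el H ==> lmap H K (%n. F h n))"
   "(!!n. n el H ==> lmap H K (%h. F h n))"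
  shows "lmap P K (%x. tsum k (comult H (g x)) F)"
 unfolding tsum_K[symmetric] by (rule lin_comult(2)) (use assms in auto)

lemma lin_comult_inner [lin]:
 assumes "m el H" "module k G"
  "!!a b. a el H ==> b el H ==> lmap P G (%x. F x a b)"
 shows "lmap P G (%x. tsum G (comult H m) (F x))"
 by (rule linear_tsum_inner[OF assms(2) comult_pairs]) fact+

lemma lin_comult_inner_k [lin]:
 assumes "m el H"
  "!!a b. a el H ==> b el H ==> lmap P K (%x. F x a b)"
 shows "lmap P K (%x. tsum k (comult H m) (F x))"
 unfolding tsum_K[symmetric] by (rule lin_comult_inner) (use assms in auto)

lemma lin_counit [lin]: "lmap P H f ==> lmap P K (%x. counit H (f x))"
 by (rule linear_comp[OF _ counit_lin])

lemma coact_cong: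
 assumes "precomod M" "m el M" "!!h n. h el H ==> n el M ==> F h n = F' h n"
 shows "tsum G (coact M m) F = tsum G (coact M m) F'"
 using assms by (intro tsum_cong[OF coact_pairs])

lemma comult_cong:
 assumes "m el H" "!!h n. h el H ==> n el H ==> F h n = F' h n"
 shows "tsum G (comult H m) F = tsum G (comult H m) F'"
 using assms by (intro tsum_cong[OF comult_pairs])

text \<open>Coassociativity is an equation in \<open>H \<otimes> (H \<otimes> M)\<close>; the linear map induced by a trilinear \<open>F\<close>
 turns it into an identity of Sweedler sums with values in any module.\<close>
lemma coact_coassoc:
 assumes M: "comod M" and m: "m el M" and G: "module k G"
  and F: "!!h2 n. h2 el H ==> n el M ==> lmap H G (%h1. F h1 h2 n)"
   "!!h1 n. h1 el H ==> n el M ==> lmap H G (%h2. F h1 h2 n)"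
   "!!h1 h2. h1 el H ==> h2 el H ==> lmap M G (%n. F h1 h2 n)"
  shows "tsum G (coact M m) (%h n. tsum G (comult H h) (%h1 h2. F h1 h2 n)) =
   tsum G (coact M m) (%h1 m'. tsum G (coact M m') (%h2 n. F h1 h2 n))"
proof -
 have M': "module k M" "precomod M" using M by auto
 let ?T = "tensor k H (tensor k H M)"
 define L where "L = (%t. tsum G t (%h1 s. tsum G s (%h2 n. F h1 h2 n)))"
 have 2: "lmap (tensor k H M) G (%s. tsum G s (%h2 n. F h1 h2 n))" if "h1 el H" for h1
  using that M' G F by (intro linear_tsum_tensor[OF linear_id]) auto
 have 3: "lmap H G (%h1. tsum G s (%h2 n. F h1 h2 n))" if "s el (tensor k H M)" for s
  using that M' G F by (intro linear_tsum_inner[OF G tensor_pairs[OF module_H M'(1)]]) auto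
 have L: "lmap ?T G L"
  unfolding L_def using M' G 2 3 by - (rule linear_tsum_tensor[OF linear_id], auto)
 have Lt: "L (tens k H (tensor k H M) h1 (tens k H M h2 n)) = F h1 h2 n" if "h1 el H" "h2 el H" "n el M" for h1 h2 n
  unfolding L_def using that M' G F 2 3
  by (subst tsum_tens) (auto intro!: bilinear_mapI tsum_tens)
 have Lsum: "L (tsum ?T t f) = tsum G t (%a b. L (f a b))"
  if "pairs A B t" "!!a b. a el A ==> b el B ==> f a b el ?T" for t f and A :: "('a1, 'b1) ring_scheme" and B :: "('a2, 'b2) ring_scheme"
  using that M' G by (intro linear_tsum[OF _ _ L]) auto
 have "tsum G (coact M m) (%h n. tsum G (comult H h) (%h1 h2. F h1 h2 n)) =
  L (tsum ?T (coact M m) (%h n. tsum ?T (comult H h) (%h1 h2. tens k H (tensor k H M) h1 (tens k H M h2 n))))"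
  using M' m
  by (subst linear_tsum[OF _ G L coact_pairs], (simp; fail)+) (auto intro!: coact_cong comult_cong
    simp: linear_tsum[OF _ G L comult_pairs] Lt)
 also have "... = L (tsum ?T (coact M m) (%h1 m'. tsum ?T (coact M m') (%h2 n. tens k H (tensor k H M) h1 (tens k H M h2 n))))"
  using left_comodule.coact_coassoc[OF M m] by (simp add: Let_def)
 also have "... = tsum G (coact M m) (%h1 m'. tsum G (coact M m') (%h2 n. F h1 h2 n))"
  using M' m
  by (subst linear_tsum[OF _ G L coact_pairs], (simp; fail)+) (auto intro!: coact_cong comult_cong
    simp: linear_tsum[OF _ G L coact_pairs] Lt)
 finally show ?thesis .
qed

end

context coalgebra
begin

lemma coact_counit:
 assumes M: "comod M" and m: "m el M" and G: "module k G" and f: "lmap M G f"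
 shows "tsum G (coact M m) (%h n. counit H h *[G] f n) = f m"
proof -
 have "f (tsum M (coact M m) (%h n. counit H h *[M] n)) = tsum G (coact M m) (%h n. f (counit H h *[M] n))"
  using M G m by (intro linear_tsum[OF _ _ f coact_pairs]) auto
 also have "... = tsum G (coact M m) (%h n. counit H h *[G] f n)"
  using M m by (intro coact_cong) (auto simp: linear_smult[OF f])
 finally show ?thesis using left_comodule.coact_counit[OF M m] by simp
qed

text \<open>\<open>H\<close> as a comodule over itself, so that rules for Sweedler sums of coactions specialize to
 those for the coproduct.\<close>
definition regular :: "('k, 'h, 'h) comodule" where
 "regular = module.extend (module.truncate H) (comodule.fields (comult H))"

lemma regular_simps: "carrier regular = carrier H" "\<zero>\<^bsub>regular\<^esub> = \<zero>\<^bsub>H\<^esub>" "add regular = add H" "smult regular = smult H"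
 "coact regular = comult H"
 by (simp_all add: regular_def module.defs comodule.defs)

lemma left_comodule_regular: "comod regular"
proof -
 have r: "tensor k H regular = tensor k H H" "tens k H regular = tens k H H"
  by (rule tensor_change; simp add: regular_simps)+
 have r2: "tsum regular t = tsum H t" for t :: "('z \<times> 'y) list"
  by (intro ext tsum_change_group) (simp_all add: regular_simps)
 have lin: "lmap regular G f \<longleftrightarrow> lmap H G f" for G :: "('k, 'g, 'v) module_scheme" and f
  by (simp add: linear_map_def regular_simps)
 interpret H: module k H by simp
 have "module k regular"
  by (intro moduleI abelian_groupI is_cring)
   (auto simp: regular_simps H.smult_l_distr H.smult_r_distr H.smult_assoc1 H.a_ac intro: H.l_neg bexI[of _ "\<ominus>\<^bsub>H\<^esub> x" for x])
 then show ?thesis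
  unfolding left_comodule_def left_comodule_axioms_def
  using comult_lin comult_coassoc comult_counit_left
  by (simp add: r r2 lin) (simp add: regular_simps)
qed

lemma linear_regular: "lmap regular G f \<longleftrightarrow> lmap H G f"
 by (simp add: linear_map_def regular_simps)

lemma comult_coassoc_G:
 assumes "x el H" and "module k G"
  "!!h2 n. h2 el H ==> n el H ==> lmap H G (%h1. F h1 h2 n)"
   "!!h1 n. h1 el H ==> n el H ==> lmap H G (%h2. F h1 h2 n)"
   "!!h1 h2. h1 el H ==> h2 el H ==> lmap H G (%n. F h1 h2 n)"
  shows "tsum G (comult H x) (%h n. tsum G (comult H h) (%h1 h2. F h1 h2 n)) =
   tsum G (comult H x) (%h1 m'. tsum G (comult H m') (%h2 n. F h1 h2 n))"
 using coact_coassoc[OF left_comodule_regular, of x G F] assms by (simp add: regular_simps linear_regular)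

lemma comult_counit_left_G:
 assumes "x el H" and "module k G" "lmap H G f"
 shows "tsum G (comult H x) (%h n. counit H h *[G] f n) = f x"
 using coact_counit[OF left_comodule_regular, of x G f] assms by (simp add: regular_simps linear_regular)

lemma comult_counit_right_G:
 assumes "x el H" and G: "module k G" and f: "lmap H G f"
 shows "tsum G (comult H x) (%h n. counit H n *[G] f h) = f x"
proof -
 have "f (tsum H (comult H x) (%h n. counit H n *[H] h)) = tsum G (comult H x) (%h n. f (counit H n *[H] h))"
  using G assms(1) by (intro linear_tsum[OF _ _ f comult_pairs]) auto
 also have "... = tsum G (comult H x) (%h n. counit H n *[G] f h)"
  using assms(1) by (intro comult_cong) (auto simp: linear_smult[OF f])
 finally show ?thesis using comult_counit_right[OF assms(1)] by simp
qed

lemma coact2_coassoc: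
 assumes M: "comod M" and N: "comod N" and m: "m el M" and n: "n el N" and G: "module k G"
  and F: "!!b c d e f. [|b el H; c el M; d el H; e el H; f el N|] ==> lmap H G (%a. F a b c d e f)"
   "!!a c d e f. [|a el H; c el M; d el H; e el H; f el N|] ==> lmap H G (%b. F a b c d e f)"
   "!!a b d e f. [|a el H; b el H; d el H; e el H; f el N|] ==> lmap M G (%c. F a b c d e f)"
   "!!a b c e f. [|a el H; b el H; c el M; e el H; f el N|] ==> lmap H G (%d. F a b c d e f)"
   "!!a b c d f. [|a el H; b el H; c el M; d el H; f el N|] ==> lmap H G (%e. F a b c d e f)"
   "!!a b c d e. [|a el H; b el H; c el M; d el H; e el H|] ==> lmap N G (%f. F a b c d e f)"
 shows "tsum G (coact M m) (%h m0. tsum G (coact N n) (%g n0. tsum G (comult H h) (%h1 h2. tsum G (comult H g) (%g1 g2.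
   F h1 h2 m0 g1 g2 n0)))) =
  tsum G (coact M m) (%h1 m'. tsum G (coact N n) (%g1 n'. tsum G (coact M m') (%h2 m0. tsum G (coact N n') (%g2 n0.
   F h1 h2 m0 g1 g2 n0))))"
proof -
 note [simp] = linear_closed[OF F(1)]
 have M': "precomod M" and N': "precomod N" using M N by auto
 have "tsum G (coact M m) (%h m0. tsum G (coact N n) (%g n0. tsum G (comult H h) (%h1 h2. tsum G (comult H g) (%g1 g2.
   F h1 h2 m0 g1 g2 n0)))) =
   tsum G (coact M m) (%h m0. tsum G (comult H h) (%h1 h2. tsum G (coact N n) (%g n0. tsum G (comult H g) (%g1 g2.
   F h1 h2 m0 g1 g2 n0))))"
  using M' N' m n G by (intro coact_cong tsum_swap[OF _ coact_pairs comult_pairs]) auto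
 also have "... = tsum G (coact M m) (%h1 m'. tsum G (coact M m') (%h2 m0. tsum G (coact N n) (%g n0. tsum G (comult H g) (%g1 g2.
   F h1 h2 m0 g1 g2 n0))))"
  using M' N' m n G by (intro coact_coassoc[OF M]) (auto intro!: lin F)
 also have "... = tsum G (coact M m) (%h1 m'. tsum G (coact M m') (%h2 m0. tsum G (coact N n) (%g1 n'. tsum G (coact N n') (%g2 n0.
   F h1 h2 m0 g1 g2 n0))))"
  using M' N' m n G by (intro coact_cong coact_coassoc[OF N]) (auto intro!: F)
 also have "... = tsum G (coact M m) (%h1 m'. tsum G (coact N n) (%g1 n'. tsum G (coact M m') (%h2 m0. tsum G (coact N n') (%g2 n0.
   F h1 h2 m0 g1 g2 n0))))"
  using M' N' m n G by (intro coact_cong swap_cc) auto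
 finally show ?thesis .
qed

lemma comult2_coassoc:
 assumes "x el H" and "y el H" and G: "module k G"
  and F: "!!b c d e f. [|b el H; c el H; d el H; e el H; f el H|] ==> lmap H G (%a. F a b c d e f)"
   "!!a c d e f. [|a el H; c el H; d el H; e el H; f el H|] ==> lmap H G (%b. F a b c d e f)"
   "!!a b d e f. [|a el H; b el H; d el H; e el H; f el H|] ==> lmap H G (%c. F a b c d e f)"
   "!!a b c e f. [|a el H; b el H; c el H; e el H; f el H|] ==> lmap H G (%d. F a b c d e f)"
   "!!a b c d f. [|a el H; b el H; c el H; d el H; f el H|] ==> lmap H G (%e. F a b c d e f)"
   "!!a b c d e. [|a el H; b el H; c el H; d el H; e el H|] ==> lmap H G (%f. F a b c d e f)"
 shows "tsum G (comult H x) (%h m0. tsum G (comult H y) (%g n0. tsum G (comult H h) (%h1 h2. tsum G (comult H g) (%g1 g2.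
   F h1 h2 m0 g1 g2 n0)))) =
  tsum G (comult H x) (%h1 m'. tsum G (comult H y) (%g1 n'. tsum G (comult H m') (%h2 m0. tsum G (comult H n') (%g2 n0.
   F h1 h2 m0 g1 g2 n0))))"
 using coact2_coassoc[OF left_comodule_regular left_comodule_regular, of x y G F] assms
 by (simp add: regular_simps linear_regular)

definition colinear where
 "colinear M N f \<longleftrightarrow> lmap M N f \<and>
   (\<forall>m\<in>carrier M. coact N (f m) = tsum (tensor k H N) (coact M m) (%h m0. tens k H N h (f m0)))"

lemma comod_hom_iff: "(M', f, N') \<in> comod_hom k H M N \<longleftrightarrow> M' = M \<and> N' = N \<and> f \<in> extensional (carrier M) \<and> colinear M N f"
 by (auto simp: comod_hom_def colinear_def)

lemma colinear_linear: "colinear M N f ==> lmap M N f"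
 by (simp add: colinear_def)

lemma coact_colinear:
 assumes f: "colinear M N f" and "precomod M" "precomod N" "m el M" "module k G"
  "!!h. h el H ==> lmap N G (%n. F h n)"
   "!!n. n el N ==> lmap H G (%h. F h n)"
 shows "tsum G (coact N (f m)) F = tsum G (coact M m) (%h m0. F h (f m0))"
proof -
 have L: "lmap (tensor k H N) G (%t. tsum G t F)" using assms by (intro tsum_linear_on_tensor bilinear_mapI) auto
 have fc: "!!m. m el M ==> f m el N" using f linear_closed by (auto simp: colinear_def)
 have "tsum G (coact N (f m)) F = tsum G (tsum (tensor k H N) (coact M m) (%h m0. tens k H N h (f m0))) F"
  using assms by (simp add: colinear_def)
 also have "... = tsum G (coact M m) (%h m0. tsum G (tens k H N h (f m0)) F)"
  using assms fc by (intro linear_tsum[OF _ _ L coact_pairs]) auto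
 also have "... = tsum G (coact M m) (%h m0. F h (f m0))"
  using assms fc by (intro coact_cong tsum_tens bilinear_mapI) auto
 finally show ?thesis .
qed

lemma colinear_cong:
 assumes "precomod M" "!!m. m el M ==> f m = g m"
 shows "colinear M N f \<longleftrightarrow> colinear M N g"
proof -
 have "tsum (tensor k H N) (coact M m) (%h m0. tens k H N h (f m0)) = tsum (tensor k H N) (coact M m) (%h m0. tens k H N h (g m0))"
  if "m el M" for m using assms that by (intro coact_cong) auto
 then show ?thesis unfolding colinear_def using assms linear_map_cong[of M f g k N] by auto
qed

lemma comod_arrow_hom:
 assumes "comod M"
 shows "comod_arrow M N f \<in> comod_hom k H M' N' \<longleftrightarrow> M = M' \<and> N = N' \<and> colinear M N f"
 using assms colinear_cong[of M f "restrict f (carrier M)" N] by (auto simp: comod_arrow_def comod_hom_iff)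

lemma colinear_id: "comod M ==> colinear M M (%m. m)"
proof -
 assume M: "comod M"
 show ?thesis unfolding colinear_def
 proof (intro conjI ballI linear_id)
  fix m assume m: "m el M"
  show "coact M m = tsum (tensor k H M) (coact M m) (%h m0. tens k H M h m0)"
   using M m by (simp add: tsum_tens_self)
 qed
qed

lemma colinear_comp:
 assumes "comod M" "comod N" "comod P" "colinear M N f" "colinear N P g"
 shows "colinear M P (%m. g (f m))"
 unfolding colinear_def
proof (intro conjI ballI)
 show "lmap M P (%m. g (f m))" using assms by (auto intro: linear_comp simp: colinear_def)
 fix m assume m: "m el M"
 have fm: "f m el N" using assms m linear_closed by (auto simp: colinear_def)
 have "coact P (g (f m)) = tsum (tensor k H P) (coact N (f m)) (%h m0. tens k H P h (g m0))"
  using assms fm by (simp add: colinear_def)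
 also have "... = tsum (tensor k H P) (coact M m) (%h m0. tens k H P h (g (f m0)))"
  using assms m by (intro coact_colinear[OF assms(4)]) (auto intro!: lin colinear_linear dest: linear_closed[OF colinear_linear])
 finally show "coact P (g (f m)) = tsum (tensor k H P) (coact M m) (%h m0. tens k H P h (g (f m0)))" .
qed

lemma colinear_inverse:
 assumes "comod M" "comod N" "colinear M N f" "lmap N M g"
  "!!n. n el N ==> f (g n) = n" "!!m. m el M ==> g (f m) = m"
 shows "colinear N M g"
 unfolding colinear_def
proof (intro conjI ballI assms(4))
 fix n assume n: "n el N"
 note g = linear_closed[OF assms(4)] and f = linear_closed[OF colinear_linear[OF assms(3)]]
 have "tsum (tensor k H M) (coact N n) (%h m0. tens k H M h (g m0)) = tsum (tensor k H M) (coact N (f (g n))) (%h m0. tens k H M h (g m0))"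
  using n assms by simp
 also have "... = tsum (tensor k H M) (coact M (g n)) (%h m0. tens k H M h (g (f m0)))"
  using assms n g f by (intro coact_colinear[OF assms(3)]) (auto intro!: lin)
 also have "... = tsum (tensor k H M) (coact M (g n)) (%h m0. tens k H M h m0)"
  using assms n g f by (intro coact_cong) auto
 also have "... = coact M (g n)" using assms n g by (simp add: tsum_tens_self)
 finally show "coact M (g n) = tsum (tensor k H M) (coact N n) (%h m0. tens k H M h (g m0))" by simp
qed

end

section \<open>The structure maps between tensor products of comodules\<close>

context scalars
begin

context
 fixes H :: "('k, 'h) hopf_data"
begin

definition ten_map :: "('k, 'h, 'x) comod \<Rightarrow> ('k, 'h, 'x) comod \<Rightarrow> (('k, 'x) univ \<Rightarrow> ('k, 'x) univ) \<Rightarrow> (('k, 'x) univ \<Rightarrow> ('k, 'x) univ)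
  \<Rightarrow> ('k, 'x) univ \<Rightarrow> ('k, 'x) univ" where
 "ten_map M' N' f g = (%t. tsum (ct H M' N') (untens t) (%m n. ut M' N' (f m) (g n)))"

definition assoc_map :: "('k, 'h, 'x) comod \<Rightarrow> ('k, 'h, 'x) comod \<Rightarrow> ('k, 'h, 'x) comod
  \<Rightarrow> ('k, 'x) univ \<Rightarrow> ('k, 'x) univ" where
 "assoc_map M N P = (%t. let NP = ct H N P; Q = ct H M NP in
     tsum Q (untens t) (%s p. tsum Q (untens s) (%m n. ut M NP m (ut N P n p))))"

definition assoc_inv :: "('k, 'h, 'x) comod \<Rightarrow> ('k, 'h, 'x) comod \<Rightarrow> ('k, 'h, 'x) comod
  \<Rightarrow> ('k, 'x) univ \<Rightarrow> ('k, 'x) univ" where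
 "assoc_inv M N P = (%t. let MN = ct H M N; Q = ct H MN P in
     tsum Q (untens t) (%m s. tsum Q (untens s) (%n p. ut MN P (ut M N m n) p)))"

definition lunit_map :: "('k, 'h, 'x) comod \<Rightarrow> ('k, 'x) univ \<Rightarrow> ('k, 'x) univ" where
 "lunit_map M = (%t. tsum M (untens t) (%c m. unscal c *[M] m))"

definition runit_map :: "('k, 'h, 'x) comod \<Rightarrow> ('k, 'x) univ \<Rightarrow> ('k, 'x) univ" where
 "runit_map M = (%t. tsum M (untens t) (%m c. unscal c *[M] m))"

definition braid_map :: "('h \<Rightarrow> 'h \<Rightarrow> 'k) \<Rightarrow> ('k, 'h, 'x) comod \<Rightarrow> ('k, 'h, 'x) comod \<Rightarrow> ('k, 'x) univ \<Rightarrow> ('k, 'x) univ" where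
 "braid_map r M N = (%t. let NM = ct H N M in tsum NM (untens t) (%m n.
     tsum NM (coact M m) (%g m0. tsum NM (coact N n) (%h n0.
      r h g *[NM] ut N M n0 m0))))"

lemma cc_simps:
 "Obj (comod_cat k H r) = {M. left_comodule k H M}"
 "Hom (comod_cat k H r) = comod_hom k H"
 "Ident (comod_cat k H r) M = comod_arrow M M (%m. m)"
 "TenO (comod_cat k H r) = ct H"
 "Unit (comod_cat k H r) = comod_unit k H"
 "Assoc (comod_cat k H r) M N P = comod_arrow (ct H (ct H M N) P)
   (ct H M (ct H N P)) (assoc_map M N P)"
 "LUnit (comod_cat k H r) M = comod_arrow (ct H (comod_unit k H) M) M (lunit_map M)"
 "RUnit (comod_cat k H r) M = comod_arrow (ct H M (comod_unit k H)) M (runit_map M)"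
 "Braid (comod_cat k H r) M N = comod_arrow (ct H M N) (ct H N M) (braid_map r M N)"
 by (simp_all add: comod_cat_def Let_def assoc_map_def lunit_map_def runit_map_def braid_map_def)

end

lemma comod_arrow_eq_iff:
 "comod_arrow M N f = comod_arrow M' N' g \<longleftrightarrow> M = M' \<and> N = N' \<and> (\<forall>m\<in>carrier M. f m = g m)"
 unfolding comod_arrow_def by (auto simp: restrict_def fun_eq_iff)

lemma comod_comp:
 assumes "lmap M N f"
 shows "comod_arrow N' P g oo\<^bsub>comod_cat k H r\<^esub> comod_arrow M N f =
  comod_arrow M P (%m. restrict g (carrier N') (f m))"
 using linear_closed[OF assms]
 by (auto simp: comod_cat_def comod_arrow_def restrict_def)

lemma comod_comp':
 assumes "lmap M N f"
 shows "comod_arrow N P g oo\<^bsub>comod_cat k H r\<^esub> comod_arrow M N f = comod_arrow M P (%m. g (f m))"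
 unfolding comod_comp[OF assms] using linear_closed[OF assms]
 by (auto simp: comod_arrow_eq_iff)

lemma comod_ten:
 assumes "module k M" "module k N"
 shows "comod_arrow M M' f xx\<^bsub>comod_cat k H r\<^esub> comod_arrow N N' g =
  comod_arrow (ct H M N) (ct H M' N') (ten_map H M' N' f g)"
proof -
 have "comod_arrow M M' f xx\<^bsub>comod_cat k H r\<^esub> comod_arrow N N' g =
  comod_arrow (ct H M N) (ct H M' N') (ten_map H M' N' (restrict f (carrier M)) (restrict g (carrier N)))"
  by (simp add: comod_cat_def comod_arrow_def ten_map_def)
 also have "... = comod_arrow (ct H M N) (ct H M' N') (ten_map H M' N' f g)"
  unfolding comod_arrow_eq_iff ten_map_def
  by (auto intro!: tsum_cong[OF pairs_untens[OF assms]])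
 finally show ?thesis .
qed

lemma linear_ten_map:
 assumes "module k M" "module k N" "module k M'" "module k N'" "lmap M M' f" "lmap N N' g"
 shows "lmap (ct H M N) (ct H M' N') (ten_map H M' N' f g)"
 unfolding ten_map_def using assms linear_closed[OF assms(5)] linear_closed[OF assms(6)] by (auto intro!: lin)

lemma ten_map_utens:
 fixes M N :: "('k, 'h, 'x) comod"
 assumes "module k M" "module k N" "module k M'" "module k N'" "lmap M M' f" "lmap N N' g" "m el M" "n el N"
 shows "ten_map H M' N' f g (ut M N m n) = ut M' N' (f m) (g n)"
 unfolding ten_map_def using assms linear_closed[OF assms(5)] linear_closed[OF assms(6)]
 by (subst tsum_utens) (auto intro!: lin)

lemma linear_assoc_map:
 assumes "module k M" "module k N" "module k P"
 shows "lmap (ct H (ct H M N) P) (ct H M (ct H N P)) (assoc_map H M N P)"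
 unfolding assoc_map_def Let_def using assms by (auto intro!: lin)

lemma assoc_map_utens:
 assumes "module k M" "module k N" "module k P" "m el M" "n el N" "p el P"
 shows "assoc_map H M N P (ut (ct H M N) P (ut M N m n) p) =
  ut M (ct H N P) m (ut N P n p)"
 unfolding assoc_map_def Let_def using assms by (simp add: lin)

lemma linear_assoc_inv:
 assumes "module k M" "module k N" "module k P"
 shows "lmap (ct H M (ct H N P)) (ct H (ct H M N) P) (assoc_inv H M N P)"
 unfolding assoc_inv_def Let_def using assms by (auto intro!: lin)

lemma assoc_inv_utens:
 assumes "module k M" "module k N" "module k P" "m el M" "n el N" "p el P"
 shows "assoc_inv H M N P (ut M (ct H N P) m (ut N P n p)) =
  ut (ct H M N) P (ut M N m n) p"
 unfolding assoc_inv_def Let_def using assms by (simp add: lin)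

lemma ct3_ext:
 assumes "module k M" "module k N" "module k P" "module k G"
  "lmap (ct H (ct H M N) P) G f" "lmap (ct H (ct H M N) P) G g"
  "!!m n p. m el M ==> n el N ==> p el P ==>
   f (ut (ct H M N) P (ut M N m n) p) = g (ut (ct H M N) P (ut M N m n) p)"
  "t el (ct H (ct H M N) P)"
 shows "f t = g t"
 by (rule ct_ext[OF _ assms(3) assms(4-6) _ assms(8)], simp add: assms,
  rule ct_ext[OF assms(1,2,4) linear_comp[OF _ assms(5)] linear_comp[OF _ assms(6)]])
  (use assms in \<open>auto intro!: lin\<close>)

lemma ct3_ext':
 assumes "module k M" "module k N" "module k P" "module k G"
  "lmap (ct H M (ct H N P)) G f" "lmap (ct H M (ct H N P)) G g"
  "!!m n p. m el M ==> n el N ==> p el P ==>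
   f (ut M (ct H N P) m (ut N P n p)) = g (ut M (ct H N P) m (ut N P n p))"
  "t el (ct H M (ct H N P))"
 shows "f t = g t"
 by (rule ct_ext[OF assms(1) _ assms(4-6) _ assms(8)], simp add: assms,
  rule ct_ext[OF assms(2,3,4) linear_comp[OF _ assms(5)] linear_comp[OF _ assms(6)]])
  (use assms in \<open>auto intro!: lin\<close>)

lemma ct4_ext:
 assumes "module k L" "module k M" "module k N" "module k P" "module k G"
  "lmap (ct H (ct H (ct H L M) N) P) G f"
  "lmap (ct H (ct H (ct H L M) N) P) G g"
  "!!l m n p. l el L ==> m el M ==> n el N ==> p el P ==>
   f (ut (ct H (ct H L M) N) P (ut (ct H L M) N (ut L M l m) n) p)
  = g (ut (ct H (ct H L M) N) P (ut (ct H L M) N (ut L M l m) n) p)"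
  "t el (ct H (ct H (ct H L M) N) P)"
 shows "f t = g t"
 by (rule ct_ext[OF _ assms(4) assms(5-7) _ assms(9)], simp add: assms,
  rule ct3_ext[OF assms(1,2,3,5) linear_comp[OF _ assms(6)] linear_comp[OF _ assms(7)]])
  (use assms in \<open>auto intro!: lin\<close>)

context fixes H :: "('k, 'h) hopf_data"
begin

lemma cu_simps:
 "carrier (comod_unit k H) = Scal ` carrier k" "\<zero>\<^bsub>comod_unit k H\<^esub> = Scal \<zero>"
 "a \<oplus>\<^bsub>comod_unit k H\<^esub> b = Scal (unscal a \<oplus> unscal b)" "c *[comod_unit k H] b = Scal (c \<otimes> unscal b)"
 by (simp_all add: comod_unit_def Let_def module.defs comodule.defs)

lemma coact_cu: "coact (comod_unit k H :: ('k, 'h, 'x) comod) = (%a. tens k H (comod_unit k H) \<one>\<^bsub>H\<^esub> a)"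
proof -
 let ?K = "\<lparr>carrier = (Scal :: 'k \<Rightarrow> ('k, 'x) univ) ` carrier k, mult = undefined, one = undefined,
    zero = Scal \<zero>, add = (%a b. Scal (unscal a \<oplus> unscal b)),
    smult = (%c a. Scal (c \<otimes> unscal a))\<rparr>"
 have "tens k H ?K = tens k H (comod_unit k H :: ('k, 'h, 'x) comod)"
  by (rule tensor_change) (simp_all add: comod_unit_def Let_def module.defs comodule.defs)
 then have "tens k H ?K \<one>\<^bsub>H\<^esub> = tens k H (comod_unit k H) \<one>\<^bsub>H\<^esub>" by simp
 moreover have "coact (comod_unit k H :: ('k, 'h, 'x) comod) = tens k H ?K \<one>\<^bsub>H\<^esub>"
  unfolding comod_unit_def Let_def module.defs comodule.defs by simp
 ultimately show ?thesis by metis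
qed

lemma module_cu [simp]: "module k (comod_unit k H)"
proof (intro moduleI abelian_groupI)
 show "cring k" by (rule cring_axioms)
 fix x assume "x el (comod_unit k H)"
 then show "\<exists>y\<in>carrier (comod_unit k H). y \<oplus>\<^bsub>comod_unit k H\<^esub> x = \<zero>\<^bsub>comod_unit k H\<^esub>"
  by (intro bexI[of _ "Scal (\<ominus> (unscal x))"]) (auto simp: cu_simps l_neg)
qed (auto simp: cu_simps l_distr r_distr m_assoc a_ac)

lemma linear_unscal [lin]: "lmap P (comod_unit k H) f ==> lmap P K (%x. unscal (f x))"
 by (rule linear_comp[where N="comod_unit k H" and g=unscal]) (auto intro!: linear_mapI simp: cu_simps)

lemma linear_Scal [lin]: "lmap P K f ==> lmap P (comod_unit k H) (%x. Scal (f x))"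
 by (rule linear_comp[where N="K"]) (auto intro!: linear_mapI simp: cu_simps)

lemma unscal_closed [simp]: "x el (comod_unit k H) ==> unscal x el k"
 and Scal_closed [simp]: "c el k ==> Scal c el (comod_unit k H)"
 and Scal_unscal [simp]: "x el (comod_unit k H) ==> Scal (unscal x) = x"
 by (auto simp: cu_simps)

lemma linear_lunit_map: "module k M ==> lmap (ct H (comod_unit k H) M) M (lunit_map M)"
 and linear_runit_map: "module k M ==> lmap (ct H M (comod_unit k H)) M (runit_map M)"
 unfolding lunit_map_def runit_map_def by (auto intro!: lin)

lemma lunit_map_utens:
 fixes M :: "('k, 'h, 'x) comod" shows
 "module k M ==> c el (comod_unit k H) ==> m el M ==>
  lunit_map M (ut (comod_unit k H) M c m) = unscal c *[M] m"
 and runit_map_utens: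
 "module k M ==> c el (comod_unit k H) ==> m el M ==>
  runit_map M (ut M (comod_unit k H) m c) = unscal c *[M] m"
 unfolding lunit_map_def runit_map_def by (simp_all add: lin)

lemma smult_utens:
 fixes M N :: "('k, 'h, 'x) comod"
 assumes "module k M" "module k N" "m el M" "n el N" "c el k"
 shows "ut M N (c *[M] m) n = c *[ct H M N] ut M N m n"
  "ut M N m (c *[N] n) = c *[ct H M N] ut M N m n"
 using linear_smult[OF linear_utens(2)[OF assms(1,2,4) linear_id] assms(5,3)]
  linear_smult[OF linear_utens(1)[OF assms(1,2,3) linear_id] assms(5,4)] by auto

lemma Scal_smult: "x el (comod_unit k H) ==> x = unscal x *[comod_unit k H] Scal \<one>"
 by (auto simp: cu_simps)

lemma linear_lunit_inv: fixes M :: "('k, 'h, 'x) comod" shows "module k M ==> lmap M (ct H (comod_unit k H) M) (%m. ut (comod_unit k H) M (Scal \<one>) m)"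
 and linear_runit_inv: "module k M ==> lmap M (ct H M (comod_unit k H)) (%m. ut M (comod_unit k H) m (Scal \<one>))"
 by (auto intro!: lin)

lemma lunit_inv:
 fixes M :: "('k, 'h, 'x) comod"
 assumes M: "module k M"
 shows "m el M ==> lunit_map M (ut (comod_unit k H) M (Scal \<one>) m) = m"
  "t el (ct H (comod_unit k H) M) ==> ut (comod_unit k H) M (Scal \<one>) (lunit_map M t) = t"
proof -
 interpret M: module k M by fact
 show "m el M ==> lunit_map M (ut (comod_unit k H) M (Scal \<one>) m) = m"
  by (simp add: lunit_map_utens M)
 assume t: "t el (ct H (comod_unit k H) M)"
 show "ut (comod_unit k H) M (Scal \<one>) (lunit_map M t) = t"
 proof (rule ct_ext[OF module_cu M module_ct[OF module_cu M] _ linear_id _ t])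
  show "lmap (ct H (comod_unit k H) M) (ct H (comod_unit k H) M) (%x. ut (comod_unit k H) M (Scal \<one>) (lunit_map M x))"
   using M by (auto intro!: lin linear_lunit_map)
  fix c m :: "('k, 'x) univ" assume c: "c el (comod_unit k H)" and m: "m el M"
  have "ut (comod_unit k H) M (unscal c *[comod_unit k H] Scal \<one>) m = ut (comod_unit k H) M (Scal \<one>) (unscal c *[M] m)"
   using c m M by (subst smult_utens(1)) (auto simp: smult_utens)
  then show "ut (comod_unit k H) M (Scal \<one>) (lunit_map M (ut (comod_unit k H) M c m)) = ut (comod_unit k H) M c m"
   using c m M Scal_smult[OF c] by (simp add: lunit_map_utens)
 qed
qed

lemma runit_inv:
 fixes M :: "('k, 'h, 'x) comod"
 assumes M: "module k M"
 shows "m el M ==> runit_map M (ut M (comod_unit k H) m (Scal \<one>)) = m"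
  "t el (ct H M (comod_unit k H)) ==> ut M (comod_unit k H) (runit_map M t) (Scal \<one>) = t"
proof -
 interpret M: module k M by fact
 show "m el M ==> runit_map M (ut M (comod_unit k H) m (Scal \<one>)) = m"
  by (simp add: runit_map_utens M)
 assume t: "t el (ct H M (comod_unit k H))"
 show "ut M (comod_unit k H) (runit_map M t) (Scal \<one>) = t"
 proof (rule ct_ext[OF M module_cu module_ct[OF M module_cu] _ linear_id _ t])
  show "lmap (ct H M (comod_unit k H)) (ct H M (comod_unit k H)) (%x. ut M (comod_unit k H) (runit_map M x) (Scal \<one>))"
   using M by (auto intro!: lin linear_runit_map)
  fix c m :: "('k, 'x) univ" assume c: "c el (comod_unit k H)" and m: "m el M"
  have "ut M (comod_unit k H) m (unscal c *[comod_unit k H] Scal \<one>) = ut M (comod_unit k H) (unscal c *[M] m) (Scal \<one>)"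
   using c m M by (subst smult_utens(2)) (auto simp: smult_utens)
  then show "ut M (comod_unit k H) (runit_map M (ut M (comod_unit k H) m c)) (Scal \<one>) = ut M (comod_unit k H) m c"
   using c m M Scal_smult[OF c] by (simp add: runit_map_utens)
 qed
qed

end

end

section \<open>Comodules over a bialgebra with an arbitrary unital product\<close>

text \<open>Colinearity of the associativity maps is the one property of the category of comodules that
 depends on associativity of \<open>H\<close>. Keeping it apart allows this locale to be applied to the deformed
 product as soon as its compatibility with the coproduct is known; for that product, colinearity of
 the associativity maps is deduced from the undeformed case.\<close>
locale nonassoc_bialgebra = coalgebra k H
 for k :: "'k ring" (structure) and H :: "('k, 'h) hopf_data" +
 assumes bilinear_mult: "bilinear_map k H H H (mult H)"
  and one_closed [simp]: "\<one>\<^bsub>H\<^esub> el H"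
  and mult_one_left [simp]: "x el H ==> \<one>\<^bsub>H\<^esub> *<H> x = x"
  and mult_one_right [simp]: "x el H ==> x *<H> \<one>\<^bsub>H\<^esub> = x"
  and comult_mult: "[|x el H; y el H|] ==>
   comult H (x *<H> y)
    = tsum (tensor k H H) (comult H x) (%x1 x2. tsum (tensor k H H) (comult H y) (%y1 y2.
      tens k H H (x1 *<H> y1) (x2 *<H> y2)))"
  and comult_one: "comult H \<one>\<^bsub>H\<^esub> = tens k H H \<one>\<^bsub>H\<^esub> \<one>\<^bsub>H\<^esub>"
  and counit_mult: "[|x el H; y el H|]
   ==> counit H (x *<H> y) = counit H x *<k> counit H y"
  and counit_one: "counit H \<one>\<^bsub>H\<^esub> = \<one>\<^bsub>k\<^esub>"

sublocale bialgebra \<subseteq> nonassoc_bialgebra k H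
proof
 show "bilinear_map k H H H (mult H)"
  by (intro bilinear_mapI linear_mapI)
   (auto simp: H.l_distr H.r_distr smult_mult_left smult_mult_right)
qed (auto simp: comult_mult comult_one counit_mult counit_one)

context nonassoc_bialgebra
begin

lemma mult_closed [simp]: "x el H ==> y el H ==> x *<H> y el H"
 by (rule bilinear_closed[OF bilinear_mult])

lemmas lin_mult [lin] = bilinear_right[OF bilinear_mult] bilinear_left[OF bilinear_mult]

lemma comult_mult_G:
 assumes x: "x el H" and y: "y el H" and G: "module k G"
  "!!h. h el H ==> lmap H G (%n. F h n)" "!!n. n el H ==> lmap H G (%h. F h n)"
 shows "tsum G (comult H (x *<H> y)) F = tsum G (comult H x) (%x1 x2. tsum G (comult H y) (%y1 y2. F (x1 *<H> y1) (x2 *<H> y2)))"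
proof -
 have L: "lmap (tensor k H H) G (%t. tsum G t F)" using G by (intro tsum_linear_on_tensor bilinear_mapI) auto
 have "tsum G (comult H (x *<H> y)) F = tsum G (comult H x) (%x1 x2. tsum G (tsum (tensor k H H) (comult H y) (%y1 y2.
      tens k H H (x1 *<H> y1) (x2 *<H> y2))) F)"
  unfolding comult_mult[OF x y] using G x y by (intro linear_tsum[OF _ _ L comult_pairs]) auto
 also have "... = tsum G (comult H x) (%x1 x2. tsum G (comult H y) (%y1 y2. tsum G (tens k H H (x1 *<H> y1) (x2 *<H> y2)) F))"
  using G x y by (intro comult_cong linear_tsum[OF _ _ L comult_pairs]) auto
 also have "... = tsum G (comult H x) (%x1 x2. tsum G (comult H y) (%y1 y2. F (x1 *<H> y1) (x2 *<H> y2)))"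
  using G x y by (intro comult_cong tsum_tens bilinear_mapI) auto
 finally show ?thesis .
qed

lemma coact_ct_utens:
 assumes "precomod M" "precomod N" "m el M" "n el N"
 shows "coact (ct H M N) (ut M N m n) =
  tsum (tensor k H (ct H M N)) (coact M m) (%g m0. tsum (tensor k H (ct H M N)) (coact N n) (%h n0.
     tens k H (ct H M N) (g *<H> h) (ut M N m0 n0)))"
 unfolding coact_ct using assms by (simp add: lin)

lemma precomod_ct [simp]:
 assumes "precomod M" "precomod N"
 shows "precomod (ct H M N)"
 unfolding precomod_def coact_ct using assms by (auto intro!: lin)

lemma tsum_coact_ct:
 assumes "precomod M" "precomod N" "m el M" "n el N" and G: "module k G"
  "!!h. h el H ==> lmap (ct H M N) G (%n. F h n)"
  "!!n. n el (ct H M N) ==> lmap H G (%h. F h n)"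
 shows "tsum G (coact (ct H M N) (ut M N m n)) F =
  tsum G (coact M m) (%g m0. tsum G (coact N n) (%h n0. F (g *<H> h) (ut M N m0 n0)))"
proof -
 let ?MN = "ct H M N"
 have L: "lmap (tensor k H ?MN) G (%t. tsum G t F)" using assms by (intro tsum_linear_on_tensor bilinear_mapI) auto
 have "tsum G (coact ?MN (ut M N m n)) F = tsum G (coact M m) (%g m0. tsum G (tsum (tensor k H ?MN) (coact N n) (%h n0.
      tens k H ?MN (g *<H> h) (ut M N m0 n0))) F)"
  unfolding coact_ct_utens[OF assms(1-4)] using assms by (intro linear_tsum[OF _ _ L coact_pairs]) auto
 also have "... = tsum G (coact M m) (%g m0. tsum G (coact N n) (%h n0. tsum G (tens k H ?MN (g *<H> h) (ut M N m0 n0)) F))"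
  using assms by (intro coact_cong linear_tsum[OF _ _ L coact_pairs]) auto
 also have "... = tsum G (coact M m) (%g m0. tsum G (coact N n) (%h n0. F (g *<H> h) (ut M N m0 n0)))"
  using assms by (intro coact_cong tsum_tens bilinear_mapI) auto
 finally show ?thesis .
qed

lemma left_comodule_ct:
 assumes M: "comod M" and N: "comod N"
 shows "comod (ct H M N)"
proof -
 let ?T = "ct H M N"
 let ?HHT = "tensor k H (tensor k H ?T)"
 have MN: "precomod M" "precomod N" "precomod ?T" using M N by auto
 then have [simp]: "module k M" "module k N" by auto
 have 1: "tsum ?HHT (coact ?T t) (%h n. tsum ?HHT (comult H h) (%h1 h2.
     tens k H (tensor k H ?T) h1 (tens k H ?T h2 n)))
    = tsum ?HHT (coact ?T t) (%h1 m'. tsum ?HHT (coact ?T m') (%h2 n.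
     tens k H (tensor k H ?T) h1 (tens k H ?T h2 n)))" if t: "t el ?T" for t
 proof (rule ct_ext[OF _ _ _ _ _ _ t])
  fix m n assume m: "m el M" and n: "n el N"
  have "tsum ?HHT (coact ?T (ut M N m n)) (%h n. tsum ?HHT (comult H h) (%h1 h2.
     tens k H (tensor k H ?T) h1 (tens k H ?T h2 n))) =
   tsum ?HHT (coact M m) (%h m0. tsum ?HHT (coact N n) (%g n0. tsum ?HHT (comult H (h *<H> g)) (%h1 h2.
    tens k H (tensor k H ?T) h1 (tens k H ?T h2 (ut M N m0 n0)))))"
   using m n MN by (intro tsum_coact_ct) (auto intro!: lin)
  also have "... = tsum ?HHT (coact M m) (%h m0. tsum ?HHT (coact N n) (%g n0. tsum ?HHT (comult H h) (%h1 h2. tsum ?HHT (comult H g) (%g1 g2.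
    tens k H (tensor k H ?T) (h1 *<H> g1) (tens k H ?T (h2 *<H> g2) (ut M N m0 n0))))))"
   using m n MN by (intro coact_cong comult_mult_G) (auto intro!: lin)
  also have "... = tsum ?HHT (coact M m) (%h1 m'. tsum ?HHT (coact N n) (%g1 n'. tsum ?HHT (coact M m') (%h2 m0. tsum ?HHT (coact N n') (%g2 n0.
    tens k H (tensor k H ?T) (h1 *<H> g1) (tens k H ?T (h2 *<H> g2) (ut M N m0 n0))))))"
   using m n MN by (intro coact2_coassoc M N) (auto intro!: lin)
  also have "... = tsum ?HHT (coact M m) (%h1 m'. tsum ?HHT (coact N n) (%g1 n'. tsum ?HHT (coact ?T (ut M N m' n')) (%h2 t.
    tens k H (tensor k H ?T) (h1 *<H> g1) (tens k H ?T h2 t))))"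
   using m n MN by (intro coact_cong tsum_coact_ct[symmetric]) (auto intro!: lin)
  also have "... = tsum ?HHT (coact ?T (ut M N m n)) (%h1 m'. tsum ?HHT (coact ?T m') (%h2 n.
     tens k H (tensor k H ?T) h1 (tens k H ?T h2 n)))"
   using m n MN by (intro tsum_coact_ct[symmetric]) (auto intro!: lin)
  finally show "tsum ?HHT (coact ?T (ut M N m n)) (%h n. tsum ?HHT (comult H h) (%h1 h2.
     tens k H (tensor k H ?T) h1 (tens k H ?T h2 n)))
    = tsum ?HHT (coact ?T (ut M N m n)) (%h1 m'. tsum ?HHT (coact ?T m') (%h2 n.
     tens k H (tensor k H ?T) h1 (tens k H ?T h2 n)))" .
 qed (use MN in \<open>auto intro!: lin\<close>)
 have 2: "tsum ?T (coact ?T t) (%h n. counit H h *[?T] n) = t" if t: "t el ?T" for t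
 proof (rule ct_ext[OF _ _ _ _ _ _ t])
  fix m n assume m: "m el M" and n: "n el N"
  have "tsum ?T (coact ?T (ut M N m n)) (%h n. counit H h *[?T] n) =
   tsum ?T (coact M m) (%g m0. tsum ?T (coact N n) (%h n0. counit H (g *<H> h) *[?T] ut M N m0 n0))"
   using m n MN by (intro tsum_coact_ct) (auto intro!: lin)
  also have "... = tsum ?T (coact M m) (%g m0. tsum ?T (coact N n) (%h n0. counit H h *[?T] (counit H g *[?T] ut M N m0 n0)))"
   using m n MN by (intro coact_cong) (auto simp: counit_mult mult_smult smult_commute)
  also have "... = tsum ?T (coact M m) (%g m0. counit H g *[?T] ut M N m0 n)"
   using m n MN by (intro coact_cong coact_counit N) (auto intro!: lin)
  also have "... = ut M N m n"
   using m n MN by (intro coact_counit M) (auto intro!: lin)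
  finally show "tsum ?T (coact ?T (ut M N m n)) (%h n. counit H h *[?T] n) = ut M N m n" .
 qed (use MN in \<open>auto intro!: lin\<close>)
 show ?thesis
  unfolding left_comodule_def left_comodule_axioms_def Let_def
  using 1 2 MN(3)[unfolded precomod_def] by auto
qed

lemma lin_coact_cu: "lmap (comod_unit k H) (tensor k H (comod_unit k H)) (coact (comod_unit k H))"
 unfolding coact_cu by (auto intro!: lin)

lemma precomod_cu [simp]: "precomod (comod_unit k H)"
 by (simp add: precomod_def lin_coact_cu)

lemma tsum_coact_cu:
 assumes "module k G" "c el (comod_unit k H)"
  "!!h. h el H ==> lmap (comod_unit k H) G (%n. F h n)"
  "!!n. n el (comod_unit k H) ==> lmap H G (%h. F h n)"
 shows "tsum G (coact (comod_unit k H) c) F = F \<one>\<^bsub>H\<^esub> c"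
 unfolding coact_cu using assms by (intro tsum_tens bilinear_mapI) auto

lemma tsum_comult_one:
 assumes "module k G"
  "!!h. h el H ==> lmap H G (%n. F h n)"
  "!!n. n el H ==> lmap H G (%h. F h n)"
 shows "tsum G (comult H \<one>\<^bsub>H\<^esub>) F = F \<one>\<^bsub>H\<^esub> \<one>\<^bsub>H\<^esub>"
 unfolding comult_one using assms by (intro tsum_tens bilinear_mapI) auto

lemma left_comodule_cu: "comod (comod_unit k H)"
proof -
 interpret U: module k "comod_unit k H" by simp
 show ?thesis
 unfolding left_comodule_def left_comodule_axioms_def Let_def
 by (auto simp: lin_coact_cu) (auto simp: tsum_coact_cu tsum_comult_one lin counit_one)
qed

lemma comodule_ten_map:
 assumes "comod M" "comod N" "comod M'" "comod N'"
  "colinear M M' f" "colinear N N' g"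
 shows "colinear (ct H M N) (ct H M' N') (ten_map H M' N' f g)"
 unfolding colinear_def
proof (intro conjI ballI)
 let ?T = "ct H M N" and ?T' = "ct H M' N'"
 have MN: "precomod M" "precomod N" "precomod M'" "precomod N'" "precomod ?T" "precomod ?T'" using assms by auto
 then have [simp]: "module k M" "module k N" "module k M'" "module k N'" by auto
 note f = assms(5)[THEN colinear_linear] and g = assms(6)[THEN colinear_linear]
 note [simp] = linear_closed[OF f] linear_closed[OF g] f g
 show L: "lmap ?T ?T' (ten_map H M' N' f g)" by (intro linear_ten_map) auto
 note [lin] = linear_comp[OF _ L]
 fix t assume t: "t el ?T"
 show "coact ?T' (ten_map H M' N' f g t) = tsum (tensor k H ?T') (coact ?T t) (%h m0. tens k H ?T' h (ten_map H M' N' f g m0))"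
 proof (rule ct_ext[OF _ _ _ _ _ _ t])
  fix m n assume m: "m el M" and n: "n el N"
  have "tsum (tensor k H ?T') (coact ?T (ut M N m n)) (%h m0. tens k H ?T' h (ten_map H M' N' f g m0)) =
   tsum (tensor k H ?T') (coact M m) (%g' m0. tsum (tensor k H ?T') (coact N n) (%h n0. tens k H ?T' (g' *<H> h) (ten_map H M' N' f g (ut M N m0 n0))))"
   using m n MN linear_closed[OF L] by (intro tsum_coact_ct) (auto intro!: lin)
  also have "... = tsum (tensor k H ?T') (coact M m) (%g' m0. tsum (tensor k H ?T') (coact N n) (%h n0. tens k H ?T' (g' *<H> h) (ut M' N' (f m0) (g n0))))"
   using m n MN by (intro coact_cong) (auto simp: ten_map_utens)
  also have "... = tsum (tensor k H ?T') (coact M m) (%g' m0. tsum (tensor k H ?T') (coact N' (g n)) (%h n0. tens k H ?T' (g' *<H> h) (ut M' N' (f m0) n0)))"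
   using m n MN by (intro coact_cong coact_colinear[OF assms(6), symmetric]) (auto intro!: lin)
  also have "... = tsum (tensor k H ?T') (coact M' (f m)) (%g' m0. tsum (tensor k H ?T') (coact N' (g n)) (%h n0. tens k H ?T' (g' *<H> h) (ut M' N' m0 n0)))"
   using m n MN by (intro coact_colinear[OF assms(5), symmetric]) (auto intro!: lin)
  also have "... = coact ?T' (ten_map H M' N' f g (ut M N m n))"
   using m n MN by (simp add: coact_ct_utens ten_map_utens)
  finally show "coact ?T' (ten_map H M' N' f g (ut M N m n)) =
   tsum (tensor k H ?T') (coact ?T (ut M N m n)) (%h m0. tens k H ?T' h (ten_map H M' N' f g m0))" by simp
 qed (use MN linear_closed[OF L] L in \<open>auto intro!: lin\<close>)
qed

lemma colinear_lunit:
 fixes M :: "('k, 'h, 'x) comod"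
 assumes M: "comod M"
 shows "colinear (ct H (comod_unit k H) M) M (lunit_map M)"
proof -
 let ?U = "comod_unit k H" and ?T = "ct H (comod_unit k H) M"
 have MN: "precomod M" "precomod ?T" using assms by auto
 then have [simp]: "module k M" by auto
 have L: "lmap ?T M (lunit_map M)" by (intro linear_lunit_map) auto
 note [lin] = linear_comp[OF _ L]
 show ?thesis unfolding colinear_def
 proof (intro conjI ballI L)
 fix t assume t: "t el ?T"
 show "coact M (lunit_map M t) = tsum (tensor k H M) (coact ?T t) (%h m0. tens k H M h (lunit_map M m0))"
 proof (rule ct_ext[OF _ _ _ _ _ _ t])
  fix c m :: "('k, 'x) univ" assume m: "m el M" and c: "c el ?U"
  let ?S = "tsum (tensor k H M)"
  have "?S (coact ?T (ut ?U M c m)) (%h m0. tens k H M h (lunit_map M m0)) =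
   ?S (coact ?U c) (%g c. ?S (coact M m) (%h m0. tens k H M (g *<H> h) (lunit_map M (ut ?U M c m0))))"
   using m c MN linear_closed[OF L] by (intro tsum_coact_ct) (auto intro!: lin)
  also have "... = ?S (coact M m) (%h m0. tens k H M (\<one>\<^bsub>H\<^esub> *<H> h) (lunit_map M (ut ?U M c m0)))"
   using m c MN linear_closed[OF L] by (intro tsum_coact_cu) (auto intro!: lin)
  also have "... = ?S (coact M m) (%h m0. unscal c *[tensor k H M] tens k H M h m0)"
   using m c MN by (intro coact_cong) (auto simp: lunit_map_utens linear_smult[OF linear_tens(1)[OF _ _ _ linear_id]])
  also have "... = unscal c *[tensor k H M] ?S (coact M m) (tens k H M)"
   using m c MN by (intro smult_c[symmetric]) auto
  also have "... = unscal c *[tensor k H M] coact M m"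
   using m MN by (simp add: tsum_tens_self)
  also have "... = coact M (lunit_map M (ut ?U M c m))"
   using m c MN linear_smult[of k M "tensor k H M" "coact M"] by (simp add: lunit_map_utens precomod_def)
  finally show "coact M (lunit_map M (ut ?U M c m)) = ?S (coact ?T (ut ?U M c m)) (%h m0. tens k H M h (lunit_map M m0))"
   by simp
 qed (use MN linear_closed[OF L] L in \<open>auto intro!: lin\<close>)
 qed
qed

lemma colinear_runit:
 fixes M :: "('k, 'h, 'x) comod"
 assumes M: "comod M"
 shows "colinear (ct H M (comod_unit k H)) M (runit_map M)"
proof -
 let ?U = "comod_unit k H" and ?T = "ct H M (comod_unit k H)"
 have MN: "precomod M" "precomod ?T" using assms by auto
 then have [simp]: "module k M" by auto
 have L: "lmap ?T M (runit_map M)" by (intro linear_runit_map) auto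
 note [lin] = linear_comp[OF _ L]
 show ?thesis unfolding colinear_def
 proof (intro conjI ballI L)
 fix t assume t: "t el ?T"
 show "coact M (runit_map M t) = tsum (tensor k H M) (coact ?T t) (%h m0. tens k H M h (runit_map M m0))"
 proof (rule ct_ext[OF _ _ _ _ _ _ t])
  fix m c :: "('k, 'x) univ" assume m: "m el M" and c: "c el ?U"
  let ?S = "tsum (tensor k H M)"
  have "?S (coact ?T (ut M ?U m c)) (%h m0. tens k H M h (runit_map M m0)) =
   ?S (coact M m) (%h m0. ?S (coact ?U c) (%g c. tens k H M (h *<H> g) (runit_map M (ut M ?U m0 c))))"
   using m c MN linear_closed[OF L] by (intro tsum_coact_ct) (auto intro!: lin)
  also have "... = ?S (coact M m) (%h m0. tens k H M (h *<H> \<one>\<^bsub>H\<^esub>) (runit_map M (ut M ?U m0 c)))"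
   using m c MN linear_closed[OF L] by (intro coact_cong tsum_coact_cu) (auto intro!: lin)
  also have "... = ?S (coact M m) (%h m0. unscal c *[tensor k H M] tens k H M h m0)"
   using m c MN by (intro coact_cong) (auto simp: runit_map_utens linear_smult[OF linear_tens(1)[OF _ _ _ linear_id]])
  also have "... = unscal c *[tensor k H M] ?S (coact M m) (tens k H M)"
   using m c MN by (intro smult_c[symmetric]) auto
  also have "... = unscal c *[tensor k H M] coact M m"
   using m MN by (simp add: tsum_tens_self)
  also have "... = coact M (runit_map M (ut M ?U m c))"
   using m c MN linear_smult[of k M "tensor k H M" "coact M"] by (simp add: runit_map_utens precomod_def)
  finally show "coact M (runit_map M (ut M ?U m c)) = ?S (coact ?T (ut M ?U m c)) (%h m0. tens k H M h (runit_map M m0))"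
   by simp
 qed (use MN linear_closed[OF L] L in \<open>auto intro!: lin\<close>)
 qed
qed

end

context bialgebra
begin

lemma colinear_assoc:
 assumes "comod M" "comod N" "comod P"
 shows "colinear (ct H (ct H M N) P) (ct H M (ct H N P)) (assoc_map H M N P)"
 unfolding colinear_def
proof (intro conjI ballI)
 let ?MN = "ct H M N" and ?NP = "ct H N P"
 let ?T = "ct H ?MN P" and ?T' = "ct H M ?NP"
 have MN: "precomod M" "precomod N" "precomod P" "precomod ?T" "precomod ?T'" "precomod ?MN" "precomod ?NP" using assms by auto
 then have [simp]: "module k M" "module k N" "module k P" by auto
 show L: "lmap ?T ?T' (assoc_map H M N P)" by (intro linear_assoc_map) auto
 note [lin] = linear_comp[OF _ L]
 fix t assume t: "t el ?T"
 show "coact ?T' (assoc_map H M N P t) = tsum (tensor k H ?T') (coact ?T t) (%h m0. tens k H ?T' h (assoc_map H M N P m0))"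
 proof (rule ct3_ext[OF _ _ _ _ _ _ _ t])
  fix m n p assume m: "m el M" and n: "n el N" and p: "p el P"
  let ?S = "tsum (tensor k H ?T')"
  have "?S (coact ?T (ut ?MN P (ut M N m n) p)) (%h m0. tens k H ?T' h (assoc_map H M N P m0)) =
   ?S (coact ?MN (ut M N m n)) (%h s. ?S (coact P p) (%l p0. tens k H ?T' (h *<H> l) (assoc_map H M N P (ut ?MN P s p0))))"
   using m n p MN linear_closed[OF L] by (intro tsum_coact_ct) (auto intro!: lin)
  also have "... = ?S (coact M m) (%g m0. ?S (coact N n) (%h n0. ?S (coact P p) (%l p0.
    tens k H ?T' ((g *<H> h) *<H> l) (assoc_map H M N P (ut ?MN P (ut M N m0 n0) p0)))))"
   using m n p MN linear_closed[OF L] by (intro tsum_coact_ct) (auto intro!: lin)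
  also have "... = ?S (coact M m) (%g m0. ?S (coact N n) (%h n0. ?S (coact P p) (%l p0.
    tens k H ?T' (g *<H> (h *<H> l)) (ut M ?NP m0 (ut N P n0 p0)))))"
   using m n p MN by (intro coact_cong) (auto simp: assoc_map_utens H.m_assoc)
  also have "... = ?S (coact M m) (%g m0. ?S (coact ?NP (ut N P n p)) (%h t.
    tens k H ?T' (g *<H> h) (ut M ?NP m0 t)))"
   using m n p MN by (intro coact_cong tsum_coact_ct[symmetric]) (auto intro!: lin)
  also have "... = coact ?T' (assoc_map H M N P (ut ?MN P (ut M N m n) p))"
   using m n p MN by (simp add: coact_ct_utens assoc_map_utens)
  finally show "coact ?T' (assoc_map H M N P (ut ?MN P (ut M N m n) p)) =
   ?S (coact ?T (ut ?MN P (ut M N m n) p)) (%h m0. tens k H ?T' h (assoc_map H M N P m0))" by simp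
 qed (use MN linear_closed[OF L] L in \<open>auto intro!: lin\<close>)
qed

end

section \<open>The monoidal category of comodules\<close>

definition ap :: "'o \<times> ('u \<Rightarrow> 'u) \<times> 'o \<Rightarrow> 'u \<Rightarrow> 'u" where "ap a = fst (snd a)"
definition cod :: "'o \<times> ('u \<Rightarrow> 'u) \<times> 'o \<Rightarrow> 'o" where "cod a = snd (snd a)"

lemma comod_arrow_dom_cod [simp]: "fst (comod_arrow M N f) = M" "cod (comod_arrow M N f) = N"
 by (simp_all add: comod_arrow_def cod_def)

lemma ap_comod_arrow [simp]: "m el M ==> ap (comod_arrow M N f) m = f m"
 by (simp add: comod_arrow_def ap_def)

lemma comod_comp_dom_cod [simp]:
 "fst (g oo\<^bsub>comod_cat k H r\<^esub> f) = fst f" "cod (g oo\<^bsub>comod_cat k H r\<^esub> f) = cod g"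
 by (cases f; cases g; simp add: comod_cat_def comod_arrow_def cod_def)+

lemma ap_comp [simp]: "m el (fst f) ==> ap (g oo\<^bsub>comod_cat k H r\<^esub> f) m = ap g (ap f m)"
 by (cases f; cases g) (simp add: comod_cat_def comod_arrow_def ap_def)

lemma comod_ten_dom_cod [simp]:
 "fst (f xx\<^bsub>comod_cat k H r\<^esub> g) = comod_tensor k H (fst f) (fst g)"
 "cod (f xx\<^bsub>comod_cat k H r\<^esub> g) = comod_tensor k H (cod f) (cod g)"
 by (cases f; cases g; simp add: comod_cat_def comod_arrow_def cod_def)+

context coalgebra
begin

definition carr where
 "carr a \<longleftrightarrow> comod (fst a) \<and> comod (cod a) \<and> a \<in> comod_hom k H (fst a) (cod a)"

lemma hom_iff:
 "M \<in> Obj (comod_cat k H r) \<and> N \<in> Obj (comod_cat k H r) \<and> a \<in> Hom (comod_cat k H r) M N \<longleftrightarrow> carr a \<and> fst a = M \<and> cod a = N"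
 unfolding cc_simps carr_def by (cases a) (auto simp: comod_hom_def cod_def)

lemma comod_homD: "a \<in> comod_hom k H M N ==> fst a = M \<and> cod a = N"
 by (auto simp: comod_hom_def cod_def)

lemma carr_comod_arrow [simp]:
 "comod M ==> comod N ==> carr (comod_arrow M N f) \<longleftrightarrow> colinear M N f"
 by (simp add: carr_def comod_arrow_hom)

lemma carr_arrow: "carr a ==> a = comod_arrow (fst a) (cod a) (ap a)"
 by (cases a) (auto simp: carr_def comod_hom_def comod_arrow_def ap_def cod_def extensional_restrict)

lemma carr_colinear: "carr a ==> fst a = M ==> cod a = N ==> colinear M N (ap a)"
 by (cases a) (auto simp: carr_def comod_hom_iff ap_def cod_def)

lemma carr_linear: "carr a ==> fst a = M ==> cod a = N ==> lmap M N (ap a)"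
 using carr_colinear colinear_linear by blast

lemma carr_dom [simp]: "carr a ==> comod (fst a)" and carr_cod [simp]: "carr a ==> comod (cod a)"
 by (simp_all add: carr_def)

lemma ap_closed: "carr a ==> m el (fst a) ==> ap a m el (cod a)"
 by (rule linear_closed[OF carr_linear[OF _ HOL.refl HOL.refl]])

lemma ap_closed' [simp]: "carr a ==> m el (fst a) ==> cod a = N ==> ap a m el N"
 using ap_closed by blast

lemma carr_eqI:
 assumes "carr a" "carr b" "fst a = fst b" "cod a = cod b" "!!m. m el (fst a) ==> ap a m = ap b m"
 shows "a = b"
proof -
 have "a = comod_arrow (fst a) (cod a) (ap a)" by (rule carr_arrow[OF assms(1)])
 also have "... = comod_arrow (fst b) (cod b) (ap b)" using assms(3-5) by (simp add: comod_arrow_eq_iff)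
 also have "... = b" by (rule carr_arrow[OF assms(2), symmetric])
 finally show ?thesis .
qed

lemma carr_comp [simp]:
 assumes "carr f" "carr g" "cod f = fst g"
 shows "carr (g oo\<^bsub>comod_cat k H r\<^esub> f)"
proof -
 have "g oo\<^bsub>comod_cat k H r\<^esub> f = comod_arrow (fst g) (cod g) (ap g) oo\<^bsub>comod_cat k H r\<^esub> comod_arrow (fst f) (cod f) (ap f)"
  using carr_arrow[OF assms(2)] carr_arrow[OF assms(1)] by (rule arg_cong2)
 also have "... = comod_arrow (fst f) (cod g) (%m. ap g (ap f m))"
  using comod_comp'[OF carr_linear[OF assms(1) HOL.refl HOL.refl]] by (simp add: assms(3))
 finally have e: "g oo\<^bsub>comod_cat k H r\<^esub> f = comod_arrow (fst f) (cod g) (%m. ap g (ap f m))" .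
 have "comod (fst f)" "comod (cod f)" "comod (cod g)"
  using carr_dom[OF assms(1)] carr_cod[OF assms(1)] carr_cod[OF assms(2)] by simp_all
 then show ?thesis unfolding e
  using colinear_comp[of "fst f" "cod f" "cod g" "ap f" "ap g"] assms by (simp add: carr_colinear)
qed

lemma carr_ident [simp]: "comod M ==> carr (comod_arrow M M (%m. m))"
 by (simp add: colinear_id)

declare colinear_id [simp]

lemma comod_category: "category (comod_cat k H r)"
proof (unfold_locales)
 fix X assume X: "X \<in> Obj (comod_cat k H r)"
 then show "Ident (comod_cat k H r) X \<in> Hom (comod_cat k H r) X X"
  by (simp add: cc_simps comod_arrow_hom colinear_id)
 fix Y f assume "Y \<in> Obj (comod_cat k H r)" "f \<in> Hom (comod_cat k H r) X Y"
 then have f: "carr f" "fst f = X" "cod f = Y" using X hom_iff by blast+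
 have XY: "comod X" "comod Y" using f by (auto simp: carr_def simp del: carr_dom carr_cod)
 show "Ident (comod_cat k H r) Y oo\<^bsub>comod_cat k H r\<^esub> f = f"
  using f XY by (intro carr_eqI) (auto simp: cc_simps)
 show "f oo\<^bsub>comod_cat k H r\<^esub> Ident (comod_cat k H r) X = f"
  using f XY by (intro carr_eqI) (auto simp: cc_simps)
 fix Z g assume "Y \<in> Obj (comod_cat k H r)" "Z \<in> Obj (comod_cat k H r)" "g \<in> Hom (comod_cat k H r) Y Z"
 then have g: "carr g" "fst g = Y" "cod g = Z" using hom_iff by blast+
 show "g oo\<^bsub>comod_cat k H r\<^esub> f \<in> Hom (comod_cat k H r) X Z"
  using carr_comp[OF f(1) g(1)] f g hom_iff comod_comp_dom_cod by metis
next
 fix W X Y Z f g h assume "W \<in> Obj (comod_cat k H r)" "X \<in> Obj (comod_cat k H r)" "Y \<in> Obj (comod_cat k H r)" "Z \<in> Obj (comod_cat k H r)"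
  "f \<in> Hom (comod_cat k H r) W X" "g \<in> Hom (comod_cat k H r) X Y" "h \<in> Hom (comod_cat k H r) Y Z"
 then have f: "carr f" "fst f = W" "cod f = X" and g: "carr g" "fst g = X" "cod g = Y" and h: "carr h" "fst h = Y" "cod h = Z"
  using hom_iff by blast+
 show "(h oo\<^bsub>comod_cat k H r\<^esub> g) oo\<^bsub>comod_cat k H r\<^esub> f = h oo\<^bsub>comod_cat k H r\<^esub> g oo\<^bsub>comod_cat k H r\<^esub> f"
  using f g h by (intro carr_eqI) auto
qed

lemma inverse_arrowsI:
 assumes "carr a" "carr b" "fst a = X" "cod a = Y" "fst b = Y" "cod b = X"
  "!!x. x el X ==> ap b (ap a x) = x" "!!y. y el Y ==> ap a (ap b y) = y"
 shows "inverse_arrows (comod_cat k H r) X Y a b"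
 unfolding inverse_arrows_def
proof (intro conjI)
 have XY: "comod X" "comod Y" using assms by (auto simp: carr_def simp del: carr_dom carr_cod)
 show "a \<in> Hom (comod_cat k H r) X Y" "b \<in> Hom (comod_cat k H r) Y X" using assms hom_iff by blast+
 show "b oo\<^bsub>comod_cat k H r\<^esub> a = Ident (comod_cat k H r) X"
  using assms XY by (intro carr_eqI) (auto simp: cc_simps)
 show "a oo\<^bsub>comod_cat k H r\<^esub> b = Ident (comod_cat k H r) Y"
  using assms XY by (intro carr_eqI) (auto simp: cc_simps)
qed

lemma inverse_comod_arrowsI:
 assumes "comod X" "comod Y" "colinear X Y f" "lmap Y X g"
  "!!x. x el X ==> g (f x) = x" "!!y. y el Y ==> f (g y) = y"
 shows "inverse_arrows (comod_cat k H r) X Y (comod_arrow X Y f) (comod_arrow Y X g)"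
proof -
 have g: "colinear Y X g" using assms by (intro colinear_inverse[of X Y f g]) auto
 note [simp] = linear_closed[OF assms(4)] linear_closed[OF colinear_linear[OF assms(3)]]
 show ?thesis using assms g by (intro inverse_arrowsI) auto
qed

end

context nonassoc_bialgebra
begin

context
 fixes r :: "'h \<Rightarrow> 'h \<Rightarrow> 'k"
begin

lemma ten_eq:
 assumes "carr f" "carr g"
 shows "f xx\<^bsub>comod_cat k H r\<^esub> g = comod_arrow (ct H (fst f) (fst g)) (ct H (cod f) (cod g))
  (ten_map H (cod f) (cod g) (ap f) (ap g))"
proof -
 have "f xx\<^bsub>comod_cat k H r\<^esub> g = comod_arrow (fst f) (cod f) (ap f) xx\<^bsub>comod_cat k H r\<^esub> comod_arrow (fst g) (cod g) (ap g)"
  using carr_arrow[OF assms(1)] carr_arrow[OF assms(2)] by (rule arg_cong2)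
 also have "... = comod_arrow (ct H (fst f) (fst g)) (ct H (cod f) (cod g))
  (ten_map H (cod f) (cod g) (ap f) (ap g))"
  using carr_dom[OF assms(1)] carr_dom[OF assms(2)] by (intro comod_ten) auto
 finally show ?thesis .
qed

lemma carr_ten [simp]:
 assumes "carr f" "carr g"
 shows "carr (f xx\<^bsub>comod_cat k H r\<^esub> g)"
proof -
 have e: "f xx\<^bsub>comod_cat k H r\<^esub> g = comod_arrow (ct H (fst f) (fst g)) (ct H (cod f) (cod g))
  (ten_map H (cod f) (cod g) (ap f) (ap g))"
  by (rule ten_eq) fact+
 show ?thesis unfolding e using assms by (simp add: left_comodule_ct comodule_ten_map carr_colinear)
qed

lemma ap_ten [simp]:
 assumes "carr f" "carr g" "fst f = M" "fst g = N" "m el M" "n el N"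
 shows "ap (f xx\<^bsub>comod_cat k H r\<^esub> g) (ut M N m n) = ut (cod f) (cod g) (ap f m) (ap g n)"
proof -
 have e: "f xx\<^bsub>comod_cat k H r\<^esub> g = comod_arrow (ct H (fst f) (fst g)) (ct H (cod f) (cod g))
  (ten_map H (cod f) (cod g) (ap f) (ap g))"
  by (rule ten_eq) fact+
 show ?thesis unfolding e using assms carr_dom[OF assms(1)] carr_cod[OF assms(1)] carr_dom[OF assms(2)] carr_cod[OF assms(2)]
  by (simp add: ten_map_utens carr_linear)
qed

lemma carr_eq2I:
 assumes "carr a" "carr b" "fst a = ct H M N" "fst b = ct H M N" "cod a = cod b"
  "comod M" "comod N"
  "!!m n. m el M ==> n el N ==> ap a (ut M N m n) = ap b (ut M N m n)"
 shows "a = b"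
proof (rule carr_eqI[OF assms(1,2)])
 have G: "module k (cod a)" using carr_cod[OF assms(1)] by simp
 fix x assume "x el (fst a)"
 then show "ap a x = ap b x"
  unfolding assms(3) by (intro ct_ext[OF assms(6)[THEN comodule_module] assms(7)[THEN comodule_module] G carr_linear[OF assms(1,3) HOL.refl] carr_linear[OF assms(2,4) assms(5)[symmetric]] assms(8)])
qed (simp_all only: assms)

lemma carr_eq3I:
 assumes "carr a" "carr b" "fst a = ct H (ct H M N) P" "fst b = ct H (ct H M N) P" "cod a = cod b"
  "comod M" "comod N" "comod P"
  "!!m n p. m el M ==> n el N ==> p el P ==> ap a (ut (ct H M N) P (ut M N m n) p)
   = ap b (ut (ct H M N) P (ut M N m n) p)"
 shows "a = b"
proof (rule carr_eqI[OF assms(1,2)])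
 have G: "module k (cod a)" using carr_cod[OF assms(1)] by simp
 fix x assume "x el (fst a)"
 then show "ap a x = ap b x"
  unfolding assms(3) by (intro ct3_ext[OF assms(6)[THEN comodule_module] assms(7)[THEN comodule_module] assms(8)[THEN comodule_module] G carr_linear[OF assms(1,3) HOL.refl] carr_linear[OF assms(2,4) assms(5)[symmetric]] assms(9)])
qed (simp_all only: assms)

lemma carr_eq3I':
 assumes "carr a" "carr b" "fst a = ct H M (ct H N P)" "fst b = ct H M (ct H N P)" "cod a = cod b"
  "comod M" "comod N" "comod P"
  "!!m n p. m el M ==> n el N ==> p el P ==> ap a (ut M (ct H N P) m (ut N P n p))
   = ap b (ut M (ct H N P) m (ut N P n p))"
 shows "a = b"
proof (rule carr_eqI[OF assms(1,2)])
 have G: "module k (cod a)" using carr_cod[OF assms(1)] by simp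
 fix x assume "x el (fst a)"
 then show "ap a x = ap b x"
  unfolding assms(3) by (intro ct3_ext'[OF assms(6)[THEN comodule_module] assms(7)[THEN comodule_module] assms(8)[THEN comodule_module] G carr_linear[OF assms(1,3) HOL.refl] carr_linear[OF assms(2,4) assms(5)[symmetric]] assms(9)])
qed (simp_all only: assms)

lemma carr_eq4I:
 assumes "carr a" "carr b" "fst a = ct H (ct H (ct H L M) N) P" "fst b = ct H (ct H (ct H L M) N) P" "cod a = cod b"
  "comod L" "comod M" "comod N" "comod P"
  "!!l m n p. l el L ==> m el M ==> n el N ==> p el P ==>
   ap a (ut (ct H (ct H L M) N) P (ut (ct H L M) N (ut L M l m) n) p)
   = ap b (ut (ct H (ct H L M) N) P (ut (ct H L M) N (ut L M l m) n) p)"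
 shows "a = b"
proof (rule carr_eqI[OF assms(1,2)])
 have G: "module k (cod a)" using carr_cod[OF assms(1)] by simp
 fix x assume "x el (fst a)"
 then show "ap a x = ap b x"
  unfolding assms(3) by (intro ct4_ext[OF assms(6)[THEN comodule_module] assms(7)[THEN comodule_module] assms(8)[THEN comodule_module] assms(9)[THEN comodule_module] G carr_linear[OF assms(1,3) HOL.refl] carr_linear[OF assms(2,4) assms(5)[symmetric]] assms(10)])
qed (simp_all only: assms)

declare left_comodule_ct [simp] left_comodule_cu [simp] colinear_lunit [simp] colinear_runit [simp]

context
 assumes colinear_assoc_map: "!!M N P :: ('k, 'h, 'x) comod. comod M ==> comod N ==> comod P ==>
  colinear (ct H (ct H M N) P) (ct H M (ct H N P)) (assoc_map H M N P)"
begin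


lemma assoc_inverseI:
 fixes M N P :: "('k, 'h, 'x) comod"
 assumes "comod M" "comod N" "comod P"
 shows "inverse_arrows (comod_cat k H r) (ct H (ct H M N) P) (ct H M (ct H N P))
  (Assoc (comod_cat k H r) M N P) (comod_arrow (ct H M (ct H N P)) (ct H (ct H M N) P) (assoc_inv H M N P))"
 unfolding cc_simps
proof (intro inverse_comod_arrowsI)
 note MNP = assms[THEN comodule_module]
 note l1 = linear_assoc_map[OF MNP, of H] and l2 = linear_assoc_inv[OF MNP, of H]
 let ?A = "ct H (ct H M N) P" and ?B = "ct H M (ct H N P)"
 show "lmap ?B ?A (assoc_inv H M N P)" by (rule l2)
 show "assoc_inv H M N P (assoc_map H M N P x) = x" if "x el ?A" for x
  by (rule ct3_ext[OF MNP _ linear_comp[OF l1 l2] linear_id _ that]) (simp_all add: MNP assoc_map_utens assoc_inv_utens)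
 show "assoc_map H M N P (assoc_inv H M N P x) = x" if "x el ?B" for x
  by (rule ct3_ext'[OF MNP _ linear_comp[OF l2 l1] linear_id _ that]) (simp_all add: MNP assoc_map_utens assoc_inv_utens)
qed (use assms colinear_assoc_map in auto)

text \<open>The coherence laws are equations between linear maps, which hold on pure tensors by the
 formulas for the structure maps.\<close>
lemma comod_monoidalI: "monoidal_category (comod_cat k H r :: (('k, 'h, 'x) comod, ('k, 'h, 'x) comod_arrow) brcat)" (is "monoidal_category ?C")
proof -
 interpret category ?C by (rule comod_category)
 note s = cc_simps
 note [simp] = colinear_assoc_map
 have obj: "X \<in> Obj ?C ==> comod X" for X by (simp add: s)
 have arr: "X \<in> Obj ?C ==> Y \<in> Obj ?C ==> f \<in> Hom ?C X Y ==> carr f \<and> fst f = X \<and> cod f = Y" for X Y f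
  using hom_iff by blast
 show ?thesis
 proof
  fix X Y X' Y' f g assume a: "X \<in> Obj ?C" "X' \<in> Obj ?C" "Y \<in> Obj ?C" "Y' \<in> Obj ?C" "f \<in> Hom ?C X X'" "g \<in> Hom ?C Y Y'"
  note f = arr[OF a(1,2,5)] and g = arr[OF a(3,4,6)]
  show "f xx\<^bsub>?C\<^esub> g \<in> Hom ?C (X ox\<^bsub>?C\<^esub> Y) (X' ox\<^bsub>?C\<^esub> Y')"
   using f g carr_ten[of f g] unfolding s by (auto simp: carr_def simp del: carr_dom carr_cod)
 next
  fix X Y assume "X \<in> Obj ?C" "Y \<in> Obj ?C"
  note o = this[THEN obj]
  show "X ox\<^bsub>?C\<^esub> Y \<in> Obj ?C" using o by (simp add: s)
  show "Ident ?C X xx\<^bsub>?C\<^esub> Ident ?C Y = Ident ?C (X ox\<^bsub>?C\<^esub> Y)"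
   unfolding s using o by (intro carr_eq2I[of _ _ X Y]) auto
  show "(Ident ?C X xx\<^bsub>?C\<^esub> LUnit ?C Y) oo\<^bsub>?C\<^esub> Assoc ?C X (Unit ?C) Y = RUnit ?C X xx\<^bsub>?C\<^esub> Ident ?C Y"
   unfolding s using o by (intro carr_eq3I[of _ _ X "comod_unit k H" Y])
    (auto simp: assoc_map_utens lunit_map_utens runit_map_utens smult_utens[where H=H] module.smult_closed)
 next
  show "Unit ?C \<in> Obj ?C" by (simp add: s)
 next
  fix X X' X'' Y Y' Y'' f f' g g'
  assume a: "X \<in> Obj ?C" "X' \<in> Obj ?C" "X'' \<in> Obj ?C" "Y \<in> Obj ?C" "Y' \<in> Obj ?C" "Y'' \<in> Obj ?C"
   "f \<in> Hom ?C X X'" "f' \<in> Hom ?C X' X''" "g \<in> Hom ?C Y Y'" "g' \<in> Hom ?C Y' Y''"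
  note o = arr[OF a(1,2,7)] arr[OF a(2,3,8)] arr[OF a(4,5,9)] arr[OF a(5,6,10)] a(1-6)[THEN obj]
  show "(f' oo\<^bsub>?C\<^esub> f) xx\<^bsub>?C\<^esub> (g' oo\<^bsub>?C\<^esub> g) = (f' xx\<^bsub>?C\<^esub> g') oo\<^bsub>?C\<^esub> (f xx\<^bsub>?C\<^esub> g)"
   using o by (intro carr_eq2I[of _ _ X Y]) auto
 next
  fix X Y Z assume "X \<in> Obj ?C" "Y \<in> Obj ?C" "Z \<in> Obj ?C"
  note o = this[THEN obj]
  show "iso_arrow ?C ((X ox\<^bsub>?C\<^esub> Y) ox\<^bsub>?C\<^esub> Z) (X ox\<^bsub>?C\<^esub> (Y ox\<^bsub>?C\<^esub> Z)) (Assoc ?C X Y Z)"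
   using assoc_inverseI[OF o] unfolding iso_arrow_def s by blast
 next
  fix X X' Y Y' Z Z' f g h
  assume a: "X \<in> Obj ?C" "X' \<in> Obj ?C" "Y \<in> Obj ?C" "Y' \<in> Obj ?C" "Z \<in> Obj ?C" "Z' \<in> Obj ?C"
   "f \<in> Hom ?C X X'" "g \<in> Hom ?C Y Y'" "h \<in> Hom ?C Z Z'"
  note o = arr[OF a(1,2,7)] arr[OF a(3,4,8)] arr[OF a(5,6,9)] a(1-6)[THEN obj]
  show "Assoc ?C X' Y' Z' oo\<^bsub>?C\<^esub> ((f xx\<^bsub>?C\<^esub> g) xx\<^bsub>?C\<^esub> h) = (f xx\<^bsub>?C\<^esub> (g xx\<^bsub>?C\<^esub> h)) oo\<^bsub>?C\<^esub> Assoc ?C X Y Z"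
   unfolding s using o by (intro carr_eq3I[of _ _ X Y Z]) (auto simp: assoc_map_utens)
 next
  fix X assume "X \<in> Obj ?C"
  note o = obj[OF this]
  show "iso_arrow ?C (Unit ?C ox\<^bsub>?C\<^esub> X) X (LUnit ?C X)"
   unfolding iso_arrow_def s
   by (rule exI, rule inverse_comod_arrowsI[OF _ _ _ linear_lunit_inv(1)]) (use o in \<open>auto simp: lunit_inv\<close>)
  show "iso_arrow ?C (X ox\<^bsub>?C\<^esub> Unit ?C) X (RUnit ?C X)"
   unfolding iso_arrow_def s
   by (rule exI, rule inverse_comod_arrowsI[OF _ _ _ linear_runit_inv]) (use o in \<open>auto simp: runit_inv\<close>)
 next
  fix X Y f assume a: "X \<in> Obj ?C" "Y \<in> Obj ?C" "f \<in> Hom ?C X Y"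
  note o = a(1,2)[THEN obj] arr[OF a]
  have f: "lmap X Y (ap f)" using o by (auto intro: carr_linear)
  show "LUnit ?C Y oo\<^bsub>?C\<^esub> (Ident ?C (Unit ?C) xx\<^bsub>?C\<^esub> f) = f oo\<^bsub>?C\<^esub> LUnit ?C X"
   unfolding s using o by (intro carr_eq2I[of _ _ "comod_unit k H" X]) (auto simp: lunit_map_utens linear_smult[OF f])
  show "RUnit ?C Y oo\<^bsub>?C\<^esub> (f xx\<^bsub>?C\<^esub> Ident ?C (Unit ?C)) = f oo\<^bsub>?C\<^esub> RUnit ?C X"
   unfolding s using o by (intro carr_eq2I[of _ _ X "comod_unit k H"]) (auto simp: runit_map_utens linear_smult[OF f])
 next
  fix W X Y Z assume "W \<in> Obj ?C" "X \<in> Obj ?C" "Y \<in> Obj ?C" "Z \<in> Obj ?C"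
  note o = this[THEN obj]
  show "(Ident ?C W xx\<^bsub>?C\<^esub> Assoc ?C X Y Z) oo\<^bsub>?C\<^esub> Assoc ?C W (X ox\<^bsub>?C\<^esub> Y) Z oo\<^bsub>?C\<^esub> (Assoc ?C W X Y xx\<^bsub>?C\<^esub> Ident ?C Z)
     = Assoc ?C W X (Y ox\<^bsub>?C\<^esub> Z) oo\<^bsub>?C\<^esub> Assoc ?C (W ox\<^bsub>?C\<^esub> X) Y Z"
   unfolding s using o by (intro carr_eq4I[of _ _ W X Y Z]) (auto simp: assoc_map_utens)
 qed
qed

end

end

end

context bialgebra
begin

declare colinear_assoc [simp]

end

section \<open>Calculation in monoidal categories\<close>

text \<open>Source and target functions turn the object arguments of the axioms into side conditions that
 rewriting decides.\<close>
locale monoidal_category_st = monoidal_category C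
 for C :: "('o, 'a, 'z) moncat_scheme" (structure) +
 fixes src tgt :: "'a \<Rightarrow> 'o"
 assumes hom_src_tgt: "[|X \<in> Obj C; Y \<in> Obj C; f \<in> Hom C X Y|] ==> src f = X \<and> tgt f = Y"
begin

definition arr :: "'a \<Rightarrow> bool" where
 "arr f \<longleftrightarrow> src f \<in> Obj C \<and> tgt f \<in> Obj C \<and> f \<in> Hom C (src f) (tgt f)"

definition inv_arr :: "'a \<Rightarrow> 'a" where
 "inv_arr f = inv_arrow C (src f) (tgt f) f"

definition iso_arr :: "'a \<Rightarrow> bool" where
 "iso_arr f \<longleftrightarrow> arr f \<and> iso_arrow C (src f) (tgt f) f"

lemma homD: "[|f \<in> Hom C X Y; X \<in> Obj C; Y \<in> Obj C|] ==> arr f \<and> src f = X \<and> tgt f = Y"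
 using hom_src_tgt by (auto simp: arr_def)

lemma hom_iff: "X \<in> Obj C ==> Y \<in> Obj C ==> f \<in> Hom C X Y \<longleftrightarrow> arr f \<and> src f = X \<and> tgt f = Y"
 using hom_src_tgt by (auto simp: arr_def)

lemma arr_src [simp]: "arr f ==> src f \<in> Obj C" and arr_tgt [simp]: "arr f ==> tgt f \<in> Obj C"
 and arr_hom: "arr f ==> f \<in> Hom C (src f) (tgt f)"
 by (simp_all add: arr_def)

lemma arr_ident [simp]: "X \<in> Obj C ==> arr (Ident C X)" "X \<in> Obj C ==> src (Ident C X) = X" "X \<in> Obj C ==> tgt (Ident C X) = X"
 using homD[OF ident_hom] by auto

lemma arr_hom': "arr f ==> src f = X ==> tgt f = Y ==> f \<in> Hom C X Y"
 by (auto intro: arr_hom)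

lemma arr_comp0:
 assumes "arr f" "arr g" "tgt f = src g"
 shows "arr (g oo f) \<and> src (g oo f) = src f \<and> tgt (g oo f) = tgt g"
proof (rule homD)
 show "g oo f \<in> Hom C (src f) (tgt g)"
  by (rule comp_hom[of _ "tgt f"]) (use assms in \<open>simp_all add: arr_hom'\<close>)
qed (use assms in simp_all)

lemma arr_comp [simp]:
 assumes "arr f" "arr g" "tgt f = src g"
 shows "arr (g oo f)" "src (g oo f) = src f" "tgt (g oo f) = tgt g"
 using arr_comp0[OF assms] by simp_all

lemma arr_ten0:
 assumes "arr f" "arr g"
 shows "arr (f xx g) \<and> src (f xx g) = src f ox src g \<and> tgt (f xx g) = tgt f ox tgt g"
proof (rule homD)
 show "f xx g \<in> Hom C (src f ox src g) (tgt f ox tgt g)"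
  by (rule tenA_hom) (use assms in \<open>simp_all add: arr_hom\<close>)
qed (use assms in \<open>simp_all add: tenO_obj\<close>)

lemma arr_ten [simp]:
 assumes "arr f" "arr g"
 shows "arr (f xx g)" "src (f xx g) = src f ox src g" "tgt (f xx g) = tgt f ox tgt g"
 using arr_ten0[OF assms] by simp_all

lemma obj_ten [simp]: "X \<in> Obj C ==> Y \<in> Obj C ==> X ox Y \<in> Obj C" by (rule tenO_obj)
lemma obj_unit [simp]: "Unit C \<in> Obj C" by (rule unit_obj)

lemma assoc [simp]: "[|arr f; arr g; arr h; tgt f = src g; tgt g = src h|] ==> (h oo g) oo f = h oo (g oo f)"
 by (rule comp_assoc[of "src f" "tgt f" "tgt g" "tgt h"]) (auto intro: arr_hom' )

lemma id_left [simp]: "arr f ==> tgt f = Y ==> Ident C Y oo f = f"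
 by (rule ident_left[of "src f"]) (auto intro: arr_hom' )

lemma id_right [simp]: "arr f ==> src f = X ==> f oo Ident C X = f"
 by (rule ident_right[of _ "tgt f"]) (auto intro: arr_hom' )

lemma id_ten: "X \<in> Obj C ==> Y \<in> Obj C ==> Ident C X xx Ident C Y = Ident C (X ox Y)"
 by (rule tenA_ident)

lemma interchange: "[|arr f; arr f'; arr g; arr g'; tgt f = src f'; tgt g = src g'|] ==>
 (f' xx g') oo (f xx g) = (f' oo f) xx (g' oo g)"
 by (rule tenA_comp[symmetric, of "src f" "tgt f" "tgt f'" "src g" "tgt g" "tgt g'"]) (auto intro: arr_hom' )

lemma interchange_comp: "[|arr f; arr f'; arr g; arr g'; tgt f = src f'; tgt g = src g'; arr h; tgt h = src f ox src g|] ==>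
 (f' xx g') oo (f xx g) oo h = ((f' oo f) xx (g' oo g)) oo h"
 by (subst assoc[symmetric]) (simp_all add: interchange)

lemma comp_cong_left: "[|p oo q = p' oo q'; arr p; arr q; arr p'; arr q'; arr h; tgt q = src p; tgt q' = src p'; tgt h = src q; src q = src q'|] ==>
  p oo q oo h = p' oo q' oo h"
 by (metis assoc)

lemma inverse_arrows_unique:
 assumes "inverse_arrows C X Y f g" "inverse_arrows C X Y f g'" "X \<in> Obj C" "Y \<in> Obj C"
 shows "g = g'"
proof -
 note a = assms[unfolded inverse_arrows_def]
 have t: "arr f" "src f = X" "tgt f = Y" "arr g" "src g = Y" "tgt g = X" "arr g'" "src g' = Y" "tgt g' = X"
  using a homD by blast+
 have "g = (g' oo f) oo g" using a t by simp
 also have "... = g' oo (f oo g)" using t by simp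
 also have "... = g'" using a t by simp
 finally show ?thesis .
qed

lemma inv_arrow_eq:
 assumes "inverse_arrows C X Y f g" "X \<in> Obj C" "Y \<in> Obj C"
 shows "inv_arrow C X Y f = g"
 unfolding inv_arrow_def using assms inverse_arrows_unique by (intro the_equality) auto

lemma iso_arrowD:
 assumes "iso_arrow C X Y f" "X \<in> Obj C" "Y \<in> Obj C"
 shows "arr f" "src f = X" "tgt f = Y" "arr (inv_arrow C X Y f)" "src (inv_arrow C X Y f) = Y" "tgt (inv_arrow C X Y f) = X"
  "inv_arrow C X Y f oo f = Ident C X" "f oo inv_arrow C X Y f = Ident C Y"
proof -
 obtain g where g: "inverse_arrows C X Y f g" using assms(1) by (auto simp: iso_arrow_def)
 note e = inv_arrow_eq[OF g assms(2,3)]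
 note a = g[unfolded inverse_arrows_def]
 show "arr f" "src f = X" "tgt f = Y" "arr (inv_arrow C X Y f)" "src (inv_arrow C X Y f) = Y" "tgt (inv_arrow C X Y f) = X"
  using a homD assms unfolding e by blast+
 show "inv_arrow C X Y f oo f = Ident C X" "f oo inv_arrow C X Y f = Ident C Y" using a unfolding e by auto
qed

lemma inverse_inv_arrow:
 assumes "iso_arrow C X Y f" "X \<in> Obj C" "Y \<in> Obj C"
 shows "inverse_arrows C Y X (inv_arrow C X Y f) f" "iso_arrow C Y X (inv_arrow C X Y f)" "inv_arrow C Y X (inv_arrow C X Y f) = f"
proof -
 show 1: "inverse_arrows C Y X (inv_arrow C X Y f) f"
  using iso_arrowD[OF assms] assms(2,3) unfolding inverse_arrows_def by (metis arr_hom)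
 then show "iso_arrow C Y X (inv_arrow C X Y f)" "inv_arrow C Y X (inv_arrow C X Y f) = f"
  using inv_arrow_eq assms unfolding iso_arrow_def by blast+
qed

lemma inv_comp [simp]:
 assumes "iso_arrow C X Y f" "X \<in> Obj C" "Y \<in> Obj C" "arr h"
 shows "tgt h = X ==> inv_arrow C X Y f oo f oo h = h" "tgt h = Y ==> f oo inv_arrow C X Y f oo h = h"
proof -
 note i = iso_arrowD[OF assms(1-3)]
 show "tgt h = X ==> inv_arrow C X Y f oo f oo h = h"
  by (subst assoc[symmetric]) (simp_all add: i assms)
 show "tgt h = Y ==> f oo inv_arrow C X Y f oo h = h"
  by (subst assoc[symmetric]) (simp_all add: i assms)
qed

lemma iso_mono:
 assumes "iso_arrow C X Y f" "X \<in> Obj C" "Y \<in> Obj C" "arr g" "arr h" "tgt g = X" "tgt h = X" "f oo g = f oo h"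
 shows "g = h"
 using inv_comp(1)[OF assms(1-3)] assms(4-) by metis

lemma iso_epi:
 assumes "iso_arrow C X Y f" "X \<in> Obj C" "Y \<in> Obj C" "arr g" "arr h" "src g = Y" "src h = Y" "g oo f = h oo f"
 shows "g = h"
proof -
 note i = iso_arrowD[OF assms(1-3)]
 have "g = (g oo f) oo inv_arrow C X Y f" using i assms(4,6) by simp
 also have "... = (h oo f) oo inv_arrow C X Y f" by (simp only: assms(8))
 also have "... = h" using i assms(5,7) by simp
 finally show ?thesis .
qed

lemma iso_ident: "X \<in> Obj C ==> iso_arrow C X X (Ident C X)"
 unfolding iso_arrow_def inverse_arrows_def using hom_iff by (intro exI[of _ "Ident C X"]) auto

lemma iso_comp:
 assumes "iso_arrow C X Y f" "iso_arrow C Y Z g" "X \<in> Obj C" "Y \<in> Obj C" "Z \<in> Obj C"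
 shows "iso_arrow C X Z (g oo f)"
 unfolding iso_arrow_def inverse_arrows_def
 using iso_arrowD[OF assms(1,3,4)] iso_arrowD[OF assms(2,4,5)] assms
 by (intro exI[of _ "inv_arrow C X Y f oo inv_arrow C Y Z g"]) (auto simp: hom_iff)

lemma iso_ten:
 assumes "iso_arrow C X Y f" "iso_arrow C X' Y' g" "X \<in> Obj C" "Y \<in> Obj C" "X' \<in> Obj C" "Y' \<in> Obj C"
 shows "iso_arrow C (X ox X') (Y ox Y') (f xx g)"
 unfolding iso_arrow_def inverse_arrows_def
 using iso_arrowD[OF assms(1,3,4)] iso_arrowD[OF assms(2,5,6)] assms
 by (intro exI[of _ "inv_arrow C X Y f xx inv_arrow C X' Y' g"]) (auto simp: hom_iff interchange id_ten)

lemma arr_assoc [simp]: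
 assumes "X \<in> Obj C" "Y \<in> Obj C" "Z \<in> Obj C"
 shows "arr (Assoc C X Y Z)" "src (Assoc C X Y Z) = (X ox Y) ox Z" "tgt (Assoc C X Y Z) = X ox Y ox Z"
 using iso_arrowD[OF assoc_iso[OF assms]] assms by auto

abbreviation Assoc' where "Assoc' X Y Z \<equiv> inv_arrow C ((X ox Y) ox Z) (X ox (Y ox Z)) (Assoc C X Y Z)"

lemma arr_assoc' [simp]:
 assumes "X \<in> Obj C" "Y \<in> Obj C" "Z \<in> Obj C"
 shows "arr (Assoc' X Y Z)" "tgt (Assoc' X Y Z) = (X ox Y) ox Z" "src (Assoc' X Y Z) = X ox Y ox Z"
  "Assoc C X Y Z oo Assoc' X Y Z = Ident C (X ox Y ox Z)" "Assoc' X Y Z oo Assoc C X Y Z = Ident C ((X ox Y) ox Z)"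
 using iso_arrowD[OF assoc_iso[OF assms]] assms by auto

lemma arr_lunit [simp]:
 assumes "X \<in> Obj C"
 shows "arr (LUnit C X)" "src (LUnit C X) = Unit C ox X" "tgt (LUnit C X) = X"
 using iso_arrowD[OF lunit_iso[OF assms]] assms by auto

lemma arr_runit [simp]:
 assumes "X \<in> Obj C"
 shows "arr (RUnit C X)" "src (RUnit C X) = X ox Unit C" "tgt (RUnit C X) = X"
 using iso_arrowD[OF runit_iso[OF assms]] assms by auto

lemma assoc_nat: "[|arr f; arr g; arr h; src f = X; src g = Y; src h = Z; tgt f = X'; tgt g = Y'; tgt h = Z'|]
   ==> Assoc C X' Y' Z' oo ((f xx g) xx h) = (f xx (g xx h)) oo Assoc C X Y Z"
 by (rule assoc_natural) (auto intro: arr_hom' )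

lemma inv_assoc_nat:
 assumes "arr f" "arr g" "arr h" "src f = X" "src g = Y" "src h = Z" "tgt f = X'" "tgt g = Y'" "tgt h = Z'"
 shows "Assoc' X' Y' Z' oo (f xx (g xx h)) = ((f xx g) xx h) oo Assoc' X Y Z"
proof -
 have o: "X \<in> Obj C" "Y \<in> Obj C" "Z \<in> Obj C" "X' \<in> Obj C" "Y' \<in> Obj C" "Z' \<in> Obj C" using assms by auto
 have "Assoc' X' Y' Z' oo (f xx (g xx h)) = Assoc' X' Y' Z' oo ((f xx (g xx h)) oo Assoc C X Y Z) oo Assoc' X Y Z"
  using assms o by simp
 also have "... = Assoc' X' Y' Z' oo (Assoc C X' Y' Z' oo ((f xx g) xx h)) oo Assoc' X Y Z"
  using assms by (simp only: assoc_nat)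
 also have "... = ((f xx g) xx h) oo Assoc' X Y Z"
  using assms o by (simp add: inv_comp[OF assoc_iso])
 finally show ?thesis .
qed

end

locale braided_monoidal_category_st = braided_monoidal_category C + monoidal_category_st C src tgt
 for C :: "('o, 'a, 'z) brcat_scheme" (structure) and src tgt :: "'a \<Rightarrow> 'o"
begin

lemma arr_braid [simp]:
 assumes "X \<in> Obj C" "Y \<in> Obj C"
 shows "arr (Braid C X Y)" "src (Braid C X Y) = X ox Y" "tgt (Braid C X Y) = Y ox X"
 using iso_arrowD[OF braid_iso[OF assms]] assms by auto

lemma braid_nat: "[|arr f; arr g; src f = X; src g = Y; tgt f = X'; tgt g = Y'|]
   ==> Braid C X' Y' oo (f xx g) = (g xx f) oo Braid C X Y"
 by (rule braid_natural) (auto intro: arr_hom' )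

lemma arr_mid_swap [simp]:
 assumes "X \<in> Obj C" "Y \<in> Obj C" "Z \<in> Obj C" "W \<in> Obj C"
 shows "arr (mid_swap C X Y Z W)" "src (mid_swap C X Y Z W) = (X ox Y) ox (Z ox W)" "tgt (mid_swap C X Y Z W) = (X ox Z) ox (Y ox W)"
 using assms by (simp_all add: mid_swap_def)

lemma mid_swap_nat:
 assumes "arr f" "arr g" "arr h" "arr l" "src f = X" "src g = Y" "src h = Z" "src l = W" "tgt f = X'" "tgt g = Y'" "tgt h = Z'" "tgt l = W'"
 shows "mid_swap C X' Y' Z' W' oo ((f xx g) xx (h xx l)) = ((f xx h) xx (g xx l)) oo mid_swap C X Y Z W"
proof -
 have o: "X \<in> Obj C" "Y \<in> Obj C" "Z \<in> Obj C" "X' \<in> Obj C" "Y' \<in> Obj C" "Z' \<in> Obj C" "W \<in> Obj C" "W' \<in> Obj C" using assms by auto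
 define I where "I Y Z W = Assoc C Z Y W oo (Braid C Y Z xx Ident C W) oo Assoc' Y Z W" for Y Z W
 have I [simp]: "arr (I Y Z W)" "src (I Y Z W) = Y ox (Z ox W)" "tgt (I Y Z W) = Z ox (Y ox W)"
  if "Y \<in> Obj C" "Z \<in> Obj C" "W \<in> Obj C" for Y Z W
  using that by (simp_all add: I_def)
 have "I Y' Z' W' oo (g xx (h xx l)) = Assoc C Z' Y' W' oo (Braid C Y' Z' xx Ident C W') oo ((g xx h) xx l) oo Assoc' Y Z W"
  unfolding I_def using assms o by (simp add: inv_assoc_nat)
 also have "... = Assoc C Z' Y' W' oo ((h xx g) xx l) oo (Braid C Y Z xx Ident C W) oo Assoc' Y Z W"
  using assms o by (simp add: interchange_comp braid_nat)
 also have "... = (h xx (g xx l)) oo I Y Z W"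
  unfolding I_def using assms o by (subst comp_cong_left[OF assoc_nat]) simp_all
 finally have I_nat: "I Y' Z' W' oo (g xx (h xx l)) = (h xx (g xx l)) oo I Y Z W" .
 have m: "mid_swap C X Y Z W = Assoc' X Z (Y ox W) oo (Ident C X xx I Y Z W) oo Assoc C X Y (Z ox W)" for X Y Z W
  by (simp add: mid_swap_def I_def)
 have "mid_swap C X' Y' Z' W' oo ((f xx g) xx (h xx l)) =
   Assoc' X' Z' (Y' ox W') oo (Ident C X' xx I Y' Z' W') oo (f xx (g xx (h xx l))) oo Assoc C X Y (Z ox W)"
  unfolding m using assms o by (simp add: assoc_nat)
 also have "... = Assoc' X' Z' (Y' ox W') oo (f xx (h xx (g xx l))) oo (Ident C X xx I Y Z W) oo Assoc C X Y (Z ox W)"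
  using assms o by (simp add: interchange_comp I_nat)
 also have "... = ((f xx h) xx (g xx l)) oo mid_swap C X Y Z W"
  unfolding m using assms o by (subst comp_cong_left[OF inv_assoc_nat]) simp_all
 finally show ?thesis .
qed

end

section \<open>Two monoidal structures on one category\<close>

text \<open>\<open>C\<close> and \<open>D\<close> share their objects and arrows and \<open>F\<close> is the identity on both; what differs is the
 tensor product, compared by the isomorphisms \<open>\<xi>\<close>. By the last assumption the braiding of \<open>D\<close> is
 the one that \<open>\<xi>\<close> carries over from \<open>C\<close>, and therefore the hexagons of \<open>D\<close> are consequences.\<close>
locale twist = monoidal_functor C D F + C: braided_monoidal_category_st C src tgt + D: monoidal_category_st D src tgt
 for C :: "('o, 'a, 'y) brcat_scheme" (structure) and D :: "('o, 'a, 'z) brcat_scheme"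
  and F :: "('o, 'a, 'o, 'a, 'w) mon_fun_scheme" and src tgt :: "'a \<Rightarrow> 'o" +
 assumes same: "Obj D = Obj C" "Hom D = Hom C" "Ident D = Ident C" "Comp D = Comp C"
  and identity: "FO F = (%X. X)" "FA F = (%f. f)"
  and braidD_hom: "[|X \<in> Obj C; Y \<in> Obj C|] ==> Braid D X Y \<in> Hom C (X ox\<^bsub>D\<^esub> Y) (Y ox\<^bsub>D\<^esub> X)"
  and xi_braid: "[|X \<in> Obj C; Y \<in> Obj C|] ==> Braid C X Y oo FXi F X Y = FXi F Y X oo Braid D X Y"
begin

abbreviation tenOD (infixr \<open>oD\<close> 70) where "X oD Y \<equiv> TenO D X Y"
abbreviation tenAD (infixr \<open>xD\<close> 70) where "f xD g \<equiv> TenA D f g"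
abbreviation xi (\<open>\<xi>\<close>) where "\<xi> X Y \<equiv> FXi F X Y"
abbreviation eta (\<open>\<eta>\<close>) where "\<eta> \<equiv> FEta F"

lemma D_arr [simp]: "D.arr = C.arr"
 by (intro ext) (simp only: C.arr_def D.arr_def same)

lemma D_iso [simp]: "inverse_arrows D = inverse_arrows C" "iso_arrow D = iso_arrow C" "inv_arrow D = inv_arrow C"
 by (intro ext; simp add: inverse_arrows_def iso_arrow_def inv_arrow_def same)+

lemmas D_simps [simp] = D.arr_ten[unfolded same D_arr] D.obj_ten[unfolded same] D.obj_unit[unfolded same]
 D.arr_assoc[unfolded same D_arr] D.arr_assoc'[unfolded same D_arr D_iso] D.arr_lunit[unfolded same D_arr]
 D.arr_runit[unfolded same D_arr]
lemmas D_interchange = D.interchange[unfolded same D_arr]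
lemmas D_interchange_comp = D.interchange_comp[unfolded same D_arr]
lemmas D_id_ten = D.id_ten[unfolded same]
lemmas D_assoc_nat = D.assoc_nat[unfolded same D_arr]
lemmas D_inv_assoc_nat = D.inv_assoc_nat[unfolded same D_arr D_iso]
lemmas D_assoc_iso = D.assoc_iso[unfolded same D_iso]
lemmas D_lunit_natural = D.lunit_natural[unfolded same]
lemmas D_iso_ten = D.iso_ten[unfolded same D_iso]

lemma obj [simp]: "Obj D = Obj C" by (rule same)

lemmas xi_iso' = xi_iso[unfolded identity D_iso]
lemmas eta_iso' = eta_iso[unfolded identity D_iso]

abbreviation xi' (\<open>\<xi>''\<close>) where "\<xi>' X Y \<equiv> inv_arrow C (X oD Y) (X ox Y) (\<xi> X Y)"
abbreviation eta' (\<open>\<eta>''\<close>) where "\<eta>' \<equiv> inv_arrow C (Unit D) (Unit C) \<eta>"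

lemma arr_xi [simp]:
 assumes "X \<in> Obj C" "Y \<in> Obj C"
 shows "C.arr (\<xi> X Y)" "src (\<xi> X Y) = X oD Y" "tgt (\<xi> X Y) = X ox Y"
  "C.arr (\<xi>' X Y)" "src (\<xi>' X Y) = X ox Y" "tgt (\<xi>' X Y) = X oD Y"
  "\<xi>' X Y oo \<xi> X Y = Ident C (X oD Y)" "\<xi> X Y oo \<xi>' X Y = Ident C (X ox Y)"
 using C.iso_arrowD[OF xi_iso'[OF assms]] assms by auto

lemma arr_eta [simp]:
 "C.arr \<eta>" "src \<eta> = Unit D" "tgt \<eta> = Unit C" "C.arr \<eta>'" "src \<eta>' = Unit C" "tgt \<eta>' = Unit D"
  "\<eta>' oo \<eta> = Ident C (Unit D)" "\<eta> oo \<eta>' = Ident C (Unit C)"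
 using C.iso_arrowD[OF eta_iso'] by auto

lemma xi_inv_comp [simp]:
 assumes "X \<in> Obj C" "Y \<in> Obj C" "C.arr h"
 shows "tgt h = X oD Y ==> \<xi>' X Y oo \<xi> X Y oo h = h" "tgt h = X ox Y ==> \<xi> X Y oo \<xi>' X Y oo h = h"
 using C.inv_comp[OF xi_iso'] assms by auto

lemma eta_inv_comp [simp]:
 assumes "C.arr h"
 shows "tgt h = Unit D ==> \<eta>' oo \<eta> oo h = h" "tgt h = Unit C ==> \<eta> oo \<eta>' oo h = h"
 using C.inv_comp[OF eta_iso'] assms by auto

lemma xi_nat:
 assumes "C.arr f" "C.arr g" "src f = X" "src g = Y" "tgt f = X'" "tgt g = Y'"
 shows "\<xi> X' Y' oo (f xD g) = (f xx g) oo \<xi> X Y"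
 using xi_natural[of X X' Y Y' f g] assms by (auto simp: identity same C.arr_hom')

lemma xi_nat_comp:
 assumes "C.arr f" "C.arr g" "src f = X" "src g = Y" "tgt f = X'" "tgt g = Y'" "C.arr h" "tgt h = X oD Y"
 shows "\<xi> X' Y' oo (f xD g) oo h = (f xx g) oo \<xi> X Y oo h"
 by (rule C.comp_cong_left[OF xi_nat[OF assms(1-6)]]) (use assms in auto)

lemma xi_inv_nat:
 assumes "C.arr f" "C.arr g" "src f = X" "src g = Y" "tgt f = X'" "tgt g = Y'"
 shows "\<xi>' X' Y' oo (f xx g) = (f xD g) oo \<xi>' X Y"
proof -
 have o: "X \<in> Obj C" "Y \<in> Obj C" "X' \<in> Obj C" "Y' \<in> Obj C" using assms by auto
 have "\<xi>' X' Y' oo (f xx g) = \<xi>' X' Y' oo ((f xx g) oo \<xi> X Y) oo \<xi>' X Y" using assms o by simp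
 also have "... = (f xD g) oo \<xi>' X Y" unfolding xi_nat[OF assms, symmetric] using assms o by simp
 finally show ?thesis .
qed

definition Th where "Th X Y Z = \<xi> X (Y ox Z) oo (Ident C X xD \<xi> Y Z)"
definition La where "La X Y Z = \<xi> (X ox Y) Z oo (\<xi> X Y xD Ident C Z)"
definition Om where "Om X Y Z W = \<xi> (X ox Y) (Z ox W) oo (\<xi> X Y xD \<xi> Z W)"

lemma arr_Th [simp]:
 assumes "X \<in> Obj C" "Y \<in> Obj C" "Z \<in> Obj C"
 shows "C.arr (Th X Y Z)" "src (Th X Y Z) = X oD Y oD Z" "tgt (Th X Y Z) = X ox Y ox Z"
  "C.arr (La X Y Z)" "src (La X Y Z) = (X oD Y) oD Z" "tgt (La X Y Z) = (X ox Y) ox Z"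
 using assms by (simp_all add: Th_def La_def)

lemma arr_Om [simp]:
 assumes "X \<in> Obj C" "Y \<in> Obj C" "Z \<in> Obj C" "W \<in> Obj C"
 shows "C.arr (Om X Y Z W)" "src (Om X Y Z W) = (X oD Y) oD (Z oD W)" "tgt (Om X Y Z W) = (X ox Y) ox (Z ox W)"
 using assms by (simp_all add: Om_def)

lemma Th_iso:
 assumes "X \<in> Obj C" "Y \<in> Obj C" "Z \<in> Obj C"
 shows "iso_arrow C (X oD Y oD Z) (X ox Y ox Z) (Th X Y Z)"
 unfolding Th_def using assms
 by (intro C.iso_comp[OF D_iso_ten[OF C.iso_ident xi_iso'] xi_iso']) auto

lemma La_iso:
 assumes "X \<in> Obj C" "Y \<in> Obj C" "Z \<in> Obj C"
 shows "iso_arrow C ((X oD Y) oD Z) ((X ox Y) ox Z) (La X Y Z)"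
 unfolding La_def using assms
 by (intro C.iso_comp[OF D_iso_ten[OF xi_iso' C.iso_ident] xi_iso']) auto

lemma Om_iso:
 assumes "X \<in> Obj C" "Y \<in> Obj C" "Z \<in> Obj C" "W \<in> Obj C"
 shows "iso_arrow C ((X oD Y) oD (Z oD W)) ((X ox Y) ox (Z ox W)) (Om X Y Z W)"
 unfolding Om_def using assms
 by (intro C.iso_comp[OF D_iso_ten[OF xi_iso' xi_iso'] xi_iso']) auto

lemma La_assoc:
 assumes "X \<in> Obj C" "Y \<in> Obj C" "Z \<in> Obj C"
 shows "Assoc C X Y Z oo La X Y Z = Th X Y Z oo Assoc D X Y Z"
 using xi_assoc[OF assms] assms unfolding La_def Th_def by (simp add: identity same)

lemma La_assoc_inv:
 assumes "X \<in> Obj C" "Y \<in> Obj C" "Z \<in> Obj C"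
 shows "La X Y Z oo D.Assoc' X Y Z = C.Assoc' X Y Z oo Th X Y Z"
proof -
 have "La X Y Z oo D.Assoc' X Y Z = C.Assoc' X Y Z oo (Assoc C X Y Z oo La X Y Z) oo D.Assoc' X Y Z"
  using assms by (simp add: C.inv_comp[OF C.assoc_iso])
 also have "... = C.Assoc' X Y Z oo Th X Y Z" unfolding La_assoc[OF assms] using assms by simp
 finally show ?thesis .
qed

lemma Th_nat:
 assumes "C.arr f" "C.arr g" "C.arr h" "src f = X" "src g = Y" "src h = Z" "tgt f = X'" "tgt g = Y'" "tgt h = Z'"
 shows "Th X' Y' Z' oo (f xD g xD h) = (f xx g xx h) oo Th X Y Z"
proof -
 have o: "X \<in> Obj C" "Y \<in> Obj C" "X' \<in> Obj C" "Y' \<in> Obj C" "Z \<in> Obj C" "Z' \<in> Obj C" using assms by auto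
 have e: "\<xi> Y' Z' oo (g xD h) = (g xx h) oo \<xi> Y Z" by (rule xi_nat) (use assms in simp_all)
 have "Th X' Y' Z' oo (f xD g xD h) = \<xi> X' (Y' ox Z') oo (f xD ((g xx h) oo \<xi> Y Z))"
  unfolding Th_def using assms o by (simp add: D_interchange e)
 also have "... = \<xi> X' (Y' ox Z') oo (f xD (g xx h)) oo (Ident C X xD \<xi> Y Z)"
  using assms o by (simp add: D_interchange)
 also have "... = (f xx g xx h) oo Th X Y Z"
  unfolding Th_def using assms o by (simp add: xi_nat_comp)
 finally show ?thesis .
qed

lemma arr_braidD [simp]:
 assumes "X \<in> Obj C" "Y \<in> Obj C"
 shows "C.arr (Braid D X Y)" "src (Braid D X Y) = X oD Y" "tgt (Braid D X Y) = Y oD X"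
 using C.homD[OF braidD_hom[OF assms]] assms by auto

lemma braidD_eq:
 assumes "X \<in> Obj C" "Y \<in> Obj C"
 shows "Braid D X Y = \<xi>' Y X oo Braid C X Y oo \<xi> X Y"
 using xi_braid[OF assms] assms by simp

lemma braidD_iso:
 assumes "X \<in> Obj C" "Y \<in> Obj C"
 shows "iso_arrow C (X oD Y) (Y oD X) (Braid D X Y)"
 unfolding braidD_eq[OF assms] using assms
 by (intro C.iso_comp[OF C.iso_comp[OF xi_iso' C.braid_iso] C.inverse_inv_arrow(2)[OF xi_iso']]) auto

lemma braidD_nat:
 assumes "C.arr f" "C.arr g" "src f = X" "src g = Y" "tgt f = X'" "tgt g = Y'"
 shows "Braid D X' Y' oo (f xD g) = (g xD f) oo Braid D X Y"
proof -
 have o: "X \<in> Obj C" "Y \<in> Obj C" "X' \<in> Obj C" "Y' \<in> Obj C" using assms by auto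
 have "Braid D X' Y' oo (f xD g) = \<xi>' Y' X' oo (Braid C X' Y' oo (f xx g)) oo \<xi> X Y"
  using assms o by (simp add: braidD_eq xi_nat)
 also have "... = (\<xi>' Y' X' oo (g xx f)) oo Braid C X Y oo \<xi> X Y"
  unfolding C.braid_nat[OF assms] using assms o by simp
 also have "... = (g xD f) oo Braid D X Y"
  unfolding xi_inv_nat[OF assms(2,1,4,3,6,5)] using assms o by (simp add: braidD_eq)
 finally show ?thesis .
qed

lemma La_braid:
 assumes "X \<in> Obj C" "Y \<in> Obj C" "Z \<in> Obj C"
 shows "La Y X Z oo (Braid D X Y xD Ident C Z) = (Braid C X Y xx Ident C Z) oo La X Y Z"
proof -
 have "La Y X Z oo (Braid D X Y xD Ident C Z) = \<xi> (Y ox X) Z oo ((Braid C X Y oo \<xi> X Y) xD (Ident C Z oo Ident C Z))"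
  unfolding La_def xi_braid[OF assms(1,2)] using assms by (simp add: D_interchange)
 also have "... = \<xi> (Y ox X) Z oo (Braid C X Y xD Ident C Z) oo (\<xi> X Y xD Ident C Z)"
  using assms by (subst D_interchange) simp_all
 also have "... = (Braid C X Y xx Ident C Z) oo La X Y Z"
  unfolding La_def using assms by (simp add: xi_nat_comp)
 finally show ?thesis .
qed

lemma Th_braid:
 assumes "X \<in> Obj C" "Y \<in> Obj C" "Z \<in> Obj C"
 shows "Th X Z Y oo (Ident C X xD Braid D Y Z) = (Ident C X xx Braid C Y Z) oo Th X Y Z"
proof -
 have "Th X Z Y oo (Ident C X xD Braid D Y Z) = \<xi> X (Z ox Y) oo ((Ident C X oo Ident C X) xD (Braid C Y Z oo \<xi> Y Z))"
  unfolding Th_def xi_braid[OF assms(2,3)] using assms by (simp add: D_interchange)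
 also have "... = \<xi> X (Z ox Y) oo (Ident C X xD Braid C Y Z) oo (Ident C X xD \<xi> Y Z)"
  using assms by (subst D_interchange) simp_all
 also have "... = (Ident C X xx Braid C Y Z) oo Th X Y Z"
  unfolding Th_def using assms by (simp add: xi_nat_comp)
 finally show ?thesis .
qed

lemma xi_braid_comp:
 assumes "X \<in> Obj C" "Y \<in> Obj C" "C.arr h" "tgt h = X oD Y"
 shows "\<xi> Y X oo Braid D X Y oo h = Braid C X Y oo \<xi> X Y oo h"
 by (rule C.comp_cong_left[OF xi_braid[OF assms(1,2), symmetric]]) (use assms in auto)

lemma La_braid_Th:
 assumes "X \<in> Obj C" "Y \<in> Obj C" "Z \<in> Obj C"
 shows "La Y Z X oo Braid D X (Y oD Z) = Braid C X (Y ox Z) oo Th X Y Z"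
proof -
 have "La Y Z X oo Braid D X (Y oD Z) = \<xi> (Y ox Z) X oo Braid D X (Y ox Z) oo (Ident C X xD \<xi> Y Z)"
  unfolding La_def using assms by (simp add: braidD_nat)
 also have "... = Braid C X (Y ox Z) oo Th X Y Z"
  unfolding Th_def using assms by (simp add: xi_braid_comp)
 finally show ?thesis .
qed

lemma Th_braid_La:
 assumes "X \<in> Obj C" "Y \<in> Obj C" "Z \<in> Obj C"
 shows "Th Z X Y oo Braid D (X oD Y) Z = Braid C (X ox Y) Z oo La X Y Z"
proof -
 have "Th Z X Y oo Braid D (X oD Y) Z = \<xi> Z (X ox Y) oo Braid D (X ox Y) Z oo (\<xi> X Y xD Ident C Z)"
  unfolding Th_def using assms by (simp add: braidD_nat)
 also have "... = Braid C (X ox Y) Z oo La X Y Z"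
  unfolding La_def using assms by (simp add: xi_braid_comp)
 finally show ?thesis .
qed

lemma hexagon1_D:
 assumes "X \<in> Obj C" "Y \<in> Obj C" "Z \<in> Obj C"
 shows "Assoc D Y Z X oo Braid D X (Y oD Z) oo Assoc D X Y Z
     = (Ident C Y xD Braid D X Z) oo Assoc D Y X Z oo (Braid D X Y xD Ident C Z)"
proof (rule C.iso_mono[OF Th_iso[of Y Z X]])
 have "Th Y Z X oo Assoc D Y Z X oo Braid D X (Y oD Z) oo Assoc D X Y Z =
  ((Th Y Z X oo Assoc D Y Z X) oo Braid D X (Y oD Z)) oo Assoc D X Y Z" using assms by simp
 also have "... = (Assoc C Y Z X oo (La Y Z X oo Braid D X (Y oD Z))) oo Assoc D X Y Z"
  unfolding La_assoc[OF assms(2,3,1), symmetric] using assms by simp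
 also have "... = Assoc C Y Z X oo Braid C X (Y ox Z) oo (Th X Y Z oo Assoc D X Y Z)"
  unfolding La_braid_Th[OF assms] using assms by simp
 also have "... = (Assoc C Y Z X oo Braid C X (Y ox Z) oo Assoc C X Y Z) oo La X Y Z"
  unfolding La_assoc[OF assms, symmetric] using assms by simp
 also have "... = (Ident C Y xx Braid C X Z) oo Assoc C Y X Z oo ((Braid C X Y xx Ident C Z) oo La X Y Z)"
  unfolding C.hexagon1[OF assms] using assms by simp
 also have "... = (Ident C Y xx Braid C X Z) oo (Assoc C Y X Z oo La Y X Z) oo (Braid D X Y xD Ident C Z)"
  unfolding La_braid[OF assms, symmetric] using assms by simp
 also have "... = ((Ident C Y xx Braid C X Z) oo Th Y X Z) oo Assoc D Y X Z oo (Braid D X Y xD Ident C Z)"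
  unfolding La_assoc[OF assms(2,1,3)] using assms by simp
 also have "... = Th Y Z X oo (Ident C Y xD Braid D X Z) oo Assoc D Y X Z oo (Braid D X Y xD Ident C Z)"
  unfolding Th_braid[OF assms(2,1,3), symmetric] using assms by simp
 finally show "Th Y Z X oo Assoc D Y Z X oo Braid D X (Y oD Z) oo Assoc D X Y Z =
  Th Y Z X oo (Ident C Y xD Braid D X Z) oo Assoc D Y X Z oo (Braid D X Y xD Ident C Z)" .
qed (use assms in simp_all)

lemma hexagon2_D:
 assumes "X \<in> Obj C" "Y \<in> Obj C" "Z \<in> Obj C"
 shows "Braid D (X oD Y) Z = Assoc D Z X Y oo (Braid D X Z xD Ident C Y) oo D.Assoc' X Z Y
      oo (Ident C X xD Braid D Y Z) oo Assoc D X Y Z"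
proof (rule C.iso_mono[OF Th_iso[of Z X Y]])
 let ?b = "Braid C X Z xx Ident C Y" and ?b' = "Braid D X Z xD Ident C Y"
 let ?c = "Ident C X xx Braid C Y Z" and ?c' = "Ident C X xD Braid D Y Z"
 have "Th Z X Y oo Braid D (X oD Y) Z = Braid C (X ox Y) Z oo La X Y Z" by (rule Th_braid_La[OF assms])
 also have "... = (Assoc C Z X Y oo ?b oo C.Assoc' X Z Y oo ?c oo Assoc C X Y Z) oo La X Y Z"
  by (simp only: C.hexagon2[OF assms])
 also have "... = Assoc C Z X Y oo ?b oo C.Assoc' X Z Y oo ?c oo (Assoc C X Y Z oo La X Y Z)"
  using assms by simp
 also have "... = Assoc C Z X Y oo ?b oo C.Assoc' X Z Y oo (?c oo Th X Y Z) oo Assoc D X Y Z"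
  unfolding La_assoc[OF assms] using assms by simp
 also have "... = Assoc C Z X Y oo ?b oo (C.Assoc' X Z Y oo Th X Z Y) oo ?c' oo Assoc D X Y Z"
  unfolding Th_braid[OF assms, symmetric] using assms by simp
 also have "... = Assoc C Z X Y oo (?b oo La X Z Y) oo D.Assoc' X Z Y oo ?c' oo Assoc D X Y Z"
  unfolding La_assoc_inv[OF assms(1,3,2), symmetric] using assms by simp
 also have "... = (Assoc C Z X Y oo La Z X Y) oo ?b' oo D.Assoc' X Z Y oo ?c' oo Assoc D X Y Z"
  unfolding La_braid[OF assms(1,3,2), symmetric] using assms by simp
 also have "... = Th Z X Y oo Assoc D Z X Y oo ?b' oo D.Assoc' X Z Y oo ?c' oo Assoc D X Y Z"
  unfolding La_assoc[OF assms(3,1,2)] using assms by simp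
 finally show "Th Z X Y oo Braid D (X oD Y) Z = Th Z X Y oo Assoc D Z X Y oo ?b' oo D.Assoc' X Z Y oo ?c' oo Assoc D X Y Z" .
qed (use assms in simp_all)

text \<open>Precomposition with isomorphisms built from \<open>\<xi>\<close> reduces the hexagons of \<open>D\<close> to those of \<open>C\<close>.\<close>
lemma braided_D: "braided_monoidal_category D"
proof
 fix X Y assume "X \<in> Obj D" "Y \<in> Obj D"
 then show "iso_arrow D (X oD Y) (Y oD X) (Braid D X Y)" using braidD_iso by simp
next
 fix X X' Y Y' f g assume a: "X \<in> Obj D" "X' \<in> Obj D" "Y \<in> Obj D" "Y' \<in> Obj D" "f \<in> Hom D X X'" "g \<in> Hom D Y Y'"
 then show "Braid D X' Y' oo\<^bsub>D\<^esub> f xD g = (g xD f) oo\<^bsub>D\<^esub> Braid D X Y"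
  using C.homD[of f X X'] C.homD[of g Y Y'] by (simp add: same braidD_nat)
next
 fix X Y Z assume "X \<in> Obj D" "Y \<in> Obj D" "Z \<in> Obj D"
 then have a: "X \<in> Obj C" "Y \<in> Obj C" "Z \<in> Obj C" by simp_all
 show "Assoc D Y Z X oo\<^bsub>D\<^esub> Braid D X (Y oD Z) oo\<^bsub>D\<^esub> Assoc D X Y Z =
  (Ident D Y xD Braid D X Z) oo\<^bsub>D\<^esub> Assoc D Y X Z oo\<^bsub>D\<^esub> (Braid D X Y xD Ident D Z)"
  using hexagon1_D[OF a] by (simp only: same)
 show "Braid D (X oD Y) Z = Assoc D Z X Y oo\<^bsub>D\<^esub> (Braid D X Z xD Ident D Y) oo\<^bsub>D\<^esub> inv_arrow D ((X oD Z) oD Y) (X oD Z oD Y) (Assoc D X Z Y) oo\<^bsub>D\<^esub>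
    (Ident D X xD Braid D Y Z) oo\<^bsub>D\<^esub> Assoc D X Y Z"
  using hexagon2_D[OF a] by (simp only: same D_iso)
qed

end

sublocale twist \<subseteq> D: braided_monoidal_category_st D src tgt
 by (rule braided_monoidal_category_st.intro[OF braided_D D.monoidal_category_st_axioms])

section \<open>Categories of modules and of Hopf algebras\<close>

lemma equivalence_functorI:
 fixes G :: "('o2, 'a2, 'o1, 'a1) cat_fun"
 assumes F: "cat_functor C D F" and G: "cat_functor D C G"
  and "!!X. X \<in> Obj C ==> FO G (FO F X) = X" "!!X Y f. X \<in> Obj C ==> Y \<in> Obj C ==> f \<in> Hom C X Y ==> FA G (FA F f) = f"
  and "!!X. X \<in> Obj D ==> FO F (FO G X) = X" "!!X Y f. X \<in> Obj D ==> Y \<in> Obj D ==> f \<in> Hom D X Y ==> FA F (FA G f) = f"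
 shows "equivalence_functor C D F"
proof -
 interpret F: cat_functor C D F by (rule F)
 interpret G: cat_functor D C G by (rule G)
 have i: "X \<in> Obj C ==> iso_arrow C X X (Ident C X)" for X
  unfolding iso_arrow_def inverse_arrows_def using F.C.ident_hom F.C.ident_left by blast
 have i': "X \<in> Obj D ==> iso_arrow D X X (Ident D X)" for X
  unfolding iso_arrow_def inverse_arrows_def using F.D.ident_hom F.D.ident_left by blast
 have "naturally_isomorphic C C (comp_functor G F) id_functor"
  unfolding naturally_isomorphic_def comp_functor_def id_functor_def
  using assms(3,4) i F.C.ident_left F.C.ident_right by (intro exI[of _ "Ident C"]) auto
 moreover have "naturally_isomorphic D D (comp_functor F G) id_functor"
  unfolding naturally_isomorphic_def comp_functor_def id_functor_def
  using assms(5,6) i' F.D.ident_left F.D.ident_right by (intro exI[of _ "Ident D"]) auto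
 ultimately show ?thesis unfolding equivalence_functor_def using F G by blast
qed

context braided_monoidal_category_st
begin

lemma algebra_typ:
 assumes "algebra_in C A"
 shows "aobj A \<in> Obj C" "arr (amul A)" "src (amul A) = aobj A ox aobj A" "tgt (amul A) = aobj A"
  "arr (aone A)" "src (aone A) = Unit C" "tgt (aone A) = aobj A"
 using assms homD[of "amul A"] homD[of "aone A"] unfolding algebra_in_def by auto

lemma algebra_eq:
 assumes "algebra_in C A"
 shows "amul A oo (amul A xx Ident C (aobj A))
    = amul A oo (Ident C (aobj A) xx amul A) oo Assoc C (aobj A) (aobj A) (aobj A)"
   "amul A oo (aone A xx Ident C (aobj A)) = LUnit C (aobj A)"
   "amul A oo (Ident C (aobj A) xx aone A) = RUnit C (aobj A)"
 using assms unfolding algebra_in_def by auto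

lemma coalgebra_typ:
 assumes "coalgebra_in C A"
 shows "aobj A \<in> Obj C" "arr (acomul A)" "tgt (acomul A) = aobj A ox aobj A" "src (acomul A) = aobj A"
  "arr (acounit A)" "tgt (acounit A) = Unit C" "src (acounit A) = aobj A"
 using assms homD[of "acomul A"] homD[of "acounit A"] unfolding coalgebra_in_def by auto

lemma coalgebra_eq:
 assumes "coalgebra_in C A"
 shows "Assoc C (aobj A) (aobj A) (aobj A) oo (acomul A xx Ident C (aobj A)) oo acomul A
    = (Ident C (aobj A) xx acomul A) oo acomul A"
   "LUnit C (aobj A) oo (acounit A xx Ident C (aobj A)) oo acomul A = Ident C (aobj A)"
   "RUnit C (aobj A) oo (Ident C (aobj A) xx acounit A) oo acomul A = Ident C (aobj A)"
 using assms unfolding coalgebra_in_def by auto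

lemma module_typ:
 assumes "module_in C A P" "aobj A \<in> Obj C"
 shows "fst P \<in> Obj C" "arr (snd P)" "src (snd P) = aobj A ox fst P" "tgt (snd P) = fst P"
 using assms homD[of "snd P"] unfolding module_in_def by (auto split: prod.splits)

lemma module_eq:
 assumes "module_in C A P" "aobj A \<in> Obj C"
 shows "snd P oo (amul A xx Ident C (fst P)) = snd P oo (Ident C (aobj A) xx snd P) oo Assoc C (aobj A) (aobj A) (fst P)"
  "snd P oo (aone A xx Ident C (fst P)) = LUnit C (fst P)"
 using assms homD[of "snd P"] unfolding module_in_def by (auto split: prod.splits)

lemma module_inI:
 assumes "aobj A \<in> Obj C" "fst P \<in> Obj C" "arr (snd P)" "src (snd P) = aobj A ox fst P" "tgt (snd P) = fst P"
  "snd P oo (amul A xx Ident C (fst P)) = snd P oo (Ident C (aobj A) xx snd P) oo Assoc C (aobj A) (aobj A) (fst P)"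
  "snd P oo (aone A xx Ident C (fst P)) = LUnit C (fst P)"
 shows "module_in C A P"
 using assms arr_hom' unfolding module_in_def by (auto split: prod.splits)

lemma module_maps_iff:
 assumes "fst P \<in> Obj C" "fst Q \<in> Obj C"
 shows "f \<in> module_maps C A P Q \<longleftrightarrow> arr f \<and> src f = fst P \<and> tgt f = fst Q \<and> f oo snd P = snd Q oo (Ident C (aobj A) xx f)"
 using assms hom_iff unfolding module_maps_def by blast

lemma module_mapsD:
 assumes "f \<in> module_maps C A P Q" "fst P \<in> Obj C" "fst Q \<in> Obj C"
 shows "arr f" "src f = fst P" "tgt f = fst Q"
 using assms module_maps_iff by blast+

lemma module_maps_eq: "f \<in> module_maps C A P Q ==> f oo snd P = snd Q oo (Ident C (aobj A) xx f)"
 by (simp add: module_maps_def)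

context
 fixes A :: "('o, 'a) hopf_in"
 assumes A: "algebra_in C A"
begin

lemma module_maps_id:
 assumes "module_in C A P"
 shows "Ident C (fst P) \<in> module_maps C A P P"
 using module_typ[OF assms algebra_typ(1)[OF A]] algebra_typ(1)[OF A] by (simp add: module_maps_iff id_ten)

lemma module_maps_comp:
 assumes "module_in C A P" "module_in C A Q" "module_in C A R" "f \<in> module_maps C A P Q" "g \<in> module_maps C A Q R"
 shows "g oo f \<in> module_maps C A P R"
proof -
 note m = module_typ[OF assms(1) algebra_typ(1)[OF A]] module_typ[OF assms(2) algebra_typ(1)[OF A]] module_typ[OF assms(3) algebra_typ(1)[OF A]] algebra_typ(1)[OF A]
 note f = module_mapsD[OF assms(4) m(1,5)] and g = module_mapsD[OF assms(5) m(5,9)]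
 note fe = module_maps_eq[OF assms(4)] and ge = module_maps_eq[OF assms(5)]
 let ?I = "Ident C (aobj A)"
 have "(g oo f) oo snd P = g oo (f oo snd P)" using f g m by simp
 also have "... = (g oo snd Q) oo (?I xx f)" unfolding fe using f g m by simp
 also have "... = (snd R oo (?I xx g)) oo (?I xx f)" by (simp only: ge)
 also have "... = snd R oo (?I xx (g oo f))" using f g m by (simp add: interchange)
 finally show ?thesis using f g m by (simp add: module_maps_iff)
qed

lemma module_maps_inverse:
 assumes "module_in C A P" "module_in C A Q" "f \<in> module_maps C A P Q" "iso_arrow C (fst P) (fst Q) f"
 shows "inv_arrow C (fst P) (fst Q) f \<in> module_maps C A Q P"
proof -
 note m = module_typ[OF assms(1) algebra_typ(1)[OF A]] module_typ[OF assms(2) algebra_typ(1)[OF A]] algebra_typ(1)[OF A]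
 note f = module_mapsD[OF assms(3) m(1,5)] and fe = module_maps_eq[OF assms(3)]
 define g where "g = inv_arrow C (fst P) (fst Q) f"
 note i = iso_arrowD[OF assms(4) m(1,5)] inv_comp[OF assms(4) m(1,5)]
 let ?I = "Ident C (aobj A)"
 have "g oo snd Q = g oo snd Q oo (?I xx f) oo (?I xx g)" using i m by (simp add: interchange id_ten g_def)
 also have "... = g oo (snd Q oo (?I xx f)) oo (?I xx g)" using i m by (simp add: g_def)
 also have "... = g oo (f oo snd P) oo (?I xx g)" by (simp only: fe)
 also have "... = snd P oo (?I xx g)" using i m by (simp add: g_def)
 finally show ?thesis using i m by (simp add: module_maps_iff g_def)
qed

lemma module_in_iso:
 assumes P: "module_in C A P" and f: "iso_arrow C X (fst P) f" and X: "X \<in> Obj C"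
  and t: "arr t" "src t = aobj A ox X" "tgt t = X" and ft: "f oo t = snd P oo (Ident C (aobj A) xx f)"
 shows "module_in C A (X, t)"
proof -
 note a = algebra_typ[OF A]
 note m = module_typ[OF P a(1)] and me = module_eq[OF P a(1)]
 note i = iso_arrowD[OF f X m(1)]
 let ?I = "Ident C (aobj A)"
 have ft': "f oo t oo h = snd P oo (?I xx f) oo h" if "arr h" "tgt h = aobj A ox X" for h
  by (rule comp_cong_left[OF ft]) (use that a m i X t in simp_all)
 show ?thesis
 proof (rule module_inI, simp_all add: a X t)
  show "t oo (amul A xx Ident C X) = t oo (?I xx t) oo Assoc C (aobj A) (aobj A) X"
  proof (rule iso_mono[OF f X m(1)])
   have "f oo t oo (amul A xx Ident C X) = (snd P oo (amul A xx Ident C (fst P))) oo (Ident C (aobj A ox aobj A) xx f)"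
    using a m i X t by (simp add: ft' interchange)
   also have "... = snd P oo (?I xx snd P) oo (Assoc C (aobj A) (aobj A) (fst P) oo ((?I xx ?I) xx f))"
    unfolding me(1) using a m i X t by (simp add: id_ten)
   also have "... = snd P oo (?I xx (snd P oo (?I xx f))) oo Assoc C (aobj A) (aobj A) X"
    using a m i X t by (simp add: assoc_nat[where X="aobj A" and Y="aobj A" and Z=X] interchange_comp)
   also have "... = snd P oo (?I xx (f oo t)) oo Assoc C (aobj A) (aobj A) X"
    by (simp only: ft)
   also have "... = f oo t oo (?I xx t) oo Assoc C (aobj A) (aobj A) X"
    using a m i X t by (simp add: ft' interchange_comp)
   finally show "f oo t oo (amul A xx Ident C X) = f oo t oo (?I xx t) oo Assoc C (aobj A) (aobj A) X" .
  qed (use a m i X t in simp_all)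
  show "t oo (aone A xx Ident C X) = LUnit C X"
  proof (rule iso_mono[OF f X m(1)])
   have "f oo t oo (aone A xx Ident C X) = (snd P oo (aone A xx Ident C (fst P))) oo (Ident C (Unit C) xx f)"
    using a m i X t by (simp add: ft' interchange)
   also have "... = f oo LUnit C X"
    unfolding me(2) using lunit_natural[of X "fst P" f] i X m by (simp add: hom_iff)
   finally show "f oo t oo (aone A xx Ident C X) = f oo LUnit C X" .
  qed (use a m i X t in simp_all)
 qed
qed

end

lemma mc_simps:
 "Obj (module_cat C A) = {P. module_in C A P}" "Hom (module_cat C A) = module_maps C A"
 "Ident (module_cat C A) P = Ident C (fst P)" "Comp (module_cat C A) = Comp C" "TenA (module_cat C A) = TenA C"
 "Assoc (module_cat C A) P Q R = Assoc C (fst P) (fst Q) (fst R)"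
 "LUnit (module_cat C A) P = LUnit C (fst P)" "RUnit (module_cat C A) P = RUnit C (fst P)"
 "TenO (module_cat C A) P Q = (fst P ox fst Q, ((snd P xx snd Q) oo mid_swap C (aobj A) (aobj A) (fst P) (fst Q)) oo (acomul A xx Ident C (fst P ox fst Q)))"
 "Unit (module_cat C A) = (Unit C, LUnit C (Unit C) oo (acounit A xx Ident C (Unit C)))"
 by (simp_all add: module_cat_def braided_tensor_action_def)

context
 fixes A :: "('o, 'a) hopf_in"
 assumes A: "algebra_in C A" and A': "coalgebra_in C A"
begin

lemma ten_module_arr:
 assumes "module_in C A P" "module_in C A Q"
 shows "fst (TenO (module_cat C A) P Q) = fst P ox fst Q" "arr (snd (TenO (module_cat C A) P Q))"
  "src (snd (TenO (module_cat C A) P Q)) = aobj A ox (fst P ox fst Q)" "tgt (snd (TenO (module_cat C A) P Q)) = fst P ox fst Q"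
  "snd (TenO (module_cat C A) P Q) = (snd P xx snd Q) oo mid_swap C (aobj A) (aobj A) (fst P) (fst Q) oo (acomul A xx Ident C (fst P ox fst Q))"
 using module_typ[OF assms(1) algebra_typ(1)[OF A]] module_typ[OF assms(2) algebra_typ(1)[OF A]] coalgebra_typ[OF A']
 by (simp_all add: mc_simps)

lemma module_maps_ten:
 assumes "module_in C A P" "module_in C A Q" "module_in C A P'" "module_in C A Q'" "f \<in> module_maps C A P P'" "g \<in> module_maps C A Q Q'"
 shows "f xx g \<in> module_maps C A (TenO (module_cat C A) P Q) (TenO (module_cat C A) P' Q')"
proof -
 note a = coalgebra_typ[OF A']
 note P = module_typ[OF assms(1) a(1)] and Q = module_typ[OF assms(2) a(1)]
 note P' = module_typ[OF assms(3) a(1)] and Q' = module_typ[OF assms(4) a(1)]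
 note f = module_mapsD[OF assms(5) P(1) P'(1)] and g = module_mapsD[OF assms(6) Q(1) Q'(1)]
 note fe = module_maps_eq[OF assms(5)] and ge = module_maps_eq[OF assms(6)]
 note t = ten_module_arr[OF assms(1,2)] and t' = ten_module_arr[OF assms(3,4)]
 let ?I = "Ident C (aobj A)" let ?A = "aobj A"
 have "(f xx g) oo snd (TenO (module_cat C A) P Q) = ((f oo snd P) xx (g oo snd Q)) oo mid_swap C ?A ?A (fst P) (fst Q) oo (acomul A xx Ident C (fst P ox fst Q))"
  unfolding t(5) using a P Q P' Q' f g
  by (simp add: interchange_comp)
 also have "... = ((snd P' oo (?I xx f)) xx (snd Q' oo (?I xx g))) oo mid_swap C ?A ?A (fst P) (fst Q) oo (acomul A xx Ident C (fst P ox fst Q))"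
  by (simp only: fe ge)
 also have "... = (snd P' xx snd Q') oo (((?I xx f) xx (?I xx g)) oo mid_swap C ?A ?A (fst P) (fst Q)) oo (acomul A xx Ident C (fst P ox fst Q))"
  using a P Q P' Q' f g by (simp add: interchange_comp)
 also have "((?I xx f) xx (?I xx g)) oo mid_swap C ?A ?A (fst P) (fst Q) = mid_swap C ?A ?A (fst P') (fst Q') oo ((?I xx ?I) xx (f xx g))"
  by (rule mid_swap_nat[symmetric]) (use a P Q P' Q' f g in simp_all)
 also have "(snd P' xx snd Q') oo (mid_swap C ?A ?A (fst P') (fst Q') oo ((?I xx ?I) xx (f xx g))) oo (acomul A xx Ident C (fst P ox fst Q))
   = snd (TenO (module_cat C A) P' Q') oo (?I xx (f xx g))"
  unfolding t'(5) using a P Q P' Q' f g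
  by (simp add: interchange id_ten)
 finally show ?thesis
  using a P Q P' Q' f g t(1-4) t'(1-4) by (subst module_maps_iff) simp_all
qed

lemma module_cat_category: "category (module_cat C A)"
 unfolding category_def mc_simps mem_Collect_eq
proof (intro conjI allI impI)
 note a = algebra_typ[OF A]
 have H: "f \<in> module_maps C A P Q ==> module_in C A P ==> module_in C A Q ==> arr f \<and> src f = fst P \<and> tgt f = fst Q" for f P Q
  using module_maps_iff module_typ(1)[OF _ a(1)] by blast
 fix P Q R f g assume PQ: "module_in C A P" "module_in C A Q" and f: "f \<in> module_maps C A P Q"
 show "Ident C (fst Q) oo f = f" "f oo Ident C (fst P) = f" using H[OF f PQ] by simp_all
 fix S h assume R: "module_in C A R" "module_in C A S" and g: "g \<in> module_maps C A Q R" and h: "h \<in> module_maps C A R S"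
 show "(h oo g) oo f = h oo g oo f" using H[OF f PQ] H[OF g PQ(2) R(1)] H[OF h R] by simp
qed (auto intro: module_maps_id[OF A] module_maps_comp[OF A])

lemma module_iso_arrowI:
 assumes "module_in C A P" "module_in C A Q" "f \<in> module_maps C A P Q" "iso_arrow C (fst P) (fst Q) f"
 shows "iso_arrow (module_cat C A) P Q f"
proof -
 note i = iso_arrowD[OF assms(4) module_typ(1)[OF assms(1) algebra_typ(1)[OF A]] module_typ(1)[OF assms(2) algebra_typ(1)[OF A]]]
 show ?thesis unfolding iso_arrow_def inverse_arrows_def mc_simps
  using module_maps_inverse[OF A assms] i assms by (intro exI[of _ "inv_arrow C (fst P) (fst Q) f"]) auto
qed

text \<open>Naturality and coherence are inherited from \<open>C\<close>. What depends on the Hopf algebra is that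
 tensor products and the unit are modules and that the structure maps are module maps.\<close>
lemma module_cat_monoidalI:
 assumes ten: "!!P Q. module_in C A P ==> module_in C A Q ==> module_in C A (TenO (module_cat C A) P Q)"
  and unit: "module_in C A (Unit (module_cat C A))"
  and assoc: "!!P Q R. module_in C A P ==> module_in C A Q ==> module_in C A R ==> Assoc C (fst P) (fst Q) (fst R) \<in>
    module_maps C A (TenO (module_cat C A) (TenO (module_cat C A) P Q) R) (TenO (module_cat C A) P (TenO (module_cat C A) Q R))"
  and lunit: "!!P. module_in C A P ==> LUnit C (fst P) \<in> module_maps C A (TenO (module_cat C A) (Unit (module_cat C A)) P) P"
  and runit: "!!P. module_in C A P ==> RUnit C (fst P) \<in> module_maps C A (TenO (module_cat C A) P (Unit (module_cat C A))) P"
 shows "monoidal_category (module_cat C A)"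
proof -
 let ?M = "module_cat C A"
 interpret M: category ?M by (rule module_cat_category)
 have H: "f \<in> module_maps C A P Q ==> module_in C A P ==> module_in C A Q ==> f \<in> Hom C (fst P) (fst Q) \<and> fst P \<in> Obj C \<and> fst Q \<in> Obj C" for f P Q
  using module_typ(1)[OF _ algebra_typ(1)[OF A]] by (auto simp: module_maps_def)
 have O: "module_in C A P ==> fst P \<in> Obj C" for P
  using module_typ(1)[OF _ algebra_typ(1)[OF A]] by blast
 have T: "fst (TenO ?M P Q) = fst P ox fst Q" "fst (Unit ?M) = Unit C" for P Q by (simp_all add: mc_simps)
 note s = mc_simps(1-8)
 show ?thesis
 proof (unfold_locales, unfold s mem_Collect_eq T)
  fix P Q P' Q' f g assume "module_in C A P" "module_in C A P'" "module_in C A Q" "module_in C A Q'"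
   "f \<in> module_maps C A P P'" "g \<in> module_maps C A Q Q'"
  then show "f xx g \<in> module_maps C A (TenO ?M P Q) (TenO ?M P' Q')" by (intro module_maps_ten)
 next
  fix P Q assume PQ: "module_in C A P" "module_in C A Q"
  then show "module_in C A (TenO ?M P Q)" by (rule ten)
  show "Ident C (fst P) xx Ident C (fst Q) = Ident C (fst P ox fst Q)" using PQ O by (intro tenA_ident)
  show "(Ident C (fst P) xx LUnit C (fst Q)) oo Assoc C (fst P) (Unit C) (fst Q) = RUnit C (fst P) xx Ident C (fst Q)"
   using PQ O by (intro triangle)
 next
  show "module_in C A (Unit ?M)" by (rule unit)
 next
  fix X X' X'' Y Y' Y'' f f' g g'
  assume a: "module_in C A X" "module_in C A X'" "module_in C A X''" "module_in C A Y" "module_in C A Y'" "module_in C A Y''"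
   "f \<in> module_maps C A X X'" "f' \<in> module_maps C A X' X''" "g \<in> module_maps C A Y Y'" "g' \<in> module_maps C A Y' Y''"
  then show "(f' oo f) xx (g' oo g) = (f' xx g') oo (f xx g)"
   using H O by (intro tenA_comp[of "fst X" "fst X'" "fst X''" "fst Y" "fst Y'" "fst Y''"]) blast+
 next
  fix P Q R assume PQ: "module_in C A P" "module_in C A Q" "module_in C A R"
  show "iso_arrow ?M (TenO ?M (TenO ?M P Q) R) (TenO ?M P (TenO ?M Q R)) (Assoc C (fst P) (fst Q) (fst R))"
   by (rule module_iso_arrowI) (use PQ O ten assoc assoc_iso in \<open>simp_all add: T\<close>)
 next
  fix X X' Y Y' Z Z' f g h
  assume a: "module_in C A X" "module_in C A X'" "module_in C A Y" "module_in C A Y'" "module_in C A Z" "module_in C A Z'"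
   "f \<in> module_maps C A X X'" "g \<in> module_maps C A Y Y'" "h \<in> module_maps C A Z Z'"
  then show "Assoc C (fst X') (fst Y') (fst Z') oo ((f xx g) xx h) = (f xx g xx h) oo Assoc C (fst X) (fst Y) (fst Z)"
   using H O by (intro assoc_natural) blast+
 next
  fix P assume P: "module_in C A P"
  show "iso_arrow ?M (TenO ?M (Unit ?M) P) P (LUnit C (fst P))"
   by (rule module_iso_arrowI) (use P O ten unit lunit lunit_iso in \<open>simp_all add: T\<close>)
  show "iso_arrow ?M (TenO ?M P (Unit ?M)) P (RUnit C (fst P))"
   by (rule module_iso_arrowI) (use P O ten unit runit runit_iso in \<open>simp_all add: T\<close>)
 next
  fix X Y f assume a: "module_in C A X" "module_in C A Y" "f \<in> module_maps C A X Y"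
  show "LUnit C (fst Y) oo (Ident C (Unit C) xx f) = f oo LUnit C (fst X)" using a H O by (intro lunit_natural) blast+
  show "RUnit C (fst Y) oo (f xx Ident C (Unit C)) = f oo RUnit C (fst X)" using a H O by (intro runit_natural) blast+
 next
  fix W X Y Z assume a: "module_in C A W" "module_in C A X" "module_in C A Y" "module_in C A Z"
  show "(Ident C (fst W) xx Assoc C (fst X) (fst Y) (fst Z)) oo Assoc C (fst W) (fst X ox fst Y) (fst Z) oo (Assoc C (fst W) (fst X) (fst Y) xx Ident C (fst Z))
     = Assoc C (fst W) (fst X) (fst Y ox fst Z) oo Assoc C (fst W ox fst X) (fst Y) (fst Z)"
   using a O by (intro pentagon)
 qed
qed

end

lemma hopf_cat_category: "category (hopf_cat C)"
proof -
 have H: "algebra_map C A B f \<and> coalgebra_map C A B f \<longleftrightarrow> arr f \<and> src f = aobj A \<and> tgt f = aobj B \<and>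
   f oo amul A = amul B oo (f xx f) \<and> f oo aone A = aone B \<and> acomul B oo f = (f xx f) oo acomul A \<and> acounit B oo f = acounit A"
  if "braided_hopf_algebra C A" "braided_hopf_algebra C B" for A B f
  using hom_iff[OF algebra_typ(1)[OF braided_hopf_algebra.algebra[OF that(1)]] algebra_typ(1)[OF braided_hopf_algebra.algebra[OF that(2)]], of f]
  unfolding algebra_map_def coalgebra_map_def by blast
 note al = algebra_typ[OF braided_hopf_algebra.algebra] and co = coalgebra_typ[OF braided_hopf_algebra.coalgebra]
 show ?thesis
  unfolding category_def hopf_cat_def cat.simps mem_Collect_eq
 proof (intro conjI allI impI)
  fix A assume A: "braided_hopf_algebra C A"
  have "algebra_map C A A (Ident C (aobj A)) \<and> coalgebra_map C A A (Ident C (aobj A))"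
   unfolding H[OF A A] using al[OF A] co[OF A] by (simp add: id_ten)
  then show "algebra_map C A A (Ident C (aobj A))" "coalgebra_map C A A (Ident C (aobj A))" by blast+
 next
  fix A B f assume A: "braided_hopf_algebra C A" "braided_hopf_algebra C B" "algebra_map C A B f \<and> coalgebra_map C A B f"
  then show "Ident C (aobj B) oo f = f" "f oo Ident C (aobj A) = f" using H[OF A(1,2)] by simp_all
 next
  fix A B E f g assume A: "braided_hopf_algebra C A" "braided_hopf_algebra C B" "braided_hopf_algebra C E"
   and "algebra_map C A B f \<and> coalgebra_map C A B f" "algebra_map C B E g \<and> coalgebra_map C B E g"
  then have f: "arr f" "src f = aobj A" "tgt f = aobj B" "f oo amul A = amul B oo (f xx f)" "f oo aone A = aone B"
     "acomul B oo f = (f xx f) oo acomul A" "acounit B oo f = acounit A"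
   and g: "arr g" "src g = aobj B" "tgt g = aobj E" "g oo amul B = amul E oo (g xx g)" "g oo aone B = aone E"
     "acomul E oo g = (g xx g) oo acomul B" "acounit E oo g = acounit B"
   using H by simp_all
  note t = al[OF A(1)] al[OF A(2)] al[OF A(3)] co[OF A(1)] co[OF A(2)] co[OF A(3)]
  have 1: "(g oo f) oo amul A = amul E oo ((g oo f) xx (g oo f))"
  proof -
   have "(g oo f) oo amul A = g oo (f oo amul A)" using f(1-3) g(1-3) t by simp
   also have "... = (g oo amul B) oo (f xx f)" unfolding f(4) using f(1-3) g(1-3) t by simp
   also have "... = amul E oo ((g oo f) xx (g oo f))" unfolding g(4) using f(1-3) g(1-3) t by (simp add: interchange)
   finally show ?thesis .
  qed
  have 2: "(g oo f) oo aone A = aone E"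
   using f(1-3,5) g(1-3,5) t by simp
  have 3: "acomul E oo (g oo f) = ((g oo f) xx (g oo f)) oo acomul A"
  proof -
   have "acomul E oo (g oo f) = (acomul E oo g) oo f" using f(1-3) g(1-3) t by simp
   also have "... = (g xx g) oo (acomul B oo f)" unfolding g(6) using f(1-3) g(1-3) t by simp
   also have "... = ((g oo f) xx (g oo f)) oo acomul A" unfolding f(6) using f(1-3) g(1-3) t by (simp add: interchange_comp)
   finally show ?thesis .
  qed
  have 4: "acounit E oo (g oo f) = acounit A"
  proof -
   have "acounit E oo (g oo f) = (acounit E oo g) oo f" using f(1-3) g(1-3) t by simp
   then show ?thesis using f(7) g(7) by simp
  qed
  have "algebra_map C A E (g oo f) \<and> coalgebra_map C A E (g oo f)"
   unfolding H[OF A(1,3)] using 1 2 3 4 f(1-3) g(1-3) by simp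
  then show "algebra_map C A E (g oo f)" "coalgebra_map C A E (g oo f)" by blast+
  fix L h assume L: "braided_hopf_algebra C L" and h: "algebra_map C E L h \<and> coalgebra_map C E L h"
  show "(h oo g) oo f = h oo g oo f" using H[OF A(3) L, of h] h f(1-3) g(1-3) by simp
 qed
qed

end

section \<open>Transport of Hopf algebras and modules\<close>

context twist
begin

lemma Th_assoc_comp:
 assumes "X \<in> Obj C" "Y \<in> Obj C" "Z \<in> Obj C" "C.arr h" "tgt h = (X oD Y) oD Z"
 shows "Assoc C X Y Z oo La X Y Z oo h = Th X Y Z oo Assoc D X Y Z oo h"
 by (rule C.comp_cong_left[OF La_assoc]) (use assms in simp_all)

definition Ph where "Ph X Y Z W = \<xi> X (Y ox Z ox W) oo (Ident C X xD Th Y Z W)"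

lemma arr_Ph [simp]:
 assumes "X \<in> Obj C" "Y \<in> Obj C" "Z \<in> Obj C" "W \<in> Obj C"
 shows "C.arr (Ph X Y Z W)" "src (Ph X Y Z W) = X oD Y oD Z oD W" "tgt (Ph X Y Z W) = X ox Y ox Z ox W"
 using assms by (simp_all add: Ph_def)

lemma Om_assoc:
 assumes "X \<in> Obj C" "Y \<in> Obj C" "Z \<in> Obj C" "W \<in> Obj C"
 shows "Assoc C X Y (Z ox W) oo Om X Y Z W = Ph X Y Z W oo Assoc D X Y (Z oD W)"
proof -
 have "Assoc C X Y (Z ox W) oo Om X Y Z W = Assoc C X Y (Z ox W) oo La X Y (Z ox W) oo ((Ident C X xD Ident C Y) xD \<xi> Z W)"
  unfolding Om_def La_def using assms by (simp add: D_interchange D_id_ten)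
 also have "... = Th X Y (Z ox W) oo (Assoc D X Y (Z ox W) oo ((Ident C X xD Ident C Y) xD \<xi> Z W))"
  using assms by (simp add: Th_assoc_comp)
 also have "Assoc D X Y (Z ox W) oo ((Ident C X xD Ident C Y) xD \<xi> Z W) = (Ident C X xD Ident C Y xD \<xi> Z W) oo Assoc D X Y (Z oD W)"
  by (rule D_assoc_nat) (use assms in simp_all)
 also have "Th X Y (Z ox W) oo (Ident C X xD Ident C Y xD \<xi> Z W) oo Assoc D X Y (Z oD W) = Ph X Y Z W oo Assoc D X Y (Z oD W)"
  unfolding Ph_def Th_def using assms by (simp add: D_interchange_comp)
 finally show ?thesis .
qed

lemma Om_assoc_inv:
 assumes "X \<in> Obj C" "Y \<in> Obj C" "Z \<in> Obj C" "W \<in> Obj C"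
 shows "Om X Y Z W oo D.Assoc' X Y (Z oD W) = C.Assoc' X Y (Z ox W) oo Ph X Y Z W"
proof -
 have "Om X Y Z W oo D.Assoc' X Y (Z oD W) = C.Assoc' X Y (Z ox W) oo (Assoc C X Y (Z ox W) oo Om X Y Z W) oo D.Assoc' X Y (Z oD W)"
  using assms by (simp add: C.inv_comp[OF C.assoc_iso])
 also have "... = C.Assoc' X Y (Z ox W) oo Ph X Y Z W" unfolding Om_assoc[OF assms] using assms by simp
 finally show ?thesis .
qed

text \<open>The interchange of the two middle factors is the only ingredient of a braided tensor product
 besides the tensor product itself, so this lemma carries over both the algebra \<open>A \<otimes>\<^sup>b A\<close> and
 its action on a tensor product of modules.\<close>
lemma Om_mid_swap:
 assumes o: "X \<in> Obj C" "Y \<in> Obj C" "Z \<in> Obj C" "W \<in> Obj C"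
 shows "Om X Z Y W oo mid_swap D X Y Z W = mid_swap C X Y Z W oo Om X Y Z W"
proof -
 define I where "I = Assoc C Z Y W oo (Braid C Y Z xx Ident C W) oo C.Assoc' Y Z W"
 define J where "J = Assoc D Z Y W oo (Braid D Y Z xD Ident C W) oo D.Assoc' Y Z W"
 have I [simp]: "C.arr I" "src I = Y ox Z ox W" "tgt I = Z ox Y ox W" using o by (simp_all add: I_def)
 have J [simp]: "C.arr J" "src J = Y oD Z oD W" "tgt J = Z oD Y oD W" using o by (simp_all add: J_def)
 have "Th Z Y W oo J = (Th Z Y W oo Assoc D Z Y W) oo (Braid D Y Z xD Ident C W) oo D.Assoc' Y Z W"
  unfolding J_def using o by simp
 also have "... = Assoc C Z Y W oo (La Z Y W oo (Braid D Y Z xD Ident C W)) oo D.Assoc' Y Z W"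
  unfolding La_assoc[OF o(3,2,4), symmetric] using o by simp
 also have "... = Assoc C Z Y W oo (Braid C Y Z xx Ident C W) oo (La Y Z W oo D.Assoc' Y Z W)"
  unfolding La_braid[OF o(2,3,4)] using o by simp
 also have "... = I oo Th Y Z W" unfolding La_assoc_inv[OF o(2,3,4)] I_def using o by simp
 finally have IJ: "Th Z Y W oo J = I oo Th Y Z W" .
 have c: "mid_swap C X Y Z W = C.Assoc' X Z (Y ox W) oo (Ident C X xx I) oo Assoc C X Y (Z ox W)"
  by (simp add: mid_swap_def I_def)
 have d: "mid_swap D X Y Z W = D.Assoc' X Z (Y oD W) oo (Ident C X xD J) oo Assoc D X Y (Z oD W)"
  by (simp add: mid_swap_def J_def same)
 have "Om X Z Y W oo mid_swap D X Y Z W = (Om X Z Y W oo D.Assoc' X Z (Y oD W)) oo (Ident C X xD J) oo Assoc D X Y (Z oD W)"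
  unfolding d using o by simp
 also have "... = C.Assoc' X Z (Y ox W) oo (\<xi> X (Z ox Y ox W) oo (Ident C X xD (Th Z Y W oo J))) oo Assoc D X Y (Z oD W)"
  unfolding Om_assoc_inv[OF o(1,3,2,4)] Ph_def using o by (simp add: D_interchange_comp)
 also have "... = C.Assoc' X Z (Y ox W) oo (\<xi> X (Z ox Y ox W) oo (Ident C X xD I) oo (Ident C X xD Th Y Z W)) oo Assoc D X Y (Z oD W)"
  unfolding IJ using o by (simp add: D_interchange)
 also have "... = C.Assoc' X Z (Y ox W) oo (Ident C X xx I) oo (Ph X Y Z W oo Assoc D X Y (Z oD W))"
  unfolding Ph_def using o by (simp add: xi_nat_comp)
 also have "... = mid_swap C X Y Z W oo Om X Y Z W"
  unfolding Om_assoc[OF o, symmetric] c using o by simp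
 finally show ?thesis .
qed

lemma arr_mid_swap_D [simp]:
 assumes "X \<in> Obj C" "Y \<in> Obj C" "Z \<in> Obj C" "W \<in> Obj C"
 shows "C.arr (mid_swap D X Y Z W)" "src (mid_swap D X Y Z W) = (X oD Y) oD (Z oD W)" "tgt (mid_swap D X Y Z W) = (X oD Z) oD (Y oD W)"
 using D.arr_mid_swap assms by simp_all

lemma xi_eta_lunit:
 "LUnit C (Unit C) oo \<xi> (Unit C) (Unit C) oo (\<eta> xD \<eta>) = \<eta> oo LUnit D (Unit D)"
proof -
 have "LUnit C (Unit C) oo \<xi> (Unit C) (Unit C) oo (\<eta> xD \<eta>) =
  (LUnit C (Unit C) oo \<xi> (Unit C) (Unit C) oo (\<eta> xD Ident C (Unit C))) oo (Ident C (Unit D) xD \<eta>)"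
  by (simp add: D_interchange)
 also have "... = LUnit D (Unit C) oo (Ident C (Unit D) xD \<eta>)"
  using xi_lunit[of "Unit C"] by (simp add: identity same)
 also have "... = \<eta> oo LUnit D (Unit D)"
  using D_lunit_natural[of "Unit D" "Unit C" \<eta>] C.arr_hom'[OF arr_eta(1-3)] D.unit_obj by (simp add: same)
 finally show ?thesis .
qed

lemma xi_lunit': "X \<in> Obj C ==> LUnit C X oo \<xi> (Unit C) X oo (\<eta> xD Ident C X) = LUnit D X"
 and xi_runit': "X \<in> Obj C ==> RUnit C X oo \<xi> X (Unit C) oo (Ident C X xD \<eta>) = RUnit D X"
 using xi_lunit xi_runit by (simp_all add: identity same)

abbreviation "T \<equiv> transport_hopf C D F"

lemma T_simps [simp]: "aobj (T A) = aobj A" "amul (T A) = amul A oo \<xi> (aobj A) (aobj A)" "aone (T A) = aone A oo \<eta>"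
 "acomul (T A) = \<xi>' (aobj A) (aobj A) oo acomul A" "acounit (T A) = \<eta>' oo acounit A" "aantip (T A) = aantip A"
 by (simp_all add: transport_hopf_def identity same)

definition Tm where "Tm A P = (fst P, snd P oo \<xi> (aobj A) (fst P))"

lemma Tm_simps [simp]: "fst (Tm A P) = fst P" "snd (Tm A P) = snd P oo \<xi> (aobj A) (fst P)"
 by (simp_all add: Tm_def)

lemma module_T:
 assumes A: "algebra_in C A" and P: "module_in C A P"
 shows "module_in D (T A) (Tm A P)"
proof (rule D.module_inI, unfold same D_arr T_simps Tm_simps)
 note a = C.algebra_typ[OF A] note m = C.module_typ[OF P a(1)] and me = C.module_eq[OF P a(1)]
 let ?A = "aobj A" let ?M = "fst P" let ?t = "snd P"
 show "?A \<in> Obj C" "?M \<in> Obj C" "C.arr (?t oo \<xi> ?A ?M)" "src (?t oo \<xi> ?A ?M) = ?A oD ?M" "tgt (?t oo \<xi> ?A ?M) = ?M"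
  using a m by simp_all
 have "(?t oo \<xi> ?A ?M) oo ((amul A oo \<xi> ?A ?A) xD Ident C ?M) = ?t oo \<xi> ?A ?M oo (amul A xD Ident C ?M) oo (\<xi> ?A ?A xD Ident C ?M)"
  using a m by (simp add: D_interchange)
 also have "... = (?t oo (amul A xx Ident C ?M)) oo La ?A ?A ?M"
  unfolding La_def using a m by (simp add: xi_nat_comp)
 also have "... = ?t oo (Ident C ?A xx ?t) oo (Assoc C ?A ?A ?M oo La ?A ?A ?M)"
  unfolding me(1) using a m by simp
 also have "... = ?t oo ((Ident C ?A xx ?t) oo \<xi> ?A (?A ox ?M)) oo (Ident C ?A xD \<xi> ?A ?M) oo Assoc D ?A ?A ?M"
  unfolding La_assoc[OF a(1) a(1) m(1)] Th_def using a m by simp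
 also have "(Ident C ?A xx ?t) oo \<xi> ?A (?A ox ?M) = \<xi> ?A ?M oo (Ident C ?A xD ?t)"
  by (rule xi_nat[symmetric]) (use a m in simp_all)
 also have "?t oo (\<xi> ?A ?M oo (Ident C ?A xD ?t)) oo (Ident C ?A xD \<xi> ?A ?M) oo Assoc D ?A ?A ?M =
   (?t oo \<xi> ?A ?M) oo (Ident C ?A xD (?t oo \<xi> ?A ?M)) oo Assoc D ?A ?A ?M"
  using a m by (simp add: D_interchange_comp)
 finally show "(?t oo \<xi> ?A ?M) oo ((amul A oo \<xi> ?A ?A) xD Ident C ?M) = (?t oo \<xi> ?A ?M) oo (Ident C ?A xD (?t oo \<xi> ?A ?M)) oo Assoc D ?A ?A ?M" .
 have "(?t oo \<xi> ?A ?M) oo ((aone A oo \<eta>) xD Ident C ?M) = ?t oo \<xi> ?A ?M oo (aone A xD Ident C ?M) oo (\<eta> xD Ident C ?M)"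
  using a m by (simp add: D_interchange)
 also have "... = (?t oo (aone A xx Ident C ?M)) oo \<xi> (Unit C) ?M oo (\<eta> xD Ident C ?M)"
  using a m by (simp add: xi_nat_comp)
 also have "... = LUnit D ?M" unfolding me(2) using xi_lunit'[OF m(1)] .
 finally show "(?t oo \<xi> ?A ?M) oo ((aone A oo \<eta>) xD Ident C ?M) = LUnit D ?M" .
qed

lemma algebra_T:
 assumes A: "algebra_in C A"
 shows "algebra_in D (T A)"
proof -
 note a = C.algebra_typ[OF A] and ae = C.algebra_eq[OF A]
 let ?A = "aobj A"
 have P: "module_in C A (?A, amul A)"
  by (rule C.module_inI) (use a ae in simp_all)
 note m = module_T[OF A P]
 have o: "aobj (T A) \<in> Obj D" using a by simp
 have "(amul A oo \<xi> ?A ?A) oo (Ident C ?A xD (aone A oo \<eta>)) = amul A oo \<xi> ?A ?A oo (Ident C ?A xD aone A) oo (Ident C ?A xD \<eta>)"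
  using a by (simp add: D_interchange)
 also have "... = (amul A oo (Ident C ?A xx aone A)) oo \<xi> ?A (Unit C) oo (Ident C ?A xD \<eta>)"
  using a by (simp add: xi_nat_comp)
 also have "... = RUnit D ?A" unfolding ae(3) using xi_runit'[OF a(1)] .
 finally have 3: "(amul A oo \<xi> ?A ?A) oo (Ident C ?A xD (aone A oo \<eta>)) = RUnit D ?A" .
 note eqs = D.module_eq[OF m o, unfolded same T_simps Tm_simps fst_conv snd_conv]
 show ?thesis
  unfolding algebra_in_def same T_simps using eqs 3 a C.arr_hom' by simp
qed

lemma coalgebra_T:
 assumes A: "coalgebra_in C A"
 shows "coalgebra_in D (T A)"
proof -
 note a = C.coalgebra_typ[OF A] and ae = C.coalgebra_eq[OF A]
 let ?A = "aobj A" let ?I = "Ident C (aobj A)" let ?d = "\<xi>' ?A ?A oo acomul A" let ?e = "\<eta>' oo acounit A"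
 have L: "La ?A ?A ?A oo (?d xD ?I) oo ?d = (acomul A xx ?I) oo acomul A"
 proof -
  have "La ?A ?A ?A oo (?d xD ?I) oo ?d = \<xi> (?A ox ?A) ?A oo (acomul A xD ?I) oo ?d"
   unfolding La_def using a by (simp add: D_interchange_comp)
  also have "... = (acomul A xx ?I) oo \<xi> ?A ?A oo ?d"
   by (rule xi_nat_comp) (use a in simp_all)
  finally show ?thesis using a by simp
 qed
 have R: "Th ?A ?A ?A oo (?I xD ?d) oo ?d = (?I xx acomul A) oo acomul A"
 proof -
  have "Th ?A ?A ?A oo (?I xD ?d) oo ?d = \<xi> ?A (?A ox ?A) oo (?I xD acomul A) oo ?d"
   unfolding Th_def using a by (simp add: D_interchange_comp)
  also have "... = (?I xx acomul A) oo \<xi> ?A ?A oo ?d"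
   by (rule xi_nat_comp) (use a in simp_all)
  finally show ?thesis using a by simp
 qed
 have 1: "Assoc D ?A ?A ?A oo (?d xD ?I) oo ?d = (?I xD ?d) oo ?d"
 proof (rule C.iso_mono[OF Th_iso[OF a(1) a(1) a(1)]])
  have "Th ?A ?A ?A oo Assoc D ?A ?A ?A oo (?d xD ?I) oo ?d = Assoc C ?A ?A ?A oo (La ?A ?A ?A oo (?d xD ?I) oo ?d)"
   by (rule Th_assoc_comp[symmetric]) (use a in simp_all)
  also have "... = Th ?A ?A ?A oo (?I xD ?d) oo ?d" by (simp only: L R ae(1))
  finally show "Th ?A ?A ?A oo Assoc D ?A ?A ?A oo (?d xD ?I) oo ?d = Th ?A ?A ?A oo (?I xD ?d) oo ?d" .
 qed (use a in simp_all)
 have 2: "LUnit D ?A oo (?e xD ?I) oo ?d = ?I"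
 proof -
  have "LUnit D ?A oo (?e xD ?I) oo ?d = LUnit C ?A oo (\<xi> (Unit C) ?A oo (acounit A xD ?I) oo ?d)"
   unfolding xi_lunit'[OF a(1), symmetric] using a by (simp add: D_interchange_comp)
  also have "\<xi> (Unit C) ?A oo (acounit A xD ?I) oo ?d = (acounit A xx ?I) oo \<xi> ?A ?A oo ?d"
   by (rule xi_nat_comp) (use a in simp_all)
  finally show ?thesis using a ae(2) by simp
 qed
 have 3: "RUnit D ?A oo (?I xD ?e) oo ?d = ?I"
 proof -
  have "RUnit D ?A oo (?I xD ?e) oo ?d = RUnit C ?A oo (\<xi> ?A (Unit C) oo (?I xD acounit A) oo ?d)"
   unfolding xi_runit'[OF a(1), symmetric] using a by (simp add: D_interchange_comp)
  also have "\<xi> ?A (Unit C) oo (?I xD acounit A) oo ?d = (?I xx acounit A) oo \<xi> ?A ?A oo ?d"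
   by (rule xi_nat_comp) (use a in simp_all)
  finally show ?thesis using a ae(3) by simp
 qed
 show ?thesis unfolding coalgebra_in_def same T_simps using 1 2 3 a C.arr_hom' by simp
qed

text \<open>Each axiom for the transported structure is the axiom for \<open>A\<close> composed with comparison
 isomorphisms.\<close>
lemma hopf_T:
 assumes A: "braided_hopf_algebra C A"
 shows "braided_hopf_algebra D (T A)"
proof (intro braided_hopf_algebra.intro braided_hopf_algebra_axioms.intro)
 note al = braided_hopf_algebra.algebra[OF A] and co = braided_hopf_algebra.coalgebra[OF A]
 note a = C.algebra_typ[OF al] C.coalgebra_typ[OF co]
 let ?A = "aobj A" let ?I = "Ident C (aobj A)" let ?d = "\<xi>' ?A ?A oo acomul A" let ?m = "amul A oo \<xi> ?A ?A"
 have S: "C.arr (aantip A)" "src (aantip A) = ?A" "tgt (aantip A) = ?A"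
  using C.homD[OF braided_hopf_algebra.antipode_hom[OF A]] a by auto
 show "braided_monoidal_category D" by (rule braided_D)
 show "algebra_in D (T A)" by (rule algebra_T[OF al])
 show "coalgebra_in D (T A)" by (rule coalgebra_T[OF co])
 show "aantip (T A) \<in> Hom D (aobj (T A)) (aobj (T A))" using braided_hopf_algebra.antipode_hom[OF A] by (simp add: same)
 have u: "aone A oo acounit A = (aone A oo \<eta>) oo (\<eta>' oo acounit A)" using a by simp
 show "amul (T A) oo\<^bsub>D\<^esub> (aantip (T A) xD Ident D (aobj (T A))) oo\<^bsub>D\<^esub> acomul (T A) = aone (T A) oo\<^bsub>D\<^esub> acounit (T A)"
 proof (unfold same T_simps)
  have "?m oo (aantip A xD ?I) oo ?d = amul A oo (\<xi> ?A ?A oo (aantip A xD ?I) oo ?d)" using a S by simp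
  also have "\<xi> ?A ?A oo (aantip A xD ?I) oo ?d = (aantip A xx ?I) oo \<xi> ?A ?A oo ?d"
   by (rule xi_nat_comp) (use a S in simp_all)
  also have "\<xi> ?A ?A oo ?d = acomul A" using a by simp
  finally show "?m oo (aantip A xD ?I) oo ?d = (aone A oo \<eta>) oo (\<eta>' oo acounit A)"
   using braided_hopf_algebra.antipode_left[OF A] u by simp
 qed
 show "amul (T A) oo\<^bsub>D\<^esub> (Ident D (aobj (T A)) xD aantip (T A)) oo\<^bsub>D\<^esub> acomul (T A) = aone (T A) oo\<^bsub>D\<^esub> acounit (T A)"
 proof (unfold same T_simps)
  have "?m oo (?I xD aantip A) oo ?d = amul A oo (\<xi> ?A ?A oo (?I xD aantip A) oo ?d)" using a S by simp
  also have "\<xi> ?A ?A oo (?I xD aantip A) oo ?d = (?I xx aantip A) oo \<xi> ?A ?A oo ?d"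
   by (rule xi_nat_comp) (use a S in simp_all)
  also have "\<xi> ?A ?A oo ?d = acomul A" using a by simp
  finally show "?m oo (?I xD aantip A) oo ?d = (aone A oo \<eta>) oo (\<eta>' oo acounit A)"
   using braided_hopf_algebra.antipode_right[OF A] u by simp
 qed
 have M: "acomul A oo amul A = ((amul A xx amul A) oo mid_swap C ?A ?A ?A ?A) oo (acomul A xx acomul A)"
  and U: "acomul A oo aone A = (aone A xx aone A) oo inv_arrow C (Unit C ox Unit C) (Unit C) (LUnit C (Unit C))"
  using braided_hopf_algebra.comul_algebra_map[OF A] by (simp_all add: algebra_map_def braided_tensor_algebra_def)
 have E: "acounit A oo amul A = LUnit C (Unit C) oo (acounit A xx acounit A)" and EU: "acounit A oo aone A = Ident C (Unit C)"
  using braided_hopf_algebra.counit_algebra_map[OF A] by (simp_all add: algebra_map_def unit_algebra_def)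
 have Om: "Om ?A ?A ?A ?A oo (?d xD ?d) = (acomul A xx acomul A) oo \<xi> ?A ?A"
 proof -
  have "Om ?A ?A ?A ?A oo (?d xD ?d) = \<xi> (?A ox ?A) (?A ox ?A) oo (acomul A xD acomul A)"
   unfolding Om_def using a by (simp add: D_interchange)
  also have "... = (acomul A xx acomul A) oo \<xi> ?A ?A"
   by (rule xi_nat) (use a in simp_all)
  finally show ?thesis .
 qed
 have 1: "?d oo ?m = ((?m xD ?m) oo mid_swap D ?A ?A ?A ?A) oo (?d xD ?d)"
 proof (rule C.iso_mono[OF xi_iso'[OF a(1) a(1)]])
  have "\<xi> ?A ?A oo ((?m xD ?m) oo mid_swap D ?A ?A ?A ?A) oo (?d xD ?d) =
    (\<xi> ?A ?A oo (amul A xD amul A)) oo (\<xi> ?A ?A xD \<xi> ?A ?A) oo mid_swap D ?A ?A ?A ?A oo (?d xD ?d)"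
   using a by (simp add: D_interchange_comp)
  also have "\<xi> ?A ?A oo (amul A xD amul A) = (amul A xx amul A) oo \<xi> (?A ox ?A) (?A ox ?A)"
   by (rule xi_nat) (use a in simp_all)
  also have "((amul A xx amul A) oo \<xi> (?A ox ?A) (?A ox ?A)) oo (\<xi> ?A ?A xD \<xi> ?A ?A) oo mid_swap D ?A ?A ?A ?A oo (?d xD ?d) =
    (amul A xx amul A) oo (Om ?A ?A ?A ?A oo mid_swap D ?A ?A ?A ?A) oo (?d xD ?d)"
   unfolding Om_def using a by simp
  also have "... = (amul A xx amul A) oo mid_swap C ?A ?A ?A ?A oo (Om ?A ?A ?A ?A oo (?d xD ?d))"
   unfolding Om_mid_swap[OF a(1) a(1) a(1) a(1)] using a by simp
  also have "... = (((amul A xx amul A) oo mid_swap C ?A ?A ?A ?A) oo (acomul A xx acomul A)) oo \<xi> ?A ?A"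
   unfolding Om using a by simp
  also have "... = \<xi> ?A ?A oo ?d oo ?m" unfolding M[symmetric] using a by simp
  finally show "\<xi> ?A ?A oo ?d oo ?m = \<xi> ?A ?A oo ((?m xD ?m) oo mid_swap D ?A ?A ?A ?A) oo (?d xD ?d)" by simp
 qed (use a in simp_all)
 let ?u = "aone A oo \<eta>" let ?l = "inv_arrow C (Unit D oD Unit D) (Unit D) (LUnit D (Unit D))"
 have oD: "Unit D \<in> Obj C" by simp
 note l = C.iso_arrowD[OF C.lunit_iso[OF C.unit_obj]] D.iso_arrowD[OF D.lunit_iso[OF D.unit_obj], unfolded same D_arr D_iso]
 have 2: "?d oo ?u = (?u xD ?u) oo ?l"
 proof (rule C.iso_mono[OF xi_iso'[OF a(1) a(1)]])
  let ?k = "inv_arrow C (Unit C ox Unit C) (Unit C) (LUnit C (Unit C))"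
  have "\<xi> (Unit C) (Unit C) oo (\<eta> xD \<eta>) oo ?l = ?k oo (LUnit C (Unit C) oo \<xi> (Unit C) (Unit C) oo (\<eta> xD \<eta>)) oo ?l"
   using l by (simp add: C.inv_comp[OF C.lunit_iso])
  also have "... = ?k oo \<eta>" unfolding xi_eta_lunit using l by simp
  finally have e: "\<xi> (Unit C) (Unit C) oo (\<eta> xD \<eta>) oo ?l = ?k oo \<eta>" .
  have "\<xi> ?A ?A oo (?u xD ?u) oo ?l = (\<xi> ?A ?A oo (aone A xD aone A)) oo (\<eta> xD \<eta>) oo ?l"
   using a l by (simp add: D_interchange_comp)
  also have "\<xi> ?A ?A oo (aone A xD aone A) = (aone A xx aone A) oo \<xi> (Unit C) (Unit C)"
   by (rule xi_nat) (use a in simp_all)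
  also have "((aone A xx aone A) oo \<xi> (Unit C) (Unit C)) oo (\<eta> xD \<eta>) oo ?l = (aone A xx aone A) oo (\<xi> (Unit C) (Unit C) oo (\<eta> xD \<eta>) oo ?l)"
   using a l by simp
  also have "... = ((aone A xx aone A) oo ?k) oo \<eta>" unfolding e using a l by simp
  also have "... = \<xi> ?A ?A oo ?d oo ?u" unfolding U[symmetric] using a by simp
  finally show "\<xi> ?A ?A oo ?d oo ?u = \<xi> ?A ?A oo (?u xD ?u) oo ?l" by simp
 qed (use a l in simp_all)
 show "algebra_map D (T A) (braided_tensor_algebra D (T A) (T A)) (acomul (T A))"
  unfolding algebra_map_def braided_tensor_algebra_def alg_in.simps same T_simps D_iso
  using 1 2 a C.arr_hom' by simp
 have 3: "(\<eta>' oo acounit A) oo ?m = LUnit D (Unit D) oo ((\<eta>' oo acounit A) xD (\<eta>' oo acounit A))"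
 proof (rule C.iso_mono[OF eta_iso'])
  have "\<eta> oo LUnit D (Unit D) oo ((\<eta>' oo acounit A) xD (\<eta>' oo acounit A)) = (\<eta> oo LUnit D (Unit D)) oo ((\<eta>' oo acounit A) xD (\<eta>' oo acounit A))"
   using a l by simp
  also have "... = LUnit C (Unit C) oo (\<xi> (Unit C) (Unit C) oo (acounit A xD acounit A))"
   unfolding xi_eta_lunit[symmetric] using a l by (simp add: D_interchange)
  also have "\<xi> (Unit C) (Unit C) oo (acounit A xD acounit A) = (acounit A xx acounit A) oo \<xi> ?A ?A"
   by (rule xi_nat) (use a in simp_all)
  also have "LUnit C (Unit C) oo (acounit A xx acounit A) oo \<xi> ?A ?A = (acounit A oo amul A) oo \<xi> ?A ?A"
   unfolding E using a l by simp
  also have "... = \<eta> oo (\<eta>' oo acounit A) oo ?m" using a by simp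
  finally show "\<eta> oo (\<eta>' oo acounit A) oo ?m = \<eta> oo LUnit D (Unit D) oo ((\<eta>' oo acounit A) xD (\<eta>' oo acounit A))" by simp
 qed (use a l in simp_all)
 have 4: "(\<eta>' oo acounit A) oo ?u = Ident C (Unit D)"
 proof -
  have "(\<eta>' oo acounit A) oo ?u = \<eta>' oo (acounit A oo aone A) oo \<eta>" using a by simp
  then show ?thesis unfolding EU by simp
 qed
 show "algebra_map D (T A) (unit_algebra D) (acounit (T A))"
  unfolding algebra_map_def unit_algebra_def alg_in.simps same T_simps
  using 3 4 a C.arr_hom' by simp
qed

end

section \<open>The transports are equivalences\<close>

context twist
begin

lemma xi_act:
 assumes A: "algebra_in C A" "coalgebra_in C A" and P: "module_in C A P" and Q: "module_in C A Q"
 shows "\<xi> (fst P) (fst Q) oo snd (TenO (module_cat D (T A)) (Tm A P) (Tm A Q)) =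
  (snd (TenO (module_cat C A) P Q) oo \<xi> (aobj A) (fst P ox fst Q)) oo (Ident C (aobj A) xD \<xi> (fst P) (fst Q))"
proof -
 note a = C.algebra_typ[OF A(1)] C.coalgebra_typ[OF A(2)]
 note m = C.module_typ[OF P a(1)] C.module_typ[OF Q a(1)]
 let ?A = "aobj A" let ?I = "Ident C (aobj A)" let ?M = "fst P" let ?N = "fst Q" let ?d = "\<xi>' ?A ?A oo acomul A"
 let ?D = "?d xD Ident C (?M oD ?N)"
 have t: "snd (TenO (module_cat D (T A)) (Tm A P) (Tm A Q)) = ((snd P oo \<xi> ?A ?M) xD (snd Q oo \<xi> ?A ?N)) oo mid_swap D ?A ?A ?M ?N oo ?D"
  using D.ten_module_arr(5)[OF algebra_T[OF A(1)] coalgebra_T[OF A(2)] module_T[OF A(1) P] module_T[OF A(1) Q]] by (simp add: same)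
 have u: "snd (TenO (module_cat C A) P Q) = (snd P xx snd Q) oo mid_swap C ?A ?A ?M ?N oo (acomul A xx Ident C (?M ox ?N))"
  by (rule C.ten_module_arr(5)[OF A P Q])
 have o: "Om ?A ?A ?M ?N oo ?D = (acomul A xx Ident C (?M ox ?N)) oo \<xi> ?A (?M ox ?N) oo (?I xD \<xi> ?M ?N)"
 proof -
  have "Om ?A ?A ?M ?N oo ?D = \<xi> (?A ox ?A) (?M ox ?N) oo (acomul A xD \<xi> ?M ?N)"
   unfolding Om_def using a m by (simp add: D_interchange)
  also have "... = \<xi> (?A ox ?A) (?M ox ?N) oo (acomul A xD Ident C (?M ox ?N)) oo (?I xD \<xi> ?M ?N)"
   using a m by (simp add: D_interchange)
  also have "... = (acomul A xx Ident C (?M ox ?N)) oo \<xi> ?A (?M ox ?N) oo (?I xD \<xi> ?M ?N)"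
   by (rule xi_nat_comp) (use a m in simp_all)
  finally show ?thesis .
 qed
 have "\<xi> ?M ?N oo snd (TenO (module_cat D (T A)) (Tm A P) (Tm A Q)) =
   (\<xi> ?M ?N oo (snd P xD snd Q)) oo (\<xi> ?A ?M xD \<xi> ?A ?N) oo mid_swap D ?A ?A ?M ?N oo ?D"
  unfolding t using a m by (simp add: D_interchange_comp)
 also have "\<xi> ?M ?N oo (snd P xD snd Q) = (snd P xx snd Q) oo \<xi> (?A ox ?M) (?A ox ?N)"
  by (rule xi_nat) (use a m in simp_all)
 also have "((snd P xx snd Q) oo \<xi> (?A ox ?M) (?A ox ?N)) oo (\<xi> ?A ?M xD \<xi> ?A ?N) oo mid_swap D ?A ?A ?M ?N oo ?D =
  (snd P xx snd Q) oo (Om ?A ?M ?A ?N oo mid_swap D ?A ?A ?M ?N) oo ?D"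
  unfolding Om_def using a m by simp
 also have "... = (snd P xx snd Q) oo mid_swap C ?A ?A ?M ?N oo (Om ?A ?A ?M ?N oo ?D)"
  unfolding Om_mid_swap[OF a(1) a(1) m(1) m(5)] using a m by simp
 also have "... = (snd (TenO (module_cat C A) P Q) oo \<xi> ?A (?M ox ?N)) oo (?I xD \<xi> ?M ?N)"
  unfolding o u using a m by simp
 finally show ?thesis .
qed

lemma eta_act:
 assumes A: "coalgebra_in C A"
 shows "\<eta> oo snd (Unit (module_cat D (T A))) = (snd (Unit (module_cat C A)) oo \<xi> (aobj A) (Unit C)) oo (Ident C (aobj A) xD \<eta>)"
proof -
 note a = C.coalgebra_typ[OF A]
 let ?A = "aobj A" let ?e = "\<eta>' oo acounit A"
 have "\<eta> oo snd (Unit (module_cat D (T A))) = (\<eta> oo LUnit D (Unit D)) oo (?e xD Ident C (Unit D))"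
  using a by (simp add: D.mc_simps same)
 also have "... = LUnit C (Unit C) oo \<xi> (Unit C) (Unit C) oo (acounit A xD \<eta>)"
  unfolding xi_eta_lunit[symmetric] using a by (simp add: D_interchange)
 also have "... = LUnit C (Unit C) oo (\<xi> (Unit C) (Unit C) oo (acounit A xD Ident C (Unit C)) oo (Ident C ?A xD \<eta>))"
  using a by (simp add: D_interchange)
 also have "\<xi> (Unit C) (Unit C) oo (acounit A xD Ident C (Unit C)) oo (Ident C ?A xD \<eta>) =
   (acounit A xx Ident C (Unit C)) oo \<xi> ?A (Unit C) oo (Ident C ?A xD \<eta>)"
  by (rule xi_nat_comp) (use a in simp_all)
 also have "LUnit C (Unit C) oo ... = (snd (Unit (module_cat C A)) oo \<xi> (aobj A) (Unit C)) oo (Ident C (aobj A) xD \<eta>)"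
  using a by (simp add: C.mc_simps)
 finally show ?thesis .
qed

lemma D_module_maps_iff:
 assumes "fst P \<in> Obj C" "fst Q \<in> Obj C"
 shows "f \<in> module_maps D B P Q \<longleftrightarrow> C.arr f \<and> src f = fst P \<and> tgt f = fst Q \<and> f oo snd P = snd Q oo (Ident C (aobj B) xD f)"
 using D.module_maps_iff[of P Q f B] assms by (simp add: same)

lemma module_maps_T:
 assumes A: "algebra_in C A" and P: "module_in C A P" and Q: "module_in C A Q" and f: "f \<in> module_maps C A P Q"
 shows "f \<in> module_maps D (T A) (Tm A P) (Tm A Q)"
proof -
 note a = C.algebra_typ[OF A]
 note m = C.module_typ[OF P a(1)] C.module_typ[OF Q a(1)] C.module_mapsD[OF f C.module_typ(1)[OF P a(1)] C.module_typ(1)[OF Q a(1)]]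
 have "f oo snd P oo \<xi> (aobj A) (fst P) = (f oo snd P) oo \<xi> (aobj A) (fst P)" using a m by simp
 also have "... = snd Q oo ((Ident C (aobj A) xx f) oo \<xi> (aobj A) (fst P))" unfolding C.module_maps_eq[OF f] using a m by simp
 also have "(Ident C (aobj A) xx f) oo \<xi> (aobj A) (fst P) = \<xi> (aobj A) (fst Q) oo (Ident C (aobj A) xD f)"
  by (rule xi_nat[symmetric]) (use a m in simp_all)
 finally show ?thesis using a m by (simp add: D_module_maps_iff)
qed

lemma hopf_functor: "cat_functor (hopf_cat C) (hopf_cat D) (transport_hopf_functor C D F)"
proof (intro cat_functor.intro cat_functor_axioms.intro C.hopf_cat_category D.hopf_cat_category)
 fix A B f assume "A \<in> Obj (hopf_cat C)" "B \<in> Obj (hopf_cat C)" and f: "f \<in> Hom (hopf_cat C) A B"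
 then have A: "braided_hopf_algebra C A" and B: "braided_hopf_algebra C B" by (simp_all add: hopf_cat_def)
 note a = C.algebra_typ[OF braided_hopf_algebra.algebra[OF A]] C.coalgebra_typ[OF braided_hopf_algebra.coalgebra[OF A]]
 note b = C.algebra_typ[OF braided_hopf_algebra.algebra[OF B]] C.coalgebra_typ[OF braided_hopf_algebra.coalgebra[OF B]]
 have fh: "f \<in> Hom C (aobj A) (aobj B)" and e: "f oo amul A = amul B oo (f xx f)" "f oo aone A = aone B"
  "acomul B oo f = (f xx f) oo acomul A" "acounit B oo f = acounit A"
  using f by (simp_all add: hopf_cat_def algebra_map_def coalgebra_map_def)
 note t = C.homD[OF fh a(1) b(1)]
 have "f oo (amul A oo \<xi> (aobj A) (aobj A)) = (f oo amul A) oo \<xi> (aobj A) (aobj A)" using t a by simp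
 also have "... = amul B oo ((f xx f) oo \<xi> (aobj A) (aobj A))" unfolding e using t a b by simp
 also have "(f xx f) oo \<xi> (aobj A) (aobj A) = \<xi> (aobj B) (aobj B) oo (f xD f)"
  by (rule xi_nat[symmetric]) (use t in simp_all)
 finally have 1: "f oo (amul A oo \<xi> (aobj A) (aobj A)) = (amul B oo \<xi> (aobj B) (aobj B)) oo (f xD f)" using t a b by simp
 have 2: "f oo (aone A oo \<eta>) = aone B oo \<eta>"
 proof -
  have "f oo (aone A oo \<eta>) = (f oo aone A) oo \<eta>" using t a by simp
  then show ?thesis using e by simp
 qed
 have "(\<xi>' (aobj B) (aobj B) oo acomul B) oo f = \<xi>' (aobj B) (aobj B) oo (acomul B oo f)" using t a b by simp
 also have "... = (\<xi>' (aobj B) (aobj B) oo (f xx f)) oo acomul A" unfolding e using t a b by simp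
 also have "\<xi>' (aobj B) (aobj B) oo (f xx f) = (f xD f) oo \<xi>' (aobj A) (aobj A)"
  by (rule xi_inv_nat) (use t in simp_all)
 finally have 3: "(\<xi>' (aobj B) (aobj B) oo acomul B) oo f = (f xD f) oo (\<xi>' (aobj A) (aobj A) oo acomul A)" using t a b by simp
 have 4: "(\<eta>' oo acounit B) oo f = \<eta>' oo acounit A"
 proof -
  have "(\<eta>' oo acounit B) oo f = \<eta>' oo (acounit B oo f)" using t b by simp
  then show ?thesis using e by simp
 qed
 show "FA (transport_hopf_functor C D F) f \<in> Hom (hopf_cat D) (FO (transport_hopf_functor C D F) A) (FO (transport_hopf_functor C D F) B)"
  unfolding hopf_cat_def transport_hopf_functor_def cat_fun.simps cat.simps identity mem_Collect_eq algebra_map_def coalgebra_map_def same T_simps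
  using fh 1 2 3 4 by blast
qed (simp_all add: hopf_cat_def transport_hopf_functor_def hopf_T identity same)

definition Finv :: "('o, 'a, 'o, 'a) mon_fun" where
 "Finv = \<lparr>FO = (%X. X), FA = (%f. f), FXi = \<xi>', FEta = \<eta>'\<rparr>"

lemma Finv_simps [simp]: "FO Finv = (%X. X)" "FA Finv = (%f. f)" "FXi Finv = \<xi>'" "FEta Finv = \<eta>'"
 by (simp_all add: Finv_def)

text \<open>The situation is symmetric: with the inverse comparison maps, \<open>C\<close> is a twist of \<open>D\<close>. All
 constructions are therefore available in both directions.\<close>
lemma twist_Finv: "twist D C Finv src tgt"
proof -
 have iso: "iso_arrow C (X ox Y) (X oD Y) (\<xi>' X Y)" if "X \<in> Obj C" "Y \<in> Obj C" for X Y
  using C.inverse_inv_arrow(2)[OF xi_iso'[OF that]] that by simp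
 have assoc: "Assoc D X Y Z oo \<xi>' (X oD Y) Z oo (\<xi>' X Y xx Ident C Z) = \<xi>' X (Y oD Z) oo (Ident C X xx \<xi>' Y Z) oo Assoc C X Y Z"
  if o: "X \<in> Obj C" "Y \<in> Obj C" "Z \<in> Obj C" for X Y Z
 proof (rule C.iso_mono[OF Th_iso[OF o]])
  let ?l = "\<xi>' (X oD Y) Z oo (\<xi>' X Y xx Ident C Z)" and ?t = "\<xi>' X (Y oD Z) oo (Ident C X xx \<xi>' Y Z)"
  have l: "La X Y Z oo ?l = Ident C ((X ox Y) ox Z)"
  proof -
   have "La X Y Z oo ?l = (\<xi> (X ox Y) Z oo (\<xi> X Y xD Ident C Z) oo ?l)" unfolding La_def using o by simp
   also have "... = (\<xi> X Y xx Ident C Z) oo \<xi> (X oD Y) Z oo ?l" by (rule xi_nat_comp) (use o in simp_all)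
   also have "... = Ident C ((X ox Y) ox Z)" using o by (simp add: C.interchange C.id_ten)
   finally show ?thesis .
  qed
  have t: "Th X Y Z oo ?t = Ident C (X ox Y ox Z)"
  proof -
   have "Th X Y Z oo ?t = (\<xi> X (Y ox Z) oo (Ident C X xD \<xi> Y Z) oo ?t)" unfolding Th_def using o by simp
   also have "... = (Ident C X xx \<xi> Y Z) oo \<xi> X (Y oD Z) oo ?t" by (rule xi_nat_comp) (use o in simp_all)
   also have "... = Ident C (X ox Y ox Z)" using o by (simp add: C.interchange C.id_ten)
   finally show ?thesis .
  qed
  have "Th X Y Z oo Assoc D X Y Z oo ?l = (Assoc C X Y Z oo La X Y Z) oo ?l" unfolding La_assoc[OF o] using o by simp
  also have "... = Assoc C X Y Z oo (La X Y Z oo ?l)" using o by simp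
  also have "... = (Th X Y Z oo ?t) oo Assoc C X Y Z" unfolding l t using o by simp
  also have "... = Th X Y Z oo \<xi>' X (Y oD Z) oo (Ident C X xx \<xi>' Y Z) oo Assoc C X Y Z" using o by simp
  finally show "Th X Y Z oo Assoc D X Y Z oo ?l = Th X Y Z oo \<xi>' X (Y oD Z) oo (Ident C X xx \<xi>' Y Z) oo Assoc C X Y Z" .
 qed (use o in simp_all)
 have lunit: "LUnit D X oo \<xi>' (Unit D) X oo (\<eta>' xx Ident C X) = LUnit C X" if o: "X \<in> Obj C" for X
 proof -
  have "LUnit D X oo \<xi>' (Unit D) X oo (\<eta>' xx Ident C X) = LUnit C X oo (\<xi> (Unit C) X oo (\<eta> xD Ident C X) oo \<xi>' (Unit D) X oo (\<eta>' xx Ident C X))"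
   unfolding xi_lunit'[OF o, symmetric] using o by simp
  also have "\<xi> (Unit C) X oo (\<eta> xD Ident C X) oo \<xi>' (Unit D) X oo (\<eta>' xx Ident C X) =
   (\<eta> xx Ident C X) oo \<xi> (Unit D) X oo \<xi>' (Unit D) X oo (\<eta>' xx Ident C X)"
   by (rule xi_nat_comp) (use o in simp_all)
  finally show ?thesis using o by (simp add: C.interchange C.id_ten)
 qed
 have runit: "RUnit D X oo \<xi>' X (Unit D) oo (Ident C X xx \<eta>') = RUnit C X" if o: "X \<in> Obj C" for X
 proof -
  have "RUnit D X oo \<xi>' X (Unit D) oo (Ident C X xx \<eta>') = RUnit C X oo (\<xi> X (Unit C) oo (Ident C X xD \<eta>) oo \<xi>' X (Unit D) oo (Ident C X xx \<eta>'))"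
   unfolding xi_runit'[OF o, symmetric] using o by simp
  also have "\<xi> X (Unit C) oo (Ident C X xD \<eta>) oo \<xi>' X (Unit D) oo (Ident C X xx \<eta>') =
   (Ident C X xx \<eta>) oo \<xi> X (Unit D) oo \<xi>' X (Unit D) oo (Ident C X xx \<eta>')"
   by (rule xi_nat_comp) (use o in simp_all)
  finally show ?thesis using o by (simp add: C.interchange C.id_ten)
 qed
 have nat: "\<xi>' X' Y' oo (f xx g) = (f xD g) oo \<xi>' X Y"
  if "X \<in> Obj C" "X' \<in> Obj C" "Y \<in> Obj C" "Y' \<in> Obj C" "f \<in> Hom C X X'" "g \<in> Hom C Y Y'" for X X' Y Y' f g
  using C.homD[OF that(5,1,2)] C.homD[OF that(6,3,4)] by (intro xi_inv_nat) simp_all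
 have br: "Braid D X Y oo \<xi>' X Y = \<xi>' Y X oo Braid C X Y" if "X \<in> Obj C" "Y \<in> Obj C" for X Y
  using that by (simp add: braidD_eq)
 have eta: "iso_arrow C (Unit C) (Unit D) \<eta>'" using C.inverse_inv_arrow(2)[OF eta_iso'] by simp
 have bh: "Braid C X Y \<in> Hom C (X ox Y) (Y ox X)" if "X \<in> Obj C" "Y \<in> Obj C" for X Y
  using that by (intro C.arr_hom') simp_all
 have F: "monoidal_functor D C Finv"
  apply (intro monoidal_functor.intro C.monoidal_category_axioms D.monoidal_category_axioms )
   apply (intro cat_functor.intro C.category_axioms D.category_axioms)
   apply (intro cat_functor_axioms.intro)
  apply (unfold Finv_simps same D_iso)
  apply (assumption | rule HOL.refl)+
  apply (intro monoidal_functor_axioms.intro)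
  apply (unfold Finv_simps same D_iso)
  apply (rule iso; assumption)
  apply (rule nat; assumption)
  apply (rule eta)
  apply (rule assoc; assumption)
  apply (rule lunit; assumption)
  apply (rule runit; assumption)
  done
 show ?thesis
  apply (intro twist.intro F D.braided_monoidal_category_st_axioms C.monoidal_category_st_axioms)
  apply (intro twist_axioms.intro)
  apply (unfold Finv_simps same)
  apply (rule HOL.refl | (rule br bh; assumption))+
  done
qed

end

context twist
begin

interpretation inv: twist D C Finv src tgt by (rule twist_Finv)

declare inv.D_arr [simp del] inv.obj [simp del] inv.D_iso [simp del]

lemma inv_xi' [simp]: "X \<in> Obj C ==> Y \<in> Obj C ==> inv_arrow C (X ox Y) (X oD Y) (\<xi>' X Y) = \<xi> X Y"
 by (rule C.inverse_inv_arrow(3)[OF xi_iso']) simp_all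

lemma inv_eta' [simp]: "inv_arrow C (Unit C) (Unit D) \<eta>' = \<eta>"
 by (rule C.inverse_inv_arrow(3)[OF eta_iso']) simp_all

lemma T_inverse:
 assumes "algebra_in C A" "coalgebra_in C A"
 shows "transport_hopf D C Finv (T A) = A"
proof -
 note a = C.algebra_typ[OF assms(1)] C.coalgebra_typ[OF assms(2)]
 show ?thesis using a by (intro hopf_in.equality) (simp_all add: transport_hopf_def same identity)
qed

lemma T_inverse':
 assumes "algebra_in D B" "coalgebra_in D B"
 shows "T (transport_hopf D C Finv B) = B"
proof -
 note a = D.algebra_typ[OF assms(1)] D.coalgebra_typ[OF assms(2)]
 show ?thesis using a by (intro hopf_in.equality) (simp_all add: transport_hopf_def same identity)
qed

text \<open>Transport along \<open>\<xi>\<close> and back is the identity on Hopf algebras, so the functor is even an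
 isomorphism of categories.\<close>
lemma hopf_equivalence: "equivalence_functor (hopf_cat C) (hopf_cat D) (transport_hopf_functor C D F)"
proof (rule equivalence_functorI[OF hopf_functor inv.hopf_functor])
 fix A assume "A \<in> Obj (hopf_cat C)"
 then have "algebra_in C A" "coalgebra_in C A" by (simp_all add: hopf_cat_def braided_hopf_algebra.algebra braided_hopf_algebra.coalgebra)
 then show "FO (transport_hopf_functor D C Finv) (FO (transport_hopf_functor C D F) A) = A"
  by (simp add: transport_hopf_functor_def T_inverse)
next
 fix A assume "A \<in> Obj (hopf_cat D)"
 then have "algebra_in D A" "coalgebra_in D A" by (simp_all add: hopf_cat_def braided_hopf_algebra.algebra braided_hopf_algebra.coalgebra)
 then show "FO (transport_hopf_functor C D F) (FO (transport_hopf_functor D C Finv) A) = A"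
  by (simp add: transport_hopf_functor_def T_inverse')
qed (simp_all add: transport_hopf_functor_def identity)

lemma Tm_inverse:
 assumes "algebra_in C A" "module_in C A P"
 shows "inv.Tm (T A) (Tm A P) = P"
proof -
 note a = C.algebra_typ[OF assms(1)]
 note m = C.module_typ[OF assms(2) a(1)]
 show ?thesis using a m by (intro prod_eqI) (simp_all add: same)
qed

lemma Tm_inverse':
 assumes "algebra_in C A" "module_in D (T A) P"
 shows "Tm A (inv.Tm (T A) P) = P"
proof -
 note a = C.algebra_typ[OF assms(1)]
 have "aobj (T A) \<in> Obj D" using a by simp
 note m = D.module_typ[OF assms(2) this, unfolded same D_arr T_simps]
 show ?thesis using a m by (intro prod_eqI) (simp_all add: same)
qed

context
 fixes A :: "('o, 'a) hopf_in"
 assumes A: "algebra_in C A" and A': "coalgebra_in C A" and monC: "monoidal_category (module_cat C A)"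
begin

abbreviation "MC \<equiv> module_cat C A"
abbreviation "MD \<equiv> module_cat D (T A)"

interpretation MC: monoidal_category MC by (rule monC)

lemma MC_modules:
 "module_in C A P ==> module_in C A Q ==> module_in C A (TenO MC P Q)" "module_in C A (Unit MC)"
 "module_in C A P ==> module_in C A Q ==> module_in C A R ==>
   Assoc C (fst P) (fst Q) (fst R) \<in> module_maps C A (TenO MC (TenO MC P Q) R) (TenO MC P (TenO MC Q R))"
 "module_in C A P ==> LUnit C (fst P) \<in> module_maps C A (TenO MC (Unit MC) P) P"
 "module_in C A P ==> RUnit C (fst P) \<in> module_maps C A (TenO MC P (Unit MC)) P"
 using MC.tenO_obj MC.unit_obj MC.assoc_iso[of P Q R] MC.lunit_iso[of P] MC.runit_iso[of P]
 by (simp_all add: C.mc_simps(1-8) iso_arrow_def inverse_arrows_def)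

lemma fst_ten [simp]: "fst (TenO MC P Q) = fst P ox fst Q" "fst (TenO MD P Q) = fst P oD fst Q"
  "fst (Unit MC) = Unit C" "fst (Unit MD) = Unit D"
 by (simp_all add: C.mc_simps D.mc_simps)

lemma D_module: "module_in D (T A) P' ==> \<exists>P. module_in C A P \<and> P' = Tm A P"
 using inv.module_T[OF algebra_T[OF A], of P'] Tm_inverse'[OF A, of P'] T_inverse[OF A A'] by metis

lemma T_obj: "aobj (T A) \<in> Obj D" using C.algebra_typ(1)[OF A] by simp

lemma module_obj: "module_in C A P ==> fst P \<in> Obj C"
 using C.module_typ(1)[OF _ C.algebra_typ(1)[OF A]] .

lemma D_ten_module:
 assumes P: "module_in C A P" and Q: "module_in C A Q"
 shows "module_in D (T A) (TenO MD (Tm A P) (Tm A Q))"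
proof -
 note t = D.ten_module_arr[OF algebra_T[OF A] coalgebra_T[OF A'] module_T[OF A P] module_T[OF A Q]]
 have "module_in D (T A) (fst P oD fst Q, snd (TenO MD (Tm A P) (Tm A Q)))"
  by (rule D.module_in_iso[OF algebra_T[OF A] module_T[OF A MC_modules(1)[OF P Q]], of _ "\<xi> (fst P) (fst Q)"])
   (use t(2-4) module_obj[OF P] module_obj[OF Q] xi_iso' xi_act[OF A A' P Q] in \<open>simp_all add: same\<close>)
 then show ?thesis using t(1) by (metis prod.collapse Tm_simps(1))
qed

lemma D_unit_module: "module_in D (T A) (Unit MD)"
proof -
 note a = C.coalgebra_typ[OF A']
 have "module_in D (T A) (Unit D, snd (Unit MD))"
  by (rule D.module_in_iso[OF algebra_T[OF A] module_T[OF A MC_modules(2)], of _ \<eta>])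
   (use a eta_iso' eta_act[OF A'] in \<open>simp_all add: same\<close>, simp_all add: D.mc_simps same)
 then show ?thesis by (simp add: D.mc_simps)
qed

lemma xi_module_map:
 assumes P: "module_in C A P" and Q: "module_in C A Q"
 shows "\<xi> (fst P) (fst Q) \<in> module_maps D (T A) (TenO MD (Tm A P) (Tm A Q)) (Tm A (TenO MC P Q))"
 using module_obj[OF P] module_obj[OF Q] xi_act[OF A A' P Q] by (subst D_module_maps_iff) simp_all

lemma eta_module_map: "\<eta> \<in> module_maps D (T A) (Unit MD) (Tm A (Unit MC))"
 using eta_act[OF A'] by (subst D_module_maps_iff) simp_all

lemma D_ten: "module_in D (T A) P' ==> module_in D (T A) Q' ==> module_in D (T A) (TenO MD P' Q')"
 using D_ten_module D_module by metis

lemma monoidal_MD: "monoidal_category MD"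
proof (rule D.module_cat_monoidalI[OF algebra_T[OF A] coalgebra_T[OF A'] D_ten D_unit_module])
 note AT = algebra_T[OF A] note AT' = coalgebra_T[OF A']
 note comp = D.module_maps_comp[OF AT, unfolded same]
 note ten = D.module_maps_ten[OF AT AT', unfolded Tm_simps fst_ten]
 note idm = D.module_maps_id[OF AT, unfolded same, unfolded Tm_simps fst_ten]
 note mT = module_T[OF A] note um = mT[OF MC_modules(2)]
 fix P' assume "module_in D (T A) P'"
 then obtain P where P: "module_in C A P" and P': "P' = Tm A P" using D_module by blast
 note Pm = mT[OF P] and oP = module_obj[OF P]
 show "LUnit D (fst P') \<in> module_maps D (T A) (TenO MD (Unit MD) P') P'"
 proof -
  have 1: "\<eta> xD Ident C (fst P) \<in> module_maps D (T A) (TenO MD (Unit MD) P') (TenO MD (Tm A (Unit MC)) P')"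
   unfolding P' using ten[OF D_unit_module Pm um Pm eta_module_map idm[OF Pm]] by simp
  have 2: "\<xi> (Unit C) (fst P) \<in> module_maps D (T A) (TenO MD (Tm A (Unit MC)) P') (Tm A (TenO MC (Unit MC) P))"
   unfolding P' using xi_module_map[OF MC_modules(2) P] by simp
  have 3: "LUnit C (fst P) \<in> module_maps D (T A) (Tm A (TenO MC (Unit MC) P)) P'"
   unfolding P' using P by (intro module_maps_T[OF A] MC_modules)
  note m = D_ten[OF D_unit_module Pm] D_ten[OF um Pm] mT[OF MC_modules(1)[OF MC_modules(2) P]]
  have "LUnit C (fst P) oo \<xi> (Unit C) (fst P) oo (\<eta> xD Ident C (fst P)) \<in> module_maps D (T A) (TenO MD (Unit MD) P') P'"
   by (rule comp[OF _ _ _ comp[OF _ _ _ 1 2] 3]) (use m Pm P' in simp_all)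
  then show ?thesis using xi_lunit'[OF oP] P' by simp
 qed
 show "RUnit D (fst P') \<in> module_maps D (T A) (TenO MD P' (Unit MD)) P'"
 proof -
  have 1: "Ident C (fst P) xD \<eta> \<in> module_maps D (T A) (TenO MD P' (Unit MD)) (TenO MD P' (Tm A (Unit MC)))"
   unfolding P' using ten[OF Pm D_unit_module Pm um idm[OF Pm] eta_module_map] by simp
  have 2: "\<xi> (fst P) (Unit C) \<in> module_maps D (T A) (TenO MD P' (Tm A (Unit MC))) (Tm A (TenO MC P (Unit MC)))"
   unfolding P' using xi_module_map[OF P MC_modules(2)] by simp
  have 3: "RUnit C (fst P) \<in> module_maps D (T A) (Tm A (TenO MC P (Unit MC))) P'"
   unfolding P' using P by (intro module_maps_T[OF A] MC_modules)
  note m = D_ten[OF Pm D_unit_module] D_ten[OF Pm um] mT[OF MC_modules(1)[OF P MC_modules(2)]]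
  have "RUnit C (fst P) oo \<xi> (fst P) (Unit C) oo (Ident C (fst P) xD \<eta>) \<in> module_maps D (T A) (TenO MD P' (Unit MD)) P'"
   by (rule comp[OF _ _ _ comp[OF _ _ _ 1 2] 3]) (use m Pm P' in simp_all)
  then show ?thesis using xi_runit'[OF oP] P' by simp
 qed
 fix Q' R' assume "module_in D (T A) Q'" "module_in D (T A) R'"
 then obtain Q R where Q: "module_in C A Q" and Q': "Q' = Tm A Q" and R: "module_in C A R" and R': "R' = Tm A R" using D_module by metis
 note Qm = mT[OF Q] and Rm = mT[OF R] and o = oP module_obj[OF Q] module_obj[OF R]
 let ?X = "fst P" let ?Y = "fst Q" let ?Z = "fst R"
 show "Assoc D (fst P') (fst Q') (fst R') \<in> module_maps D (T A) (TenO MD (TenO MD P' Q') R') (TenO MD P' (TenO MD Q' R'))"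
 proof -
  have l1: "\<xi> ?X ?Y xD Ident C ?Z \<in> module_maps D (T A) (TenO MD (TenO MD P' Q') R') (TenO MD (Tm A (TenO MC P Q)) R')"
   unfolding P' Q' R' using ten[OF D_ten[OF Pm Qm] Rm mT[OF MC_modules(1)[OF P Q]] Rm xi_module_map[OF P Q] idm[OF Rm]] by simp
  have l2: "\<xi> (?X ox ?Y) ?Z \<in> module_maps D (T A) (TenO MD (Tm A (TenO MC P Q)) R') (Tm A (TenO MC (TenO MC P Q) R))"
   unfolding R' using xi_module_map[OF MC_modules(1)[OF P Q] R] by simp
  have r1: "Ident C ?X xD \<xi> ?Y ?Z \<in> module_maps D (T A) (TenO MD P' (TenO MD Q' R')) (TenO MD P' (Tm A (TenO MC Q R)))"
   unfolding P' Q' R' using ten[OF Pm D_ten[OF Qm Rm] Pm mT[OF MC_modules(1)[OF Q R]] idm[OF Pm] xi_module_map[OF Q R]] by simp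
  have r2: "\<xi> ?X (?Y ox ?Z) \<in> module_maps D (T A) (TenO MD P' (Tm A (TenO MC Q R))) (Tm A (TenO MC P (TenO MC Q R)))"
   unfolding P' using xi_module_map[OF P MC_modules(1)[OF Q R]] by simp
  have s: "Assoc C ?X ?Y ?Z \<in> module_maps D (T A) (Tm A (TenO MC (TenO MC P Q) R)) (Tm A (TenO MC P (TenO MC Q R)))"
   using P Q R by (intro module_maps_T[OF A] MC_modules)
  note PQ = MC_modules(1)[OF P Q] and QR = MC_modules(1)[OF Q R]
  note PQR = MC_modules(1)[OF PQ R] MC_modules(1)[OF P QR]
  note m = D_ten[OF D_ten[OF Pm Qm] Rm] D_ten[OF mT[OF PQ] Rm] D_ten[OF Pm D_ten[OF Qm Rm]] D_ten[OF Pm mT[OF QR]] mT[OF PQR(1)] mT[OF PQR(2)]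
  have l: "La ?X ?Y ?Z \<in> module_maps D (T A) (TenO MD (TenO MD P' Q') R') (Tm A (TenO MC (TenO MC P Q) R))"
   unfolding La_def by (rule comp[OF _ _ _ l1 l2]) (use m P' Q' R' in simp_all)
  have r: "Th ?X ?Y ?Z \<in> module_maps D (T A) (TenO MD P' (TenO MD Q' R')) (Tm A (TenO MC P (TenO MC Q R)))"
   unfolding Th_def by (rule comp[OF _ _ _ r1 r2]) (use m P' Q' R' in simp_all)
  let ?t = "inv_arrow C (?X oD ?Y oD ?Z) (?X ox ?Y ox ?Z) (Th ?X ?Y ?Z)"
  have ri: "?t \<in> module_maps D (T A) (Tm A (TenO MC P (TenO MC Q R))) (TenO MD P' (TenO MD Q' R'))"
   using D.module_maps_inverse[OF AT _ _ r] m P' Q' R' Th_iso[OF o] by simp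
  have "?t oo (Assoc C ?X ?Y ?Z oo La ?X ?Y ?Z) \<in> module_maps D (T A) (TenO MD (TenO MD P' Q') R') (TenO MD P' (TenO MD Q' R'))"
   by (rule comp[OF _ _ _ comp[OF _ _ _ l s] ri]) (use m P' Q' R' in simp_all)
  moreover have "?t oo (Assoc C ?X ?Y ?Z oo La ?X ?Y ?Z) = Assoc D ?X ?Y ?Z"
   unfolding La_assoc[OF o] using o by (simp add: C.inv_comp[OF Th_iso])
  ultimately show ?thesis using P' Q' R' by simp
 qed
qed

definition GT :: "('o \<times> 'a, 'a, 'o \<times> 'a, 'a) mon_fun" where
 "GT = \<lparr>FO = Tm A, FA = (%f. f), FXi = (%P Q. \<xi> (fst P) (fst Q)), FEta = \<eta>\<rparr>"

lemma cat_functor_GT: "cat_functor MC MD GT"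
 by (intro cat_functor.intro cat_functor_axioms.intro C.module_cat_category D.module_cat_category A A' algebra_T coalgebra_T)
  (simp_all add: GT_def C.mc_simps(1-8) D.mc_simps(1-8) module_T A module_maps_T same)

lemma monoidal_functor_GT: "monoidal_functor MC MD GT"
proof (intro monoidal_functor.intro monoidal_functor_axioms.intro monC monoidal_MD cat_functor_GT)
 note s = GT_def mon_fun.simps cat_fun.simps C.mc_simps(1-8) D.mc_simps(1-8) Tm_simps mem_Collect_eq fst_ten same
 note iso = D.module_iso_arrowI[OF algebra_T[OF A] coalgebra_T[OF A']]
 note mT = module_T[OF A]
 {
  fix P Q assume "P \<in> Obj MC" "Q \<in> Obj MC"
  then have P: "module_in C A P" and Q: "module_in C A Q" by (simp_all add: s)
  show "iso_arrow MD (FO GT P ox\<^bsub>MD\<^esub> FO GT Q) (FO GT (P ox\<^bsub>MC\<^esub> Q)) (FXi GT P Q)"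
   unfolding s by (rule iso[OF D_ten_module[OF P Q] mT[OF MC_modules(1)[OF P Q]] xi_module_map[OF P Q]])
    (use module_obj[OF P] module_obj[OF Q] xi_iso' in simp)
 next
  fix P P' Q Q' f g assume "P \<in> Obj MC" "P' \<in> Obj MC" "Q \<in> Obj MC" "Q' \<in> Obj MC" "f \<in> Hom MC P P'" "g \<in> Hom MC Q Q'"
  then have m: "module_in C A P" "module_in C A P'" "module_in C A Q" "module_in C A Q'" and f: "f \<in> module_maps C A P P'" "g \<in> module_maps C A Q Q'"
   by (simp_all add: s)
  note o = m[THEN module_obj]
  show "FXi GT P' Q' oo\<^bsub>MD\<^esub> (FA GT f xx\<^bsub>MD\<^esub> FA GT g) = FA GT (f xx\<^bsub>MC\<^esub> g) oo\<^bsub>MD\<^esub> FXi GT P Q"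
   unfolding s using C.module_mapsD[OF f(1) o(1,2)] C.module_mapsD[OF f(2) o(3,4)] by (intro xi_nat)
 next
  show "iso_arrow MD (Unit MD) (FO GT (Unit MC)) (FEta GT)"
   unfolding s by (rule iso[OF D_unit_module mT[OF MC_modules(2)] eta_module_map]) (use eta_iso' in simp)
 next
  fix P Q R assume "P \<in> Obj MC" "Q \<in> Obj MC" "R \<in> Obj MC"
  then have m: "module_in C A P" "module_in C A Q" "module_in C A R" by (simp_all add: s)
  note o = m[THEN module_obj]
  show "FA GT (Assoc MC P Q R) oo\<^bsub>MD\<^esub> FXi GT (P ox\<^bsub>MC\<^esub> Q) R oo\<^bsub>MD\<^esub> (FXi GT P Q xx\<^bsub>MD\<^esub> Ident MD (FO GT R)) =
   FXi GT P (Q ox\<^bsub>MC\<^esub> R) oo\<^bsub>MD\<^esub> (Ident MD (FO GT P) xx\<^bsub>MD\<^esub> FXi GT Q R) oo\<^bsub>MD\<^esub> Assoc MD (FO GT P) (FO GT Q) (FO GT R)"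
   unfolding s using La_assoc[OF o] o unfolding La_def Th_def by simp
 next
  fix P assume "P \<in> Obj MC"
  then have o: "fst P \<in> Obj C" using module_obj by (simp add: s)
  show "FA GT (LUnit MC P) oo\<^bsub>MD\<^esub> FXi GT (Unit MC) P oo\<^bsub>MD\<^esub> (FEta GT xx\<^bsub>MD\<^esub> Ident MD (FO GT P)) = LUnit MD (FO GT P)"
   unfolding s by (rule xi_lunit'[OF o])
  show "FA GT (RUnit MC P) oo\<^bsub>MD\<^esub> FXi GT P (Unit MC) oo\<^bsub>MD\<^esub> (Ident MD (FO GT P) xx\<^bsub>MD\<^esub> FEta GT) = RUnit MD (FO GT P)"
   unfolding s by (rule xi_runit'[OF o])
 }
qed

text \<open>Sending an action \<open>\<theta>\<close> to \<open>\<theta> \<xi>\<close> is a bijection between the module structures on an object and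
 keeps the module maps; the maps \<open>\<xi>\<close> and \<open>\<eta>\<close> of \<open>F\<close> are module maps and make this functor
 monoidal.\<close>
lemma module_equivalence: "monoidal_equivalence MC MD GT"
proof -
 let ?G = "\<lparr>FO = inv.Tm (T A), FA = (%f. f)\<rparr> :: ('o \<times> 'a, 'a, 'o \<times> 'a, 'a) cat_fun"
 note AT = algebra_T[OF A] note AT' = coalgebra_T[OF A'] and Ti = T_inverse[OF A A']
 have G: "cat_functor MD MC ?G"
  by (intro cat_functor.intro cat_functor_axioms.intro C.module_cat_category D.module_cat_category A A' AT AT')
   (use inv.module_T[OF AT] inv.module_maps_T[OF AT] in \<open>simp_all add: Ti C.mc_simps(1-8) D.mc_simps(1-8) same\<close>)
 have "equivalence_functor MC MD GT"
  by (rule equivalence_functorI[OF cat_functor_GT G])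
   (simp_all add: GT_def C.mc_simps(1-8) D.mc_simps(1-8) Tm_inverse[OF A] Tm_inverse'[OF A])
 then show ?thesis using monoidal_functor_GT unfolding monoidal_equivalence_def by blast
qed

end

end

section \<open>Bilinear forms acting on tensor products of comodules\<close>

context coalgebra
begin

abbreviation oneH where "oneH \<equiv> \<one>\<^bsub>H\<^esub>"


lemma form_closed: "bform \<phi> ==> x el H ==> y el H ==> \<phi> x y el k"
 using bilinear_closed[of k H H K \<phi> x y] by (simp add: bilinear_form_iff)

lemma linear_form:
 "bform \<phi> ==> x el H ==> lmap P H f ==> lmap P K (%y. \<phi> x (f y))"
 "bform \<phi> ==> x el H ==> lmap P H f ==> lmap P K (%y. \<phi> (f y) x)"
 unfolding bilinear_form_iff by (auto intro: bilinear_left bilinear_right)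

lemma bilinear_formI:
 assumes "!!x. x el H ==> lmap H K (%y. \<phi> x y)" "!!y. y el H ==> lmap H K (%x. \<phi> x y)"
 shows "bform \<phi>"
 using assms by (simp add: bilinear_form_def)

lemma bilinear_flip: "bform \<phi> ==> bform (%x y. \<phi> y x)"
 by (simp add: bilinear_form_def)

context
 fixes \<phi> \<psi> assumes \<phi>: "bform \<phi>" and \<psi>: "bform \<psi>"
begin

lemma bilinear_conv: "bform (conv k H \<phi> \<psi>)"
 unfolding conv_def using form_closed[OF \<phi>] form_closed[OF \<psi>]
 by (intro bilinear_formI) (auto intro!: lin linear_form[OF \<phi>] linear_form[OF \<psi>])

lemma conv_smult:
 assumes "x el H" "y el H" "module k G" "v el G"
 shows "conv k H \<phi> \<psi> x y *[G] v = tsum G (comult H x) (%x1 x2. tsum G (comult H y) (%y1 y2. \<phi> x1 y1 *[G] (\<psi> x2 y2 *[G] v)))"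
proof -
 note [simp] = form_closed[OF \<phi>] form_closed[OF \<psi>]
 have "conv k H \<phi> \<psi> x y *[G] v = tsum G (comult H x) (%x1 x2. tsum k (comult H y) (%y1 y2. \<phi> x1 y1 \<otimes> \<psi> x2 y2) *[G] v)"
  unfolding conv_def using assms by (intro smult_m) auto
 also have "... = tsum G (comult H x) (%x1 x2. tsum G (comult H y) (%y1 y2. (\<phi> x1 y1 \<otimes> \<psi> x2 y2) *[G] v))"
  using assms by (intro comult_cong smult_m) auto
 also have "... = tsum G (comult H x) (%x1 x2. tsum G (comult H y) (%y1 y2. \<phi> x1 y1 *[G] (\<psi> x2 y2 *[G] v)))"
  using assms by (intro comult_cong) (auto simp: mult_smult)
 finally show ?thesis .
qed

lemma conv_flip:
 assumes "x el H" "y el H"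
 shows "conv k H (%x y. \<phi> y x) (%x y. \<psi> y x) x y = conv k H \<phi> \<psi> y x"
 using form_closed[OF \<phi>] form_closed[OF \<psi>] tsum_swap[OF module_K comult_pairs[OF assms(1)] comult_pairs[OF assms(2)], of "%x1 x2 y1 y2. \<phi> y1 x1 \<otimes> \<psi> y2 x2"]
 unfolding conv_def by (simp add: tsum_K)

end

text \<open>The map \<open>m \<otimes> n \<mapsto> \<Sum> \<phi>(m\<^sub>-\<^sub>1, n\<^sub>-\<^sub>1) u(m\<^sub>0, n\<^sub>0)\<close>. The braiding and the comparison \<open>\<xi>\<close> have
 this form, and their composites are governed by convolution of the forms.\<close>
definition act where
 "act G M N \<phi> u m n = tsum G (coact M m) (%g m0. tsum G (coact N n) (%h n0. \<phi> g h *[G] u m0 n0))"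

definition act3 where
 "act3 G M N P \<phi> u m n p = tsum G (coact M m) (%g m0. tsum G (coact N n) (%h n0. tsum G (coact P p) (%l p0. \<phi> g h l *[G] u m0 n0 p0)))"

lemma act3_cong:
 assumes "precomod M" "precomod N" "precomod P" "m el M" "n el N" "p el P"
  "!!g h l. g el H ==> h el H ==> l el H ==> \<phi> g h l = \<psi> g h l"
 shows "act3 G M N P \<phi> u m n p = act3 G M N P \<psi> u m n p"
 unfolding act3_def using assms by (intro coact_cong) auto

lemma act_cong:
 assumes "precomod M" "precomod N" "m el M" "n el N"
  "!!g h. g el H ==> h el H ==> \<phi> g h = \<psi> g h"
  "!!m n. m el M ==> n el N ==> u m n = v m n"
 shows "act G M N \<phi> u m n = act G M N \<psi> v m n"
 unfolding act_def using assms by (intro coact_cong) auto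

context
 fixes M N G and u
 assumes M: "comod M" and N: "comod N" and G: "module k G"
  and u: "!!m. m el M ==> lmap N G (%n. u m n)" "!!n. n el N ==> lmap M G (%m. u m n)"
begin

lemma act_closed:
 assumes \<phi>: "bform \<phi>" and "m el M" "n el N"
 shows "act G M N \<phi> u m n el G"
 unfolding act_def using assms form_closed[OF \<phi>] linear_closed[OF u(1)] M N G by simp

lemma linear_act:
 assumes \<phi>: "bform \<phi>"
 shows "m el M ==> lmap N G (%n. act G M N \<phi> u m n)" "n el N ==> lmap M G (%m. act G M N \<phi> u m n)"
 unfolding act_def using form_closed[OF \<phi>] linear_closed[OF u(1)] M N G by (auto intro!: lin linear_form[OF \<phi>] linear_comp[OF _ u(1)] linear_comp[OF _ u(2)])

lemma act_swap:
 assumes \<phi>: "bform \<phi>" and m: "m el M" and n: "n el N"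
 shows "act G M N \<phi> u m n = act G N M (%h g. \<phi> g h) (%n m. u m n) n m"
 unfolding act_def using form_closed[OF \<phi>] linear_closed[OF u(1)] M N G m n by (intro swap_cc) simp_all

text \<open>Coassociativity of \<open>M\<close> and \<open>N\<close> replaces the iterated coactions by coproducts, whose sum is the
 convolution product.\<close>
lemma act_act:
 assumes \<phi>: "bform \<phi>" and \<psi>: "bform \<psi>" and m: "m el M" and n: "n el N"
 shows "act G M N \<phi> (act G M N \<psi> u) m n = act G M N (conv k H \<phi> \<psi>) u m n"
proof -
 note mods [simp] = M[THEN comodule_precomod] N[THEN comodule_precomod] G
 note [lin] = linear_comp[OF _ u(1)] linear_comp[OF _ u(2)]
 note [simp] = linear_closed[OF u(1)]
 note [simp] = form_closed[OF \<phi>] form_closed[OF \<psi>]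
 note [lin] = linear_form[OF \<phi>] linear_form[OF \<psi>]
 let ?S = "%t. tsum G t"
 have "act G M N \<phi> (act G M N \<psi> u) m n =
  ?S (coact M m) (%g m'. ?S (coact N n) (%h n'. ?S (coact M m') (%g2 m0. \<phi> g h *[G] ?S (coact N n') (%h2 n0. \<psi> g2 h2 *[G] u m0 n0))))"
  unfolding act_def using m n by (intro coact_cong smult_c) simp_all
 also have "... = ?S (coact M m) (%g m'. ?S (coact N n) (%h n'. ?S (coact M m') (%g2 m0. ?S (coact N n') (%h2 n0. \<phi> g h *[G] (\<psi> g2 h2 *[G] u m0 n0)))))"
  using m n by (intro coact_cong smult_c) simp_all
 also have "... = ?S (coact M m) (%g m0. ?S (coact N n) (%h n0. ?S (comult H g) (%g1 g2. ?S (comult H h) (%h1 h2. \<phi> g1 h1 *[G] (\<psi> g2 h2 *[G] u m0 n0)))))"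
  by (rule coact2_coassoc[OF M N m n G, symmetric]) (auto intro!: lin)
 also have "... = act G M N (conv k H \<phi> \<psi>) u m n"
  unfolding act_def using m n by (intro coact_cong conv_smult[OF \<phi> \<psi>, symmetric]) simp_all
 finally show ?thesis .
qed

lemma act_counit:
 assumes m: "m el M" and n: "n el N"
 shows "act G M N (%g h. counit H g \<otimes> counit H h) u m n = u m n"
proof -
 note mods [simp] = M[THEN comodule_precomod] N[THEN comodule_precomod] G
 note [lin] = linear_comp[OF _ u(1)] linear_comp[OF _ u(2)]
 note [simp] = linear_closed[OF u(1)]
 have "act G M N (%g h. counit H g \<otimes> counit H h) u m n =
  tsum G (coact M m) (%g m0. tsum G (coact N n) (%h n0. counit H h *[G] (counit H g *[G] u m0 n0)))"
  unfolding act_def using m n by (intro coact_cong) (simp_all add: mult_smult smult_commute)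
 also have "... = tsum G (coact M m) (%g m0. counit H g *[G] u m0 n)"
  using m n by (intro coact_cong coact_counit N) (auto intro!: lin)
 also have "... = u m n"
  using m n by (intro coact_counit M) (auto intro!: lin)
 finally show ?thesis .
qed

lemma act_inverse:
 assumes \<phi>: "bform \<phi>" and \<psi>: "bform \<psi>" and m: "m el M" and n: "n el N"
  and inv: "!!x y. x el H ==> y el H ==> conv k H \<phi> \<psi> x y = counit H x \<otimes> counit H y"
 shows "act G M N \<phi> (act G M N \<psi> u) m n = u m n"
 unfolding act_act[OF assms(1-4)] act_counit[OF m n, symmetric]
 using m n inv M N by (intro act_cong) simp_all

lemma linear_act_push:
 assumes \<phi>: "bform \<phi>" and L: "lmap G G' L" and G': "module k G'" and m: "m el M" and n: "n el N"
 shows "L (act G M N \<phi> u m n) = act G' M N \<phi> (%m n. L (u m n)) m n"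
proof -
 note mods [simp] = M[THEN comodule_precomod] N[THEN comodule_precomod] G
 note [lin] = linear_comp[OF _ u(1)] linear_comp[OF _ u(2)]
 note [simp] = linear_closed[OF u(1)]
 note [simp] = form_closed[OF \<phi>] G'
 have "L (act G M N \<phi> u m n) = tsum G' (coact M m) (%g m0. L (tsum G (coact N n) (%h n0. \<phi> g h *[G] u m0 n0)))"
  unfolding act_def using m n by (intro linear_tsum[OF _ _ L coact_pairs]) simp_all
 also have "... = tsum G' (coact M m) (%g m0. tsum G' (coact N n) (%h n0. L (\<phi> g h *[G] u m0 n0)))"
  using m n by (intro coact_cong linear_tsum[OF _ _ L coact_pairs]) simp_all
 also have "... = act G' M N \<phi> (%m n. L (u m n)) m n"
  unfolding act_def using m n by (intro coact_cong) (simp_all add: linear_smult[OF L])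
 finally show ?thesis .
qed

lemma act_colinear:
 assumes \<phi>: "bform \<phi>" and M': "comod M'" and N': "comod N'"
  and f: "colinear M' M f" and g: "colinear N' N g" and m: "m el M'" and n: "n el N'"
 shows "act G M N \<phi> u (f m) (g n) = act G M' N' \<phi> (%m n. u (f m) (g n)) m n"
proof -
 note mods [simp] = M[THEN comodule_precomod] N[THEN comodule_precomod] G
 note [lin] = linear_comp[OF _ u(1)] linear_comp[OF _ u(2)]
 note [simp] = linear_closed[OF u(1)]
 note [simp] = form_closed[OF \<phi>] linear_closed[OF colinear_linear[OF f]] linear_closed[OF colinear_linear[OF g]] M'[THEN comodule_precomod] N'[THEN comodule_precomod]
 note [lin] = linear_form[OF \<phi>]
 have "act G M N \<phi> u (f m) (g n) = tsum G (coact M' m) (%g' m0. tsum G (coact N (g n)) (%h n0. \<phi> g' h *[G] u (f m0) n0))"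
  unfolding act_def using m n by (intro coact_colinear[OF f]) (auto intro!: lin)
 also have "... = act G M' N' \<phi> (%m n. u (f m) (g n)) m n"
  unfolding act_def using m n by (intro coact_cong coact_colinear[OF g]) (auto intro!: lin)
 finally show ?thesis .
qed

end

context
 fixes M N P G and u
 assumes M: "comod M" and N: "comod N" and P: "comod P" and G: "module k G"
  and u: "!!n p. n el N ==> p el P ==> lmap M G (%m. u m n p)"
   "!!m p. m el M ==> p el P ==> lmap N G (%n. u m n p)"
   "!!m n. m el M ==> n el N ==> lmap P G (%p. u m n p)"
begin

text \<open>Forms acting one after the other on overlapping pairs of factors amount to one trilinear form.
 The forms that arise here are those in the multiplicativity axioms of a universal \<open>R\<close>-form.\<close>
lemma act3_12_13:
 assumes \<phi>: "bform \<phi>" and \<psi>: "bform \<psi>" and m: "m el M" and n: "n el N" and p: "p el P"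
 shows "act G M N \<phi> (%m n. act G M P \<psi> (%m p. u m n p) m p) m n =
  act3 G M N P (%g h l. tsum k (comult H g) (%g1 g2. \<phi> g1 h \<otimes> \<psi> g2 l)) u m n p"
proof -
 note mods [simp] = M[THEN comodule_precomod] N[THEN comodule_precomod] P[THEN comodule_precomod] G
 note [lin] = linear_comp[OF _ u(1)] linear_comp[OF _ u(2)] linear_comp[OF _ u(3)]
 note [simp] = linear_closed[OF u(1)]
 note [simp] = form_closed[OF \<phi>] form_closed[OF \<psi>]
 note [lin] = linear_form[OF \<phi>] linear_form[OF \<psi>]
 let ?S = "%t. tsum G t"
 have "act G M N \<phi> (%m n. act G M P \<psi> (%m p. u m n p) m p) m n =
  ?S (coact M m) (%g m'. ?S (coact N n) (%h n0. ?S (coact M m') (%g2 m0. \<phi> g h *[G] ?S (coact P p) (%l p0. \<psi> g2 l *[G] u m0 n0 p0))))"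
  unfolding act_def using m n p by (intro coact_cong smult_c) simp_all
 also have "... = ?S (coact M m) (%g m'. ?S (coact N n) (%h n0. ?S (coact M m') (%g2 m0. ?S (coact P p) (%l p0. \<phi> g h *[G] (\<psi> g2 l *[G] u m0 n0 p0)))))"
  using m n p by (intro coact_cong smult_c) simp_all
 also have "... = ?S (coact M m) (%g m'. ?S (coact M m') (%g2 m0. ?S (coact N n) (%h n0. ?S (coact P p) (%l p0. \<phi> g h *[G] (\<psi> g2 l *[G] u m0 n0 p0)))))"
  using m n p by (intro coact_cong swap_cc) simp_all
 also have "... = ?S (coact M m) (%g m0. ?S (comult H g) (%g1 g2. ?S (coact N n) (%h n0. ?S (coact P p) (%l p0. \<phi> g1 h *[G] (\<psi> g2 l *[G] u m0 n0 p0)))))"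
  using m n p by (intro coact_coassoc[OF M, symmetric]) (auto intro!: lin)
 also have "... = ?S (coact M m) (%g m0. ?S (coact N n) (%h n0. ?S (comult H g) (%g1 g2. ?S (coact P p) (%l p0. \<phi> g1 h *[G] (\<psi> g2 l *[G] u m0 n0 p0)))))"
  using m n p by (intro coact_cong swap_mc) simp_all
 also have "... = ?S (coact M m) (%g m0. ?S (coact N n) (%h n0. ?S (coact P p) (%l p0. ?S (comult H g) (%g1 g2. \<phi> g1 h *[G] (\<psi> g2 l *[G] u m0 n0 p0)))))"
  using m n p by (intro coact_cong swap_mc) simp_all
 also have "... = ?S (coact M m) (%g m0. ?S (coact N n) (%h n0. ?S (coact P p) (%l p0. ?S (comult H g) (%g1 g2. (\<phi> g1 h \<otimes> \<psi> g2 l) *[G] u m0 n0 p0))))"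
  using m n p by (intro coact_cong comult_cong) (simp_all add: mult_smult)
 also have "... = act3 G M N P (%g h l. tsum k (comult H g) (%g1 g2. \<phi> g1 h \<otimes> \<psi> g2 l)) u m n p"
  unfolding act3_def using m n p by (intro coact_cong smult_m[symmetric]) simp_all
 finally show ?thesis .
qed

lemma act3_23_13:
 assumes \<phi>: "bform \<phi>" and \<psi>: "bform \<psi>" and m: "m el M" and n: "n el N" and p: "p el P"
 shows "act G N P \<phi> (%n p. act G M P \<psi> (%m p. u m n p) m p) n p =
  act3 G M N P (%g h l. tsum k (comult H l) (%l1 l2. \<phi> h l1 \<otimes> \<psi> g l2)) u m n p"
proof -
 note mods [simp] = M[THEN comodule_precomod] N[THEN comodule_precomod] P[THEN comodule_precomod] G
 note [lin] = linear_comp[OF _ u(1)] linear_comp[OF _ u(2)] linear_comp[OF _ u(3)]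
 note [simp] = linear_closed[OF u(1)]
 note [simp] = form_closed[OF \<phi>] form_closed[OF \<psi>]
 note [lin] = linear_form[OF \<phi>] linear_form[OF \<psi>]
 let ?S = "%t. tsum G t"
 have "act G N P \<phi> (%n p. act G M P \<psi> (%m p. u m n p) m p) n p =
  ?S (coact N n) (%h n0. ?S (coact P p) (%l p'. ?S (coact M m) (%g m0. \<phi> h l *[G] ?S (coact P p') (%l2 p0. \<psi> g l2 *[G] u m0 n0 p0))))"
  unfolding act_def using m n p by (intro coact_cong smult_c) simp_all
 also have "... = ?S (coact N n) (%h n0. ?S (coact P p) (%l p'. ?S (coact M m) (%g m0. ?S (coact P p') (%l2 p0. \<phi> h l *[G] (\<psi> g l2 *[G] u m0 n0 p0)))))"
  using m n p by (intro coact_cong smult_c) simp_all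
 also have "... = ?S (coact N n) (%h n0. ?S (coact M m) (%g m0. ?S (coact P p) (%l p'. ?S (coact P p') (%l2 p0. \<phi> h l *[G] (\<psi> g l2 *[G] u m0 n0 p0)))))"
  using m n p by (intro coact_cong swap_cc) simp_all
 also have "... = ?S (coact M m) (%g m0. ?S (coact N n) (%h n0. ?S (coact P p) (%l p'. ?S (coact P p') (%l2 p0. \<phi> h l *[G] (\<psi> g l2 *[G] u m0 n0 p0)))))"
  using m n p by (intro swap_cc) simp_all
 also have "... = ?S (coact M m) (%g m0. ?S (coact N n) (%h n0. ?S (coact P p) (%l p0. ?S (comult H l) (%l1 l2. \<phi> h l1 *[G] (\<psi> g l2 *[G] u m0 n0 p0)))))"
  using m n p by (intro coact_cong coact_coassoc[OF P, symmetric]) (auto intro!: lin)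
 also have "... = ?S (coact M m) (%g m0. ?S (coact N n) (%h n0. ?S (coact P p) (%l p0. ?S (comult H l) (%l1 l2. (\<phi> h l1 \<otimes> \<psi> g l2) *[G] u m0 n0 p0))))"
  using m n p by (intro coact_cong comult_cong) (simp_all add: mult_smult)
 also have "... = act3 G M N P (%g h l. tsum k (comult H l) (%l1 l2. \<phi> h l1 \<otimes> \<psi> g l2)) u m n p"
  unfolding act3_def using m n p by (intro coact_cong smult_m[symmetric]) simp_all
 finally show ?thesis .
qed

end

end

context nonassoc_bialgebra
begin

lemma act_ct_left:
 assumes M: "comod M" and N: "comod N" and P: "comod P" and G: "module k G"
  and \<phi>: "bform \<phi>" and m: "m el M" and n: "n el N" and p: "p el P"
  and u: "!!s. s el (ct H M N) ==> lmap P G (%p. u s p)"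
   "!!p. p el P ==> lmap (ct H M N) G (%s. u s p)"
 shows "act G (ct H M N) P \<phi> u (ut M N m n) p = act3 G M N P (%g h l. \<phi> (g *<H> h) l) (%m n p. u (ut M N m n) p) m n p"
 unfolding act_def act3_def using M N P G m n p form_closed[OF \<phi>] linear_closed[OF u(1)]
 by (intro tsum_coact_ct) (auto intro!: lin linear_form[OF \<phi>] u linear_comp[OF _ u(1)] linear_comp[OF _ u(2)])

lemma act_ct_right:
 assumes M: "comod M" and N: "comod N" and P: "comod P" and G: "module k G"
  and \<phi>: "bform \<phi>" and m: "m el M" and n: "n el N" and p: "p el P"
  and u: "!!s. s el (ct H N P) ==> lmap M G (%m. u m s)"
   "!!m. m el M ==> lmap (ct H N P) G (%s. u m s)"
 shows "act G M (ct H N P) \<phi> u m (ut N P n p) = act3 G M N P (%g h l. \<phi> g (h *<H> l)) (%m n p. u m (ut N P n p)) m n p"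
 unfolding act_def act3_def using M N P G m n p form_closed[OF \<phi>] linear_closed[OF u(1)]
 by (intro coact_cong tsum_coact_ct) (auto intro!: lin linear_form[OF \<phi>] u linear_comp[OF _ u(1)] linear_comp[OF _ u(2)])

end

section \<open>The braiding of comodules\<close>

context coalgebra
begin

lemma act3_cong':
 assumes "precomod M" "precomod N" "precomod P" "m el M" "n el N" "p el P"
  "!!g h l. g el H ==> h el H ==> l el H ==> \<phi> g h l = \<psi> g h l"
  "!!m n p. m el M ==> n el N ==> p el P ==> u m n p = v m n p"
 shows "act3 G M N P \<phi> u m n p = act3 G M N P \<psi> v m n p"
 unfolding act3_def using assms by (intro coact_cong) auto

lemma comod_src_tgt:
 "[|X \<in> Obj (comod_cat k H r); Y \<in> Obj (comod_cat k H r); f \<in> Hom (comod_cat k H r) X Y|] ==> fst f = X \<and> cod f = Y"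
 using hom_iff by blast

end

context bialgebra
begin

lemma assoc_inverse:
 assumes "comod M" "comod N" "comod P"
 shows "inverse_arrows (comod_cat k H r) (ct H (ct H M N) P) (ct H M (ct H N P))
  (Assoc (comod_cat k H r) M N P) (comod_arrow (ct H M (ct H N P)) (ct H (ct H M N) P) (assoc_inv H M N P))"
 by (rule assoc_inverseI[OF _ assms]) (rule colinear_assoc)

lemma comod_monoidal: "monoidal_category (comod_cat k H r)"
 by (rule comod_monoidalI) (rule colinear_assoc)

lemma comod_monoidal_st: "monoidal_category_st (comod_cat k H r) fst cod"
 by (intro monoidal_category_st.intro monoidal_category_st_axioms.intro comod_monoidal comod_src_tgt)

lemma inv_assoc:
 assumes "comod M" "comod N" "comod P"
 shows "inv_arrow (comod_cat k H r) (ct H (ct H M N) P) (ct H M (ct H N P))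
  (Assoc (comod_cat k H r) M N P) = comod_arrow (ct H M (ct H N P)) (ct H (ct H M N) P) (assoc_inv H M N P)"
 by (rule monoidal_category_st.inv_arrow_eq[OF comod_monoidal_st assoc_inverse[OF assms]])
  (use assms in \<open>simp_all add: cc_simps\<close>)

lemma colinear_assoc_inv:
 assumes "comod M" "comod N" "comod P"
 shows "colinear (ct H M (ct H N P)) (ct H (ct H M N) P) (assoc_inv H M N P)"
 using assoc_inverse[OF assms, of undefined] assms
 by (simp add: inverse_arrows_def cc_simps comod_arrow_hom)

context
 fixes r assumes r: "bform r"
begin

lemma braid_map_eq: "braid_map H r M N = (%t. tsum (ct H N M) (untens t) (act (ct H N M) M N (%g h. r h g) (%m n. ut N M n m)))"
 by (simp add: braid_map_def act_def[abs_def] Let_def)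

lemma linear_braid_act:
 assumes "comod M" "comod N"
 shows "m el M ==> lmap N (ct H N M) (%n. act (ct H N M) M N (%g h. r h g) (%m n. ut N M n m) m n)"
  "n el N ==> lmap M (ct H N M) (%m. act (ct H N M) M N (%g h. r h g) (%m n. ut N M n m) m n)"
proof -
 have 1: "lmap N (ct H N M) (%n. ut N M n m)" if "m el M" for m using that assms by (auto intro!: lin)
 have 2: "lmap M (ct H N M) (%m. ut N M n m)" if "n el N" for n using that assms by (auto intro!: lin)
 note l = linear_act[OF assms _ _ _ bilinear_flip[OF r], of "ct H N M" "%m n. ut N M n m"]
 show "m el M ==> lmap N (ct H N M) (%n. act (ct H N M) M N (%g h. r h g) (%m n. ut N M n m) m n)"
  "n el N ==> lmap M (ct H N M) (%m. act (ct H N M) M N (%g h. r h g) (%m n. ut N M n m) m n)"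
  using l 1 2 assms by auto
qed

lemma linear_braid_map:
 assumes "comod M" "comod N"
 shows "lmap (ct H M N) (ct H N M) (braid_map H r M N)"
 unfolding braid_map_eq using assms linear_braid_act by (intro linear_untens_id) auto

lemma braid_map_utens:
 assumes "comod M" "comod N" "m el M" "n el N"
 shows "braid_map H r M N (ut M N m n) = act (ct H N M) M N (%g h. r h g) (%m n. ut N M n m) m n"
 unfolding braid_map_eq using assms linear_braid_act by (intro tsum_utens) auto

lemma braid_map_push:
 assumes M: "comod M" and N: "comod N" and m: "m el M" and n: "n el N"
  and L: "lmap (ct H N M) G L" and G: "module k G"
 shows "L (braid_map H r M N (ut M N m n)) = act G M N (%g h. r h g) (%m n. L (ut N M n m)) m n"
 unfolding braid_map_utens[OF M N m n] using M N
 by (intro linear_act_push[OF M N _ _ _ bilinear_flip[OF r] L G m n]) (auto intro!: lin)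

end

text \<open>By convolution: the braiding for the convolution inverse of \<open>r\<close> undoes the braiding for \<open>r\<close>.\<close>
lemma braid_inverse:
 assumes M: "comod M" and N: "comod N" and r: "bform r" and s: "bform s"
  and inv: "!!x y. x el H ==> y el H ==> conv k H r s x y = counit H x *<k> counit H y"
  and t: "t el (ct H M N)"
 shows "braid_map H (%x y. s y x) N M (braid_map H r M N t) = t"
proof -
 let ?MN = "ct H M N" and ?NM = "ct H N M"
 have [simp]: "module k M" "module k N" using M N by auto
 note r' = bilinear_flip[OF r] and s' = bilinear_flip[OF s]
 note L = linear_braid_map[OF s' N M]
 have ul: "!!m. m el M ==> lmap N ?MN (%n. ut M N m n)" "!!n. n el N ==> lmap M ?MN (%m. ut M N m n)"
  by (auto intro!: lin)
 show ?thesis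
 proof (rule ct_ext[OF _ _ _ linear_comp[OF linear_braid_map[OF r M N] L] linear_id _ t])
  fix m n assume m: "m el M" and n: "n el N"
  have "braid_map H (%x y. s y x) N M (braid_map H r M N (ut M N m n)) =
   act ?MN M N (%g h. r h g) (%m n. braid_map H (%x y. s y x) N M (ut N M n m)) m n"
   by (rule braid_map_push[OF r M N m n L]) simp
  also have "... = act ?MN M N (%g h. r h g) (%m n. act ?MN N M (%h g. s h g) (%n m. ut M N m n) n m) m n"
   using M N m n by (intro act_cong) (auto simp: braid_map_utens[OF s'])
  also have "... = act ?MN M N (%g h. r h g) (%m n. act ?MN M N (%g h. s h g) (ut M N) m n) m n"
   using M N m n by (intro act_cong act_swap[OF M N _ ul s', symmetric]) auto
  also have "... = ut M N m n"
   using act_inverse[OF M N _ ul r' s' m n] inv by (simp add: conv_flip[OF r s] cring.cring_simprules(14)[OF R.is_cring])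
  finally show "braid_map H (%x y. s y x) N M (braid_map H r M N (ut M N m n)) = ut M N m n" .
 qed simp_all
qed

end

context cobraided_hopf_algebra
begin

text \<open>After coassociativity has moved both coactions into coproducts, the two sides differ by the
 axiom that \<open>r\<close> intertwines the product of \<open>H\<close> with the opposite product.\<close>
lemma colinear_braid:
 assumes M: "comod M" and N: "comod N"
 shows "colinear (ct H M N) (ct H N M) (braid_map H r M N)"
 unfolding colinear_def
proof (intro conjI ballI linear_braid_map[OF r_bilinear M N])
 let ?T = "ct H M N" and ?T' = "ct H N M"
 have MN: "precomod M" "precomod N" "precomod ?T" "precomod ?T'" using M N by auto
 then have [simp]: "module k M" "module k N" by auto
 note L = linear_braid_map[OF r_bilinear M N]
 note [lin] = linear_comp[OF _ L] linear_form[OF r_bilinear]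
 note [simp] = form_closed[OF r_bilinear]
 have Lc: "lmap ?T' (tensor k H ?T') (coact ?T')" using MN(4) by (simp add: precomod_def)
 fix t assume t: "t el ?T"
 let ?S = "tsum (tensor k H ?T')" let ?G = "tensor k H ?T'"
 show "coact ?T' (braid_map H r M N t) = ?S (coact ?T t) (%h m0. tens k H ?T' h (braid_map H r M N m0))"
 proof (rule ct_ext[OF _ _ _ _ _ _ t])
  fix m n assume m: "m el M" and n: "n el N"
  have "coact ?T' (braid_map H r M N (ut M N m n)) = act ?G M N (%g h. r h g) (%m n. coact ?T' (ut N M n m)) m n"
   by (rule braid_map_push[OF r_bilinear M N m n Lc]) simp
  also have "... = ?S (coact M m) (%g m'. ?S (coact N n) (%h n'. ?S (coact N n') (%h2 n0. r h g *[?G] ?S (coact M m') (%g2 m0. tens k H ?T' (h2 *<H> g2) (ut N M n0 m0)))))"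
   unfolding act_def using m n MN by (intro coact_cong) (simp_all add: coact_ct_utens smult_c)
  also have "... = ?S (coact M m) (%g m'. ?S (coact N n) (%h n'. ?S (coact N n') (%h2 n0. ?S (coact M m') (%g2 m0. r h g *[?G] tens k H ?T' (h2 *<H> g2) (ut N M n0 m0)))))"
   using m n MN by (intro coact_cong) (simp_all add: smult_c)
  also have "... = ?S (coact M m) (%g m'. ?S (coact N n) (%h n'. ?S (coact M m') (%g2 m0. ?S (coact N n') (%h2 n0. r h g *[?G] tens k H ?T' (h2 *<H> g2) (ut N M n0 m0)))))"
   using m n MN by (intro coact_cong swap_cc) simp_all
  also have "... = ?S (coact M m) (%g m0. ?S (coact N n) (%h n0. ?S (comult H g) (%g1 g2. ?S (comult H h) (%h1 h2. r h1 g1 *[?G] tens k H ?T' (h2 *<H> g2) (ut N M n0 m0)))))"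
   using m n MN by (intro coact2_coassoc[OF M N m n, symmetric]) (auto intro!: lin)
  also have "... = ?S (coact M m) (%g m0. ?S (coact N n) (%h n0. ?S (comult H g) (%g1 g2. ?S (comult H h) (%h1 h2. r h2 g2 *[?G] tens k H ?T' (g1 *<H> h1) (ut N M n0 m0)))))"
  proof (intro coact_cong MN m n)
   fix g m0 h n0 assume g: "g el H" and m0: "m0 el M" and h: "h el H" and n0: "n0 el N"
   let ?J = "%x. tens k H ?T' x (ut N M n0 m0)"
   have J: "lmap H ?G ?J" using m0 n0 MN by (auto intro!: lin)
   have Jc [simp]: "?J x el ?G" if "x el H" for x using linear_closed[OF J that] .
   have J2: "?J (tsum H (comult H h) (%h1 h2. tsum H (comult H g) (%g1 g2. r' h1 h2 g1 g2 *[H] z h1 h2 g1 g2)))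
     = ?S (comult H g) (%g1 g2. ?S (comult H h) (%h1 h2. r' h1 h2 g1 g2 *[?G] ?J (z h1 h2 g1 g2)))"
    if [simp]: "!!h1 h2 g1 g2. h1 el H ==> h2 el H ==> g1 el H ==> g2 el H ==> r' h1 h2 g1 g2 el k"
     "!!h1 h2 g1 g2. h1 el H ==> h2 el H ==> g1 el H ==> g2 el H ==> z h1 h2 g1 g2 el H" for r' z
   proof -
    have "?J (tsum H (comult H h) (%h1 h2. tsum H (comult H g) (%g1 g2. r' h1 h2 g1 g2 *[H] z h1 h2 g1 g2)))
     = ?S (comult H h) (%h1 h2. ?J (tsum H (comult H g) (%g1 g2. r' h1 h2 g1 g2 *[H] z h1 h2 g1 g2)))"
     using g h MN by (intro linear_tsum[OF _ _ J comult_pairs]) simp_all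
    also have "... = ?S (comult H h) (%h1 h2. ?S (comult H g) (%g1 g2. ?J (r' h1 h2 g1 g2 *[H] z h1 h2 g1 g2)))"
     using g h MN by (intro comult_cong linear_tsum[OF _ _ J comult_pairs]) simp_all
    also have "... = ?S (comult H h) (%h1 h2. ?S (comult H g) (%g1 g2. r' h1 h2 g1 g2 *[?G] ?J (z h1 h2 g1 g2)))"
     using g h MN by (intro comult_cong) (simp_all add: linear_smult[OF J])
    also have "... = ?S (comult H g) (%g1 g2. ?S (comult H h) (%h1 h2. r' h1 h2 g1 g2 *[?G] ?J (z h1 h2 g1 g2)))"
     using g h MN by (intro swap_mm) simp_all
    finally show ?thesis .
   qed
   show "?S (comult H g) (%g1 g2. ?S (comult H h) (%h1 h2. r h1 g1 *[?G] ?J (h2 *<H> g2))) =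
    ?S (comult H g) (%g1 g2. ?S (comult H h) (%h1 h2. r h2 g2 *[?G] ?J (g1 *<H> h1)))"
    using arg_cong[OF r_commute[OF h g], of ?J] by (simp add: J2)
  qed
  also have "... = ?S (coact M m) (%g m'. ?S (coact N n) (%h n'. ?S (coact M m') (%g2 m0. ?S (coact N n') (%h2 n0. r h2 g2 *[?G] tens k H ?T' (g *<H> h) (ut N M n0 m0)))))"
   using m n MN by (intro coact2_coassoc[OF M N m n]) (auto intro!: lin)
  also have "... = ?S (coact M m) (%g m'. ?S (coact N n) (%h n'. tens k H ?T' (g *<H> h) (braid_map H r M N (ut M N m' n'))))"
  proof (intro coact_cong MN m n)
   fix g m' h n' assume g: "g el H" and m': "m' el M" and h: "h el H" and n': "n' el N"
   have "tens k H ?T' (g *<H> h) (braid_map H r M N (ut M N m' n')) = act ?G M N (%g h. r h g) (%m n. tens k H ?T' (g *<H> h) (ut N M n m)) m' n'"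
    by (rule braid_map_push[OF r_bilinear M N m' n']) (use g h MN in \<open>auto intro!: lin\<close>)
   then show "?S (coact M m') (%g2 m0. ?S (coact N n') (%h2 n0. r h2 g2 *[?G] tens k H ?T' (g *<H> h) (ut N M n0 m0))) =
    tens k H ?T' (g *<H> h) (braid_map H r M N (ut M N m' n'))" by (simp add: act_def)
  qed
  also have "... = ?S (coact ?T (ut M N m n)) (%h m0. tens k H ?T' h (braid_map H r M N m0))"
   using m n MN linear_closed[OF L] by (intro tsum_coact_ct[symmetric]) (auto intro!: lin)
  finally show "coact ?T' (braid_map H r M N (ut M N m n)) = ?S (coact ?T (ut M N m n)) (%h m0. tens k H ?T' h (braid_map H r M N m0))" .
 qed (use MN linear_closed[OF L] L in \<open>auto intro!: lin\<close>)
qed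

declare colinear_braid [simp]

abbreviation CC where "CC \<equiv> comod_cat k H r"
abbreviation compC (infixr \<open>oC\<close> 55) where "g oC f \<equiv> g oo\<^bsub>CC\<^esub> f"
abbreviation tenC (infixr \<open>xC\<close> 70) where "f xC g \<equiv> f xx\<^bsub>CC\<^esub> g"

lemma carr_braid [simp]: "comod M ==> comod N ==>
 carr (comod_arrow (ct H M N) (ct H N M) (braid_map H r M N))"
 by (simp add: colinear_braid left_comodule_ct)

text \<open>Both sides are \<open>act3\<close> for the trilinear form \<open>r(h l, g)\<close>, which multiplicativity in the first
 argument splits into two successive braidings.\<close>
lemma braid_hexagon1:
 assumes X: "comod X" and Y: "comod Y" and Z: "comod Z"
 shows "Assoc CC Y Z X oC Braid CC X (Y ox\<^bsub>CC\<^esub> Z) oC Assoc CC X Y Z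
     = (Ident CC Y xC Braid CC X Z) oC Assoc CC Y X Z oC (Braid CC X Y xC Ident CC Z)" (is "?lhs = ?rhs")
proof (rule carr_eq3I[of _ _ X Y Z])
 note [simp] = X Y Z left_comodule_ct
 note s = cc_simps
 let ?YZ = "ct H Y Z" and ?ZX = "ct H Z X" and ?XZ = "ct H X Z" and ?YX = "ct H Y X" and ?XY = "ct H X Y"
 let ?Q = "ct H Y ?ZX"
 show "carr ?lhs" "carr ?rhs" unfolding s by simp_all
 show "fst ?lhs = ct H ?XY Z" "fst ?rhs = ct H ?XY Z" "cod ?lhs = cod ?rhs" unfolding s by simp_all
 fix x y z assume x: "x el X" and y: "y el Y" and z: "z el Z"
 note [simp] = x y z linear_closed[OF linear_braid_map[OF r_bilinear]]
 let ?w = "%x y z. ut Y ?ZX y (ut Z X z x)"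
 have m: "module k X" "module k Y" "module k Z" by simp_all
 have "ap ?lhs (ut ?XY Z (ut X Y x y) z) = assoc_map H Y Z X (braid_map H r X ?YZ (ut X ?YZ x (ut Y Z y z)))"
  unfolding s by (simp add: assoc_map_utens)
 also have "... = act ?Q X ?YZ (%g h. r h g) (%x s. assoc_map H Y Z X (ut ?YZ X s x)) x (ut Y Z y z)"
  by (rule braid_map_push[OF r_bilinear _ _ _ _ linear_assoc_map]) simp_all
 also have "... = act3 ?Q X Y Z (%g h l. r (h *<H> l) g) (%x y z. assoc_map H Y Z X (ut ?YZ X (ut Y Z y z) x)) x y z"
  by (rule act_ct_right[OF X Y Z _ bilinear_flip[OF r_bilinear]]) (auto intro!: lin linear_comp[OF _ linear_assoc_map])
 also have "... = act3 ?Q X Y Z (%g h l. tsum k (comult H g) (%g1 g2. r h g1 *<k> r l g2)) ?w x y z"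
  by (rule act3_cong') (simp_all add: assoc_map_utens r_mult_left)
 also have "... = act ?Q X Y (%g h. r h g) (%x y. act ?Q X Z (%g h. r h g) (%x z. ?w x y z) x z) x y"
  by (rule act3_12_13[OF X Y Z _ _ _ _ bilinear_flip[OF r_bilinear] bilinear_flip[OF r_bilinear], symmetric]) (auto intro!: lin)
 finally have l: "ap ?lhs (ut ?XY Z (ut X Y x y) z) = ..." .
 define L where "L = (%s. ap (Ident CC Y xC Braid CC X Z) (assoc_map H Y X Z (ut ?YX Z s z)))"
 have L: "lmap ?YX ?Q L"
  unfolding L_def s
  by (rule linear_comp[OF linear_comp[OF linear_utens(2) linear_assoc_map] carr_linear]) (simp_all add: linear_id)
 have "ap ?rhs (ut ?XY Z (ut X Y x y) z) = L (braid_map H r X Y (ut X Y x y))"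
  unfolding L_def s by (simp add: linear_closed[OF linear_assoc_map])
 also have "... = act ?Q X Y (%g h. r h g) (%x y. L (ut Y X y x)) x y"
  by (rule braid_map_push[OF r_bilinear _ _ _ _ L]) simp_all
 also have "... = act ?Q X Y (%g h. r h g) (%x y. act ?Q X Z (%g h. r h g) (%x z. ?w x y z) x z) x y"
 proof (rule act_cong)
  fix x y assume x': "x el X" and y': "y el Y"
  have "L (ut Y X y x) = ut Y ?ZX y (braid_map H r X Z (ut X Z x z))"
   unfolding L_def s using x' y' by (simp add: assoc_map_utens)
  also have "... = act ?Q X Z (%g h. r h g) (%x z. ?w x y z) x z"
   by (rule braid_map_push[OF r_bilinear]) (use x' y' in \<open>auto intro!: lin\<close>)
  finally show "L (ut Y X y x) = act ?Q X Z (%g h. r h g) (%x z. ?w x y z) x z" .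
 qed simp_all
 finally show "ap ?lhs (ut ?XY Z (ut X Y x y) z) = ap ?rhs (ut ?XY Z (ut X Y x y) z)" using l by simp
qed (use assms in auto)

text \<open>As before, with multiplicativity in the second argument.\<close>
lemma braid_hexagon2:
 assumes X: "comod X" and Y: "comod Y" and Z: "comod Z"
 shows "Braid CC (X ox\<^bsub>CC\<^esub> Y) Z
     = Assoc CC Z X Y oC (Braid CC X Z xC Ident CC Y)
      oC inv_arrow CC ((X ox\<^bsub>CC\<^esub> Z) ox\<^bsub>CC\<^esub> Y) (X ox\<^bsub>CC\<^esub> (Z ox\<^bsub>CC\<^esub> Y)) (Assoc CC X Z Y)
      oC (Ident CC X xC Braid CC Y Z) oC Assoc CC X Y Z" (is "?lhs = ?rhs")
proof (rule carr_eq3I[of _ _ X Y Z])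
 note [simp] = X Y Z left_comodule_ct
 note inv = inv_assoc[OF X Z Y, of r, unfolded cc_simps]
 note s = inv cc_simps
 note [simp] = colinear_assoc_inv
 let ?ZY = "ct H Z Y" and ?YZ = "ct H Y Z" and ?XZ = "ct H X Z" and ?XY = "ct H X Y" and ?ZX = "ct H Z X"
 let ?Q = "ct H Z ?XY"
 show "carr ?lhs" "carr ?rhs" unfolding s by simp_all
 show "fst ?lhs = ct H ?XY Z" "fst ?rhs = ct H ?XY Z" "cod ?lhs = cod ?rhs" unfolding s by simp_all
 fix x y z assume x: "x el X" and y: "y el Y" and z: "z el Z"
 note [simp] = x y z linear_closed[OF linear_braid_map[OF r_bilinear]]
 let ?w = "%x y z. ut Z ?XY z (ut X Y x y)"
 have "ap ?lhs (ut ?XY Z (ut X Y x y) z) = act ?Q ?XY Z (%g h. r h g) (%s z. ut Z ?XY z s) (ut X Y x y) z"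
  unfolding s by (simp add: braid_map_utens[OF r_bilinear])
 also have "... = act3 ?Q X Y Z (%g h l. r l (g *<H> h)) ?w x y z"
  by (rule act_ct_left[OF X Y Z _ bilinear_flip[OF r_bilinear]]) (auto intro!: lin)
 also have "... = act3 ?Q X Y Z (%g h l. tsum k (comult H l) (%l1 l2. r l1 h *<k> r l2 g)) ?w x y z"
  by (rule act3_cong') (simp_all add: r_mult_right)
 also have "... = act ?Q Y Z (%g h. r h g) (%y z. act ?Q X Z (%g h. r h g) (%x z. ?w x y z) x z) y z"
  by (rule act3_23_13[OF X Y Z _ _ _ _ bilinear_flip[OF r_bilinear] bilinear_flip[OF r_bilinear], symmetric]) (auto intro!: lin)
 finally have l: "ap ?lhs (ut ?XY Z (ut X Y x y) z) = ..." .
 define L where "L = (%s. assoc_map H Z X Y (ap (Braid CC X Z xC Ident CC Y) (assoc_inv H X Z Y (ut X ?ZY x s))))"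
 have L: "lmap ?ZY ?Q L"
  unfolding L_def s
  by (rule linear_comp[OF linear_comp[OF linear_comp[OF linear_utens(1) linear_assoc_inv] carr_linear] linear_assoc_map]) (simp_all add: linear_id)
 have "ap ?rhs (ut ?XY Z (ut X Y x y) z) = L (braid_map H r Y Z (ut Y Z y z))"
  unfolding L_def s by (simp add: assoc_map_utens linear_closed[OF linear_assoc_inv])
 also have "... = act ?Q Y Z (%g h. r h g) (%y z. L (ut Z Y z y)) y z"
  by (rule braid_map_push[OF r_bilinear _ _ _ _ L]) simp_all
 also have "... = act ?Q Y Z (%g h. r h g) (%y z. act ?Q X Z (%g h. r h g) (%x z. ?w x y z) x z) y z"
 proof (rule act_cong)
  fix y z assume y': "y el Y" and z': "z el Z"
  let ?J = "%s. assoc_map H Z X Y (ut ?ZX Y s y)"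
  have "L (ut Z Y z y) = ?J (braid_map H r X Z (ut X Z x z))"
   unfolding L_def s using y' z' by (simp add: assoc_inv_utens)
  also have "... = act ?Q X Z (%g h. r h g) (%x z. ?J (ut Z X z x)) x z"
   by (rule braid_map_push[OF r_bilinear]) (use y' z' in \<open>auto intro!: lin linear_comp[OF _ linear_assoc_map]\<close>)
  also have "... = act ?Q X Z (%g h. r h g) (%x z. ?w x y z) x z"
   by (rule act_cong) (use y' z' in \<open>simp_all add: assoc_map_utens\<close>)
  finally show "L (ut Z Y z y) = act ?Q X Z (%g h. r h g) (%x z. ?w x y z) x z" .
 qed simp_all
 finally show "ap ?lhs (ut ?XY Z (ut X Y x y) z) = ap ?rhs (ut ?XY Z (ut X Y x y) z)" using l by simp
qed (use assms in auto)

lemma comod_braided: "braided_monoidal_category CC" (is "braided_monoidal_category ?C")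
proof -
 interpret monoidal_category ?C by (rule comod_monoidal)
 note s = cc_simps
 have obj: "X \<in> Obj ?C ==> comod X" for X by (simp add: s)
 obtain t where t: "conv_inverse k H r t" using r_invertible by blast
 then have tb: "bform t" and t1: "!!x y. x el H ==> y el H ==> conv k H r t x y = counit H x *<k> counit H y"
  and t2: "!!x y. x el H ==> y el H ==> conv k H t r x y = counit H x *<k> counit H y"
  by (simp_all add: conv_inverse_def)
 show ?thesis
 proof
  fix X Y assume "X \<in> Obj ?C" "Y \<in> Obj ?C"
  note o = this[THEN obj]
  let ?t = "%x y. t y x"
  have t2': "conv k H (%x y. t y x) (%x y. r y x) x y = counit H x *<k> counit H y" if "x el H" "y el H" for x y
   using that t2 conv_flip[OF tb r_bilinear that] by (simp add: R.m_comm)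
  show "iso_arrow ?C (X ox\<^bsub>?C\<^esub> Y) (Y ox\<^bsub>?C\<^esub> X) (Braid ?C X Y)"
   unfolding s iso_arrow_def
   by (rule exI, rule inverse_comod_arrowsI[OF _ _ colinear_braid linear_braid_map[OF bilinear_flip[OF tb]]])
    (use o braid_inverse[OF o r_bilinear tb t1] braid_inverse[OF o(2,1) bilinear_flip[OF tb] bilinear_flip[OF r_bilinear] t2'] in \<open>simp_all add: left_comodule_ct\<close>)
 next
  fix X X' Y Y' f g assume a: "X \<in> Obj ?C" "X' \<in> Obj ?C" "Y \<in> Obj ?C" "Y' \<in> Obj ?C" "f \<in> Hom ?C X X'" "g \<in> Hom ?C Y Y'"
  note o = a(1-4)[THEN obj]
  have f: "carr f" "fst f = X" "cod f = X'" and g: "carr g" "fst g = Y" "cod g = Y'" using hom_iff a by blast+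
  note cf = carr_colinear[OF f] and cg = carr_colinear[OF g]
  note [simp] = o f g left_comodule_ct linear_closed[OF linear_braid_map[OF r_bilinear]]
  have gf: "lmap (ct H Y X) (ct H Y' X') (ap (g xx\<^bsub>?C\<^esub> f))" by (rule carr_linear) simp_all
  show "Braid ?C X' Y' oo\<^bsub>?C\<^esub> (f xx\<^bsub>?C\<^esub> g) = (g xx\<^bsub>?C\<^esub> f) oo\<^bsub>?C\<^esub> Braid ?C X Y"
   unfolding s
  proof (rule carr_eq2I[of _ _ X Y])
   fix x y assume x: "x el X" and y: "y el Y"
   have "braid_map H r X' Y' (ut X' Y' (ap f x) (ap g y)) = act (ct H Y' X') X Y (%g h. r h g) (%x y. ut Y' X' (ap g y) (ap f x)) x y"
    using x y by (subst braid_map_utens[OF r_bilinear], simp_all)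
     (rule act_colinear[OF _ _ _ _ _ bilinear_flip[OF r_bilinear] _ _ cf cg], auto intro!: lin)
   also have "... = act (ct H Y' X') X Y (%g h. r h g) (%x y. ap (g xx\<^bsub>?C\<^esub> f) (ut Y X y x)) x y"
    using x y by (intro act_cong) simp_all
   also have "... = ap (g xx\<^bsub>?C\<^esub> f) (braid_map H r X Y (ut X Y x y))"
    using x y by (intro braid_map_push[OF r_bilinear _ _ _ _ gf, symmetric]) simp_all
   finally show "ap (comod_arrow (ct H X' Y') (ct H Y' X') (braid_map H r X' Y') oo\<^bsub>?C\<^esub> (f xx\<^bsub>?C\<^esub> g)) (ut X Y x y) =
     ap ((g xx\<^bsub>?C\<^esub> f) oo\<^bsub>?C\<^esub> comod_arrow (ct H X Y) (ct H Y X) (braid_map H r X Y)) (ut X Y x y)"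
    using x y by simp
  qed simp_all
 next
  fix X Y Z assume "X \<in> Obj ?C" "Y \<in> Obj ?C" "Z \<in> Obj ?C"
  note o = this[THEN obj]
  show "Assoc ?C Y Z X oo\<^bsub>?C\<^esub> Braid ?C X (Y ox\<^bsub>?C\<^esub> Z) oo\<^bsub>?C\<^esub> Assoc ?C X Y Z
     = (Ident ?C Y xx\<^bsub>?C\<^esub> Braid ?C X Z) oo\<^bsub>?C\<^esub> Assoc ?C Y X Z oo\<^bsub>?C\<^esub> (Braid ?C X Y xx\<^bsub>?C\<^esub> Ident ?C Z)"
   by (rule braid_hexagon1[OF o])
  show "Braid ?C (X ox\<^bsub>?C\<^esub> Y) Z
     = Assoc ?C Z X Y oo\<^bsub>?C\<^esub> (Braid ?C X Z xx\<^bsub>?C\<^esub> Ident ?C Y)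
      oo\<^bsub>?C\<^esub> inv_arrow ?C ((X ox\<^bsub>?C\<^esub> Z) ox\<^bsub>?C\<^esub> Y) (X ox\<^bsub>?C\<^esub> (Z ox\<^bsub>?C\<^esub> Y)) (Assoc ?C X Z Y)
      oo\<^bsub>?C\<^esub> (Ident ?C X xx\<^bsub>?C\<^esub> Braid ?C Y Z) oo\<^bsub>?C\<^esub> Assoc ?C X Y Z"
   by (rule braid_hexagon2[OF o])
 qed
qed

end

section \<open>The product deformed by a two-cocycle\<close>

context coalgebra
begin

text \<open>Convolution of bilinear maps whose values are combined by a pairing \<open>B\<close>.\<close>
definition cprod where
 "cprod G B u v x y = tsum G (comult H x) (%x1 x2. tsum G (comult H y) (%y1 y2. B (u x1 y1) (v x2 y2)))"

lemma bilinear_cprod: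
 assumes "module k A1" "module k A2" "module k G" "bilinear_map k A1 A2 G B" "bilinear_map k H H A1 u" "bilinear_map k H H A2 v"
 shows "bilinear_map k H H G (cprod G B u v)"
 unfolding cprod_def
proof (rule bilinear_mapI)
 note [simp] = assms(1-3) bilinear_closed[OF assms(5)] bilinear_closed[OF assms(6)] bilinear_closed[OF assms(4)]
 note [lin] = bilinear_left[OF assms(4)] bilinear_right[OF assms(4)] bilinear_left[OF assms(5)] bilinear_right[OF assms(5)] bilinear_left[OF assms(6)] bilinear_right[OF assms(6)]
 show "lmap H G (%n. tsum G (comult H m) (%x1 x2. tsum G (comult H n) (%y1 y2. B (u x1 y1) (v x2 y2))))" if "m el H" for m
  using that by (auto intro!: lin)
 show "lmap H G (%m. tsum G (comult H m) (%x1 x2. tsum G (comult H n) (%y1 y2. B (u x1 y1) (v x2 y2))))" if "n el H" for n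
  using that by (auto intro!: lin)
qed

lemma cprod_cong:
 assumes "x el H" "y el H"
  "!!x y. x el H ==> y el H ==> u x y = u' x y"
  "!!x y. x el H ==> y el H ==> v x y = v' x y"
 shows "cprod G B u v x y = cprod G B u' v' x y"
 unfolding cprod_def using assms by (intro comult_cong) auto

lemma cprod_push:
 assumes L: "lmap G G' L" and G: "module k G" "module k G'" and "x el H" "y el H"
  "!!x1 x2 y1 y2. x1 el H ==> x2 el H ==> y1 el H ==> y2 el H ==> B (u x1 y1) (v x2 y2) el G"
 shows "L (cprod G B u v x y) = cprod G' (%a b. L (B a b)) u v x y"
proof -
 have "L (cprod G B u v x y) = tsum G' (comult H x) (%x1 x2. L (tsum G (comult H y) (%y1 y2. B (u x1 y1) (v x2 y2))))"
  unfolding cprod_def using assms by (intro linear_tsum[OF _ _ L comult_pairs]) simp_all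
 also have "... = cprod G' (%a b. L (B a b)) u v x y"
  unfolding cprod_def using assms by (intro comult_cong linear_tsum[OF _ _ L comult_pairs]) simp_all
 finally show ?thesis .
qed

text \<open>Convolution is associative in whatever way the pairings are; the instances used below mix forms
 on \<open>H\<close> with the products of \<open>H\<close>.\<close>
lemma cprod_assoc:
 assumes mods: "module k A1" "module k A2" "module k A3" "module k A12" "module k A23" "module k G"
  and B: "bilinear_map k A1 A2 A12 B2" "bilinear_map k A12 A3 G B1" "bilinear_map k A2 A3 A23 B4" "bilinear_map k A1 A23 G B3"
  and uvw: "bilinear_map k H H A1 u" "bilinear_map k H H A2 v" "bilinear_map k H H A3 w"
  and e: "!!a b c. a el A1 ==> b el A2 ==> c el A3 ==> B1 (B2 a b) c = B3 a (B4 b c)"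
  and x: "x el H" and y: "y el H"
 shows "cprod G B1 (cprod A12 B2 u v) w x y = cprod G B3 u (cprod A23 B4 v w) x y"
proof -
 note [simp] = mods bilinear_closed[OF uvw(1)] bilinear_closed[OF uvw(2)] bilinear_closed[OF uvw(3)]
  bilinear_closed[OF B(1)] bilinear_closed[OF B(2)] bilinear_closed[OF B(3)] bilinear_closed[OF B(4)]
 note [lin] = bilinear_left[OF B(1)] bilinear_right[OF B(1)] bilinear_left[OF B(2)] bilinear_right[OF B(2)]
  bilinear_left[OF B(3)] bilinear_right[OF B(3)] bilinear_left[OF B(4)] bilinear_right[OF B(4)]
  bilinear_left[OF uvw(1)] bilinear_right[OF uvw(1)] bilinear_left[OF uvw(2)] bilinear_right[OF uvw(2)] bilinear_left[OF uvw(3)] bilinear_right[OF uvw(3)]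
 let ?S = "tsum G"
 have l1: "lmap A12 G (%a. B1 a c)" if "c el A3" for c using that by (auto intro!: lin)
 have l2: "lmap A23 G (%a. B3 c a)" if "c el A1" for c using that by (auto intro!: lin)
 have "cprod G B1 (cprod A12 B2 u v) w x y =
  ?S (comult H x) (%x' x3. ?S (comult H y) (%y' y3. cprod G (%a b. B1 (B2 a b) (w x3 y3)) u v x' y'))"
  unfolding cprod_def[of _ B1] using x y by (intro comult_cong cprod_push[OF l1]) simp_all
 also have "... = ?S (comult H x) (%x' x3. ?S (comult H y) (%y' y3. ?S (comult H x') (%x1 x2. ?S (comult H y') (%y1 y2.
   B3 (u x1 y1) (B4 (v x2 y2) (w x3 y3))))))"
  unfolding cprod_def using x y by (intro comult_cong) (simp_all add: e)
 also have "... = ?S (comult H x) (%x1 x'. ?S (comult H y) (%y1 y'. ?S (comult H x') (%x2 x3. ?S (comult H y') (%y2 y3.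
   B3 (u x1 y1) (B4 (v x2 y2) (w x3 y3))))))"
  using x y by (intro comult2_coassoc) (auto intro!: lin)
 also have "... = ?S (comult H x) (%x1 x'. ?S (comult H y) (%y1 y'. cprod G (%b c. B3 (u x1 y1) (B4 b c)) v w x' y'))"
  unfolding cprod_def ..
 also have "... = cprod G B3 u (cprod A23 B4 v w) x y"
  unfolding cprod_def[of _ B3] using x y by (intro comult_cong cprod_push[OF l2, symmetric]) simp_all
 finally show ?thesis .
qed

definition lact where "lact G \<phi> u = cprod G (%c v. c *[G] v) \<phi> u"
definition ract where "ract G \<phi> u = cprod G (%v c. c *[G] v) u \<phi>"

lemma bilinear_smult: "module k G ==> bilinear_map k K G G (%c v. c *[G] v)" "module k G ==> bilinear_map k G K G (%v c. c *[G] v)"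
 by (auto intro!: bilinear_mapI lin)

lemma conv_cprod: "conv k H \<phi> \<psi> = cprod K (%a b. a \<otimes> b) \<phi> \<psi>"
 by (simp add: conv_def[abs_def] cprod_def[abs_def] tsum_K)

lemma bilinear_lact:
 assumes "module k G" "bform \<phi>" "bilinear_map k H H G u"
 shows "bilinear_map k H H G (lact G \<phi> u)"
 unfolding lact_def
 by (rule bilinear_cprod[OF module_K assms(1) assms(1) bilinear_smult(1)[OF assms(1)] assms(2)[unfolded bilinear_form_iff] assms(3)])

lemma bilinear_ract:
 assumes "module k G" "bform \<phi>" "bilinear_map k H H G u"
 shows "bilinear_map k H H G (ract G \<phi> u)"
 unfolding ract_def
 by (rule bilinear_cprod[OF assms(1) module_K assms(1) bilinear_smult(2)[OF assms(1)] assms(3) assms(2)[unfolded bilinear_form_iff]])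

lemma ract_ract:
 assumes "module k G" "bform \<phi>" "bform \<psi>" "bilinear_map k H H G u" "x el H" "y el H"
 shows "ract G \<phi> (ract G \<psi> u) x y = ract G (conv k H \<psi> \<phi>) u x y"
 unfolding ract_def conv_cprod
 by (rule cprod_assoc[where ?A2.0=K and ?A3.0=K and ?A1.0=G and ?A12.0=G and ?A23.0=K])
  (use assms in \<open>simp_all add: bilinear_smult bilinear_smult[OF module_K, simplified] bilinear_form_iff mult_smult smult_commute\<close>)

lemma lact_ract:
 assumes "module k G" "bform \<phi>" "bform \<psi>" "bilinear_map k H H G u" "x el H" "y el H"
 shows "ract G \<psi> (lact G \<phi> u) x y = lact G \<phi> (ract G \<psi> u) x y"
 unfolding ract_def lact_def
 by (rule cprod_assoc[where ?A1.0=K and ?A2.0=G and ?A3.0=K and ?A12.0=G and ?A23.0=G])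
  (use assms in \<open>simp_all add: bilinear_smult bilinear_form_iff smult_commute\<close>)

lemma ract_counit:
 assumes G: "module k G" and u: "bilinear_map k H H G u" and x: "x el H" and y: "y el H"
 shows "ract G (%x y. counit H x \<otimes> counit H y) u x y = u x y"
proof -
 note [simp] = G bilinear_closed[OF u]
 note [lin] = bilinear_left[OF u] bilinear_right[OF u]
 have "ract G (%x y. counit H x \<otimes> counit H y) u x y =
  tsum G (comult H x) (%x1 x2. tsum G (comult H y) (%y1 y2. counit H y2 *[G] (counit H x2 *[G] u x1 y1)))"
  unfolding ract_def cprod_def using x y by (intro comult_cong) (simp_all add: mult_smult smult_commute)
 also have "... = tsum G (comult H x) (%x1 x2. counit H x2 *[G] u x1 y)"
  using x y by (intro comult_cong comult_counit_right_G) (auto intro!: lin)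
 also have "... = u x y" using x y by (intro comult_counit_right_G) (auto intro!: lin)
 finally show ?thesis .
qed

lemma ract_cong:
 assumes "x el H" "y el H"
  "!!x y. x el H ==> y el H ==> u x y = u' x y"
  "!!x y. x el H ==> y el H ==> \<phi> x y = \<phi>' x y"
 shows "ract G \<phi> u x y = ract G \<phi>' u' x y" "lact G \<phi> u x y = lact G \<phi>' u' x y"
 unfolding ract_def lact_def using assms by (auto intro: cprod_cong)

lemma ract_inverse:
 assumes G: "module k G" and f: "bform \<phi>" "bform \<psi>" and u: "bilinear_map k H H G u" and x: "x el H" and y: "y el H"
  and inv: "!!x y. x el H ==> y el H ==> conv k H \<psi> \<phi> x y = counit H x \<otimes> counit H y"
 shows "ract G \<phi> (ract G \<psi> u) x y = u x y"
 using ract_ract[OF G f u x y] ract_counit[OF G u x y] ract_cong(1)[of x y u u "conv k H \<psi> \<phi>" "%x y. counit H x \<otimes> counit H y" G] inv x y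
 by simp

lemma ract_cancel:
 assumes G: "module k G" and f: "bform \<phi>" "bform \<psi>" and u: "bilinear_map k H H G u" "bilinear_map k H H G v" and x: "x el H" and y: "y el H"
  and inv: "!!x y. x el H ==> y el H ==> conv k H \<psi> \<phi> x y = counit H x \<otimes> counit H y"
  and eq: "!!x y. x el H ==> y el H ==> ract G \<psi> u x y = ract G \<psi> v x y"
 shows "u x y = v x y"
proof -
 have "ract G \<phi> (ract G \<psi> u) x y = ract G \<phi> (ract G \<psi> v) x y"
  by (rule ract_cong(1)[OF x y]) (simp_all add: eq)
 then show ?thesis using ract_inverse[OF G f u(1) x y inv] ract_inverse[OF G f u(2) x y inv] by simp
qed

end

context bialgebra
begin

lemma tsum_comult_one_k:
 assumes "!!h. h el H ==> lmap H K (%n. F h n)" "!!n. n el H ==> lmap H K (%h. F h n)"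
 shows "tsum k (comult H oneH) F = F oneH oneH"
 using tsum_comult_one[OF module_K assms] by (simp add: tsum_K)

lemma conv_one_right:
 assumes f: "bform \<phi>" "bform \<psi>" and x: "x el H"
 shows "conv k H \<phi> \<psi> x oneH = tsum k (comult H x) (%x1 x2. \<phi> x1 oneH *<k> \<psi> x2 oneH)"
proof -
 note [simp] = form_closed[OF f(1)] form_closed[OF f(2)]
 note [lin] = linear_form[OF f(1)] linear_form[OF f(2)]
 show ?thesis unfolding conv_def using x by (intro comult_cong tsum_comult_one_k) (auto intro!: lin)
qed

lemma conv_one_left:
 assumes f: "bform \<phi>" "bform \<psi>" and x: "x el H"
 shows "conv k H \<phi> \<psi> oneH x = tsum k (comult H x) (%x1 x2. \<phi> oneH x1 *<k> \<psi> oneH x2)"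
proof -
 note [simp] = form_closed[OF f(1)] form_closed[OF f(2)]
 note [lin] = linear_form[OF f(1)] linear_form[OF f(2)]
 show ?thesis unfolding conv_def using x by (intro tsum_comult_one_k) (auto intro!: lin simp: tsum_K[symmetric])
qed

text \<open>\<open>f = f * (f * g) = (f * f) * g = c f * g = c \<epsilon>\<close> for the convolution product \<open>*\<close>.\<close>
lemma norm_aux:
 assumes f: "lmap H K f" and g: "lmap H K g" and c: "c el k" and x: "x el H"
  and ff: "!!x. x el H ==> tsum k (comult H x) (%x1 x2. f x1 *<k> f x2) = c *<k> f x"
  and fg: "!!x. x el H ==> tsum k (comult H x) (%x1 x2. f x1 *<k> g x2) = counit H x"
 shows "f x = c *<k> counit H x"
proof -
 note [simp] = linear_closed[OF f, simplified] linear_closed[OF g, simplified] c R.m_assoc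
 note [lin] = linear_comp[OF _ f] linear_comp[OF _ g]
 have lk: "lmap K K (%x. x *<k> d)" "lmap K K (%x. d *<k> x)" if "d el k" for d
  using that by (auto intro!: lin)
 have "f x = tsum K (comult H x) (%x1 x2. counit H x2 *[K] f x1)"
  using x by (intro comult_counit_right_G[symmetric] f) simp_all
 also have "... = tsum K (comult H x) (%x1 a. f x1 *<k> tsum K (comult H a) (%x2 x3. f x2 *<k> g x3))"
  using x by (intro comult_cong) (simp_all add: fg tsum_K R.m_comm)
 also have "... = tsum K (comult H x) (%x1 a. tsum K (comult H a) (%x2 x3. f x1 *<k> (f x2 *<k> g x3)))"
  using x by (intro comult_cong linear_tsum[OF _ _ lk(2) comult_pairs]) simp_all
 also have "... = tsum K (comult H x) (%a x3. tsum K (comult H a) (%x1 x2. f x1 *<k> (f x2 *<k> g x3)))"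
  using x by (intro comult_coassoc_G[symmetric]) (auto intro!: lin)
 also have "... = tsum K (comult H x) (%a x3. tsum K (comult H a) (%x1 x2. f x1 *<k> f x2) *<k> g x3)"
  using x by (intro comult_cong HOL.trans[OF _ linear_tsum[OF module_K module_K lk(1) comult_pairs, symmetric]]) simp_all
 also have "... = tsum K (comult H x) (%a x3. c *<k> (f a *<k> g x3))"
  using x by (intro comult_cong) (simp_all add: ff tsum_K)
 also have "... = c *<k> tsum K (comult H x) (%a x3. f a *<k> g x3)"
  using x by (intro linear_tsum[OF _ _ lk(2) comult_pairs, symmetric]) simp_all
 also have "... = c *<k> counit H x" using x by (simp add: fg tsum_K)
 finally show ?thesis .
qed

end

locale cocycle_twist = bialgebra k H
 for k :: "'k ring" and H :: "('k, 'h) hopf_data" +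
 fixes \<sigma> :: "'h \<Rightarrow> 'h \<Rightarrow> 'k"
 assumes cocycle: "two_cocycle k H \<sigma>"
begin

abbreviation H' where "H' \<equiv> cocycle_deformation k H \<sigma>"
abbreviation \<sigma>' where "\<sigma>' \<equiv> conv_inv k H \<sigma>"

lemma H'_simps [simp]: "carrier H' = carrier H" "\<zero>\<^bsub>H'\<^esub> = \<zero>\<^bsub>H\<^esub>" "\<one>\<^bsub>H'\<^esub> = oneH" "add H' = add H" "smult H' = smult H" "comult H' = comult H" "counit H' = counit H"
 by (simp_all add: cocycle_deformation_def)

lemma \<sigma>_bilinear: "bform \<sigma>" using cocycle by (simp add: two_cocycle_def)

lemma \<sigma>'_inverse: "conv_inverse k H \<sigma> \<sigma>'"
 using cocycle someI_ex[of "conv_inverse k H \<sigma>"] by (simp add: two_cocycle_def conv_inv_def)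

lemma \<sigma>'_bilinear: "bform \<sigma>'" using \<sigma>'_inverse by (simp add: conv_inverse_def)

lemma \<sigma>_\<sigma>': "x el H ==> y el H ==> conv k H \<sigma> \<sigma>' x y = counit H x *<k> counit H y"
 and \<sigma>'_\<sigma>: "x el H ==> y el H ==> conv k H \<sigma>' \<sigma> x y = counit H x *<k> counit H y"
 using \<sigma>'_inverse by (simp_all add: conv_inverse_def)

lemmas [simp] = form_closed[OF \<sigma>_bilinear] form_closed[OF \<sigma>'_bilinear]
lemmas [lin] = linear_form[OF \<sigma>_bilinear] linear_form[OF \<sigma>'_bilinear]

abbreviation star (infixl \<open>\<star>\<close> 70) where "x \<star> y \<equiv> x *<H'> y"

lemma star_eq:
 assumes x: "x el H" and y: "y el H"
 shows "x \<star> y = lact H \<sigma> (ract H \<sigma>' (mult H)) x y"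
proof -
 let ?S = "tsum H"
 have "x \<star> y = ?S (comult H x) (%x1 a. ?S (comult H a) (%x2 x3. ?S (comult H y) (%y1 b. ?S (comult H b) (%y2 y3.
    \<sigma> x1 y1 *[H] (\<sigma>' x3 y3 *[H] (x2 *<H> y2))))))"
  unfolding cocycle_deformation_def using x y by (simp, intro comult_cong) (simp_all add: mult_smult)
 also have "... = ?S (comult H x) (%x1 a. ?S (comult H y) (%y1 b. ?S (comult H a) (%x2 x3. ?S (comult H b) (%y2 y3.
    \<sigma> x1 y1 *[H] (\<sigma>' x3 y3 *[H] (x2 *<H> y2))))))"
  using x y by (intro comult_cong swap_mm) simp_all
 also have "... = ?S (comult H x) (%x1 a. ?S (comult H y) (%y1 b. ?S (comult H a) (%x2 x3. \<sigma> x1 y1 *[H] ?S (comult H b) (%y2 y3.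
    \<sigma>' x3 y3 *[H] (x2 *<H> y2)))))"
  using x y by (intro comult_cong smult_tsum[OF _ comult_pairs, symmetric]) simp_all
 also have "... = lact H \<sigma> (ract H \<sigma>' (mult H)) x y"
  unfolding lact_def ract_def cprod_def using x y by (intro comult_cong smult_tsum[OF _ comult_pairs, symmetric]) simp_all
 finally show ?thesis .
qed

lemma bilinear_star: "bilinear_map k H H H (mult H')"
proof -
 have "bilinear_map k H H H (lact H \<sigma> (ract H \<sigma>' (mult H)))"
  by (intro bilinear_lact bilinear_ract bilinear_mult \<sigma>_bilinear \<sigma>'_bilinear) simp_all
 then show ?thesis using star_eq
  by (simp add: bilinear_map_def cong: linear_map_cong)
qed

lemma star_closed [simp]: "x el H ==> y el H ==> x \<star> y el H"
 by (rule bilinear_closed[OF bilinear_star])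

lemmas lin_star [lin] = bilinear_left[OF bilinear_star] bilinear_right[OF bilinear_star]

text \<open>\<open>\<Sum> (x\<^sub>1 \<star> y\<^sub>1) \<sigma>(x\<^sub>2, y\<^sub>2) = \<Sum> \<sigma>(x\<^sub>1, y\<^sub>1) x\<^sub>2 y\<^sub>2\<close>. As \<open>\<sigma>\<close> can be cancelled, properties of
 \<open>\<star>\<close> can be checked after multiplication by \<open>\<sigma>\<close>, where this identity leads back to \<open>H\<close>.\<close>
lemma star_\<sigma>:
 assumes x: "x el H" and y: "y el H"
 shows "ract H \<sigma> (mult H') x y = lact H \<sigma> (mult H) x y"
proof -
 note b = bilinear_ract[OF module_H \<sigma>'_bilinear bilinear_mult]
 have "ract H \<sigma> (mult H') x y = ract H \<sigma> (lact H \<sigma> (ract H \<sigma>' (mult H))) x y"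
  by (rule ract_cong(1)[OF x y star_eq]) simp_all
 also have "... = lact H \<sigma> (ract H \<sigma> (ract H \<sigma>' (mult H))) x y"
  by (rule lact_ract[OF module_H \<sigma>_bilinear \<sigma>_bilinear b x y])
 also have "... = lact H \<sigma> (mult H) x y"
  by (rule ract_cong(2)[OF x y ract_inverse[OF module_H \<sigma>_bilinear \<sigma>'_bilinear bilinear_mult _ _ \<sigma>'_\<sigma>]]) simp_all
 finally show ?thesis .
qed

lemma \<sigma>_one_inverse: "\<sigma> oneH oneH *<k> \<sigma>' oneH oneH = \<one>\<^bsub>k\<^esub>"
proof -
 have "tsum k (comult H oneH) (%x1 x2. \<sigma> x1 oneH *<k> \<sigma>' x2 oneH) = \<sigma> oneH oneH *<k> \<sigma>' oneH oneH"
  by (rule tsum_comult_one_k) (auto intro!: lin)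
 then show ?thesis using \<sigma>_\<sigma>'[of "oneH" "oneH"] conv_one_right[OF \<sigma>_bilinear \<sigma>'_bilinear one_closed] by (simp add: counit_one)
qed

end

lemma (in coalgebra) lact_act: "lact G \<phi> u x y = act G regular regular \<phi> u x y"
 by (simp add: lact_def cprod_def act_def regular_simps)

lemma (in coalgebra) lact_counit:
 assumes "module k G" "bilinear_map k H H G u" "x el H" "y el H"
 shows "lact G (%x y. counit H x \<otimes> counit H y) u x y = u x y"
 unfolding lact_act using assms
 by (intro act_counit left_comodule_regular) (auto simp: linear_regular regular_simps bilinear_map_def)

context cocycle_twist
begin

lemma cocycle_eq:
 "x el H ==> y el H ==> z el H ==>
    tsum k (comult H x) (%x1 x2. tsum k (comult H y) (%y1 y2. \<sigma> x1 y1 *<k> \<sigma> (x2 *<H> y2) z))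
    = tsum k (comult H y) (%y1 y2. tsum k (comult H z) (%z1 z2. \<sigma> y1 z1 *<k> \<sigma> x (y2 *<H> z2)))"
 using cocycle by (simp add: two_cocycle_def)

abbreviation \<sigma>11 where "\<sigma>11 \<equiv> \<sigma> oneH oneH"

text \<open>For \<open>y = z = 1\<close> the cocycle identity reads \<open>f * f = \<sigma>(1, 1) f\<close> with \<open>f = \<sigma>(-, 1)\<close>.\<close>
lemma \<sigma>_one_right:
 assumes x: "x el H"
 shows "\<sigma> x oneH = \<sigma>11 *<k> counit H x"
proof (rule norm_aux[of "%x. \<sigma> x oneH" "%x. \<sigma>' x oneH", OF _ _ _ x])
 fix x assume x: "x el H"
 show "tsum k (comult H x) (%x1 x2. \<sigma> x1 oneH *<k> \<sigma>' x2 oneH) = counit H x"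
  using \<sigma>_\<sigma>'[OF x one_closed] conv_one_right[OF \<sigma>_bilinear \<sigma>'_bilinear x] x by (simp add: counit_one)
 show "tsum k (comult H x) (%x1 x2. \<sigma> x1 oneH *<k> \<sigma> x2 oneH) = \<sigma>11 *<k> \<sigma> x oneH"
 proof -
  have "tsum k (comult H x) (%x1 x2. tsum k (comult H oneH) (%y1 y2. \<sigma> x1 y1 *<k> \<sigma> (x2 *<H> y2) oneH)) =
    tsum k (comult H x) (%x1 x2. \<sigma> x1 oneH *<k> \<sigma> x2 oneH)"
   using x by (intro comult_cong) (auto simp: tsum_comult_one_k lin)
  moreover have "tsum k (comult H oneH) (%y1 y2. tsum k (comult H oneH) (%z1 z2. \<sigma> y1 z1 *<k> \<sigma> x (y2 *<H> z2))) = \<sigma>11 *<k> \<sigma> x oneH"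
   using x by (subst tsum_comult_one_k) (auto simp: tsum_comult_one_k lin intro!: lin)
  ultimately show ?thesis using cocycle_eq[OF x one_closed one_closed] by simp
 qed
qed (auto intro!: lin)

lemma \<sigma>_one_left:
 assumes x: "x el H"
 shows "\<sigma> oneH x = \<sigma>11 *<k> counit H x"
proof (rule norm_aux[of "%x. \<sigma> oneH x" "%x. \<sigma>' oneH x", OF _ _ _ x])
 fix x assume x: "x el H"
 show "tsum k (comult H x) (%x1 x2. \<sigma> oneH x1 *<k> \<sigma>' oneH x2) = counit H x"
  using \<sigma>_\<sigma>'[OF one_closed x] conv_one_left[OF \<sigma>_bilinear \<sigma>'_bilinear x] x by (simp add: counit_one)
 show "tsum k (comult H x) (%x1 x2. \<sigma> oneH x1 *<k> \<sigma> oneH x2) = \<sigma>11 *<k> \<sigma> oneH x"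
 proof -
  have "tsum k (comult H oneH) (%x1 x2. tsum k (comult H oneH) (%y1 y2. \<sigma> x1 y1 *<k> \<sigma> (x2 *<H> y2) x)) = \<sigma>11 *<k> \<sigma> oneH x"
   using x by (subst tsum_comult_one_k) (auto simp: tsum_comult_one_k lin intro!: lin)
  moreover have "tsum k (comult H oneH) (%y1 y2. tsum k (comult H x) (%z1 z2. \<sigma> y1 z1 *<k> \<sigma> oneH (y2 *<H> z2))) =
    tsum k (comult H x) (%z1 z2. \<sigma> oneH z1 *<k> \<sigma> oneH z2)"
   using x by (subst tsum_comult_one_k) (auto intro!: lin comult_cong)
  ultimately show ?thesis using cocycle_eq[OF one_closed one_closed x] by simp
 qed
qed (auto intro!: lin)

lemma \<sigma>_one_inverse': "\<sigma>' oneH oneH *<k> \<sigma>11 = \<one>\<^bsub>k\<^esub>"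
 by (rule HOL.trans[OF R.m_comm \<sigma>_one_inverse]) simp_all

lemma \<sigma>11_cancel:
 assumes G: "module k G" and v: "v el G" "w el G" and e: "\<sigma>11 *[G] v = \<sigma>11 *[G] w"
 shows "v = w"
proof -
 have i: "\<sigma>' oneH oneH *[G] (\<sigma>11 *[G] v) = v" if "v el G" for v
 proof -
  have "\<sigma>' oneH oneH *[G] (\<sigma>11 *[G] v) = (\<sigma>' oneH oneH *<k> \<sigma>11) *[G] v"
   by (rule mult_smult[symmetric]) (use that G in simp_all)
  then show ?thesis using that G by (simp add: \<sigma>_one_inverse' one_smult)
 qed
 have "v = \<sigma>' oneH oneH *[G] (\<sigma>11 *[G] w)" unfolding e[symmetric] by (rule i[OF v(1), symmetric])
 also have "... = w" by (rule i[OF v(2)])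
 finally show ?thesis .
qed

lemma \<sigma>_one_smult:
 assumes "module k G" "v el G" "x el H"
 shows "\<sigma> x oneH *[G] v = counit H x *[G] (\<sigma>11 *[G] v)" "\<sigma> oneH x *[G] v = counit H x *[G] (\<sigma>11 *[G] v)"
proof -
 have "(\<sigma>11 *<k> counit H x) *[G] v = counit H x *[G] (\<sigma>11 *[G] v)"
  using assms by (simp add: mult_smult smult_commute)
 then show "\<sigma> x oneH *[G] v = counit H x *[G] (\<sigma>11 *[G] v)" "\<sigma> oneH x *[G] v = counit H x *[G] (\<sigma>11 *[G] v)"
  unfolding \<sigma>_one_right[OF assms(3)] \<sigma>_one_left[OF assms(3)] by simp_all
qed

lemma star_one_right:
 assumes x: "x el H"
 shows "x \<star> oneH = x"
proof (rule \<sigma>11_cancel[OF module_H])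
 have "ract H \<sigma> (mult H') x oneH = tsum H (comult H x) (%x1 x2. \<sigma> x2 oneH *[H] (x1 \<star> oneH))"
  unfolding ract_def cprod_def using x by (intro comult_cong tsum_comult_one) (auto intro!: lin)
 also have "... = tsum H (comult H x) (%x1 x2. counit H x2 *[H] (\<sigma>11 *[H] (x1 \<star> oneH)))"
  using x by (intro comult_cong \<sigma>_one_smult(1)) simp_all
 also have "... = \<sigma>11 *[H] (x \<star> oneH)"
  using x by (intro comult_counit_right_G) (auto intro!: lin)
 finally have 1: "ract H \<sigma> (mult H') x oneH = \<sigma>11 *[H] (x \<star> oneH)" .
 have "lact H \<sigma> (mult H) x oneH = tsum H (comult H x) (%x1 x2. \<sigma> x1 oneH *[H] (x2 *<H> oneH))"
  unfolding lact_def cprod_def using x by (intro comult_cong tsum_comult_one) (auto intro!: lin)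
 also have "... = tsum H (comult H x) (%x1 x2. counit H x1 *[H] (\<sigma>11 *[H] x2))"
  using x by (intro comult_cong HOL.trans[OF \<sigma>_one_smult(1)]) simp_all
 also have "... = \<sigma>11 *[H] x"
  using x by (intro comult_counit_left_G) (auto intro!: lin)
 finally show "\<sigma>11 *[H] (x \<star> oneH) = \<sigma>11 *[H] x" using 1 star_\<sigma>[OF x one_closed] by simp
qed (use x in simp_all)

lemma star_one_left:
 assumes x: "x el H"
 shows "oneH \<star> x = x"
proof (rule \<sigma>11_cancel[OF module_H])
 have "ract H \<sigma> (mult H') oneH x = tsum H (comult H x) (%x1 x2. \<sigma> oneH x2 *[H] (oneH \<star> x1))"
  unfolding ract_def cprod_def using x by (intro tsum_comult_one) (auto intro!: lin)
 also have "... = tsum H (comult H x) (%x1 x2. counit H x2 *[H] (\<sigma>11 *[H] (oneH \<star> x1)))"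
  using x by (intro comult_cong \<sigma>_one_smult(2)) simp_all
 also have "... = \<sigma>11 *[H] (oneH \<star> x)"
  using x by (intro comult_counit_right_G) (auto intro!: lin)
 finally have 1: "ract H \<sigma> (mult H') oneH x = \<sigma>11 *[H] (oneH \<star> x)" .
 have "lact H \<sigma> (mult H) oneH x = tsum H (comult H x) (%x1 x2. \<sigma> oneH x1 *[H] (oneH *<H> x2))"
  unfolding lact_def cprod_def using x by (intro tsum_comult_one) (auto intro!: lin)
 also have "... = tsum H (comult H x) (%x1 x2. counit H x1 *[H] (\<sigma>11 *[H] x2))"
  using x by (intro comult_cong HOL.trans[OF \<sigma>_one_smult(2)]) simp_all
 also have "... = \<sigma>11 *[H] x"
  using x by (intro comult_counit_left_G) (auto intro!: lin)
 finally show "\<sigma>11 *[H] (oneH \<star> x) = \<sigma>11 *[H] x" using 1 star_\<sigma>[OF one_closed x] by simp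
qed (use x in simp_all)

lemma linear_lact_push:
 assumes "lmap G G' L" "module k G" "module k G'" "bform \<phi>" "bilinear_map k H H G u" "x el H" "y el H"
 shows "L (lact G \<phi> u x y) = lact G' \<phi> (%x y. L (u x y)) x y" "L (ract G \<phi> u x y) = ract G' \<phi> (%x y. L (u x y)) x y"
proof -
 note [simp] = form_closed[OF assms(4)] bilinear_closed[OF assms(5)]
 have "L (lact G \<phi> u x y) = cprod G' (%a b. L (a *[G] b)) \<phi> u x y" unfolding lact_def
  using assms by (intro cprod_push) simp_all
 also have "... = lact G' \<phi> (%x y. L (u x y)) x y" unfolding lact_def cprod_def
  using assms by (intro comult_cong) (simp_all add: linear_smult[OF assms(1)])
 finally show "L (lact G \<phi> u x y) = lact G' \<phi> (%x y. L (u x y)) x y" .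
 have "L (ract G \<phi> u x y) = cprod G' (%b a. L (a *[G] b)) u \<phi> x y" unfolding ract_def
  using assms by (intro cprod_push) simp_all
 also have "... = ract G' \<phi> (%x y. L (u x y)) x y" unfolding ract_def cprod_def
  using assms by (intro comult_cong) (simp_all add: linear_smult[OF assms(1)])
 finally show "L (ract G \<phi> u x y) = ract G' \<phi> (%x y. L (u x y)) x y" .
qed

lemma counit_star:
 assumes x: "x el H" and y: "y el H"
 shows "counit H (x \<star> y) = counit H x *<k> counit H y"
proof (rule ract_cancel[OF module_K \<sigma>'_bilinear \<sigma>_bilinear _ _ x y \<sigma>_\<sigma>'])
 let ?e = "%x y. counit H x *<k> counit H y"
 have e: "bform ?e" by (intro bilinear_formI) (auto intro!: lin)
 show "bilinear_map k H H K ?e" using e by (simp add: bilinear_form_iff)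
 show "bilinear_map k H H K (%x y. counit H (x \<star> y))" by (intro bilinear_mapI) (auto intro!: lin)
 fix x y assume x: "x el H" and y: "y el H"
 have "ract K \<sigma> (%x y. counit H (x \<star> y)) x y = counit H (ract H \<sigma> (mult H') x y)"
  using linear_lact_push(2)[OF counit_lin module_H module_K \<sigma>_bilinear bilinear_star x y] by simp
 also have "... = lact K \<sigma> (%x y. counit H (x *<H> y)) x y"
  unfolding star_\<sigma>[OF x y] by (rule linear_lact_push(1)[OF counit_lin module_H module_K \<sigma>_bilinear bilinear_mult x y])
 also have "... = lact K \<sigma> ?e x y" by (rule ract_cong(2)[OF x y]) (simp_all add: counit_mult)
 also have "... = ract K ?e \<sigma> x y" unfolding lact_def ract_def cprod_def using x y by (intro comult_cong) (simp_all add: R.m_comm)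
 also have "... = \<sigma> x y" using \<sigma>_bilinear by (intro ract_counit x y) (simp_all add: bilinear_form_iff)
 also have "... = lact K ?e \<sigma> x y" using \<sigma>_bilinear by (intro lact_counit[symmetric] x y) (simp_all add: bilinear_form_iff)
 also have "... = ract K \<sigma> ?e x y" unfolding lact_def ract_def cprod_def using x y by (intro comult_cong) (simp_all add: R.m_comm)
 finally show "ract K \<sigma> (%x y. counit H (x \<star> y)) x y = ract K \<sigma> ?e x y" .
qed

text \<open>Multiplied by \<open>\<sigma>\<close> on the right, the right-hand side allows \<open>\<sigma>\<close> to pass through both factors: each
 passage turns one product \<open>\<star>\<close> into the product of \<open>H\<close>, for which the coproduct is multiplicative.\<close>
lemma comult_star:
 assumes x: "x el H" and y: "y el H"
 shows "comult H (x \<star> y) = cprod (tensor k H H) (tens k H H) (mult H') (mult H') x y"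
proof (rule ract_cancel[OF _ \<sigma>'_bilinear \<sigma>_bilinear _ _ x y \<sigma>_\<sigma>'])
 let ?T = "tensor k H H" and ?t = "tens k H H"
 note bt = bilinear_tens[OF module_H module_H]
 note s1 = bilinear_smult[OF module_H] bilinear_smult[OF module_tensor[OF module_H module_H]] \<sigma>_bilinear[unfolded bilinear_form_iff]
 note sm = linear_smult[OF linear_tens(1)[OF module_H module_H _ linear_id]] linear_smult[OF linear_tens(2)[OF module_H module_H _ linear_id]]
 show "module k ?T" by simp
 show "bilinear_map k H H ?T (%x y. comult H (x \<star> y))" by (intro bilinear_mapI) (auto intro!: lin)
 show "bilinear_map k H H ?T (cprod ?T ?t (mult H') (mult H'))" by (rule bilinear_cprod[OF module_H module_H _ bt bilinear_star bilinear_star]) simp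
 fix x y assume x: "x el H" and y: "y el H"
 have "ract ?T \<sigma> (%x y. comult H (x \<star> y)) x y = comult H (ract H \<sigma> (mult H') x y)"
  using linear_lact_push(2)[OF comult_lin module_H _ \<sigma>_bilinear bilinear_star x y] by simp
 also have "... = lact ?T \<sigma> (%x y. comult H (x *<H> y)) x y"
  unfolding star_\<sigma>[OF x y] by (rule linear_lact_push(1)[OF comult_lin module_H _ \<sigma>_bilinear bilinear_mult x y]) simp
 also have "... = lact ?T \<sigma> (cprod ?T ?t (mult H) (mult H)) x y"
  by (rule ract_cong(2)[OF x y]) (simp_all add: comult_mult cprod_def)
 also have "... = cprod ?T ?t (lact H \<sigma> (mult H)) (mult H) x y"
  unfolding lact_def by (rule cprod_assoc[symmetric, where ?A1.0=K and ?A2.0=H and ?A3.0=H and ?A12.0=H and ?A23.0="?T"])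
   (simp_all add: s1 bt bilinear_mult x y sm)
 also have "... = cprod ?T ?t (ract H \<sigma> (mult H')) (mult H) x y"
  by (rule cprod_cong[OF x y]) (simp_all add: star_\<sigma>)
 also have "... = cprod ?T ?t (mult H') (lact H \<sigma> (mult H)) x y"
  unfolding lact_def ract_def by (rule cprod_assoc[where ?A1.0=H and ?A2.0=K and ?A3.0=H and ?A12.0=H and ?A23.0=H])
   (simp_all add: s1 bt bilinear_mult bilinear_star x y sm)
 also have "... = cprod ?T ?t (mult H') (ract H \<sigma> (mult H')) x y"
  by (rule cprod_cong[OF x y]) (simp_all add: star_\<sigma>)
 also have "... = ract ?T \<sigma> (cprod ?T ?t (mult H') (mult H')) x y"
  unfolding ract_def by (rule cprod_assoc[symmetric, where ?A1.0=H and ?A2.0=H and ?A3.0=K and ?A12.0="?T" and ?A23.0=H])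
   (simp_all add: s1 bt bilinear_star x y sm)
 finally show "ract ?T \<sigma> (%x y. comult H (x \<star> y)) x y = ract ?T \<sigma> (cprod ?T ?t (mult H') (mult H')) x y" .
qed

lemma tensor_H': "tensor k H' = tensor k H" "tens k H' = tens k H" "tensor k M H' = tensor k M H" "tens k M H' = tens k M H"
 by (intro ext tensor_change; simp)+

lemma tsum_H': "tsum H' = tsum H"
 by (intro ext tsum_change_group) simp_all

lemma linear_H': "lmap H' G f = lmap H G f" "lmap L H' g = lmap L H g"
 by (simp_all add: linear_map_def)

lemma module_H': "module k H'"
 by (intro moduleI abelian_groupI R.is_cring)
  (auto simp: smult_l_distr smult_r_distr smult_assoc1 M.a_ac intro: M.l_neg bexI[of _ "\<ominus>\<^bsub>H\<^esub> x" for x])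

lemma nonassoc_H': "nonassoc_bialgebra k H'"
proof (intro nonassoc_bialgebra.intro nonassoc_bialgebra_axioms.intro coalgebra.intro coalgebra_axioms.intro scalars_axioms module_H')
 show "lmap H' (tensor k H' H') (comult H')" using comult_lin by (simp add: tensor_H' linear_H')
 show "lmap H' K (counit H')" using counit_lin by (simp add: linear_H')
 show "bilinear_map k H' H' H' (mult H')" using bilinear_star by (simp add: bilinear_map_def linear_H')
 fix x assume x: "x el H'"
 show "let HHH = tensor k H' (tensor k H' H')
     in tsum HHH (comult H' x) (%a x3. tsum HHH (comult H' a) (%x1 x2. tens k H' (tensor k H' H') x1 (tens k H' H' x2 x3))) =
      tsum HHH (comult H' x) (%x1 b. tsum HHH (comult H' b) (%x2 x3. tens k H' (tensor k H' H') x1 (tens k H' H' x2 x3)))"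
  using comult_coassoc x by (simp add: tensor_H')
 show "tsum H' (comult H' x) (%x1 x2. counit H' x1 *[H'] x2) = x" "tsum H' (comult H' x) (%x1 x2. counit H' x2 *[H'] x1) = x"
  using comult_counit_left comult_counit_right x by (simp_all add: tsum_H')
 show "\<one>\<^bsub>H'\<^esub> \<star> x = x" "x \<star> \<one>\<^bsub>H'\<^esub> = x" using x star_one_left star_one_right by simp_all
 fix y assume y: "y el H'"
 show "comult H' (x \<star> y) = tsum (tensor k H' H') (comult H' x) (%x1 x2. tsum (tensor k H' H') (comult H' y) (%y1 y2. tens k H' H' (x1 \<star> y1) (x2 \<star> y2)))"
  using x y comult_star by (simp add: tensor_H' cprod_def)
 show "counit H' (x \<star> y) = counit H' x *<k> counit H' y" using x y counit_star by simp
qed (simp_all add: tensor_H' comult_one counit_one)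

lemma left_comodule_H': "left_comodule k H' M \<longleftrightarrow> comod M"
 unfolding left_comodule_def left_comodule_axioms_def tensor_H' H'_simps by (rule HOL.refl)

lemma comod_hom_H': "comod_hom k H' = comod_hom k H"
 unfolding comod_hom_def[abs_def] tensor_H' by (rule HOL.refl)

end

section \<open>The comparison of the two tensor products\<close>

context coalgebra
begin

context
 fixes M N P G and u and \<phi> and \<psi>
 assumes M: "comod M" and N: "comod N" and P: "comod P" and G: "module k G"
  and u: "!!n p. n el N ==> p el P ==> lmap M G (%m. u m n p)"
   "!!m p. m el M ==> p el P ==> lmap N G (%n. u m n p)"
   "!!m n. m el M ==> n el N ==> lmap P G (%p. u m n p)"
  and \<phi>: "bform \<phi>"
  and \<psi>: "!!h l. h el H ==> l el H ==> lmap H K (%g. \<psi> g h l)"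
   "!!g l. g el H ==> l el H ==> lmap H K (%h. \<psi> g h l)"
   "!!g h. g el H ==> h el H ==> lmap H K (%l. \<psi> g h l)"
begin

lemma act3_12_123:
 assumes m: "m el M" and n: "n el N" and p: "p el P"
 shows "act G M N \<phi> (%m n. act3 G M N P \<psi> u m n p) m n =
  act3 G M N P (%g h l. tsum k (comult H g) (%g1 g2. tsum k (comult H h) (%h1 h2. \<phi> g1 h1 \<otimes> \<psi> g2 h2 l))) u m n p"
proof -
 note mods [simp] = M[THEN comodule_precomod] N[THEN comodule_precomod] P[THEN comodule_precomod] G
 note [lin] = linear_comp[OF _ u(1)] linear_comp[OF _ u(2)] linear_comp[OF _ u(3)]
 note [simp] = linear_closed[OF u(1)] linear_closed[OF \<psi>(1), simplified]
 note [simp] = form_closed[OF \<phi>]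
 note [lin] = linear_form[OF \<phi>] linear_comp[OF _ \<psi>(1)] linear_comp[OF _ \<psi>(2)] linear_comp[OF _ \<psi>(3)]
 let ?S = "%t. tsum G t"
 have "act G M N \<phi> (%m n. act3 G M N P \<psi> u m n p) m n =
  ?S (coact M m) (%g m'. ?S (coact N n) (%h n'. ?S (coact M m') (%g2 m0. \<phi> g h *[G] ?S (coact N n') (%h2 n0. ?S (coact P p) (%l p0. \<psi> g2 h2 l *[G] u m0 n0 p0)))))"
  unfolding act_def act3_def using m n p by (intro coact_cong smult_c) simp_all
 also have "... = ?S (coact M m) (%g m'. ?S (coact N n) (%h n'. ?S (coact M m') (%g2 m0. ?S (coact N n') (%h2 n0. \<phi> g h *[G] ?S (coact P p) (%l p0. \<psi> g2 h2 l *[G] u m0 n0 p0)))))"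
  using m n p by (intro coact_cong smult_c) simp_all
 also have "... = ?S (coact M m) (%g m'. ?S (coact N n) (%h n'. ?S (coact M m') (%g2 m0. ?S (coact N n') (%h2 n0. ?S (coact P p) (%l p0. \<phi> g h *[G] (\<psi> g2 h2 l *[G] u m0 n0 p0))))))"
  using m n p by (intro coact_cong smult_c) simp_all
 also have "... = ?S (coact M m) (%g m0. ?S (coact N n) (%h n0. ?S (comult H g) (%g1 g2. ?S (comult H h) (%h1 h2. ?S (coact P p) (%l p0. \<phi> g1 h1 *[G] (\<psi> g2 h2 l *[G] u m0 n0 p0))))))"
  using m n p by (intro coact2_coassoc[OF M N m n, symmetric]) (auto intro!: lin)
 also have "... = ?S (coact M m) (%g m0. ?S (coact N n) (%h n0. ?S (comult H g) (%g1 g2. ?S (coact P p) (%l p0. ?S (comult H h) (%h1 h2. \<phi> g1 h1 *[G] (\<psi> g2 h2 l *[G] u m0 n0 p0))))))"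
  using m n p by (intro coact_cong comult_cong swap_mc) simp_all
 also have "... = ?S (coact M m) (%g m0. ?S (coact N n) (%h n0. ?S (coact P p) (%l p0. ?S (comult H g) (%g1 g2. ?S (comult H h) (%h1 h2. \<phi> g1 h1 *[G] (\<psi> g2 h2 l *[G] u m0 n0 p0))))))"
  using m n p by (intro coact_cong swap_mc) simp_all
 also have "... = ?S (coact M m) (%g m0. ?S (coact N n) (%h n0. ?S (coact P p) (%l p0. ?S (comult H g) (%g1 g2. ?S (comult H h) (%h1 h2. (\<phi> g1 h1 \<otimes> \<psi> g2 h2 l) *[G] u m0 n0 p0)))))"
  using m n p by (intro coact_cong comult_cong) (simp_all add: mult_smult)
 also have "... = ?S (coact M m) (%g m0. ?S (coact N n) (%h n0. ?S (coact P p) (%l p0. ?S (comult H g) (%g1 g2. tsum k (comult H h) (%h1 h2. \<phi> g1 h1 \<otimes> \<psi> g2 h2 l) *[G] u m0 n0 p0))))"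
  using m n p by (intro coact_cong comult_cong smult_m[symmetric]) simp_all
 also have "... = act3 G M N P (%g h l. tsum k (comult H g) (%g1 g2. tsum k (comult H h) (%h1 h2. \<phi> g1 h1 \<otimes> \<psi> g2 h2 l))) u m n p"
  unfolding act3_def using m n p by (intro coact_cong smult_m[symmetric]) simp_all
 finally show ?thesis .
qed

lemma act3_23_123:
 assumes m: "m el M" and n: "n el N" and p: "p el P"
 shows "act G N P \<phi> (%n p. act3 G M N P \<psi> u m n p) n p =
  act3 G M N P (%g h l. tsum k (comult H h) (%h1 h2. tsum k (comult H l) (%l1 l2. \<phi> h1 l1 \<otimes> \<psi> g h2 l2))) u m n p"
proof -
 note mods [simp] = M[THEN comodule_precomod] N[THEN comodule_precomod] P[THEN comodule_precomod] G
 note [lin] = linear_comp[OF _ u(1)] linear_comp[OF _ u(2)] linear_comp[OF _ u(3)]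
 note [simp] = linear_closed[OF u(1)] linear_closed[OF \<psi>(1), simplified]
 note [simp] = form_closed[OF \<phi>]
 note [lin] = linear_form[OF \<phi>] linear_comp[OF _ \<psi>(1)] linear_comp[OF _ \<psi>(2)] linear_comp[OF _ \<psi>(3)]
 let ?S = "%t. tsum G t"
 have "act G N P \<phi> (%n p. act3 G M N P \<psi> u m n p) n p =
  ?S (coact N n) (%h n'. ?S (coact P p) (%l p'. ?S (coact M m) (%g m0. \<phi> h l *[G] ?S (coact N n') (%h2 n0. ?S (coact P p') (%l2 p0. \<psi> g h2 l2 *[G] u m0 n0 p0)))))"
  unfolding act_def act3_def using m n p by (intro coact_cong smult_c) simp_all
 also have "... = ?S (coact N n) (%h n'. ?S (coact P p) (%l p'. ?S (coact M m) (%g m0. ?S (coact N n') (%h2 n0. \<phi> h l *[G] ?S (coact P p') (%l2 p0. \<psi> g h2 l2 *[G] u m0 n0 p0)))))"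
  using m n p by (intro coact_cong smult_c) simp_all
 also have "... = ?S (coact N n) (%h n'. ?S (coact P p) (%l p'. ?S (coact M m) (%g m0. ?S (coact N n') (%h2 n0. ?S (coact P p') (%l2 p0. \<phi> h l *[G] (\<psi> g h2 l2 *[G] u m0 n0 p0))))))"
  using m n p by (intro coact_cong smult_c) simp_all
 also have "... = ?S (coact N n) (%h n'. ?S (coact P p) (%l p'. ?S (coact N n') (%h2 n0. ?S (coact M m) (%g m0. ?S (coact P p') (%l2 p0. \<phi> h l *[G] (\<psi> g h2 l2 *[G] u m0 n0 p0))))))"
  using m n p by (intro coact_cong swap_cc) simp_all
 also have "... = ?S (coact N n) (%h n'. ?S (coact P p) (%l p'. ?S (coact N n') (%h2 n0. ?S (coact P p') (%l2 p0. ?S (coact M m) (%g m0. \<phi> h l *[G] (\<psi> g h2 l2 *[G] u m0 n0 p0))))))"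
  using m n p by (intro coact_cong swap_cc) simp_all
 also have "... = ?S (coact N n) (%h n0. ?S (coact P p) (%l p0. ?S (comult H h) (%h1 h2. ?S (comult H l) (%l1 l2. ?S (coact M m) (%g m0. \<phi> h1 l1 *[G] (\<psi> g h2 l2 *[G] u m0 n0 p0))))))"
  using m n p by (intro coact2_coassoc[OF N P n p, symmetric]) (auto intro!: lin)
 also have "... = ?S (coact N n) (%h n0. ?S (coact P p) (%l p0. ?S (comult H h) (%h1 h2. ?S (coact M m) (%g m0. ?S (comult H l) (%l1 l2. \<phi> h1 l1 *[G] (\<psi> g h2 l2 *[G] u m0 n0 p0))))))"
  using m n p by (intro coact_cong comult_cong swap_mc) simp_all
 also have "... = ?S (coact N n) (%h n0. ?S (coact P p) (%l p0. ?S (coact M m) (%g m0. ?S (comult H h) (%h1 h2. ?S (comult H l) (%l1 l2. \<phi> h1 l1 *[G] (\<psi> g h2 l2 *[G] u m0 n0 p0))))))"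
  using m n p by (intro coact_cong swap_mc) simp_all
 also have "... = ?S (coact N n) (%h n0. ?S (coact M m) (%g m0. ?S (coact P p) (%l p0. ?S (comult H h) (%h1 h2. ?S (comult H l) (%l1 l2. \<phi> h1 l1 *[G] (\<psi> g h2 l2 *[G] u m0 n0 p0))))))"
  using m n p by (intro coact_cong swap_cc) simp_all
 also have "... = ?S (coact M m) (%g m0. ?S (coact N n) (%h n0. ?S (coact P p) (%l p0. ?S (comult H h) (%h1 h2. ?S (comult H l) (%l1 l2. \<phi> h1 l1 *[G] (\<psi> g h2 l2 *[G] u m0 n0 p0))))))"
  using m n p by (intro swap_cc) simp_all
 also have "... = ?S (coact M m) (%g m0. ?S (coact N n) (%h n0. ?S (coact P p) (%l p0. ?S (comult H h) (%h1 h2. ?S (comult H l) (%l1 l2. (\<phi> h1 l1 \<otimes> \<psi> g h2 l2) *[G] u m0 n0 p0)))))"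
  using m n p by (intro coact_cong comult_cong) (simp_all add: mult_smult)
 also have "... = ?S (coact M m) (%g m0. ?S (coact N n) (%h n0. ?S (coact P p) (%l p0. ?S (comult H h) (%h1 h2. tsum k (comult H l) (%l1 l2. \<phi> h1 l1 \<otimes> \<psi> g h2 l2) *[G] u m0 n0 p0))))"
  using m n p by (intro coact_cong comult_cong smult_m[symmetric]) simp_all
 also have "... = act3 G M N P (%g h l. tsum k (comult H h) (%h1 h2. tsum k (comult H l) (%l1 l2. \<phi> h1 l1 \<otimes> \<psi> g h2 l2))) u m n p"
  unfolding act3_def using m n p by (intro coact_cong smult_m[symmetric]) simp_all
 finally show ?thesis .
qed

end

definition act_map :: "('h \<Rightarrow> 'h \<Rightarrow> 'k) \<Rightarrow> ('k, 'h, 'x) comod \<Rightarrow> ('k, 'h, 'x) comod \<Rightarrow> ('k, 'x) univ \<Rightarrow> ('k, 'x) univ" where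
 "act_map \<phi> M N t = tsum (ct H M N) (untens t) (act (ct H M N) M N \<phi> (ut M N))"

context
 fixes M N :: "('k, 'h, 'x) comod" and \<phi>
 assumes M: "comod M" and N: "comod N" and \<phi>: "bform \<phi>"
begin

lemma linear_utens_fun:
 "m el M ==> lmap N (ct H M N) (ut M N m)" "n el N ==> lmap M (ct H M N) (%m. ut M N m n)"
 using M N by (auto intro: linear_utens linear_id)

lemma linear_act_map: "lmap (ct H M N) (ct H M N) (act_map \<phi> M N)"
 unfolding act_map_def[abs_def] using M N linear_act[OF M N _ linear_utens_fun \<phi>] by (intro linear_untens_id) auto

lemma act_map_utens:
 "m el M ==> n el N ==> act_map \<phi> M N (ut M N m n) = act (ct H M N) M N \<phi> (ut M N) m n"
 unfolding act_map_def using M N linear_act[OF M N _ linear_utens_fun \<phi>] by (intro tsum_utens) auto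

lemma act_map_push:
 assumes m: "m el M" and n: "n el N" and L: "lmap (ct H M N) G L" and G: "module k G"
 shows "L (act_map \<phi> M N (ut M N m n)) = act G M N \<phi> (%m n. L (ut M N m n)) m n"
 unfolding act_map_utens[OF m n] using M N
 by (intro linear_act_push[OF M N _ _ _ \<phi> L G m n] linear_utens_fun) auto

end

lemma act_map_inverse:
 assumes M: "comod M" and N: "comod N" and \<phi>: "bform \<phi>" and \<psi>: "bform \<psi>"
  and inv: "!!x y. x el H ==> y el H ==> conv k H \<psi> \<phi> x y = counit H x \<otimes> counit H y"
  and t: "t el (ct H M N)"
 shows "act_map \<phi> M N (act_map \<psi> M N t) = t"
proof (rule ct_ext[OF _ _ _ linear_comp[OF linear_act_map[OF M N \<psi>] linear_act_map[OF M N \<phi>]] linear_id _ t])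
 let ?T = "ct H M N"
 have T: "module k ?T" using M N by simp
 fix m n assume m: "m el M" and n: "n el N"
 have "act_map \<phi> M N (act_map \<psi> M N (ut M N m n)) = act ?T M N \<psi> (%m n. act_map \<phi> M N (ut M N m n)) m n"
  by (rule act_map_push[OF M N \<psi> m n linear_act_map[OF M N \<phi>] T])
 also have "... = act ?T M N \<psi> (act ?T M N \<phi> (ut M N)) m n"
  using M N m n by (intro act_cong) (simp_all add: act_map_utens \<phi>)
 also have "... = ut M N m n"
  by (rule act_inverse[OF M N T linear_utens_fun[OF M N \<phi>] \<psi> \<phi> m n inv])
 finally show "act_map \<phi> M N (act_map \<psi> M N (ut M N m n)) = ut M N m n" .
qed (use M N in simp_all)

end

context nonassoc_bialgebra
begin
declare left_comodule_ct [simp]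
end

context cocycle_twist
begin

text \<open>On pure tensors the two sides are \<open>act3\<close> for the two sides of the cocycle identity.\<close>
lemma cocycle_act_map:
 assumes M: "comod M" and N: "comod N" and P: "comod P"
  and m: "m el M" and n: "n el N" and p: "p el P"
 shows "assoc_map H M N P (act_map \<sigma> (ct H M N) P (ut (ct H M N) P (act_map \<sigma> M N (ut M N m n)) p)) =
  act_map \<sigma> M (ct H N P) (ut M (ct H N P) m (act_map \<sigma> N P (ut N P n p)))"
proof -
 note [simp] = M N P m n p
 let ?MN = "ct H M N" and ?NP = "ct H N P" let ?Q = "ct H M ?NP" and ?Q' = "ct H ?MN P"
 let ?w = "%m n p. ut M ?NP m (ut N P n p)"
 note [lin] = linear_form[OF \<sigma>_bilinear] linear_comp[OF _ linear_assoc_map]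
 have La: "lmap ?Q' ?Q (assoc_map H M N P)" by (rule linear_assoc_map) simp_all
 define L where "L = (%s. assoc_map H M N P (act_map \<sigma> ?MN P (ut ?MN P s p)))"
 have L: "lmap ?MN ?Q L" unfolding L_def
  by (rule linear_comp[OF linear_comp[OF linear_utens(2) linear_act_map] La]) (simp_all add: linear_id \<sigma>_bilinear)
 have Lu: "L (ut M N m n) = act3 ?Q M N P (%g h l. \<sigma> (g *<H> h) l) ?w m n p" if "m el M" "n el N" for m n
 proof -
  note [simp] = that
  have "L (ut M N m n) = act ?Q ?MN P \<sigma> (%s p. assoc_map H M N P (ut ?MN P s p)) (ut M N m n) p"
   unfolding L_def by (rule act_map_push[OF _ _ \<sigma>_bilinear _ _ La]) simp_all
  also have "... = act3 ?Q M N P (%g h l. \<sigma> (g *<H> h) l) (%m n p. assoc_map H M N P (ut ?MN P (ut M N m n) p)) m n p"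
   by (rule act_ct_left[OF M N P _ \<sigma>_bilinear]) (auto intro!: lin)
  also have "... = act3 ?Q M N P (%g h l. \<sigma> (g *<H> h) l) ?w m n p"
   by (rule act3_cong') (simp_all add: assoc_map_utens)
  finally show ?thesis .
 qed
 have "L (act_map \<sigma> M N (ut M N m n)) = act ?Q M N \<sigma> (%m n. L (ut M N m n)) m n"
  by (rule act_map_push[OF M N \<sigma>_bilinear m n L]) simp
 also have "... = act ?Q M N \<sigma> (%m n. act3 ?Q M N P (%g h l. \<sigma> (g *<H> h) l) ?w m n p) m n"
  by (rule act_cong) (simp_all add: Lu)
 also have "... = act3 ?Q M N P (%g h l. tsum k (comult H g) (%g1 g2. tsum k (comult H h) (%h1 h2. \<sigma> g1 h1 *<k> \<sigma> (g2 *<H> h2) l))) ?w m n p"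
  by (rule act3_12_123[OF M N P _ _ _ _ \<sigma>_bilinear]) (auto intro!: lin)
 also have "... = act3 ?Q M N P (%g h l. tsum k (comult H h) (%h1 h2. tsum k (comult H l) (%l1 l2. \<sigma> h1 l1 *<k> \<sigma> g (h2 *<H> l2)))) ?w m n p"
  by (rule act3_cong) (simp_all add: cocycle_eq)
 also have "... = act ?Q N P \<sigma> (%n p. act3 ?Q M N P (%g h l. \<sigma> g (h *<H> l)) ?w m n p) n p"
  by (rule act3_23_123[OF M N P _ _ _ _ \<sigma>_bilinear, symmetric]) (auto intro!: lin)
 also have "... = act ?Q N P \<sigma> (%n p. act_map \<sigma> M ?NP (ut M ?NP m (ut N P n p))) n p"
 proof (rule act_cong)
  fix n p assume [simp]: "n el N" "p el P"
  have "act_map \<sigma> M ?NP (ut M ?NP m (ut N P n p)) = act ?Q M ?NP \<sigma> (ut M ?NP) m (ut N P n p)"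
   by (rule act_map_utens) (simp_all add: \<sigma>_bilinear)
  also have "... = act3 ?Q M N P (%g h l. \<sigma> g (h *<H> l)) ?w m n p"
   by (rule act_ct_right[OF M N P _ \<sigma>_bilinear]) (auto intro!: linear_utens linear_id)
  finally show "act3 ?Q M N P (%g h l. \<sigma> g (h *<H> l)) ?w m n p = act_map \<sigma> M ?NP (ut M ?NP m (ut N P n p))" ..
 qed simp_all
 also have "... = act_map \<sigma> M ?NP (ut M ?NP m (act_map \<sigma> N P (ut N P n p)))"
  by (rule act_map_push[OF N P \<sigma>_bilinear n p linear_comp[OF linear_utens(1) linear_act_map], symmetric]) (simp_all add: linear_id \<sigma>_bilinear)
 finally show ?thesis unfolding L_def .
qed

interpretation H': nonassoc_bialgebra k H' by (rule nonassoc_H')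

lemma ct_H' [simp]: "carrier (ct H' M N) = carrier (ct H M N)"
 "tsum (ct H' M N) = tsum (ct H M N)"
proof -
 show "carrier (ct H' M N) = carrier (ct H M N)" by (rule ct_change_H)
 show "tsum (ct H' M N) = tsum (ct H M N)"
  by (intro ext tsum_change_group ct_change_H)
qed

lemma linear_ct_H' [simp]: "lmap (ct H' M N) G f = lmap (ct H M N) G f"
 "lmap L (ct H' M N) g = lmap L (ct H M N) g"
 unfolding linear_map_def ct_change_H[of H' M N H] by (rule HOL.refl)+

lemma utens_ct_H' [simp]:
 "ut (ct H' M N) P = ut (ct H M N) P" "ut P (ct H' M N) = ut P (ct H M N)"
proof -
 show "ut (ct H' M N) P = ut (ct H M N) P"
  by (intro ext) (simp add: utens_def tensor_change(2)[of "ct H' M N" "ct H M N" P P] ct_change_H[of H' M N H])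
 show "ut P (ct H' M N) = ut P (ct H M N)"
  by (intro ext) (simp add: utens_def tensor_change(2)[of P P "ct H' M N" "ct H M N"] ct_change_H[of H' M N H])
qed

text \<open>The identity \<open>star_\<sigma>\<close>, read in comodules.\<close>
lemma colinear_act_map:
 assumes M: "comod M" and N: "comod N"
 shows "colinear (ct H' M N) (ct H M N) (act_map \<sigma> M N)"
 unfolding colinear_def
proof (intro conjI ballI)
 let ?T = "ct H M N" and ?T' = "ct H' M N"
 have MN: "precomod M" "precomod N" "precomod ?T" and [simp]: "module k M" "module k N" using M N by auto
 have MN': "H'.precomod M" "H'.precomod N" using M N by (auto simp: left_comodule_H')
 have T': "precomod ?T'" using M N H'.left_comodule_ct[of M N] by (simp add: left_comodule_H')
 note L = linear_act_map[OF M N \<sigma>_bilinear]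
 show "lmap ?T' ?T (act_map \<sigma> M N)" using L by simp
 note [lin] = linear_comp[OF _ L] linear_form[OF \<sigma>_bilinear]
 note [simp] = form_closed[OF \<sigma>_bilinear]
 have Lc: "lmap ?T (tensor k H ?T) (coact ?T)" using MN(3) by (simp add: precomod_def)
 fix t assume "t el ?T'"
 then have t: "t el ?T" by simp
 let ?S = "tsum (tensor k H ?T)" let ?G = "tensor k H ?T"
 have R: "lmap ?T ?G (%t. ?S (coact ?T' t) (%h m0. tens k H ?T h (act_map \<sigma> M N m0)))"
 proof -
  have "lmap ?T' ?G (%t. ?S (coact ?T' t) (%h m0. tens k H ?T h (act_map \<sigma> M N m0)))"
   using MN T' linear_closed[OF L] by (intro lin_coact(2) linear_id) (auto intro!: lin simp: L)
  then show ?thesis by simp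
 qed
 show "coact ?T (act_map \<sigma> M N t) = ?S (coact ?T' t) (%h m0. tens k H ?T h (act_map \<sigma> M N m0))"
 proof (rule ct_ext[OF _ _ _ linear_comp[OF L Lc] R _ t])
  fix m n assume m: "m el M" and n: "n el N"
  have "coact ?T (act_map \<sigma> M N (ut M N m n)) = act ?G M N \<sigma> (%m n. coact ?T (ut M N m n)) m n"
   by (rule act_map_push[OF M N \<sigma>_bilinear m n Lc]) (use MN in simp)
  also have "... = ?S (coact M m) (%g m'. ?S (coact N n) (%h n'. ?S (coact M m') (%g2 m0. \<sigma> g h *[?G] ?S (coact N n') (%h2 n0. tens k H ?T (g2 *<H> h2) (ut M N m0 n0)))))"
   unfolding act_def using m n MN by (intro coact_cong) (simp_all add: coact_ct_utens smult_c)
  also have "... = ?S (coact M m) (%g m'. ?S (coact N n) (%h n'. ?S (coact M m') (%g2 m0. ?S (coact N n') (%h2 n0. \<sigma> g h *[?G] tens k H ?T (g2 *<H> h2) (ut M N m0 n0)))))"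
   using m n MN by (intro coact_cong) (simp_all add: smult_c)
  also have "... = ?S (coact M m) (%g m0. ?S (coact N n) (%h n0. ?S (comult H g) (%g1 g2. ?S (comult H h) (%h1 h2. \<sigma> g1 h1 *[?G] tens k H ?T (g2 *<H> h2) (ut M N m0 n0)))))"
   using m n MN by (intro coact2_coassoc[OF M N m n, symmetric]) (auto intro!: lin)
  also have "... = ?S (coact M m) (%g m0. ?S (coact N n) (%h n0. ?S (comult H g) (%g1 g2. ?S (comult H h) (%h1 h2. \<sigma> g2 h2 *[?G] tens k H ?T (g1 \<star> h1) (ut M N m0 n0)))))"
  proof (intro coact_cong MN m n)
   fix g m0 h n0 assume g: "g el H" and m0: "m0 el M" and h: "h el H" and n0: "n0 el N"
   let ?J = "%x. tens k H ?T x (ut M N m0 n0)"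
   have J: "lmap H ?G ?J" using m0 n0 MN by (auto intro!: lin)
   have G: "module k ?G" using MN by simp
   show "?S (comult H g) (%g1 g2. ?S (comult H h) (%h1 h2. \<sigma> g1 h1 *[?G] ?J (g2 *<H> h2))) =
    ?S (comult H g) (%g1 g2. ?S (comult H h) (%h1 h2. \<sigma> g2 h2 *[?G] ?J (g1 \<star> h1)))"
    using arg_cong[OF star_\<sigma>[OF g h], of ?J] linear_lact_push(1)[OF J module_H G \<sigma>_bilinear bilinear_mult g h]
     linear_lact_push(2)[OF J module_H G \<sigma>_bilinear bilinear_star g h]
    by (simp add: lact_def ract_def cprod_def)
  qed
  also have "... = ?S (coact M m) (%g m'. ?S (coact N n) (%h n'. ?S (coact M m') (%g2 m0. ?S (coact N n') (%h2 n0. \<sigma> g2 h2 *[?G] tens k H ?T (g \<star> h) (ut M N m0 n0)))))"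
   using m n MN by (intro coact2_coassoc[OF M N m n]) (auto intro!: lin)
  also have "... = ?S (coact M m) (%g m'. ?S (coact N n) (%h n'. tens k H ?T (g \<star> h) (act_map \<sigma> M N (ut M N m' n'))))"
  proof (intro coact_cong MN m n)
   fix g m' h n' assume g: "g el H" and m': "m' el M" and h: "h el H" and n': "n' el N"
   have "tens k H ?T (g \<star> h) (act_map \<sigma> M N (ut M N m' n')) = act ?G M N \<sigma> (%m n. tens k H ?T (g \<star> h) (ut M N m n)) m' n'"
    by (rule act_map_push[OF M N \<sigma>_bilinear m' n']) (use g h MN in \<open>auto intro!: lin\<close>)
   then show "?S (coact M m') (%g2 m0. ?S (coact N n') (%h2 n0. \<sigma> g2 h2 *[?G] tens k H ?T (g \<star> h) (ut M N m0 n0))) =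
    tens k H ?T (g \<star> h) (act_map \<sigma> M N (ut M N m' n'))" by (simp add: act_def)
  qed
  also have "... = ?S (coact ?T' (ut M N m n)) (%h m0. tens k H ?T h (act_map \<sigma> M N m0))"
   using m n MN linear_closed[OF L] by (intro H'.tsum_coact_ct[OF MN' m n, symmetric]) (auto intro!: lin simp: L linear_H')
  finally show "coact ?T (act_map \<sigma> M N (ut M N m n)) = ?S (coact ?T' (ut M N m n)) (%h m0. tens k H ?T h (act_map \<sigma> M N m0))" .
 qed (use MN in simp_all)
qed

end

context coalgebra
begin

lemma colinear_smult:
 assumes M: "comod M" and c: "c el k"
 shows "colinear M M (%m. c *[M] m)"
 unfolding colinear_def
proof (intro conjI ballI)
 have mM: "module k M" using M by simp
 have cl: "lmap M (tensor k H M) (coact M)" using comodule_precomod[OF M] by (simp add: precomod_def)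
 have sl: "lmap (tensor k H M) (tensor k H M) (%t. c *[tensor k H M] t)" using mM c by (auto intro!: lin)
 show "lmap M M (%m. c *[M] m)" using mM c by (auto intro!: lin)
 fix m assume m: "m el M"
 have "coact M (c *[M] m) = c *[tensor k H M] tsum (tensor k H M) (coact M m) (tens k H M)"
  using m c M by (simp add: tsum_tens_self linear_smult[OF cl])
 also have "... = tsum (tensor k H M) (coact M m) (%h m0. c *[tensor k H M] tens k H M h m0)"
  using m mM M by (intro linear_tsum[OF _ _ sl coact_pairs]) simp_all
 also have "... = tsum (tensor k H M) (coact M m) (%h m0. tens k H M h (c *[M] m0))"
 proof (intro coact_cong comodule_precomod M m)
  fix h n assume "h el H" "n el M"
  then show "c *[tensor k H M] tens k H M h n = tens k H M h (c *[M] n)"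
   using linear_smult[OF linear_tens(1)[OF module_H mM _ linear_id] c] by simp
 qed
 finally show "coact M (c *[M] m) = tsum (tensor k H M) (coact M m) (%h m0. tens k H M h (c *[M] m0))" .
qed

end

context cocycle_twist
begin

interpretation H': nonassoc_bialgebra k H' by (rule nonassoc_H')

lemma colinear_H': "H'.colinear = colinear"
 unfolding colinear_def[abs_def] H'.colinear_def[abs_def] tensor_H' by (rule HOL.refl)

lemma precomod_H' [simp]: "H'.precomod = precomod"
 unfolding precomod_def[abs_def] H'.precomod_def[abs_def] tensor_H' by (rule HOL.refl)

lemma carr_H': "H'.carr = carr"
 unfolding carr_def[abs_def] H'.carr_def[abs_def] left_comodule_H' comod_hom_H' by (rule HOL.refl)

lemma comod_unit_H': "comod_unit k H' = comod_unit k H"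
 unfolding comod_unit_def tensor_H' H'_simps by (rule HOL.refl)

lemma comp_H': "(oo\<^bsub>comod_cat k H' r'\<^esub>) = (oo\<^bsub>comod_cat k H r\<^esub>)"
 by (simp add: comod_cat_def)

lemma left_comodule_ct_H' [simp]: "comod M ==> comod N ==> comod (ct H' M N)"
 using H'.left_comodule_ct[of M N] by (simp add: left_comodule_H')

lemma utensor_ct_H':
 "utensor k (ct H' M N) P = utensor k (ct H M N) P" "utensor k P (ct H' M N) = utensor k P (ct H M N)"
 by (simp_all add: utensor_def Let_def tensor_change(1)[of "ct H' M N" "ct H M N" P P]
  tensor_change(1)[of P P "ct H' M N" "ct H M N"] ct_change_H[of H' M N H])

lemma ct_inner_H' [simp]:
 "carrier (ct H (ct H' M N) P) = carrier (ct H (ct H M N) P)"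
 "carrier (ct H P (ct H' M N)) = carrier (ct H P (ct H M N))"
 "tsum (ct H (ct H' M N) P) = tsum (ct H (ct H M N) P)"
 "tsum (ct H P (ct H' M N)) = tsum (ct H P (ct H M N))"
 by (simp_all add: ct_fields utensor_ct_H') (intro ext tsum_change_group; simp add: ct_fields utensor_ct_H')+

lemma linear_ct_inner_H' [simp]:
 "lmap (ct H (ct H' M N) P) G f = lmap (ct H (ct H M N) P) G f"
 "lmap (ct H P (ct H' M N)) G f = lmap (ct H P (ct H M N)) G f"
 "lmap L (ct H (ct H' M N) P) g = lmap L (ct H (ct H M N) P) g"
 "lmap L (ct H P (ct H' M N)) g = lmap L (ct H P (ct H M N)) g"
 unfolding linear_map_def ct_inner_H' ct_fields utensor_ct_H' by (rule HOL.refl)+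

lemma ten_map_H': "ten_map H' M N f g = ten_map H M N f g"
 unfolding ten_map_def ct_H' ..

lemma assoc_map_H': "assoc_map H' M N P = assoc_map H M N P"
 unfolding assoc_map_def Let_def ct_H' ct_inner_H' utens_ct_H' ..

lemma braid_map_H':
 assumes M: "comod M" and N: "comod N" and f: "bform \<phi>" and t: "t el (ct H M N)"
 shows "braid_map H' \<phi> M N t = braid_map H \<phi> M N t"
 unfolding braid_map_def Let_def ct_H' ct_change_H[of H' N M H] ..

lemma carr_ten_D [simp]: "carr f ==> carr g ==> carr (f xx\<^bsub>comod_cat k H' r'\<^esub> g)"
 using H'.carr_ten[of f g r'] by (simp add: carr_H')

lemma ap_ten_D [simp]:
 "[|carr f; carr g; fst f = M; fst g = N; m el M; n el N|] ==>
  ap (f xx\<^bsub>comod_cat k H' r'\<^esub> g) (ut M N m n) = ut (cod f) (cod g) (ap f m) (ap g n)"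
 using H'.ap_ten[of f g M N m n r'] by (simp add: carr_H')

lemma ap_ten_D' [simp]:
 "[|carr f; carr g; fst f = ct H' M L; fst g = N; m el (ct H M L); n el N|] ==>
  ap (f xx\<^bsub>comod_cat k H' r'\<^esub> g) (ut (ct H M L) N m n) = ut (cod f) (cod g) (ap f m) (ap g n)"
 "[|carr f; carr g; fst f = M; fst g = ct H' N L; m el M; n el (ct H N L)|] ==>
  ap (f xx\<^bsub>comod_cat k H' r'\<^esub> g) (ut M (ct H N L) m n) = ut (cod f) (cod g) (ap f m) (ap g n)"
 using ap_ten_D[of f g "ct H' M L" N m n r'] ap_ten_D[of f g M "ct H' N L" m n r'] by simp_all

lemmas eq2I_D = H'.carr_eq2I[unfolded carr_H' left_comodule_H']
lemmas eq3I_D = H'.carr_eq3I[unfolded carr_H' left_comodule_H']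

lemma \<sigma>_\<sigma>'_maps:
 assumes "comod M" "comod N" "t el (ct H M N)"
 shows "act_map \<sigma>' M N (act_map \<sigma> M N t) = t" "act_map \<sigma> M N (act_map \<sigma>' M N t) = t"
 by (rule act_map_inverse[OF assms(1,2) \<sigma>'_bilinear \<sigma>_bilinear \<sigma>_\<sigma>' assms(3)], assumption+)
  (rule act_map_inverse[OF assms(1,2) \<sigma>_bilinear \<sigma>'_bilinear \<sigma>'_\<sigma> assms(3)], assumption+)

lemma colinear_act_map':
 assumes M: "comod M" and N: "comod N"
 shows "colinear (ct H M N) (ct H' M N) (act_map \<sigma>' M N)"
 by (rule colinear_inverse[OF _ _ colinear_act_map[OF M N]])
  (use M N linear_act_map[OF M N \<sigma>'_bilinear] \<sigma>_\<sigma>'_maps[OF M N] in simp_all)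

lemma colinear_ten_map_D:
 assumes "comod M" "comod N" "comod M'" "comod N'"
  "colinear M M' f" "colinear N N' g"
 shows "colinear (ct H' M N) (ct H' M' N') (ten_map H M' N' f g)"
 using H'.comodule_ten_map[of M N M' N' f g] assms by (simp add: left_comodule_H' colinear_H' ten_map_H')

text \<open>The comparison maps are isomorphisms of comodules, and by the cocycle identity they carry the
 associativity map of \<open>C\<close> to that of \<open>D\<close>, which has the same values on pure tensors. In this way
 associativity of the deformed product is used without being computed.\<close>
lemma colinear_assoc_D:
 assumes M: "comod M" and N: "comod N" and P: "comod P"
 shows "colinear (ct H' (ct H' M N) P) (ct H' M (ct H' N P)) (assoc_map H M N P)"
proof -
 note [simp] = M N P
 let ?MN = "ct H M N" and ?NP = "ct H N P" and ?MN' = "ct H' M N" and ?NP' = "ct H' N P"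
 let ?A = "ct H' ?MN' P" and ?B = "ct H' M ?NP'"
 define l where "l = ten_map H ?MN P (act_map \<sigma> M N) (%p. p)"
 define r where "r = ten_map H M ?NP' (%p. p) (act_map \<sigma>' N P)"
 have l: "colinear ?A (ct H' ?MN P) l"
  unfolding l_def by (rule colinear_ten_map_D) (simp_all add: colinear_act_map)
 have r: "colinear (ct H' M ?NP) ?B r"
  unfolding r_def by (rule colinear_ten_map_D) (simp_all add: colinear_act_map')
 have c1: "colinear ?A (ct H ?MN P) (%t. act_map \<sigma> ?MN P (l t))"
  by (rule colinear_comp[OF _ _ _ l colinear_act_map]) simp_all
 have c2: "colinear ?A (ct H M ?NP) (%t. assoc_map H M N P (act_map \<sigma> ?MN P (l t)))"
  by (rule colinear_comp[OF _ _ _ c1 colinear_assoc]) simp_all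
 have c3: "colinear ?A (ct H' M ?NP) (%t. act_map \<sigma>' M ?NP (assoc_map H M N P (act_map \<sigma> ?MN P (l t))))"
  by (rule colinear_comp[OF _ _ _ c2 colinear_act_map']) simp_all
 have c4: "colinear ?A ?B (%t. r (act_map \<sigma>' M ?NP (assoc_map H M N P (act_map \<sigma> ?MN P (l t)))))"
  by (rule colinear_comp[OF _ _ _ c3 r]) simp_all
 have La: "lmap ?A ?B (assoc_map H M N P)"
  using linear_assoc_map[of M N P H] by simp
 have "r (act_map \<sigma>' M ?NP (assoc_map H M N P (act_map \<sigma> ?MN P (l t)))) = assoc_map H M N P t" if t: "t el ?A" for t
 proof (rule ct3_ext[OF _ _ _ _ _ _ _ t])
  show "lmap (ct H' (ct H' M N) P) ?B (%t. r (act_map \<sigma>' M ?NP (assoc_map H M N P (act_map \<sigma> ?MN P (l t)))))"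
   by (rule colinear_linear[OF c4])
  show "lmap (ct H' (ct H' M N) P) ?B (assoc_map H M N P)" by (rule La)
  fix m n p assume mnp [simp]: "m el M" "n el N" "p el P"
  have s: "act_map \<sigma> N P (ut N P n p) el ?NP" "act_map \<sigma> M N (ut M N m n) el ?MN"
   using linear_closed[OF linear_act_map[OF N P \<sigma>_bilinear]] linear_closed[OF linear_act_map[OF M N \<sigma>_bilinear]] by simp_all
  have "l (ut ?MN' P (ut M N m n) p) = ut ?MN P (act_map \<sigma> M N (ut M N m n)) p"
   unfolding l_def by (rule ten_map_utens) (simp_all add: linear_act_map \<sigma>_bilinear linear_id)
  then have "assoc_map H M N P (act_map \<sigma> ?MN P (l (ut ?MN' P (ut M N m n) p))) = act_map \<sigma> M ?NP (ut M ?NP m (act_map \<sigma> N P (ut N P n p)))"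
   using cocycle_act_map[OF M N P mnp] by simp
  then have "act_map \<sigma>' M ?NP (assoc_map H M N P (act_map \<sigma> ?MN P (l (ut ?MN' P (ut M N m n) p)))) = ut M ?NP m (act_map \<sigma> N P (ut N P n p))"
   using s by (simp add: \<sigma>_\<sigma>'_maps)
  moreover have "r (ut M ?NP m (act_map \<sigma> N P (ut N P n p))) = ut M ?NP' m (act_map \<sigma>' N P (act_map \<sigma> N P (ut N P n p)))"
   unfolding r_def by (rule ten_map_utens) (simp_all add: linear_act_map \<sigma>'_bilinear linear_id s)
  ultimately show "r (act_map \<sigma>' M ?NP (assoc_map H M N P (act_map \<sigma> ?MN P (l (ut ?MN' P (ut M N m n) p))))) = assoc_map H M N P (ut ?MN' P (ut M N m n) p)"
   by (simp add: \<sigma>_\<sigma>'_maps assoc_map_utens)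
 qed simp_all
 then show ?thesis by (intro colinear_cong[THEN iffD1, OF _ _ c4]) simp_all
qed

lemma monoidal_D: "monoidal_category (comod_cat k H' r')"
 by (rule H'.comod_monoidalI) (simp add: left_comodule_H' colinear_H' assoc_map_H' colinear_assoc_D)

lemma monoidal_D_st: "monoidal_category_st (comod_cat k H' r') fst cod"
 by (intro monoidal_category_st.intro monoidal_category_st_axioms.intro monoidal_D H'.comod_src_tgt)

lemma act_map_eq: "(%t. tsum (ct H M N) (untens t) (%m n. tsum (ct H M N) (coact M m) (%g m0. tsum (ct H M N) (coact N n) (%h n0.
      \<sigma> g h *[ct H M N] ut M N m0 n0)))) = act_map \<sigma> M N"
 unfolding act_map_def[abs_def] act_def[abs_def] ..

lemma twist_functor_simps:
 "FO (twist_functor k H \<sigma>) = (%M. M)" "FA (twist_functor k H \<sigma>) = (%f. f)"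
 "FXi (twist_functor k H \<sigma>) M N = comod_arrow (ct H' M N) (ct H M N) (act_map \<sigma> M N)"
 "FEta (twist_functor k H \<sigma>) = comod_arrow (comod_unit k H) (comod_unit k H) (%c. inv\<^bsub>k\<^esub> \<sigma>11 *[comod_unit k H] c)"
 by (simp_all add: twist_functor_def Let_def act_map_eq comod_unit_H')

lemma inv_\<sigma>11: "inv\<^bsub>k\<^esub> \<sigma>11 = \<sigma>' oneH oneH"
 by (rule R.comm_inv_char) (simp_all add: \<sigma>_one_inverse)

lemma comod_cat_same:
 "Obj (comod_cat k H' r') = Obj (comod_cat k H r)" "Hom (comod_cat k H' r') = Hom (comod_cat k H r)"
 "Ident (comod_cat k H' r') = Ident (comod_cat k H r)" "Comp (comod_cat k H' r') = Comp (comod_cat k H r)"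
 by (simp_all add: comod_cat_def left_comodule_H' comod_hom_H')

lemma twist_monoidal_functor: "monoidal_functor (comod_cat k H r) (comod_cat k H' r') (twist_functor k H \<sigma>)" (is "monoidal_functor ?C ?D ?F")
proof -
 interpret C: monoidal_category ?C by (rule comod_monoidal)
 interpret D: monoidal_category ?D by (rule monoidal_D)
 note s = cc_simps twist_functor_simps comod_unit_H' assoc_map_H' comp_H'[where r=r and r'=r']
 have obj: "X \<in> Obj ?C ==> comod X" for X by (simp add: cc_simps)
 have arr: "X \<in> Obj ?C ==> Y \<in> Obj ?C ==> f \<in> Hom ?C X Y ==> carr f \<and> fst f = X \<and> cod f = Y" for X Y f
  using hom_iff by blast
 note [simp] = colinear_act_map colinear_assoc
 have [simp]: "act_map \<sigma> M N t el (ct H M N)" if "comod M" "comod N" "t el (ct H M N)" for M N t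
  using linear_closed[OF linear_act_map[OF that(1,2) \<sigma>_bilinear] that(3)] .
 let ?U = "comod_unit k H"
 let ?e = "%c. inv\<^bsub>k\<^esub> \<sigma>11 *[?U] c"
 have e: "colinear ?U ?U ?e" by (rule colinear_smult) (simp_all add: inv_\<sigma>11 left_comodule_cu)
 note [simp] = left_comodule_cu
 have ce [simp]: "carr (comod_arrow ?U ?U ?e)" using e by (simp only: carr_comod_arrow left_comodule_cu)
 have [simp]: "inv\<^bsub>k\<^esub> \<sigma>11 el k" "\<sigma>11 *<k> inv\<^bsub>k\<^esub> \<sigma>11 = \<one>\<^bsub>k\<^esub>" "inv\<^bsub>k\<^esub> \<sigma>11 *<k> \<sigma>11 = \<one>\<^bsub>k\<^esub>"
  by (simp_all add: inv_\<sigma>11 \<sigma>_one_inverse \<sigma>_one_inverse')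
 have unit: "\<sigma>11 *[X] (unscal (?e c) *[X] x) = unscal c *[X] x" if "comod X" "c el ?U" "x el X" for c x and X :: "('k, 'h, 'x) comod"
 proof -
  have "\<sigma>11 *[X] (unscal (?e c) *[X] x) = (\<sigma>11 *<k> (inv\<^bsub>k\<^esub> \<sigma>11 *<k> unscal c)) *[X] x"
   using that by (simp add: cu_simps(4) mult_smult)
  also have "\<sigma>11 *<k> (inv\<^bsub>k\<^esub> \<sigma>11 *<k> unscal c) = unscal c"
   using that by (subst R.m_assoc[symmetric]) simp_all
  finally show ?thesis .
 qed
 show ?thesis
 proof (intro monoidal_functor.intro cat_functor.intro monoidal_functor_axioms.intro cat_functor_axioms.intro)
  show "category ?C" "category ?D" "monoidal_category ?C" "monoidal_category ?D" by unfold_locales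
  fix X Y assume o': "X \<in> Obj ?C" "Y \<in> Obj ?C"
  note o = this[THEN obj]
  show "iso_arrow ?D (FO ?F X ox\<^bsub>?D\<^esub> FO ?F Y) (FO ?F (X ox\<^bsub>?C\<^esub> Y)) (FXi ?F X Y)"
   unfolding iso_arrow_def s
   by (rule exI, rule H'.inverse_comod_arrowsI[unfolded left_comodule_H' colinear_H', OF _ _ _ colinear_linear[OF colinear_act_map'[OF o]]])
    (use o in \<open>simp_all add: \<sigma>_\<sigma>'_maps\<close>)
 next
  fix X X' Y Y' f g assume a: "X \<in> Obj ?C" "X' \<in> Obj ?C" "Y \<in> Obj ?C" "Y' \<in> Obj ?C" "f \<in> Hom ?C X X'" "g \<in> Hom ?C Y Y'"
  note o = a(1-4)[THEN obj]
  have f: "carr f" "fst f = X" "cod f = X'" and g: "carr g" "fst g = Y" "cod g = Y'" using arr a by blast+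
  note cf = carr_colinear[OF f] and cg = carr_colinear[OF g]
  note [simp] = o f g
  have fg: "lmap (ct H X Y) (ct H X' Y') (ap (f xx\<^bsub>?C\<^esub> g))" by (rule carr_linear) simp_all
  show "FXi ?F X' Y' oo\<^bsub>?D\<^esub> (FA ?F f xx\<^bsub>?D\<^esub> FA ?F g) = FA ?F (f xx\<^bsub>?C\<^esub> g) oo\<^bsub>?D\<^esub> FXi ?F X Y"
   unfolding s
  proof (rule eq2I_D[of _ _ X Y])
   fix x y assume x: "x el X" and y: "y el Y"
   have "act_map \<sigma> X' Y' (ut X' Y' (ap f x) (ap g y)) = act (ct H X' Y') X' Y' \<sigma> (ut X' Y') (ap f x) (ap g y)"
    using x y by (intro act_map_utens) (simp_all add: \<sigma>_bilinear)
   also have "... = act (ct H X' Y') X Y \<sigma> (%x y. ut X' Y' (ap f x) (ap g y)) x y"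
    by (rule act_colinear[OF o(2,4) _ linear_utens_fun[OF o(2,4) \<sigma>_bilinear] \<sigma>_bilinear o(1,3) cf cg x y]) simp_all
   also have "... = act (ct H X' Y') X Y \<sigma> (%x y. ap (f xx\<^bsub>?C\<^esub> g) (ut X Y x y)) x y"
    using x y by (intro act_cong) simp_all
   also have "... = ap (f xx\<^bsub>?C\<^esub> g) (act_map \<sigma> X Y (ut X Y x y))"
    using x y by (intro act_map_push[OF o(1,3) \<sigma>_bilinear _ _ fg, symmetric]) simp_all
   finally show "ap (comod_arrow (ct H' X' Y') (ct H X' Y') (act_map \<sigma> X' Y') oo\<^bsub>?C\<^esub> (f xx\<^bsub>?D\<^esub> g)) (ut X Y x y) =
     ap ((f xx\<^bsub>?C\<^esub> g) oo\<^bsub>?C\<^esub> comod_arrow (ct H' X Y) (ct H X Y) (act_map \<sigma> X Y)) (ut X Y x y)"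
    using x y by simp
  qed simp_all
 next
  show "iso_arrow ?D (Unit ?D) (FO ?F (Unit ?C)) (FEta ?F)"
   unfolding iso_arrow_def s
  proof (rule exI, rule H'.inverse_comod_arrowsI[unfolded left_comodule_H' colinear_H'])
   show "lmap ?U ?U (%c. \<sigma>11 *[?U] c)" by (auto intro!: lin)
  qed (use e in \<open>simp_all add: mult_smult[symmetric] one_smult\<close>)
 next
  fix X Y Z assume "X \<in> Obj ?C" "Y \<in> Obj ?C" "Z \<in> Obj ?C"
  note o = this[THEN obj]
  show "FA ?F (Assoc ?C X Y Z) oo\<^bsub>?D\<^esub> FXi ?F (X ox\<^bsub>?C\<^esub> Y) Z oo\<^bsub>?D\<^esub> (FXi ?F X Y xx\<^bsub>?D\<^esub> Ident ?D (FO ?F Z))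
     = FXi ?F X (Y ox\<^bsub>?C\<^esub> Z) oo\<^bsub>?D\<^esub> (Ident ?D (FO ?F X) xx\<^bsub>?D\<^esub> FXi ?F Y Z)
      oo\<^bsub>?D\<^esub> Assoc ?D (FO ?F X) (FO ?F Y) (FO ?F Z)"
   unfolding s
   by (rule eq3I_D[of _ _ X Y Z]) (use o in \<open>simp_all add: colinear_assoc_D cocycle_act_map assoc_map_utens\<close>)
 next
  fix X assume "X \<in> Obj ?C"
  note o = obj[OF this]
  note [lin] = linear_form[OF \<sigma>_bilinear]
  have l: "lmap (ct H ?U X) X (lunit_map X)" and r: "lmap (ct H X ?U) X (runit_map X)"
   using o by (simp_all add: linear_lunit_map linear_runit_map)
  have U: "precomod ?U" "precomod X" "module k X" "comod ?U" using o by simp_all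
  note [simp] = o form_closed[OF \<sigma>_bilinear]
  have "lunit_map X (act_map \<sigma> ?U X (ut ?U X (?e c) x)) = unscal c *[X] x" if c: "c el ?U" and x: "x el X" for c x
  proof -
   have c': "?e c el ?U" using c by simp
   have "lunit_map X (act_map \<sigma> ?U X (ut ?U X (?e c) x)) = act X ?U X \<sigma> (%c x. lunit_map X (ut ?U X c x)) (?e c) x"
    by (rule act_map_push[OF U(4) o \<sigma>_bilinear c' x l U(3)])
   also have "... = act X ?U X \<sigma> (%c x. unscal c *[X] x) (?e c) x"
    using c' x by (intro act_cong) (simp_all add: lunit_map_utens)
   also have "... = tsum X (coact X x) (%h x0. \<sigma> oneH h *[X] (unscal (?e c) *[X] x0))"
    unfolding act_def using c' x U by (intro tsum_coact_cu) (auto intro!: lin)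
   also have "... = tsum X (coact X x) (%h x0. counit H h *[X] (\<sigma>11 *[X] (unscal (?e c) *[X] x0)))"
    using c' x U by (intro coact_cong \<sigma>_one_smult(2)) simp_all
   also have "... = \<sigma>11 *[X] (unscal (?e c) *[X] x)"
    using c' x U by (intro coact_counit o) (auto intro!: lin)
   also have "... = unscal c *[X] x" by (rule unit[OF o c x])
   finally show ?thesis .
  qed
  then show "FA ?F (LUnit ?C X) oo\<^bsub>?D\<^esub> FXi ?F (Unit ?C) X oo\<^bsub>?D\<^esub> (FEta ?F xx\<^bsub>?D\<^esub> Ident ?D (FO ?F X)) = LUnit ?D (FO ?F X)"
   unfolding s
   by (intro eq2I_D[of _ _ ?U X]) (use e H'.colinear_lunit[of X] in \<open>simp_all add: lunit_map_utens colinear_lunit colinear_H' left_comodule_H' comod_unit_H'\<close>)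
  have "runit_map X (act_map \<sigma> X ?U (ut X ?U x (?e c))) = unscal c *[X] x" if c: "c el ?U" and x: "x el X" for c x
  proof -
   have c': "?e c el ?U" using c by simp
   have "runit_map X (act_map \<sigma> X ?U (ut X ?U x (?e c))) = act X X ?U \<sigma> (%x c. runit_map X (ut X ?U x c)) x (?e c)"
    by (rule act_map_push[OF o U(4) \<sigma>_bilinear x c' r U(3)])
   also have "... = act X X ?U \<sigma> (%x c. unscal c *[X] x) x (?e c)"
    using c' x by (intro act_cong) (simp_all add: runit_map_utens)
   also have "... = tsum X (coact X x) (%h x0. \<sigma> h oneH *[X] (unscal (?e c) *[X] x0))"
    unfolding act_def using c' x U by (intro coact_cong tsum_coact_cu) (auto intro!: lin)
   also have "... = tsum X (coact X x) (%h x0. counit H h *[X] (\<sigma>11 *[X] (unscal (?e c) *[X] x0)))"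
    using c' x U by (intro coact_cong \<sigma>_one_smult(1)) simp_all
   also have "... = \<sigma>11 *[X] (unscal (?e c) *[X] x)"
    using c' x U by (intro coact_counit o) (auto intro!: lin)
   also have "... = unscal c *[X] x" by (rule unit[OF o c x])
   finally show ?thesis .
  qed
  then show "FA ?F (RUnit ?C X) oo\<^bsub>?D\<^esub> FXi ?F X (Unit ?C) oo\<^bsub>?D\<^esub> (Ident ?D (FO ?F X) xx\<^bsub>?D\<^esub> FEta ?F) = RUnit ?D (FO ?F X)"
   unfolding s
   by (intro eq2I_D[of _ _ X ?U]) (use e H'.colinear_runit[of X] in \<open>simp_all add: runit_map_utens colinear_runit colinear_H' left_comodule_H' comod_unit_H'\<close>)
 qed (simp_all add: twist_functor_simps comod_cat_same[of r' r])
qed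

end

locale cobraided_twist = cocycle_twist k H \<sigma> + cobraided_hopf_algebra k H r
 for k :: "'k ring" and H :: "('k, 'h) hopf_data" and \<sigma> r
begin

interpretation H': nonassoc_bialgebra k H' by (rule nonassoc_H')

abbreviation r\<sigma> where "r\<sigma> \<equiv> deformed_r_form k H \<sigma> r"

lemma r\<sigma>_bilinear: "bform r\<sigma>"
 unfolding deformed_r_form_def by (rule bilinear_conv[OF bilinear_conv[OF bilinear_flip[OF \<sigma>_bilinear] r_bilinear] \<sigma>'_bilinear])

lemma conv_ract:
 assumes "bform \<phi>" "bform \<psi>" "x el H" "y el H"
 shows "conv k H \<phi> \<psi> x y = ract K \<psi> \<phi> x y"
 unfolding conv_cprod ract_def cprod_def using assms(3,4) form_closed[OF assms(1)] form_closed[OF assms(2)]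
 by (intro comult_cong) (simp_all add: R.m_comm)

lemma r\<sigma>_\<sigma>:
 assumes x: "x el H" and y: "y el H"
 shows "conv k H r\<sigma> \<sigma> x y = conv k H (%x y. \<sigma> y x) r x y"
proof -
 let ?f = "conv k H (%x y. \<sigma> y x) r"
 have f: "bform ?f" by (rule bilinear_conv[OF bilinear_flip[OF \<sigma>_bilinear] r_bilinear])
 have "conv k H r\<sigma> \<sigma> x y = ract K \<sigma> r\<sigma> x y" by (rule conv_ract[OF r\<sigma>_bilinear \<sigma>_bilinear x y])
 also have "... = ract K \<sigma> (ract K \<sigma>' ?f) x y"
  by (rule ract_cong(1)[OF x y]) (simp_all add: deformed_r_form_def conv_ract[OF f \<sigma>'_bilinear])
 also have "... = ?f x y" using f by (intro ract_inverse[OF module_K \<sigma>_bilinear \<sigma>'_bilinear _ x y \<sigma>'_\<sigma>]) (simp_all add: bilinear_form_iff)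
 finally show ?thesis .
qed

text \<open>Both composites are given by convolution products of forms, and \<open>r\<^sub>\<sigma> * \<sigma> = \<sigma>\<^sub>2\<^sub>1 * r\<close>.\<close>
lemma braid_act_map:
 assumes M: "comod M" and N: "comod N" and t: "t el (ct H M N)"
 shows "braid_map H r M N (act_map \<sigma> M N t) = act_map \<sigma> N M (braid_map H r\<sigma> M N t)"
proof (rule ct_ext[OF _ _ _ linear_comp[OF linear_act_map[OF M N \<sigma>_bilinear] linear_braid_map[OF r_bilinear M N]]
   linear_comp[OF linear_braid_map[OF r\<sigma>_bilinear M N] linear_act_map[OF N M \<sigma>_bilinear]] _ t])
 note [simp] = M N
 let ?T = "ct H N M" let ?v = "%m n. ut N M n m"
 have T: "module k ?T" by simp
 note f = \<sigma>_bilinear r_bilinear bilinear_flip[OF \<sigma>_bilinear] bilinear_flip[OF r_bilinear] bilinear_flip[OF r\<sigma>_bilinear]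
 have v: "!!m. m el M ==> lmap N ?T (?v m)" "!!n. n el N ==> lmap M ?T (%m. ?v m n)"
  by (auto intro!: lin)
 fix m n assume m: "m el M" and n: "n el N"
 have "braid_map H r M N (act_map \<sigma> M N (ut M N m n)) = act ?T M N \<sigma> (%m n. braid_map H r M N (ut M N m n)) m n"
  by (rule act_map_push[OF M N \<sigma>_bilinear m n linear_braid_map[OF r_bilinear M N] T])
 also have "... = act ?T M N \<sigma> (act ?T M N (%g h. r h g) ?v) m n"
  using m n by (intro act_cong) (simp_all add: braid_map_utens r_bilinear)
 also have "... = act ?T M N (conv k H \<sigma> (%g h. r h g)) ?v m n"
  by (rule act_act[OF M N T v f(1,4) m n])
 also have "... = act ?T M N (conv k H (%g h. r\<sigma> h g) (%g h. \<sigma> h g)) ?v m n"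
  using m n conv_flip[OF f(3) r_bilinear] conv_flip[OF r\<sigma>_bilinear \<sigma>_bilinear] by (intro act_cong) (simp_all add: r\<sigma>_\<sigma>)
 also have "... = act ?T M N (%g h. r\<sigma> h g) (act ?T M N (%g h. \<sigma> h g) ?v) m n"
  by (rule act_act[OF M N T v f(5,3) m n, symmetric])
 also have "... = act ?T M N (%g h. r\<sigma> h g) (%m n. act_map \<sigma> N M (ut N M n m)) m n"
 proof (intro act_cong m n)
  fix m n assume m: "m el M" and n: "n el N"
  have "act ?T N M \<sigma> (ut N M) n m = act ?T M N (%g h. \<sigma> h g) ?v m n"
   by (rule act_swap[OF N M T linear_utens_fun[OF N M \<sigma>_bilinear] \<sigma>_bilinear n m])
  then show "act ?T M N (%g h. \<sigma> h g) ?v m n = act_map \<sigma> N M (ut N M n m)"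
   using m n by (simp add: act_map_utens \<sigma>_bilinear)
 qed simp_all
 also have "... = act_map \<sigma> N M (braid_map H r\<sigma> M N (ut M N m n))"
  by (rule braid_map_push[OF r\<sigma>_bilinear M N m n linear_act_map[OF N M \<sigma>_bilinear] T, symmetric])
 finally show "braid_map H r M N (act_map \<sigma> M N (ut M N m n)) = act_map \<sigma> N M (braid_map H r\<sigma> M N (ut M N m n))" .
qed (use M N in simp_all)

lemma colinear_braid_D:
 assumes M: "comod M" and N: "comod N"
 shows "colinear (ct H' M N) (ct H' N M) (braid_map H r\<sigma> M N)"
proof -
 note [simp] = M N
 have c: "colinear (ct H' M N) (ct H' N M) (%t. act_map \<sigma>' N M (braid_map H r M N (act_map \<sigma> M N t)))"
  by (rule colinear_comp[OF _ _ _ colinear_comp[OF _ _ _ colinear_act_map colinear_braid] colinear_act_map']) simp_all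
 have "act_map \<sigma>' N M (braid_map H r M N (act_map \<sigma> M N t)) = braid_map H r\<sigma> M N t" if "t el (ct H' M N)" for t
  using that linear_closed[OF linear_braid_map[OF r\<sigma>_bilinear M N]] by (simp add: braid_act_map \<sigma>_\<sigma>'_maps)
 then show ?thesis by (intro colinear_cong[THEN iffD1, OF _ _ c]) simp_all
qed

abbreviation DD where "DD \<equiv> comod_cat k H' r\<sigma>"

lemma twist_instance: "twist (CC :: (('k, 'h, 'x) comod, ('k, 'h, 'x) comod_arrow) brcat) DD (twist_functor k H \<sigma>) fst cod"
proof (intro twist.intro braided_monoidal_category_st.intro twist_axioms.intro twist_monoidal_functor comod_braided comod_monoidal_st monoidal_D_st comod_cat_same)
 show "FO (twist_functor k H \<sigma>) = (%X. X)" "FA (twist_functor k H \<sigma>) = (%f. f)" by (simp_all add: twist_functor_simps)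
 fix X Y :: "('k, 'h, 'x) comod" assume "X \<in> Obj CC" "Y \<in> Obj CC"
 then have o [simp]: "comod X" "comod Y" by (simp_all add: cc_simps)
 have e: "Braid DD X Y = comod_arrow (ct H' X Y) (ct H' Y X) (braid_map H r\<sigma> X Y)"
  unfolding cc_simps comod_arrow_eq_iff using braid_map_H'[OF o r\<sigma>_bilinear] by simp
 show "Braid DD X Y \<in> Hom CC (X ox\<^bsub>DD\<^esub> Y) (Y ox\<^bsub>DD\<^esub> X)"
  unfolding e unfolding cc_simps by (simp add: comod_arrow_hom colinear_braid_D)
 show "Braid CC X Y oo\<^bsub>CC\<^esub> FXi (twist_functor k H \<sigma>) X Y = FXi (twist_functor k H \<sigma>) Y X oo\<^bsub>CC\<^esub> Braid DD X Y"
  unfolding e unfolding cc_simps twist_functor_simps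
  by (rule carr_eqI) (simp_all add: colinear_act_map colinear_braid_D braid_act_map
   linear_closed[OF linear_braid_map[OF r\<sigma>_bilinear o]] linear_closed[OF linear_act_map[OF o \<sigma>_bilinear]])
qed

end

section \<open>Modules over a Hopf algebra in the category of comodules\<close>

context coalgebra
begin

lemma act_commute:
 assumes M: "comod M" and N: "comod N" and P: "comod P" and Q: "comod Q" and G: "module k G"
  and \<phi>: "bform \<phi>" and \<psi>: "bform \<psi>"
  and u: "!!m n p q. m el M ==> n el N ==> p el P ==> q el Q ==> u m n p q el G"
  and m: "m el M" and n: "n el N" and p: "p el P" and q: "q el Q"
 shows "act G M N \<phi> (%m n. act G P Q \<psi> (%p q. u m n p q) p q) m n = act G P Q \<psi> (%p q. act G M N \<phi> (%m n. u m n p q) m n) p q"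
proof -
 note [simp] = M[THEN comodule_precomod] N[THEN comodule_precomod] P[THEN comodule_precomod] Q[THEN comodule_precomod] G u
  form_closed[OF \<phi>] form_closed[OF \<psi>]
 let ?S = "%t. tsum G t"
 have "act G M N \<phi> (%m n. act G P Q \<psi> (%p q. u m n p q) p q) m n =
  ?S (coact M m) (%g m0. ?S (coact N n) (%h n0. ?S (coact P p) (%i p0. \<phi> g h *[G] ?S (coact Q q) (%j q0. \<psi> i j *[G] u m0 n0 p0 q0))))"
  unfolding act_def using m n p q by (intro coact_cong smult_c) simp_all
 also have "... = ?S (coact M m) (%g m0. ?S (coact N n) (%h n0. ?S (coact P p) (%i p0. ?S (coact Q q) (%j q0. \<phi> g h *[G] (\<psi> i j *[G] u m0 n0 p0 q0)))))"
  using m n p q by (intro coact_cong smult_c) simp_all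
 also have "... = ?S (coact M m) (%g m0. ?S (coact P p) (%i p0. ?S (coact N n) (%h n0. ?S (coact Q q) (%j q0. \<phi> g h *[G] (\<psi> i j *[G] u m0 n0 p0 q0)))))"
  using m n p q by (intro coact_cong swap_cc) simp_all
 also have "... = ?S (coact P p) (%i p0. ?S (coact M m) (%g m0. ?S (coact N n) (%h n0. ?S (coact Q q) (%j q0. \<phi> g h *[G] (\<psi> i j *[G] u m0 n0 p0 q0)))))"
  using m n p q by (intro swap_cc) simp_all
 also have "... = ?S (coact P p) (%i p0. ?S (coact M m) (%g m0. ?S (coact Q q) (%j q0. ?S (coact N n) (%h n0. \<phi> g h *[G] (\<psi> i j *[G] u m0 n0 p0 q0)))))"
  using m n p q by (intro coact_cong swap_cc) simp_all
 also have "... = ?S (coact P p) (%i p0. ?S (coact Q q) (%j q0. ?S (coact M m) (%g m0. ?S (coact N n) (%h n0. \<phi> g h *[G] (\<psi> i j *[G] u m0 n0 p0 q0)))))"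
  using m n p q by (intro coact_cong swap_cc) simp_all
 also have "... = ?S (coact P p) (%i p0. ?S (coact Q q) (%j q0. ?S (coact M m) (%g m0. ?S (coact N n) (%h n0. \<psi> i j *[G] (\<phi> g h *[G] u m0 n0 p0 q0)))))"
  using m n p q by (intro coact_cong smult_commute) simp_all
 also have "... = ?S (coact P p) (%i p0. ?S (coact Q q) (%j q0. ?S (coact M m) (%g m0. \<psi> i j *[G] ?S (coact N n) (%h n0. \<phi> g h *[G] u m0 n0 p0 q0))))"
  using m n p q by (intro coact_cong smult_c[symmetric]) simp_all
 also have "... = act G P Q \<psi> (%p q. act G M N \<phi> (%m n. u m n p q) m n) p q"
  unfolding act_def using m n p q by (intro coact_cong smult_c[symmetric]) simp_all
 finally show ?thesis .
qed

lemma linear_untens_expand: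
 fixes M N :: "('k, 'h, 'x) comod"
 assumes M: "module k M" and N: "module k N" and G: "module k G" and L: "lmap (ct H M N) G L" and t: "t el (ct H M N)"
 shows "L t = tsum G (untens t) (%m n. L (ut M N m n))"
proof -
 have "L t = L (tsum (ct H M N) (untens t) (ut M N))" using tsum_utens_self[OF M N t] by simp
 also have "... = tsum G (untens t) (%m n. L (ut M N m n))"
  using M N G t by (intro linear_tsum[OF _ _ L pairs_untens[OF M N t]]) simp_all
 finally show ?thesis .
qed

end

context nonassoc_bialgebra
begin

lemma carr_eq22I:
 assumes ab: "carr a" "carr b" "fst a = ct H (ct H J L) (ct H M N)" "fst b = ct H (ct H J L) (ct H M N)" "cod a = cod b"
  and JLMN: "comod J" "comod L" "comod M" "comod N"
  and eq: "!!x y m n. x el J ==> y el L ==> m el M ==> n el N ==>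
   ap a (ut (ct H J L) (ct H M N) (ut J L x y) (ut M N m n))
   = ap b (ut (ct H J L) (ct H M N) (ut J L x y) (ut M N m n))"
 shows "a = b"
proof (rule carr_eq3I[OF ab(1-5)])
 note [simp] = JLMN
 have G: "module k (cod a)" using carr_cod[OF ab(1)] by simp
 fix x y t assume x: "x el J" and y: "y el L" and t: "t el (ct H M N)"
 note la = carr_linear[OF ab(1,3) HOL.refl] and lb = carr_linear[OF ab(2,4) ab(5)[symmetric]]
 show "ap a (ut (ct H J L) (ct H M N) (ut J L x y) t) = ap b (ut (ct H J L) (ct H M N) (ut J L x y) t)"
  by (rule ct_ext[OF _ _ G linear_comp[OF linear_utens(1) la] linear_comp[OF linear_utens(1) lb] _ t])
   (use x y in \<open>simp_all add: linear_id eq\<close>)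
qed (use JLMN in simp_all)

lemma carr_eq13I:
 assumes ab: "carr a" "carr b" "fst a = ct H J (ct H (ct H L M) N)" "fst b = ct H J (ct H (ct H L M) N)" "cod a = cod b"
  and JLMN: "comod J" "comod L" "comod M" "comod N"
  and eq: "!!x y m n. x el J ==> y el L ==> m el M ==> n el N ==>
   ap a (ut J (ct H (ct H L M) N) x (ut (ct H L M) N (ut L M y m) n))
   = ap b (ut J (ct H (ct H L M) N) x (ut (ct H L M) N (ut L M y m) n))"
 shows "a = b"
proof (rule carr_eq2I[OF ab(1-5)])
 note [simp] = JLMN
 have G: "module k (cod a)" using carr_cod[OF ab(1)] by simp
 fix x t assume x: "x el J" and t: "t el (ct H (ct H L M) N)"
 note la = carr_linear[OF ab(1,3) HOL.refl] and lb = carr_linear[OF ab(2,4) ab(5)[symmetric]]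
 show "ap a (ut J (ct H (ct H L M) N) x t) = ap b (ut J (ct H (ct H L M) N) x t)"
  by (rule ct3_ext[OF _ _ _ G linear_comp[OF linear_utens(1) la] linear_comp[OF linear_utens(1) lb] _ t])
   (use x in \<open>simp_all add: linear_id eq\<close>)
qed (use JLMN in simp_all)

lemma lin_ap: "carr f ==> fst f = M ==> cod f = N ==> lmap P M g ==> lmap P N (%x. ap f (g x))"
 by (rule linear_comp[OF _ carr_linear])

end

context cobraided_hopf_algebra
begin

text \<open>Multiplicativity of \<open>r\<close> at \<open>1 1 = 1\<close> says that \<open>r(-, 1)\<close> is idempotent for convolution.\<close>
lemma r_one_right: assumes x: "x el H" shows "r x oneH = counit H x"
proof -
 obtain t where t: "conv_inverse k H r t" using r_invertible by blast
 then have tb: "bform t" and t1: "!!x y. x el H ==> y el H ==> conv k H r t x y = counit H x *<k> counit H y"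
  by (simp_all add: conv_inverse_def)
 note [simp] = form_closed[OF r_bilinear] form_closed[OF tb]
 have "r x oneH = \<one>\<^bsub>k\<^esub> *<k> counit H x"
 proof (rule norm_aux[of "%x. r x oneH" "%x. t x oneH", OF _ _ _ x])
  fix x assume x: "x el H"
  show "tsum k (comult H x) (%x1 x2. r x1 oneH *<k> t x2 oneH) = counit H x"
   using t1[OF x one_closed] conv_one_right[OF r_bilinear tb x] x by (simp add: counit_one)
  show "tsum k (comult H x) (%x1 x2. r x1 oneH *<k> r x2 oneH) = \<one>\<^bsub>k\<^esub> *<k> r x oneH"
   using r_mult_right[OF x one_closed one_closed] x by simp
 qed (auto intro!: linear_form[OF r_bilinear] linear_form[OF tb] linear_id)
 then show ?thesis using x by simp
qed

lemma r_one_left: assumes x: "x el H" shows "r oneH x = counit H x"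
proof -
 obtain t where t: "conv_inverse k H r t" using r_invertible by blast
 then have tb: "bform t" and t1: "!!x y. x el H ==> y el H ==> conv k H r t x y = counit H x *<k> counit H y"
  by (simp_all add: conv_inverse_def)
 note [simp] = form_closed[OF r_bilinear] form_closed[OF tb]
 have "r oneH x = \<one>\<^bsub>k\<^esub> *<k> counit H x"
 proof (rule norm_aux[of "%x. r oneH x" "%x. t oneH x", OF _ _ _ x])
  fix x assume x: "x el H"
  show "tsum k (comult H x) (%x1 x2. r oneH x1 *<k> t oneH x2) = counit H x"
   using t1[OF one_closed x] conv_one_left[OF r_bilinear tb x] x by (simp add: counit_one)
  show "tsum k (comult H x) (%x1 x2. r oneH x1 *<k> r oneH x2) = \<one>\<^bsub>k\<^esub> *<k> r oneH x"
   using r_mult_left[OF one_closed one_closed x] x by simp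
 qed (auto intro!: linear_form[OF r_bilinear] linear_form[OF tb] linear_id)
 then show ?thesis using x by simp
qed

abbreviation r21 where "r21 \<equiv> %h g. r g h"

lemmas r21_bilinear = bilinear_flip[OF r_bilinear]

lemma carr_mid_swap:
 assumes "comod X" "comod Y" "comod Z" "comod W"
 shows "carr (mid_swap CC X Y Z W)" "fst (mid_swap CC X Y Z W) = ct H (ct H X Y) (ct H Z W)"
  "cod (mid_swap CC X Y Z W) = ct H (ct H X Z) (ct H Y W)"
proof -
 note [simp] = assms left_comodule_ct colinear_assoc_inv
 note s = cc_simps inv_assoc[of X Z "ct H Y W" r, simplified cc_simps] inv_assoc[of Y Z W r, simplified cc_simps]
 show "carr (mid_swap CC X Y Z W)" "fst (mid_swap CC X Y Z W) = ct H (ct H X Y) (ct H Z W)"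
  "cod (mid_swap CC X Y Z W) = ct H (ct H X Z) (ct H Y W)"
  unfolding mid_swap_def by (simp_all add: s)
qed

lemma mid_swap_utens:
 assumes X: "comod X" and Y: "comod Y" and Z: "comod Z" and W: "comod W"
  and x: "x el X" and y: "y el Y" and z: "z el Z" and w: "w el W"
 shows "ap (mid_swap CC X Y Z W) (ut (ct H X Y) (ct H Z W) (ut X Y x y) (ut Z W z w)) =
  act (ct H (ct H X Z) (ct H Y W)) Y Z r21 (%y z. ut (ct H X Z) (ct H Y W) (ut X Z x z) (ut Y W y w)) y z"
proof -
 note [simp] = X Y Z W x y z w left_comodule_ct colinear_assoc_inv linear_closed[OF linear_braid_map[OF r_bilinear]]
 let ?YW = "ct H Y W" and ?ZY = "ct H Z Y" let ?Q = "ct H (ct H X Z) ?YW"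
 have i1: "inv_arrow CC (ct H (ct H X Z) ?YW) (ct H X (ct H Z ?YW)) (Assoc CC X Z ?YW) = comod_arrow (ct H X (ct H Z ?YW)) (ct H (ct H X Z) ?YW) (assoc_inv H X Z ?YW)"
  by (rule inv_assoc) simp_all
 have i2: "inv_arrow CC (ct H (ct H Y Z) W) (ct H Y (ct H Z W)) (Assoc CC Y Z W) = comod_arrow (ct H Y (ct H Z W)) (ct H (ct H Y Z) W) (assoc_inv H Y Z W)"
  by (rule inv_assoc) simp_all
 define L where "L = (%s. assoc_inv H X Z ?YW (ut X (ct H Z ?YW) x (assoc_map H Z Y W (ut ?ZY W s w))))"
 have L: "lmap ?ZY ?Q L" unfolding L_def
  by (rule linear_comp[OF linear_comp[OF linear_comp[OF linear_utens(2) linear_assoc_map] linear_utens(1)] linear_assoc_inv]) (simp_all add: linear_id)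
 have m: "mid_swap CC X Y Z W = comod_arrow (ct H X (ct H Z ?YW)) ?Q (assoc_inv H X Z ?YW) oC
   (Ident CC X xC (Assoc CC Z Y W oC (Braid CC Y Z xC Ident CC W) oC comod_arrow (ct H Y (ct H Z W)) (ct H (ct H Y Z) W) (assoc_inv H Y Z W)))
   oC Assoc CC X Y (ct H Z W)"
  unfolding mid_swap_def using i1 i2 by (simp add: cc_simps(4))
 have lc: "assoc_map H Z Y W (ut ?ZY W s w) el (ct H Z ?YW)" if "s el ?ZY" for s
  using that by (intro linear_closed[OF linear_assoc_map]) simp_all
 have "ap (mid_swap CC X Y Z W) (ut (ct H X Y) (ct H Z W) (ut X Y x y) (ut Z W z w)) = L (braid_map H r Y Z (ut Y Z y z))"
  unfolding m L_def cc_simps by (simp add: assoc_map_utens assoc_inv_utens lc)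
 also have "... = act ?Q Y Z r21 (%y z. L (ut Z Y z y)) y z"
  by (rule braid_map_push[OF r_bilinear _ _ _ _ L]) simp_all
 also have "... = act ?Q Y Z r21 (%y z. ut (ct H X Z) ?YW (ut X Z x z) (ut Y W y w)) y z"
  unfolding L_def by (rule act_cong) (simp_all add: assoc_map_utens assoc_inv_utens)
 finally show ?thesis .
qed

text \<open>For \<open>f = g\<close> the product of \<open>A\<close> this is the product of \<open>A \<otimes>\<^sup>b A\<close>; for two actions it is the
 action on the tensor product of modules.\<close>
lemma pair_action:
 assumes f: "carr f" "fst f = ct H X Z" "cod f = X'" and g: "carr g" "fst g = ct H Y W" "cod g = Y'"
  and X: "comod X" and Y: "comod Y" and Z: "comod Z" and W: "comod W"
  and x: "x el X" and y: "y el Y" and z: "z el Z" and w: "w el W"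
 shows "ap ((f xC g) oC mid_swap CC X Y Z W) (ut (ct H X Y) (ct H Z W) (ut X Y x y) (ut Z W z w)) =
  act (ct H X' Y') Y Z r21 (%y z. ut X' Y' (ap f (ut X Z x z)) (ap g (ut Y W y w))) y z"
proof -
 note [simp] = X Y Z W x y z w f g left_comodule_ct carr_mid_swap
 have XY': "comod X'" "comod Y'" using carr_cod[OF f(1)] carr_cod[OF g(1)] f g by simp_all
 let ?Q = "ct H (ct H X Z) (ct H Y W)"
 have L: "lmap ?Q (ct H X' Y') (ap (f xC g))" by (rule carr_linear) simp_all
 have "ap ((f xC g) oC mid_swap CC X Y Z W) (ut (ct H X Y) (ct H Z W) (ut X Y x y) (ut Z W z w)) =
  ap (f xC g) (act ?Q Y Z r21 (%y z. ut (ct H X Z) (ct H Y W) (ut X Z x z) (ut Y W y w)) y z)"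
  by (simp add: mid_swap_utens)
 also have "... = act (ct H X' Y') Y Z r21 (%y z. ap (f xC g) (ut (ct H X Z) (ct H Y W) (ut X Z x z) (ut Y W y w))) y z"
  by (rule linear_act_push[OF Y Z _ _ _ r21_bilinear L]) (use XY' in \<open>auto intro!: lin\<close>)
 also have "... = act (ct H X' Y') Y Z r21 (%y z. ut X' Y' (ap f (ut X Z x z)) (ap g (ut Y W y w))) y z"
  by (rule act_cong) simp_all
 finally show ?thesis .
qed

end

context coalgebra
begin

lemma act_tsum:
 fixes X Y :: "('k, 'h, 'y) comod"
 assumes M: "comod M" and N: "comod N" and G: "module k G" and \<phi>: "bform \<phi>"
  and X: "module k X" and Y: "module k Y" and s: "s el (ct H X Y)"
  and u: "!!x y m n. x el X ==> y el Y ==> m el M ==> n el N ==> u x y m n el G"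
  and m: "m el M" and n: "n el N"
 shows "act G M N \<phi> (%m n. tsum G (untens s) (%x y. u x y m n)) m n = tsum G (untens s) (%x y. act G M N \<phi> (u x y) m n)"
proof -
 note [simp] = M[THEN comodule_precomod] N[THEN comodule_precomod] G u form_closed[OF \<phi>]
 note ps = pairs_untens[OF X Y s]
 have "act G M N \<phi> (%m n. tsum G (untens s) (%x y. u x y m n)) m n =
   tsum G (coact M m) (%g m0. tsum G (coact N n) (%h n0. tsum G (untens s) (%x y. \<phi> g h *[G] u x y m0 n0)))"
  unfolding act_def using m n by (intro coact_cong smult_tsum[OF _ ps]) simp_all
 also have "... = tsum G (coact M m) (%g m0. tsum G (untens s) (%x y. tsum G (coact N n) (%h n0. \<phi> g h *[G] u x y m0 n0)))"
  using m n by (intro coact_cong tsum_swap[OF _ coact_pairs ps]) simp_all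
 also have "... = tsum G (untens s) (%x y. act G M N \<phi> (u x y) m n)"
  unfolding act_def using m n by (intro tsum_swap[OF _ coact_pairs ps]) simp_all
 finally show ?thesis .
qed

lemma tsum_untens_cong:
 fixes X Y :: "('k, 'h, 'y) comod"
 assumes "module k X" "module k Y" "s el (ct H X Y)" "!!x y. x el X ==> y el Y ==> F x y = F' x y"
 shows "tsum G (untens s) F = tsum G (untens s) F'"
 using assms by (intro tsum_cong[OF pairs_untens[OF assms(1-3)]]) auto

end

context cobraided_hopf_algebra
begin

lemma arrD:
 assumes "f \<in> Hom CC M N" "comod M" "comod N"
 shows "carr f" "fst f = M" "cod f = N"
proof -
 have "carr f \<and> fst f = M \<and> cod f = N" by (rule hom_iff[THEN iffD1, of _ r]) (use assms in \<open>simp add: cc_simps\<close>)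
 then show "carr f" "fst f = M" "cod f = N" by blast+
qed

lemma homI: "carr f ==> fst f = M ==> cod f = N ==> f \<in> Hom CC M N"
 using hom_iff[of M r N f] by simp

context
 fixes A :: "(('k, 'h, 'x) comod, ('k, 'h, 'x) comod_arrow) hopf_in"
 assumes A: "braided_hopf_algebra CC A"
begin

abbreviation X where "X \<equiv> aobj A"
abbreviation XX where "XX \<equiv> ct H X X"
abbreviation mu where "mu a b \<equiv> ap (amul A) (ut X X a b)"
abbreviation D where "D \<equiv> ap (acomul A)"
abbreviation eA where "eA \<equiv> ap (aone A) (Scal \<one>\<^bsub>k\<^esub>)"
abbreviation eps where "eps a \<equiv> unscal (ap (acounit A) a)"
abbreviation U where "U \<equiv> (comod_unit k H :: ('k, 'h, 'x) comod)"
abbreviation IX where "IX \<equiv> Ident CC X"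

lemmas alg = braided_hopf_algebra.algebra[OF A] and coalg = braided_hopf_algebra.coalgebra[OF A]
 and comul_map = braided_hopf_algebra.comul_algebra_map[OF A] and counit_map = braided_hopf_algebra.counit_algebra_map[OF A]

lemma X [simp]: "comod X"
 using alg by (simp add: algebra_in_def cc_simps)

lemma mul_arr [simp]: "carr (amul A)" "fst (amul A) = XX" "cod (amul A) = X"
 and one_arr [simp]: "carr (aone A)" "fst (aone A) = U" "cod (aone A) = X"
 and comul_arr [simp]: "carr (acomul A)" "fst (acomul A) = X" "cod (acomul A) = XX"
 and counit_arr [simp]: "carr (acounit A)" "fst (acounit A) = X" "cod (acounit A) = U"
proof -
 have "amul A \<in> Hom CC XX X" "aone A \<in> Hom CC U X" using alg by (simp_all add: algebra_in_def cc_simps)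
 note h = this[THEN arrD(1)] this[THEN arrD(2)] this[THEN arrD(3)]
 show "carr (amul A)" "fst (amul A) = XX" "cod (amul A) = X" "carr (aone A)" "fst (aone A) = U" "cod (aone A) = X"
  using h by (simp_all add: left_comodule_ct left_comodule_cu)
 have "acomul A \<in> Hom CC X XX" "acounit A \<in> Hom CC X U" using coalg by (simp_all add: coalgebra_in_def cc_simps)
 note h = this[THEN arrD(1)] this[THEN arrD(2)] this[THEN arrD(3)]
 show "carr (acomul A)" "fst (acomul A) = X" "cod (acomul A) = XX" "carr (acounit A)" "fst (acounit A) = X" "cod (acounit A) = U"
  using h by (simp_all add: left_comodule_ct left_comodule_cu)
qed

lemmas [simp] = left_comodule_ct left_comodule_cu colinear_assoc_inv carr_mid_swap form_closed[OF r_bilinear]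
lemmas [lin] = lin_ap[OF mul_arr] lin_ap[OF one_arr] lin_ap[OF comul_arr] lin_ap[OF counit_arr] linear_form[OF r_bilinear]

lemma linear_tsum_D [lin]:
 assumes "module k G" "lmap P X f" "!!m. m el X ==> lmap X G (%n. F m n)" "!!n. n el X ==> lmap X G (%m. F m n)"
 shows "lmap P G (%x. tsum G (untens (D (f x))) F)"
 by (rule linear_untens[OF _ _ assms(1) lin_ap[OF comul_arr assms(2)] assms(3,4)]) simp_all

lemma D_closed: "a el X ==> D a el XX" by simp

lemma D_pairs: "a el X ==> pairs X X (untens (D a))"
 by (rule pairs_untens[OF comodule_module[OF X] comodule_module[OF X] D_closed])

lemma D_cong: "a el X ==> (!!x y. x el X ==> y el X ==> F x y = F' x y) ==> tsum G (untens (D a)) F = tsum G (untens (D a)) F'"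
 by (rule tsum_untens_cong[OF comodule_module[OF X] comodule_module[OF X] D_closed])

lemma tsum_D_closed [simp]: "a el X ==> module k G ==> (!!x y. x el X ==> y el X ==> F x y el G) ==> tsum G (untens (D a)) F el G"
 by (rule tsum_closed[OF _ D_pairs])

lemma linear_tsum_D_inner [lin]:
 "a el X ==> module k G ==> (!!x y. x el X ==> y el X ==> lmap P G (%v. F v x y)) ==> lmap P G (%v. tsum G (untens (D a)) (F v))"
 by (rule linear_tsum_inner[OF _ D_pairs])

lemma eps_closed [simp]: "a el X ==> eps a el k"
 by (rule unscal_closed[of _ H]) simp

lemmas D_expand = linear_untens_expand[OF comodule_module[OF X] comodule_module[OF X]]

lemma D_mu:
 assumes a: "a el X" and b: "b el X"
 shows "D (mu a b) = tsum XX (untens (D a)) (%a1 a2. tsum XX (untens (D b)) (%b1 b2.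
  act XX X X r21 (%a2 b1. ut X X (mu a1 b1) (mu a2 b2)) a2 b1))"
proof -
 note [simp] = a b
 let ?f = "(amul A xC amul A) oC mid_swap CC X X X X"
 let ?P = "ap ?f"
 have P: "lmap (ct H XX XX) XX ?P" by (rule carr_linear) simp_all
 have e: "acomul A oC amul A = ?f oC (acomul A xC acomul A)"
  using comul_map by (simp add: algebra_map_def braided_tensor_algebra_def)
 have "ap (acomul A oC amul A) (ut X X a b) = ap (?f oC (acomul A xC acomul A)) (ut X X a b)" by (simp only: e)
 then have "D (mu a b) = ?P (ut XX XX (D a) (D b))" by simp
 also have "... = tsum XX (untens (D a)) (%a1 a2. ?P (ut XX XX (ut X X a1 a2) (D b)))"
  by (rule D_expand[OF _ linear_comp[OF linear_utens(2) P]]) (simp_all add: linear_id)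
 also have "... = tsum XX (untens (D a)) (%a1 a2. tsum XX (untens (D b)) (%b1 b2. ?P (ut XX XX (ut X X a1 a2) (ut X X b1 b2))))"
  by (intro D_cong D_expand[OF _ linear_comp[OF linear_utens(1) P]]) (simp_all add: linear_id)
 also have "... = tsum XX (untens (D a)) (%a1 a2. tsum XX (untens (D b)) (%b1 b2.
  act XX X X r21 (%a2 b1. ut X X (mu a1 b1) (mu a2 b2)) a2 b1))"
  by (intro D_cong pair_action) simp_all
 finally show ?thesis .
qed

lemma eA_closed [simp]: "eA el X" by simp

lemma D_one: "D eA = ut X X eA eA"
proof -
 have i: "inv_arrow CC (U ox\<^bsub>CC\<^esub> U) U (LUnit CC U) = comod_arrow U (ct H U U) (%m. ut U U (Scal \<one>\<^bsub>k\<^esub>) m)"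
 proof (rule monoidal_category_st.inv_arrow_eq[OF comod_monoidal_st])
  show "inverse_arrows CC (U ox\<^bsub>CC\<^esub> U) U (LUnit CC U) (comod_arrow U (ct H U U) (%m. ut U U (Scal \<one>\<^bsub>k\<^esub>) m))"
   unfolding cc_simps by (rule inverse_comod_arrowsI[OF _ _ _ linear_lunit_inv(1)]) (simp_all add: lunit_inv colinear_lunit)
 qed (simp_all add: cc_simps)
 have c: "carr (comod_arrow U (ct H U U) (%m. ut U U (Scal \<one>\<^bsub>k\<^esub>) m))"
  by (subst carr_comod_arrow, simp, simp, rule colinear_inverse[OF _ _ colinear_lunit linear_lunit_inv(1)]) (simp_all add: lunit_inv)
 have e: "acomul A oC aone A = (aone A xC aone A) oC comod_arrow U (ct H U U) (%m. ut U U (Scal \<one>\<^bsub>k\<^esub>) m)"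
  using comul_map i by (simp add: algebra_map_def braided_tensor_algebra_def cc_simps)
 have "ap (acomul A oC aone A) (Scal \<one>\<^bsub>k\<^esub>) = ap ((aone A xC aone A) oC comod_arrow U (ct H U U) (%m. ut U U (Scal \<one>\<^bsub>k\<^esub>) m)) (Scal \<one>\<^bsub>k\<^esub>)"
  by (simp only: e)
 then show ?thesis using c by simp
qed

lemma eps_mu: "a el X ==> b el X ==> eps (mu a b) = eps a *<k> eps b"
 and counit_aone: "c el U ==> ap (acounit A) (ap (aone A) c) = c"
 and eps_one: "eps eA = \<one>\<^bsub>k\<^esub>"
proof -
 have e: "acounit A oC amul A = LUnit CC U oC (acounit A xC acounit A)" "acounit A oC aone A = Ident CC U"
  using counit_map by (simp_all add: algebra_map_def unit_algebra_def cc_simps)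
 show "eps (mu a b) = eps a *<k> eps b" if [simp]: "a el X" "b el X"
  using arg_cong[OF e(1), of "%f. unscal (ap f (ut X X a b))"] by (simp add: cc_simps lunit_map_utens cu_simps(4))
 show "ap (acounit A) (ap (aone A) c) = c" if [simp]: "c el U"
  using arg_cong[OF e(2), of "%f. ap f c"] by (simp add: cc_simps)
 show "eps eA = \<one>\<^bsub>k\<^esub>"
  using arg_cong[OF e(2), of "%f. unscal (ap f (Scal \<one>\<^bsub>k\<^esub>))"] by (simp add: cc_simps)
qed

lemma D_coassoc:
 assumes a: "a el X" and G: "module k G"
  and Z: "!!y z. y el X ==> z el X ==> lmap X G (%x. Z x y z)"
   "!!x z. x el X ==> z el X ==> lmap X G (%y. Z x y z)"
   "!!x y. x el X ==> y el X ==> lmap X G (%z. Z x y z)"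
 shows "tsum G (untens (D a)) (%b z. tsum G (untens (D b)) (%x y. Z x y z)) = tsum G (untens (D a)) (%x b. tsum G (untens (D b)) (%y z. Z x y z))"
proof -
 note [simp] = a G linear_closed[OF Z(1)]
 note [lin] = linear_comp[OF _ Z(1)] linear_comp[OF _ Z(2)] linear_comp[OF _ Z(3)]
 define L where "L = (%t. tsum G (untens t) (%x s. tsum G (untens s) (%y z. Z x y z)))"
 have L: "lmap (ct H X XX) G L" unfolding L_def by (auto intro!: lin)
 have Lu: "L (ut X XX x (ut X X y z)) = Z x y z" if [simp]: "x el X" "y el X" "z el X" for x y z
  unfolding L_def by (simp add: lin)
 note As = linear_assoc_map[of X X X H]
 have A3: "lmap (ct H XX X) (ct H X XX) (assoc_map H X X X)" by (rule As) simp_all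
 have e: "Assoc CC X X X oC (acomul A xC IX) oC acomul A = (IX xC acomul A) oC acomul A"
  using coalg by (simp add: coalgebra_in_def)
 have l: "lmap XX (ct H XX X) (ap (acomul A xC IX))" and r: "lmap XX (ct H X XX) (ap (IX xC acomul A))"
  by (rule carr_linear, simp_all add: cc_simps)+
 have "L (assoc_map H X X X (ap (acomul A xC IX) (D a))) = L (ap (IX xC acomul A) (D a))"
  using arg_cong[OF e, of "%f. L (ap f a)"] linear_closed[OF l] by (simp add: cc_simps(6))
 moreover have "L (assoc_map H X X X (ap (acomul A xC IX) (D a))) = tsum G (untens (D a)) (%b z. tsum G (untens (D b)) (%x y. Z x y z))"
 proof -
  have "L (assoc_map H X X X (ap (acomul A xC IX) (D a))) = tsum G (untens (D a)) (%b z. L (assoc_map H X X X (ap (acomul A xC IX) (ut X X b z))))"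
   by (rule D_expand[OF G linear_comp[OF linear_comp[OF l A3] L]]) simp
  also have "... = tsum G (untens (D a)) (%b z. L (assoc_map H X X X (ut XX X (D b) z)))"
   by (rule D_cong) (simp_all add: cc_simps)
  also have "... = tsum G (untens (D a)) (%b z. tsum G (untens (D b)) (%x y. L (assoc_map H X X X (ut XX X (ut X X x y) z))))"
   by (intro D_cong D_expand[OF G linear_comp[OF linear_comp[OF linear_utens(2) A3] L]]) (simp_all add: linear_id)
  also have "... = tsum G (untens (D a)) (%b z. tsum G (untens (D b)) (%x y. Z x y z))"
   by (intro D_cong) (simp_all add: assoc_map_utens Lu)
  finally show ?thesis .
 qed
 moreover have "L (ap (IX xC acomul A) (D a)) = tsum G (untens (D a)) (%x b. tsum G (untens (D b)) (%y z. Z x y z))"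
 proof -
  have "L (ap (IX xC acomul A) (D a)) = tsum G (untens (D a)) (%x b. L (ap (IX xC acomul A) (ut X X x b)))"
   by (rule D_expand[OF G linear_comp[OF r L]]) simp
  also have "... = tsum G (untens (D a)) (%x b. L (ut X XX x (D b)))"
   by (rule D_cong) (simp_all add: cc_simps)
  also have "... = tsum G (untens (D a)) (%x b. tsum G (untens (D b)) (%y z. L (ut X XX x (ut X X y z))))"
   by (intro D_cong D_expand[OF G linear_comp[OF linear_utens(1) L]]) (simp_all add: linear_id)
  also have "... = tsum G (untens (D a)) (%x b. tsum G (untens (D b)) (%y z. Z x y z))"
   by (intro D_cong) (simp_all add: Lu)
  finally show ?thesis .
 qed
 ultimately show ?thesis by simp
qed

lemma D_counit:
 assumes a: "a el X" and G: "module k G" and f: "lmap X G f"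
 shows "tsum G (untens (D a)) (%x y. eps x *[G] f y) = f a" "tsum G (untens (D a)) (%x y. eps y *[G] f x) = f a"
proof -
 note [simp] = a G
 have e: "LUnit CC X oC (acounit A xC IX) oC acomul A = IX" "RUnit CC X oC (IX xC acounit A) oC acomul A = IX"
  using coalg by (simp_all add: coalgebra_in_def)
 have l: "lmap XX (ct H U X) (ap (acounit A xC IX))" and r: "lmap XX (ct H X U) (ap (IX xC acounit A))"
  by (rule carr_linear, simp_all add: cc_simps)+
 have ll: "lmap (ct H U X) X (lunit_map X)" and lr: "lmap (ct H X U) X (runit_map X)" by (simp_all add: linear_lunit_map linear_runit_map)
 have "f a = f (lunit_map X (ap (acounit A xC IX) (D a)))"
  using arg_cong[OF e(1), of "%f. ap f a"] linear_closed[OF l] by (simp add: cc_simps)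
 also have "... = tsum G (untens (D a)) (%x y. f (lunit_map X (ap (acounit A xC IX) (ut X X x y))))"
  by (rule D_expand[OF G linear_comp[OF linear_comp[OF l ll] f]]) simp
 also have "... = tsum G (untens (D a)) (%x y. eps x *[G] f y)"
  by (rule D_cong) (simp_all add: cc_simps lunit_map_utens linear_smult[OF f])
 finally show "tsum G (untens (D a)) (%x y. eps x *[G] f y) = f a" ..
 have "f a = f (runit_map X (ap (IX xC acounit A) (D a)))"
  using arg_cong[OF e(2), of "%f. ap f a"] linear_closed[OF r] by (simp add: cc_simps)
 also have "... = tsum G (untens (D a)) (%x y. f (runit_map X (ap (IX xC acounit A) (ut X X x y))))"
  by (rule D_expand[OF G linear_comp[OF linear_comp[OF r lr] f]]) simp
 also have "... = tsum G (untens (D a)) (%x y. eps y *[G] f x)"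
  by (rule D_cong) (simp_all add: cc_simps runit_map_utens linear_smult[OF f])
 finally show "tsum G (untens (D a)) (%x y. eps y *[G] f x) = f a" ..
qed

abbreviation dot where "dot \<theta> M a m \<equiv> ap \<theta> (ut X M a m)"

lemma moduleD:
 assumes P: "module_in CC A (M, \<theta>)"
 shows "comod M" "carr \<theta>" "fst \<theta> = ct H X M" "cod \<theta> = M"
  "[|a el X; b el X; m el M|] ==> dot \<theta> M (mu a b) m = dot \<theta> M a (dot \<theta> M b m)"
  "m el M ==> dot \<theta> M eA m = m"
proof -
 show M [simp]: "comod M" using P by (simp add: module_in_def cc_simps)
 have "\<theta> \<in> Hom CC (ct H X M) M" using P by (simp add: module_in_def cc_simps)
 note h [simp] = arrD[OF this, simplified]
 show "carr \<theta>" "fst \<theta> = ct H X M" "cod \<theta> = M" by simp_all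
 have e: "\<theta> oC (amul A xC Ident CC M) = \<theta> oC (IX xC \<theta>) oC Assoc CC X X M" "\<theta> oC (aone A xC Ident CC M) = LUnit CC M"
  using P by (simp_all add: module_in_def)
 show "dot \<theta> M (mu a b) m = dot \<theta> M a (dot \<theta> M b m)" if [simp]: "a el X" "b el X" "m el M"
  using arg_cong[OF e(1), of "%f. ap f (ut XX M (ut X X a b) m)"] by (simp add: cc_simps assoc_map_utens)
 show "dot \<theta> M eA m = m" if [simp]: "m el M"
  using arg_cong[OF e(2), of "%f. ap f (ut U M (Scal \<one>\<^bsub>k\<^esub>) m)"] by (simp add: cc_simps lunit_map_utens one_smult)
qed

lemma TO_simps: "TenO (module_cat CC A) P Q = (ct H (fst P) (fst Q),
  ((snd P xC snd Q) oC mid_swap CC X X (fst P) (fst Q)) oC (acomul A xC Ident CC (ct H (fst P) (fst Q))))"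
 by (simp add: module_cat_def braided_tensor_action_def cc_simps(4))

abbreviation TA where "TA P Q \<equiv> snd (TenO (module_cat CC A) P Q)"

text \<open>The coaction on the unit object is \<open>1 \<otimes> -\<close>, where \<open>r\<close> reduces to the counit.\<close>
lemma act_one:
 assumes c: "c el U" and m: "m el M'" and M': "comod M'" and G: "module k G"
  and u: "!!c. c el U ==> lmap M' G (%m. u c m)" "!!m. m el M' ==> lmap U G (%c. u c m)"
 shows "act G U M' r21 u c m = u c m" "act G M' U r21 (%m c. u c m) m c = u c m"
proof -
 note [simp] = c m M' G linear_closed[OF u(1)]
 note [lin] = linear_comp[OF _ u(1)] linear_comp[OF _ u(2)]
 have "act G U M' r21 u c m = tsum G (coact M' m) (%h m0. r h oneH *[G] u c m0)"
  unfolding act_def by (intro tsum_coact_cu) (auto intro!: lin)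
 also have "... = tsum G (coact M' m) (%h m0. counit H h *[G] u c m0)"
  by (intro coact_cong) (simp_all add: r_one_right)
 also have "... = u c m" by (intro coact_counit M') (auto intro!: lin)
 finally show "act G U M' r21 u c m = u c m" .
 have "act G M' U r21 (%m c. u c m) m c = tsum G (coact M' m) (%h m0. r oneH h *[G] u c m0)"
  unfolding act_def by (intro coact_cong tsum_coact_cu) (auto intro!: lin)
 also have "... = tsum G (coact M' m) (%h m0. counit H h *[G] u c m0)"
  by (intro coact_cong) (simp_all add: r_one_left)
 also have "... = u c m" by (intro coact_counit M') (auto intro!: lin)
 finally show "act G M' U r21 (%m c. u c m) m c = u c m" .
qed

context
 fixes M N \<theta> \<theta>' assumes P: "module_in CC A (M, \<theta>)" and Q: "module_in CC A (N, \<theta>')"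
begin

lemmas [simp] = moduleD(1-4)[OF P] moduleD(1-4)[OF Q]
lemmas linP = lin_ap[OF moduleD(2-4)[OF P]] lin_ap[OF moduleD(2-4)[OF Q]]
lemmas [lin] = linP

abbreviation T where "T \<equiv> ct H M N"
abbreviation \<beta> where "\<beta> m n a1 a2 \<equiv> act T X M r21 (%a2 m. ut M N (dot \<theta> M a1 m) (dot \<theta>' N a2 n)) a2 m"

lemma TA_arr: "carr (TA (M, \<theta>) (N, \<theta>'))" "fst (TA (M, \<theta>) (N, \<theta>')) = ct H X T" "cod (TA (M, \<theta>) (N, \<theta>')) = T" "fst (TenO (module_cat CC A) (M, \<theta>) (N, \<theta>')) = T"
 by (simp_all add: TO_simps cc_simps(3))

lemma linear_\<beta>:
 assumes "m el M" "n el N"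
 shows "a1 el X ==> lmap X T (%a2. \<beta> m n a1 a2)" "a2 el X ==> lmap X T (%a1. \<beta> m n a1 a2)"
 unfolding act_def using assms by (auto intro!: lin)

lemma \<beta>_closed: "m el M ==> n el N ==> a1 el X ==> a2 el X ==> \<beta> m n a1 a2 el T"
 using linear_closed[OF linear_\<beta>(1)] .

lemma TA_utens:
 assumes [simp]: "a el X" "m el M" "n el N"
 shows "ap (TA (M, \<theta>) (N, \<theta>')) (ut X T a (ut M N m n)) = tsum T (untens (D a)) (\<beta> m n)"
proof -
 let ?f = "(\<theta> xC \<theta>') oC mid_swap CC X X M N"
 have L: "lmap (ct H XX T) T (ap ?f)" by (rule carr_linear) simp_all
 have "ap (TA (M, \<theta>) (N, \<theta>')) (ut X T a (ut M N m n)) = ap ?f (ut XX T (D a) (ut M N m n))"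
  by (simp add: TO_simps cc_simps(3))
 also have "... = tsum T (untens (D a)) (%a1 a2. ap ?f (ut XX T (ut X X a1 a2) (ut M N m n)))"
  by (rule D_expand[OF _ linear_comp[OF linear_utens(2) L]]) (simp_all add: linear_id)
 also have "... = tsum T (untens (D a)) (\<beta> m n)"
  by (intro D_cong pair_action) simp_all
 finally show ?thesis .
qed

text \<open>Write \<open>\<beta>\<close> for the action of \<open>a\<^sub>1 \<otimes> a\<^sub>2\<close> on \<open>m \<otimes> n\<close>. Both sides apply \<open>r\<close> to the pairs \<open>(b\<^sub>1, a\<^sub>2)\<close>,
 \<open>(m, b\<^sub>2)\<close> and \<open>(m, a\<^sub>2)\<close>. On the left the last two come from the coaction on \<open>a\<^sub>2 b\<^sub>2\<close> and
 multiplicativity of \<open>r\<close> in the second argument, on the right the first and the last from the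
 coaction on \<open>b\<^sub>1 m\<close> and multiplicativity in the first argument.\<close>
lemma \<beta>_mult:
 assumes [simp]: "a1 el X" "a2 el X" "b1 el X" "b2 el X" and m: "m el M" and n [simp]: "n el N"
 shows "act T X X r21 (%a2 b1. \<beta> m n (mu a1 b1) (mu a2 b2)) a2 b1 = act T X M r21 (%b2 m. \<beta> (dot \<theta> M b1 m) (dot \<theta>' N b2 n) a1 a2) b2 m"
proof -
 note [simp] = m
 note XM = X moduleD(1)[OF P] and T = comodule_module[OF left_comodule_ct[OF moduleD(1)[OF P] moduleD(1)[OF Q]]]
 let ?W = "%a2 b1 b2 m. ut M N (dot \<theta> M a1 (dot \<theta> M b1 m)) (dot \<theta>' N a2 (dot \<theta>' N b2 n))"
 have L: "\<beta> m n (mu a1 b1) (mu a2 b2) = act T X M r21 (%b2 m. act T X M r21 (%a2 m. ?W a2 b1 b2 m) a2 m) b2 m"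
  if [simp]: "a2 el X" "b1 el X" for a2 b1
 proof -
  have "\<beta> m n (mu a1 b1) (mu a2 b2) = act T XX M r21 (%s m. ut M N (dot \<theta> M (mu a1 b1) m) (dot \<theta>' N (ap (amul A) s) n)) (ut X X a2 b2) m"
   by (rule act_colinear[OF XM T _ _ r21_bilinear _ _ carr_colinear[OF mul_arr] colinear_id]) (auto intro!: lin)
  also have "... = act3 T X X M (%g h l. r l (g *<H> h)) (%a2 b2 m. ut M N (dot \<theta> M (mu a1 b1) m) (dot \<theta>' N (mu a2 b2) n)) a2 b2 m"
   by (rule act_ct_left[OF X XM T r21_bilinear]) (auto intro!: lin)
  also have "... = act3 T X X M (%g h l. tsum k (comult H l) (%l1 l2. r l1 h *<k> r l2 g)) (%a2 b2 m. ?W a2 b1 b2 m) a2 b2 m"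
   by (rule act3_cong') (simp_all add: r_mult_right moduleD(5)[OF P] moduleD(5)[OF Q])
  also have "... = act T X M r21 (%b2 m. act T X M r21 (%a2 m. ?W a2 b1 b2 m) a2 m) b2 m"
   by (rule act3_23_13[OF X XM T _ _ _ r21_bilinear r21_bilinear, symmetric]) (auto intro!: lin)
  finally show ?thesis .
 qed
 have R: "\<beta> (dot \<theta> M b1 m) (dot \<theta>' N b2 n) a1 a2 = act T X X r21 (%a2 b1. act T X M r21 (%a2 m. ?W a2 b1 b2 m) a2 m) a2 b1"
  if [simp]: "b2 el X" "m el M" for b2 m
 proof -
  have "\<beta> (dot \<theta> M b1 m) (dot \<theta>' N b2 n) a1 a2 = act T X (ct H X M) r21 (%a2 s. ut M N (dot \<theta> M a1 (ap \<theta> s)) (dot \<theta>' N a2 (dot \<theta>' N b2 n))) a2 (ut X M b1 m)"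
   by (rule act_colinear[OF XM T _ _ r21_bilinear _ _ colinear_id carr_colinear[OF moduleD(2-4)[OF P]]]) (auto intro!: lin)
  also have "... = act3 T X X M (%g h l. r (h *<H> l) g) (%a2 b1 m. ?W a2 b1 b2 m) a2 b1 m"
   by (rule act_ct_right[OF X XM T r21_bilinear]) (auto intro!: lin)
  also have "... = act3 T X X M (%g h l. tsum k (comult H g) (%g1 g2. r h g1 *<k> r l g2)) (%a2 b1 m. ?W a2 b1 b2 m) a2 b1 m"
   by (rule act3_cong) (simp_all add: r_mult_left)
  also have "... = act T X X r21 (%a2 b1. act T X M r21 (%a2 m. ?W a2 b1 b2 m) a2 m) a2 b1"
   by (rule act3_12_13[OF X XM T _ _ _ r21_bilinear r21_bilinear, symmetric]) (auto intro!: lin)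
  finally show ?thesis .
 qed
 have "act T X X r21 (%a2 b1. \<beta> m n (mu a1 b1) (mu a2 b2)) a2 b1 = act T X X r21 (%a2 b1. act T X M r21 (%b2 m. act T X M r21 (%a2 m. ?W a2 b1 b2 m) a2 m) b2 m) a2 b1"
  by (rule act_cong) (simp_all add: L)
 also have "... = act T X M r21 (%b2 m. act T X X r21 (%a2 b1. act T X M r21 (%a2 m. ?W a2 b1 b2 m) a2 m) a2 b1) b2 m"
  by (rule act_commute[OF X X XM T r21_bilinear r21_bilinear]) (simp_all add: act_def)
 also have "... = act T X M r21 (%b2 m. \<beta> (dot \<theta> M b1 m) (dot \<theta>' N b2 n) a1 a2) b2 m"
  by (rule act_cong) (simp_all add: R)
 finally show ?thesis .
qed

lemma TA_mult:
 assumes [simp]: "a el X" "b el X" and m [simp]: "m el M" and n [simp]: "n el N"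
 shows "ap (TA (M, \<theta>) (N, \<theta>')) (ut X T (mu a b) (ut M N m n)) = ap (TA (M, \<theta>) (N, \<theta>')) (ut X T a (ap (TA (M, \<theta>) (N, \<theta>')) (ut X T b (ut M N m n))))"
proof -
 note [simp] = TA_arr
 note XM = X moduleD(1)[OF P] and T = comodule_module[OF left_comodule_ct[OF moduleD(1)[OF P] moduleD(1)[OF Q]]]
 note bc [simp] = \<beta>_closed
 define E where "E = (%s. tsum T (untens s) (\<beta> m n))"
 have E: "lmap XX T E" unfolding E_def by (rule linear_untens_id) (simp_all add: linear_\<beta>)
 have Eu: "E (ut X X x y) = \<beta> m n x y" if "x el X" "y el X" for x y
  unfolding E_def by (rule tsum_utens) (use that linear_\<beta> in simp_all)
 have ac: "act XX X X r21 (%a2 b1. ut X X (mu a1 b1) (mu a2 b2)) a2 b1 el XX" if "a1 el X" "a2 el X" "b1 el X" "b2 el X" for a1 a2 b1 b2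
  using that by (simp add: act_def)
 let ?t = "ap (TA (M, \<theta>) (N, \<theta>'))"
 have tl: "lmap (ct H X T) T ?t" by (rule carr_linear) simp_all
 have tl': "lmap T T (%s. ?t (ut X T a s))" by (rule linear_comp[OF linear_utens(1) tl]) (simp_all add: linear_id)
 have "?t (ut X T (mu a b) (ut M N m n)) = E (D (mu a b))" by (simp add: TA_utens E_def)
 also have "... = tsum T (untens (D a)) (%a1 a2. E (tsum XX (untens (D b)) (%b1 b2. act XX X X r21 (%a2 b1. ut X X (mu a1 b1) (mu a2 b2)) a2 b1)))"
  unfolding D_mu[OF assms(1,2)] by (rule linear_tsum[OF _ _ E D_pairs]) (simp_all add: ac)
 also have "... = tsum T (untens (D a)) (%a1 a2. tsum T (untens (D b)) (%b1 b2. E (act XX X X r21 (%a2 b1. ut X X (mu a1 b1) (mu a2 b2)) a2 b1)))"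
  by (intro D_cong linear_tsum[OF _ _ E D_pairs]) (simp_all add: ac)
 also have "... = tsum T (untens (D a)) (%a1 a2. tsum T (untens (D b)) (%b1 b2. act T X X r21 (%a2 b1. E (ut X X (mu a1 b1) (mu a2 b2))) a2 b1))"
  by (intro D_cong linear_act_push[OF X X _ _ _ r21_bilinear E]) (auto intro!: lin)
 also have "... = tsum T (untens (D a)) (%a1 a2. tsum T (untens (D b)) (%b1 b2. act T X X r21 (%a2 b1. \<beta> m n (mu a1 b1) (mu a2 b2)) a2 b1))"
  by (intro D_cong act_cong) (simp_all add: Eu)
 also have "... = tsum T (untens (D a)) (%a1 a2. tsum T (untens (D b)) (%b1 b2. act T X M r21 (%b2 m. \<beta> (dot \<theta> M b1 m) (dot \<theta>' N b2 n) a1 a2) b2 m))"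
  by (intro D_cong \<beta>_mult) simp_all
 also have "... = tsum T (untens (D b)) (%b1 b2. tsum T (untens (D a)) (%a1 a2. act T X M r21 (%b2 m. \<beta> (dot \<theta> M b1 m) (dot \<theta>' N b2 n) a1 a2) b2 m))"
  by (rule tsum_swap[OF _ D_pairs D_pairs]) (simp_all add: act_def)
 also have "... = tsum T (untens (D b)) (%b1 b2. act T X M r21 (%b2 m. tsum T (untens (D a)) (%a1 a2. \<beta> (dot \<theta> M b1 m) (dot \<theta>' N b2 n) a1 a2)) b2 m)"
  by (intro D_cong act_tsum[OF XM T r21_bilinear comodule_module[OF X] comodule_module[OF X] D_closed, symmetric]) simp_all
 also have "... = tsum T (untens (D b)) (%b1 b2. act T X M r21 (%b2 m. ?t (ut X T a (ut M N (dot \<theta> M b1 m) (dot \<theta>' N b2 n)))) b2 m)"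
  by (intro D_cong act_cong) (simp_all add: TA_utens)
 also have "... = tsum T (untens (D b)) (%b1 b2. ?t (ut X T a (\<beta> m n b1 b2)))"
  by (intro D_cong linear_act_push[OF XM _ _ _ r21_bilinear tl', symmetric]) (auto intro!: lin)
 also have "... = ?t (ut X T a (tsum T (untens (D b)) (\<beta> m n)))"
  by (rule linear_tsum[OF _ _ tl' D_pairs, symmetric]) simp_all
 also have "... = ?t (ut X T a (?t (ut X T b (ut M N m n))))" by (simp add: TA_utens)
 finally show ?thesis .
qed

lemma TA_one:
 assumes [simp]: "m el M" "n el N"
 shows "ap (TA (M, \<theta>) (N, \<theta>')) (ut X T eA (ut M N m n)) = ut M N m n"
proof -
 note XM = X moduleD(1)[OF P] and T = comodule_module[OF left_comodule_ct[OF moduleD(1)[OF P] moduleD(1)[OF Q]]]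
 have "ap (TA (M, \<theta>) (N, \<theta>')) (ut X T eA (ut M N m n)) = tsum T (untens (ut X X eA eA)) (\<beta> m n)" by (simp add: TA_utens D_one)
 also have "... = \<beta> m n eA eA" by (rule tsum_utens) (simp_all add: linear_\<beta>)
 also have "... = act T U M r21 (%c m. ut M N (dot \<theta> M eA m) (dot \<theta>' N (ap (aone A) c) n)) (Scal \<one>\<^bsub>k\<^esub>) m"
  by (rule act_colinear[OF XM T _ _ r21_bilinear _ _ carr_colinear[OF one_arr] colinear_id]) (auto intro!: lin)
 also have "... = ut M N (dot \<theta> M eA m) (dot \<theta>' N eA n)"
  by (rule act_one) (auto intro!: lin)
 finally show ?thesis by (simp add: moduleD(6)[OF P] moduleD(6)[OF Q])
qed

lemma module_TO: "module_in CC A (TenO (module_cat CC A) (M, \<theta>) (N, \<theta>'))"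
proof -
 note [simp] = TA_arr
 let ?t = "TA (M, \<theta>) (N, \<theta>')"
 have t: "TenO (module_cat CC A) (M, \<theta>) (N, \<theta>') = (T, ?t)" using TA_arr(4) by (metis prod.collapse)
 have h: "?t \<in> Hom CC (X ox\<^bsub>CC\<^esub> T) T" by (rule homI) (simp_all add: cc_simps)
 have 1: "?t oC (amul A xC Ident CC T) = ?t oC (IX xC ?t) oC Assoc CC X X T"
  by (rule carr_eq22I[of _ _ X X M N]) (simp_all add: cc_simps assoc_map_utens TA_mult)
 have 2: "?t oC (aone A xC Ident CC T) = LUnit CC T"
 proof (rule carr_eq3I'[of _ _ U M N])
  fix c m n assume c: "c el U" and [simp]: "m el M" "n el N"
  note [simp] = c
  have l: "lmap U X (ap (aone A))" by (rule carr_linear) simp_all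
  have u [simp]: "unscal c el k" by (rule unscal_closed[OF c])
  have "ap (aone A) c = unscal c *[X] eA"
   using arg_cong[OF Scal_smult[OF c], of "ap (aone A)"] linear_smult[OF l u, of "Scal \<one>\<^bsub>k\<^esub>"] by simp
  moreover have "lmap X T (%a. ap ?t (ut X T a (ut M N m n)))"
   by (rule linear_comp[OF linear_utens(2) carr_linear]) (simp_all add: linear_id)
  note linear_smult[OF this, of "unscal c" eA]
  ultimately have "ap ?t (ut X T (ap (aone A) c) (ut M N m n)) = unscal c *[T] ut M N m n"
   by (simp add: TA_one)
  then show "ap (?t oC (aone A xC Ident CC T)) (ut U T c (ut M N m n)) = ap (LUnit CC T) (ut U T c (ut M N m n))"
   by (simp add: cc_simps lunit_map_utens)
 qed (simp_all add: cc_simps colinear_lunit)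
 have "module_in CC A (T, ?t)" unfolding module_in_def using h 1 2 by (simp add: cc_simps(1))
 then show ?thesis by (subst t)
qed

end

definition \<theta>U where "\<theta>U = LUnit CC U oC (acounit A xC Ident CC U)"

lemma unit_simps: "Unit (module_cat CC A) = (U, \<theta>U)"
 by (simp add: \<theta>U_def module_cat_def cc_simps(5))

lemma \<theta>U_arr [simp]: "carr \<theta>U" "fst \<theta>U = ct H X U" "cod \<theta>U = U"
 by (simp_all add: \<theta>U_def cc_simps colinear_lunit)

lemma dot_\<theta>U: "a el X ==> c el U ==> dot \<theta>U U a c = eps a *[U] c"
 by (simp add: \<theta>U_def cc_simps lunit_map_utens)

lemma module_unit: "module_in CC A (U, \<theta>U)"
proof -
 have h: "\<theta>U \<in> Hom CC (X ox\<^bsub>CC\<^esub> U) U" by (rule homI) (simp_all add: cc_simps(4))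
 have 1: "\<theta>U oC (amul A xC Ident CC U) = \<theta>U oC (IX xC \<theta>U) oC Assoc CC X X U"
 proof (rule carr_eq3I[of _ _ X X U])
  fix a b c assume [simp]: "a el X" "b el X" "c el U"
  show "ap (\<theta>U oC (amul A xC Ident CC U)) (ut (ct H X X) U (ut X X a b) c) =
   ap (\<theta>U oC (IX xC \<theta>U) oC Assoc CC X X U) (ut (ct H X X) U (ut X X a b) c)"
   by (simp add: cc_simps assoc_map_utens dot_\<theta>U eps_mu mult_smult)
 qed (simp_all add: cc_simps colinear_lunit)
 have 2: "\<theta>U oC (aone A xC Ident CC U) = LUnit CC U"
  by (rule carr_eq2I[of _ _ U U]) (simp_all add: cc_simps colinear_lunit lunit_map_utens dot_\<theta>U counit_aone)
 show ?thesis unfolding module_in_def using h 1 2 by (simp add: cc_simps(1,5))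
qed

lemma lunit_module_map:
 assumes P: "module_in CC A (M, \<theta>)"
 shows "LUnit CC M \<in> module_maps CC A (TenO (module_cat CC A) (U, \<theta>U) (M, \<theta>)) (M, \<theta>)"
proof -
 note [simp] = moduleD(1-4)[OF P] TA_arr[OF module_unit P] colinear_lunit
 note [lin] = linP[OF module_unit P]
 let ?T = "ct H U M"
 have L: "lmap ?T M (lunit_map M)" by (simp add: linear_lunit_map)
 have "LUnit CC M oC TA (U, \<theta>U) (M, \<theta>) = \<theta> oC (IX xC LUnit CC M)"
 proof (rule carr_eq3I'[of _ _ X U M])
  fix a c m assume a [simp]: "a el X" and c [simp]: "c el U" and m [simp]: "m el M"
  have u [simp]: "unscal c el k" by (rule unscal_closed[OF c])
  have b: "\<beta> U M \<theta>U \<theta> c m a1 a2 = ut U M (dot \<theta>U U a1 c) (dot \<theta> M a2 m)" if [simp]: "a1 el X" "a2 el X" for a1 a2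
   by (rule act_one(2)) (auto intro!: lin)
  have "lunit_map M (tsum ?T (untens (D a)) (\<beta> U M \<theta>U \<theta> c m)) = tsum M (untens (D a)) (%a1 a2. lunit_map M (\<beta> U M \<theta>U \<theta> c m a1 a2))"
   by (rule linear_tsum[OF _ _ L D_pairs]) (simp_all add: \<beta>_closed[OF module_unit P])
  also have "... = tsum M (untens (D a)) (%a1 a2. eps a1 *[M] (unscal c *[M] dot \<theta> M a2 m))"
   by (rule D_cong) (simp_all add: b lunit_map_utens dot_\<theta>U mult_smult cu_simps(4))
  also have "... = unscal c *[M] dot \<theta> M a m"
   by (rule D_counit(1)) (auto intro!: lin)
  also have "... = dot \<theta> M a (unscal c *[M] m)"
  proof -
   have "lmap M M (%m. dot \<theta> M a m)" by (auto intro!: lin)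
   from linear_smult[OF this u m] show ?thesis by simp
  qed
  finally show "ap (LUnit CC M oC TA (U, \<theta>U) (M, \<theta>)) (ut X (ct H U M) a (ut U M c m)) = ap (\<theta> oC (IX xC LUnit CC M)) (ut X (ct H U M) a (ut U M c m))"
   using TA_utens[OF module_unit P a c m] by (simp add: cc_simps(3,7) lunit_map_utens \<beta>_closed[OF module_unit P])
 qed (simp_all add: cc_simps(3,7))
 moreover have "LUnit CC M \<in> Hom CC ?T M" by (rule homI) (simp_all add: cc_simps(7))
 ultimately show ?thesis by (simp add: module_maps_def)
qed

lemma runit_module_map:
 assumes P: "module_in CC A (M, \<theta>)"
 shows "RUnit CC M \<in> module_maps CC A (TenO (module_cat CC A) (M, \<theta>) (U, \<theta>U)) (M, \<theta>)"
proof -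
 note [simp] = moduleD(1-4)[OF P] TA_arr[OF P module_unit] colinear_runit
 note [lin] = linP[OF P module_unit]
 let ?T = "ct H M U"
 have L: "lmap ?T M (runit_map M)" by (simp add: linear_runit_map)
 have T: "module k ?T" by simp
 have "RUnit CC M oC TA (M, \<theta>) (U, \<theta>U) = \<theta> oC (IX xC RUnit CC M)"
 proof (rule carr_eq3I'[of _ _ X M U])
  fix a c m assume a [simp]: "a el X" and m [simp]: "m el M" and c [simp]: "c el U"
  have u [simp]: "unscal c el k" by (rule unscal_closed[OF c])
  have b: "\<beta> M U \<theta> \<theta>U m c a1 a2 = ut M U (dot \<theta> M a1 m) (eps a2 *[U] c)" if [simp]: "a1 el X" "a2 el X" for a1 a2
  proof -
   have "\<beta> M U \<theta> \<theta>U m c a1 a2 = act ?T X M r21 (%a2 m. ut M U (dot \<theta> M a1 m) (unscal (ap (acounit A) a2) *[U] c)) a2 m"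
    by (rule act_cong) (simp_all add: dot_\<theta>U)
   also have "... = act ?T U M r21 (%d m. ut M U (dot \<theta> M a1 m) (unscal d *[U] c)) (ap (acounit A) a2) m"
    by (rule act_colinear[OF left_comodule_cu moduleD(1)[OF P] T _ _ r21_bilinear X moduleD(1)[OF P] carr_colinear[OF counit_arr] colinear_id[OF moduleD(1)[OF P]], symmetric]) (auto intro!: lin unscal_closed[of _ H])
   also have "... = ut M U (dot \<theta> M a1 m) (eps a2 *[U] c)"
    by (rule act_one(1)) (auto intro!: lin unscal_closed[of _ H])
   finally show ?thesis .
  qed
  have "runit_map M (tsum ?T (untens (D a)) (\<beta> M U \<theta> \<theta>U m c)) = tsum M (untens (D a)) (%a1 a2. runit_map M (\<beta> M U \<theta> \<theta>U m c a1 a2))"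
   by (rule linear_tsum[OF _ _ L D_pairs]) (simp_all add: \<beta>_closed[OF P module_unit])
  also have "... = tsum M (untens (D a)) (%a1 a2. eps a2 *[M] (unscal c *[M] dot \<theta> M a1 m))"
   by (rule D_cong) (simp_all add: b runit_map_utens mult_smult cu_simps(4))
  also have "... = unscal c *[M] dot \<theta> M a m"
   by (rule D_counit(2)) (auto intro!: lin)
  also have "... = dot \<theta> M a (unscal c *[M] m)"
  proof -
   have "lmap M M (%m. dot \<theta> M a m)" by (auto intro!: lin)
   from linear_smult[OF this u m] show ?thesis by simp
  qed
  finally show "ap (RUnit CC M oC TA (M, \<theta>) (U, \<theta>U)) (ut X (ct H M U) a (ut M U m c)) = ap (\<theta> oC (IX xC RUnit CC M)) (ut X (ct H M U) a (ut M U m c))"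
   using TA_utens[OF P module_unit a m c] by (simp add: cc_simps(3,8) runit_map_utens \<beta>_closed[OF P module_unit])
 qed (simp_all add: cc_simps(3,8))
 moreover have "RUnit CC M \<in> Hom CC ?T M" by (rule homI) (simp_all add: cc_simps(8))
 ultimately show ?thesis by (simp add: module_maps_def)
qed

text \<open>Let \<open>x\<close>, \<open>y\<close>, \<open>z\<close> be the three parts of \<open>a\<close> that act on \<open>m\<close>, \<open>n\<close>, \<open>p\<close>. Both sides braid \<open>z\<close> past
 \<open>m\<close> and \<open>n\<close>, and \<open>y\<close> past \<open>m\<close>; the last two exchanges involve different variables and commute. What
 remains is coassociativity of the coproduct of \<open>A\<close>.\<close>
lemma assoc_module_map:
 assumes P: "module_in CC A (M, \<theta>)" and Q: "module_in CC A (N, \<theta>')" and S: "module_in CC A (R, \<rho>)"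
 shows "Assoc CC M N R \<in> module_maps CC A (TenO (module_cat CC A) (TenO (module_cat CC A) (M, \<theta>) (N, \<theta>')) (R, \<rho>))
   (TenO (module_cat CC A) (M, \<theta>) (TenO (module_cat CC A) (N, \<theta>') (R, \<rho>)))"
proof -
 let ?MN = "ct H M N" and ?NR = "ct H N R" let ?T1 = "ct H ?MN R" and ?T = "ct H M ?NR"
 define s where "s = TA (M, \<theta>) (N, \<theta>')" define t where "t = TA (N, \<theta>') (R, \<rho>)"
 have s: "TenO (module_cat CC A) (M, \<theta>) (N, \<theta>') = (?MN, s)" and t: "TenO (module_cat CC A) (N, \<theta>') (R, \<rho>) = (?NR, t)"
  unfolding s_def t_def using TA_arr(4)[OF P Q] TA_arr(4)[OF Q S] by (metis prod.collapse)+
 have ms: "module_in CC A (?MN, s)" and mt: "module_in CC A (?NR, t)" using module_TO[OF P Q] module_TO[OF Q S] s t by simp_all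
 note [simp] = moduleD(1-4)[OF P] moduleD(1-4)[OF Q] moduleD(1-4)[OF S] moduleD(2-4)[OF ms] moduleD(2-4)[OF mt] TA_arr[OF ms S] TA_arr[OF P mt] colinear_assoc
 note [lin] = linP[OF P Q] linP[OF ms S] linP[OF P mt]
 note M = moduleD(1)[OF P] and N = moduleD(1)[OF Q] and R = moduleD(1)[OF S]
 have MN: "comod ?MN" and T: "module k ?T" and XX: "comod XX" by simp_all
 let ?A = "assoc_map H M N R"
 have As: "lmap ?T1 ?T ?A" by (rule linear_assoc_map) simp_all
 have Ac [simp]: "x el ?T1 ==> ?A x el ?T" for x by (rule linear_closed[OF As])
 note [lin] = linear_comp[OF _ As]
 have "Assoc CC M N R oC TA (?MN, s) (R, \<rho>) = TA (M, \<theta>) (?NR, t) oC (IX xC Assoc CC M N R)"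
 proof (rule carr_eq13I[of _ _ X M N R])
  fix a m n p assume a [simp]: "a el X" and m [simp]: "m el M" and n [simp]: "n el N" and p [simp]: "p el R"
  let ?W = "%x y z m n. ut M ?NR (dot \<theta> M x m) (ut N R (dot \<theta>' N y n) (dot \<rho> R z p))"
  let ?Z = "%x y z. act ?T X M r21 (%z m. act ?T X M r21 (%y m. act ?T X N r21 (%z n. ?W x y z m n) z n) y m) z m"
  have 1: "?A (\<beta> ?MN R s \<rho> (ut M N m n) p b z) = tsum ?T (untens (D b)) (%x y. ?Z x y z)" if [simp]: "b el X" "z el X" for b z
  proof -
   have V: "?A (ut ?MN R (dot s ?MN b (ut M N m n)) (dot \<rho> R z p)) = tsum ?T (untens (D b)) (%x y. act ?T X M r21 (%y m. ?W x y z m n) y m)"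
    if [simp]: "z el X" "m el M" "n el N" for z m n
   proof -
    let ?K = "%v. ?A (ut ?MN R v (dot \<rho> R z p))"
    have K: "lmap ?MN ?T ?K" by (auto intro!: lin)
    have "?K (dot s ?MN b (ut M N m n)) = ?K (tsum ?MN (untens (D b)) (\<beta> M N \<theta> \<theta>' m n))"
     unfolding s_def by (simp add: TA_utens[OF P Q])
    also have "... = tsum ?T (untens (D b)) (%x y. ?K (\<beta> M N \<theta> \<theta>' m n x y))"
     by (rule linear_tsum[OF _ _ K D_pairs]) (simp_all add: \<beta>_closed[OF P Q])
    also have "... = tsum ?T (untens (D b)) (%x y. act ?T X M r21 (%y m. ?K (ut M N (dot \<theta> M x m) (dot \<theta>' N y n))) y m)"
     by (intro D_cong linear_act_push[OF X M _ _ _ r21_bilinear K]) (auto intro!: lin)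
    also have "... = tsum ?T (untens (D b)) (%x y. act ?T X M r21 (%y m. ?W x y z m n) y m)"
     by (intro D_cong act_cong) (simp_all add: assoc_map_utens)
    finally show ?thesis .
   qed
   have "?A (\<beta> ?MN R s \<rho> (ut M N m n) p b z) = act ?T X ?MN r21 (%z v. ?A (ut ?MN R (dot s ?MN b v) (dot \<rho> R z p))) z (ut M N m n)"
    by (rule linear_act_push[OF X MN _ _ _ r21_bilinear As]) (auto intro!: lin)
   also have "... = act3 ?T X M N (%g h l. r (h *<H> l) g) (%z m n. ?A (ut ?MN R (dot s ?MN b (ut M N m n)) (dot \<rho> R z p))) z m n"
    by (rule act_ct_right[OF X M N T r21_bilinear]) (auto intro!: lin)
   also have "... = act3 ?T X M N (%g h l. tsum k (comult H g) (%g1 g2. r h g1 *<k> r l g2)) (%z m n. tsum ?T (untens (D b)) (%x y. act ?T X M r21 (%y m. ?W x y z m n) y m)) z m n"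
    by (rule act3_cong') (simp_all add: r_mult_left V)
   also have "... = act ?T X M r21 (%z m. act ?T X N r21 (%z n. tsum ?T (untens (D b)) (%x y. act ?T X M r21 (%y m. ?W x y z m n) y m)) z n) z m"
    by (rule act3_12_13[OF X M N T _ _ _ r21_bilinear r21_bilinear, symmetric]) (auto simp: act_def intro!: lin)
   also have "... = act ?T X M r21 (%z m. tsum ?T (untens (D b)) (%x y. act ?T X N r21 (%z n. act ?T X M r21 (%y m. ?W x y z m n) y m) z n)) z m"
    by (intro act_cong act_tsum[OF X N T r21_bilinear _ _ D_closed]) (simp_all add: act_def)
   also have "... = tsum ?T (untens (D b)) (%x y. act ?T X M r21 (%z m. act ?T X N r21 (%z n. act ?T X M r21 (%y m. ?W x y z m n) y m) z n) z m)"
    by (intro act_tsum[OF X M T r21_bilinear _ _ D_closed]) (simp_all add: act_def)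
   also have "... = tsum ?T (untens (D b)) (%x y. ?Z x y z)"
    by (intro D_cong act_cong act_commute[OF X N X M T r21_bilinear r21_bilinear]) simp_all
   finally show ?thesis .
  qed
  have 2: "\<beta> M ?NR \<theta> t m (ut N R n p) x b = tsum ?T (untens (D b)) (%y z. ?Z x y z)" if [simp]: "x el X" "b el X" for x b
  proof -
   let ?J = "%v m. ut M ?NR (dot \<theta> M x m) (tsum ?NR (untens v) (\<beta> N R \<theta>' \<rho> n p))"
   have Jl: "lmap XX ?NR (%v. tsum ?NR (untens v) (\<beta> N R \<theta>' \<rho> n p))"
    by (rule linear_untens_id) (simp_all add: linear_\<beta>[OF Q S])
   note [lin] = linear_comp[OF _ Jl]
   have [simp]: "tsum ?NR (untens v) (\<beta> N R \<theta>' \<rho> n p) el ?NR" if "v el XX" for v using linear_closed[OF Jl that] .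
   have J1: "lmap M ?T (%m. ?J v m)" if "v el XX" for v using that by (auto intro!: lin)
   have J2: "lmap XX ?T (%v. ?J v m)" if "m el M" for m using that by (auto intro!: lin)
   have Ju: "?J (ut X X y z) m = act ?T X N r21 (%z n. ?W x y z m n) z n" if [simp]: "y el X" "z el X" "m el M" for y z m
   proof -
    have "tsum ?NR (untens (ut X X y z)) (\<beta> N R \<theta>' \<rho> n p) = \<beta> N R \<theta>' \<rho> n p y z"
     by (rule tsum_utens) (simp_all add: linear_\<beta>[OF Q S])
    moreover have "ut M ?NR (dot \<theta> M x m) (\<beta> N R \<theta>' \<rho> n p y z) = act ?T X N r21 (%z n. ?W x y z m n) z n"
     by (rule linear_act_push[OF X N _ _ _ r21_bilinear]) (auto intro!: lin)
    ultimately show ?thesis by simp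
   qed
   have "\<beta> M ?NR \<theta> t m (ut N R n p) x b = act ?T X M r21 (%b m. ?J (D b) m) b m"
    unfolding t_def by (rule act_cong) (simp_all add: TA_utens[OF Q S])
   also have "... = act ?T XX M r21 ?J (D b) m"
    by (rule act_colinear[OF XX M T J1 J2 r21_bilinear X M carr_colinear[OF comul_arr] colinear_id[OF M], symmetric]) simp_all
   also have "... = tsum ?T (untens (D b)) (%y z. act ?T XX M r21 ?J (ut X X y z) m)"
    by (rule D_expand[OF T linear_act(2)[OF XX M T J1 J2 r21_bilinear]]) simp_all
   also have "... = tsum ?T (untens (D b)) (%y z. act3 ?T X X M (%g h l. r l (g *<H> h)) (%y z m. ?J (ut X X y z) m) y z m)"
    by (intro D_cong act_ct_left[OF X X M T r21_bilinear]) (simp_all add: J1 J2)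
   also have "... = tsum ?T (untens (D b)) (%y z. act3 ?T X X M (%g h l. tsum k (comult H l) (%l1 l2. r l1 h *<k> r l2 g)) (%y z m. act ?T X N r21 (%z n. ?W x y z m n) z n) y z m)"
    by (intro D_cong act3_cong') (simp_all add: r_mult_right Ju)
   also have "... = tsum ?T (untens (D b)) (%y z. ?Z x y z)"
    by (intro D_cong act3_23_13[OF X X M T _ _ _ r21_bilinear r21_bilinear, symmetric]) (auto simp: act_def intro!: lin)
   finally show ?thesis .
  qed
  have "?A (ap (TA (?MN, s) (R, \<rho>)) (ut X ?T1 a (ut ?MN R (ut M N m n) p))) = ?A (tsum ?T1 (untens (D a)) (\<beta> ?MN R s \<rho> (ut M N m n) p))"
   by (simp add: TA_utens[OF ms S])
  also have "... = tsum ?T (untens (D a)) (%b z. ?A (\<beta> ?MN R s \<rho> (ut M N m n) p b z))"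
   by (rule linear_tsum[OF _ _ As D_pairs]) (simp_all add: \<beta>_closed[OF ms S])
  also have "... = tsum ?T (untens (D a)) (%b z. tsum ?T (untens (D b)) (%x y. ?Z x y z))"
   by (intro D_cong 1) simp_all
  also have "... = tsum ?T (untens (D a)) (%x b. tsum ?T (untens (D b)) (%y z. ?Z x y z))"
   by (rule D_coassoc) (auto simp: act_def intro!: lin)
  also have "... = tsum ?T (untens (D a)) (\<beta> M ?NR \<theta> t m (ut N R n p))"
   by (intro D_cong 2[symmetric]) simp_all
  also have "... = ap (TA (M, \<theta>) (?NR, t)) (ut X ?T a (ut M ?NR m (ut N R n p)))"
   by (simp add: TA_utens[OF P mt])
  finally show "ap (Assoc CC M N R oC TA (?MN, s) (R, \<rho>)) (ut X ?T1 a (ut ?MN R (ut M N m n) p)) =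
   ap (TA (M, \<theta>) (?NR, t) oC (IX xC Assoc CC M N R)) (ut X ?T1 a (ut ?MN R (ut M N m n) p))"
   by (simp add: cc_simps(3,6) assoc_map_utens)
 qed (simp_all add: cc_simps(3,6))
 moreover have "Assoc CC M N R \<in> Hom CC ?T1 ?T" by (rule homI) (simp_all add: cc_simps(6))
 ultimately show ?thesis unfolding s t by (simp add: module_maps_def)
qed

lemma module_cat_monoidal: "monoidal_category (module_cat CC A)"
proof (rule braided_monoidal_category_st.module_cat_monoidalI[OF _ alg coalg])
 show "braided_monoidal_category_st CC fst cod" by (rule braided_monoidal_category_st.intro[OF comod_braided comod_monoidal_st])
 fix P Q R assume PQR: "module_in CC A P" "module_in CC A Q" "module_in CC A R"
 show "Assoc CC (fst P) (fst Q) (fst R) \<in> module_maps CC A (TenO (module_cat CC A) (TenO (module_cat CC A) P Q) R) (TenO (module_cat CC A) P (TenO (module_cat CC A) Q R))"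
  using assoc_module_map[of "fst P" "snd P" "fst Q" "snd Q" "fst R" "snd R"] PQR by simp
next
 fix P Q assume PQ: "module_in CC A P" "module_in CC A Q"
 show "module_in CC A (TenO (module_cat CC A) P Q)"
  using module_TO[of "fst P" "snd P" "fst Q" "snd Q"] PQ by simp
next
 show "module_in CC A (Unit (module_cat CC A))" unfolding unit_simps by (rule module_unit)
next
 fix P assume P: "module_in CC A P"
 show "LUnit CC (fst P) \<in> module_maps CC A (TenO (module_cat CC A) (Unit (module_cat CC A)) P) P"
  using lunit_module_map[of "fst P" "snd P"] P by (simp add: unit_simps)
 show "RUnit CC (fst P) \<in> module_maps CC A (TenO (module_cat CC A) P (Unit (module_cat CC A))) P"
  using runit_module_map[of "fst P" "snd P"] P by (simp add: unit_simps)
qed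

end

end

section \<open>The equivalences for a two-cocycle\<close>

lemma (in twist) braided_monoidal_equivalence_F: "braided_monoidal_equivalence C D F"
proof -
 have "cat_functor D C \<lparr>FO = (%X. X), FA = (%f. f)\<rparr>"
  by (intro cat_functor.intro cat_functor_axioms.intro C.category_axioms D.category_axioms) (simp_all add: same)
 then have "equivalence_functor C D F"
  by (rule equivalence_functorI[OF cat_functor_axioms]) (simp_all add: identity)
 then have "monoidal_equivalence C D F" unfolding monoidal_equivalence_def by (intro conjI monoidal_functor_axioms)
 then show ?thesis
  unfolding braided_monoidal_equivalence_def
  by (intro conjI C.braided_monoidal_category_axioms braided_D ballI) (simp_all add: identity same xi_braid)
qed

theorem proposition4p1:
  fixes k :: "'k ring"
    and H :: "('k, 'h) hopf_data"
    and r \<sigma> :: "'h \<Rightarrow> 'h \<Rightarrow> 'k"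
    and C D :: "(('k, 'h, 'x) comod, ('k, 'h, 'x) comod_arrow) brcat"
    and F :: "(('k, 'h, 'x) comod, ('k, 'h, 'x) comod_arrow,
               ('k, 'h, 'x) comod, ('k, 'h, 'x) comod_arrow) mon_fun"
  assumes "cring k" and "\<one>\<^bsub>k\<^esub> \<noteq> \<zero>\<^bsub>k\<^esub>"
    and "cobraided_hopf_algebra k H r"
    and "two_cocycle k H \<sigma>"
    and C: "C = comod_cat k H r"
    and D: "D = comod_cat k (cocycle_deformation k H \<sigma>) (deformed_r_form k H \<sigma> r)"
    and F: "F = twist_functor k H \<sigma>"
  shows "(\<forall>A. braided_hopf_algebra C A \<longrightarrow> braided_hopf_algebra D (transport_hopf C D F A)) \<and>
         (braided_monoidal_equivalence C D F \<and>
          equivalence_functor (hopf_cat C) (hopf_cat D) (transport_hopf_functor C D F)) \<and>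
         (\<forall>A. braided_hopf_algebra C A \<longrightarrow>
           (\<exists>G :: (_, _, _, _) mon_fun.
              monoidal_equivalence (module_cat C A) (module_cat D (transport_hopf C D F A)) G))"
proof -
  interpret H: cobraided_hopf_algebra k H r by fact
  interpret S: cobraided_twist k H \<sigma> r
    by (intro cobraided_twist.intro cocycle_twist.intro cocycle_twist_axioms.intro H.bialgebra_axioms H.cobraided_hopf_algebra_axioms assms(4))
  interpret F: twist C D F fst cod
    unfolding C D F by (rule S.twist_instance)
  have "\<exists>G :: (_, _, _, _) mon_fun. monoidal_equivalence (module_cat C A) (module_cat D (transport_hopf C D F A)) G"
    if A: "braided_hopf_algebra C A" for A
    by (rule exI, rule F.module_equivalence[OF braided_hopf_algebra.algebra[OF A] braided_hopf_algebra.coalgebra[OF A]])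
      (rule H.module_cat_monoidal[OF A[unfolded C], folded C])
  then show ?thesis
    using F.hopf_T F.braided_monoidal_equivalence_F F.hopf_equivalence by blast
qed

end
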